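(* Let $s,D:U\otimes U\to U\otimes U$ be any $\mathbf{H}(S_3)$-structure on a $\mathbb{Z}$-module $U$ and let $\Psi:V\otimes V\to V\otimes V$ be a quadratic braiding on a $\Bbbk$-module $V$. Define the $\Bbbk$-linear endomorphism $\Psi_U$ of $(U\otimes V)^{\otimes 2}$ by $$\Psi_U=\tau_{23}^{-1}\circ\bigl(s\otimes\Psi+(1-q)D\otimes \mathrm{Id}_{V\otimes V}\bigr)\circ\tau_{23},$$ where $\tau_{23}:(U\otimes V)\otimes(U\otimes V)\to(U\otimes U)\otimes(V\otimes V)$ is the permutation of the two middle factors. Then: (a) The linear endomorphism $\Psi_U$ of $(U\otimes V)^{\otimes 2}$ is also a quadratic braiding (on $U\otimes V$). (b) For $n\ge 3$, the functor $F_{U^{\otimes n}}$ satisfies $F_{U^{\otimes n}}(V^{\otimes n})\cong(U\otimes V)^{\otimes n}$ as $H_q(S_n)$-modules, where $V^{\otimes n}$ is naturally an $H_q(S_n)$-module via the quadratic braiding $\Psi$ and $(U\otimes V)^{\otimes n}$ is naturally an $H_q(S_n)$-module via the quadratic braiding $\Psi_U$.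
   Context: $\Bbbk$ is a commutative unital ring with a fixed element $q\in\Bbbk$. Tensor powers of $\Bbbk$-modules (such as $V$ and $U\otimes V$) are over $\Bbbk$; tensor powers of $U$ and the product $U\otimes V$ are over $\mathbb{Z}$. $H_q(S_n)$ is the $\Bbbk$-algebra generated by $T_1,\ldots,T_{n-1}$ subject to $T_iT_jT_i=T_jT_iT_j$ if $|i-j|=1$, $T_iT_j=T_jT_i$ if $|i-j|>1$, and $T_i^2=(1-q)T_i+q$. $\mathbf{H}(S_n)$ is the $\mathbb{Z}$-algebra generated by $s_i$ and $D_i$, $i=1,\ldots,n-1$, subject to: (1) $s_i^2=1$, $s_iD_i+D_is_i=s_i-1$, $D_i^2=D_i$; (2) $s_js_i=s_is_j$, $D_js_i=s_iD_j$, $D_jD_i=D_iD_j$ if $|i-j|>1$; (3) $s_js_is_j=s_is_js_i$, $D_is_js_i=s_js_iD_j$, $D_js_iD_j=s_iD_jD_i+D_iD_js_i+s_iD_js_i$ if $|i-j|=1$. A $\Bbbk$-linear map $\Psi:V\otimes V\to V\otimes V$ is a quadratic braiding on $V$ if $\Psi_1\Psi_2\Psi_1=\Psi_2\Psi_1\Psi_2$ on $V^{\otimes 3}$ and $\Psi^2=(1-q)\Psi+q\cdot\mathrm{Id}_{V\otimes V}$, where $\Psi_1=\Psi\otimes\mathrm{Id}_V$, $\Psi_2=\mathrm{Id}_V\otimes\Psi$. In that case $V^{\otimes n}$ is an $H_q(S_n)$-module with $T_i$ acting by $\Psi$ on the $i$-th and $(i+1)$-st tensor factors (identity on the others). A pair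 of $\mathbb{Z}$-linear maps $s,D:U\otimes U\to U\otimes U$ is an $\mathbf{H}(S_3)$-structure on $U$ if the assignments $s_1\mapsto s\otimes\mathrm{Id}_U$, $s_2\mapsto\mathrm{Id}_U\otimes s$, $D_1\mapsto D\otimes\mathrm{Id}_U$, $D_2\mapsto\mathrm{Id}_U\otimes D$ define a structure of an $\mathbf{H}(S_3)$-module on $U^{\otimes 3}$. In that case $U^{\otimes n}$ ($n\ge 3$) is an $\mathbf{H}(S_n)$-module with $s_i$, $D_i$ acting by $s$, $D$ respectively on the $i$-th and $(i+1)$-st tensor factors. For an $\mathbf{H}(S_n)$-module $M$, $F_M$ is the endo-functor of the category of $H_q(S_n)$-modules given by $F_M(X)=M\otimes_{\mathbb{Z}}X$, on which $T_i$ acts by $s_i\otimes T_i+D_i\otimes(1-q)$. *)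

theory Defs
  imports "HOL-Algebra.QuotRing" "HOL-Algebra.IntRing" "HOL-Algebra.Module"
begin

section \<open>Modules\<close>

text \<open>Unlike \<^locale>\<open>module\<close>, the ring of scalars need not be commutative here.\<close>

locale left_module = A?: ring A + M?: abelian_group M for A (structure) and M (structure) +
  assumes smult_closed:
      "\<lbrakk>a \<in> carrier A; x \<in> carrier M\<rbrakk> \<Longrightarrow> a \<odot>\<^bsub>M\<^esub> x \<in> carrier M"
    and smult_l_distr:
      "\<lbrakk>a \<in> carrier A; b \<in> carrier A; x \<in> carrier M\<rbrakk> \<Longrightarrow>
        (a \<oplus> b) \<odot>\<^bsub>M\<^esub> x = a \<odot>\<^bsub>M\<^esub> x \<oplus>\<^bsub>M\<^esub> b \<odot>\<^bsub>M\<^esub> x"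
    and smult_r_distr:
      "\<lbrakk>a \<in> carrier A; x \<in> carrier M; y \<in> carrier M\<rbrakk> \<Longrightarrow>
        a \<odot>\<^bsub>M\<^esub> (x \<oplus>\<^bsub>M\<^esub> y) = a \<odot>\<^bsub>M\<^esub> x \<oplus>\<^bsub>M\<^esub> a \<odot>\<^bsub>M\<^esub> y"
    and smult_assoc:
      "\<lbrakk>a \<in> carrier A; b \<in> carrier A; x \<in> carrier M\<rbrakk> \<Longrightarrow>
        (a \<otimes> b) \<odot>\<^bsub>M\<^esub> x = a \<odot>\<^bsub>M\<^esub> (b \<odot>\<^bsub>M\<^esub> x)"
    and smult_one: "x \<in> carrier M \<Longrightarrow> \<one> \<odot>\<^bsub>M\<^esub> x = x"

definition linear_maps ::
  "('k, 'e) ring_scheme \<Rightarrow> ('k, 'm, 'f) module_scheme \<Rightarrow> ('k, 'n, 'g) module_scheme \<Rightarrow> ('m \<Rightarrow> 'n) set"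
  where "linear_maps A M N = {f \<in> carrier M \<rightarrow> carrier N.
    (\<forall>x\<in>carrier M. \<forall>y\<in>carrier M. f (x \<oplus>\<^bsub>M\<^esub> y) = f x \<oplus>\<^bsub>N\<^esub> f y) \<and>
    (\<forall>a\<in>carrier A. \<forall>x\<in>carrier M. f (a \<odot>\<^bsub>M\<^esub> x) = a \<odot>\<^bsub>N\<^esub> f x)}"

definition left_module_iso ::
  "('a, 'e) ring_scheme \<Rightarrow> ('a, 'm, 'f) module_scheme \<Rightarrow> ('a, 'n, 'g) module_scheme \<Rightarrow> bool"
  where "left_module_iso A M N \<longleftrightarrow> left_module A M \<and> left_module A N \<and>
    (\<exists>f \<in> linear_maps A M N. bij_betw f (carrier M) (carrier N))"

definition zmod :: "('m, 'e) ring_scheme \<Rightarrow> (int, 'm) module"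
  where "zmod M = \<lparr>carrier = carrier M, mult = undefined, one = undefined,
    zero = \<zero>\<^bsub>M\<^esub>, add = add M, smult = (\<lambda>k x. [k] \<cdot>\<^bsub>M\<^esub> x)\<rparr>"

section \<open>Free modules, quotients and tensor products\<close>

definition delta :: "('k, 'e) ring_scheme \<Rightarrow> 'x \<Rightarrow> 'x \<Rightarrow> 'k"
  where "delta R x = (\<lambda>y. if y = x then \<one>\<^bsub>R\<^esub> else \<zero>\<^bsub>R\<^esub>)"

definition free_module :: "('k, 'e) ring_scheme \<Rightarrow> 'x set \<Rightarrow> ('k, 'x \<Rightarrow> 'k) module"
  where "free_module R X = \<lparr>
    carrier = {a. (\<forall>x. a x \<in> carrier R) \<and> (\<forall>x. x \<notin> X \<longrightarrow> a x = \<zero>\<^bsub>R\<^esub>) \<and>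
                  finite {x. a x \<noteq> \<zero>\<^bsub>R\<^esub>}},
    mult = undefined, one = undefined,
    zero = (\<lambda>x. \<zero>\<^bsub>R\<^esub>), add = (\<lambda>a b x. a x \<oplus>\<^bsub>R\<^esub> b x),
    smult = (\<lambda>c a x. c \<otimes>\<^bsub>R\<^esub> a x)\<rparr>"

definition gen_submodule ::
  "('k, 'e) ring_scheme \<Rightarrow> ('k, 'm, 'f) module_scheme \<Rightarrow> 'm set \<Rightarrow> 'm set"
  where "gen_submodule R M S = \<Inter>{H. submodule H R M \<and> S \<subseteq> H}"

definition quot_module :: "('k, 'm, 'f) module_scheme \<Rightarrow> 'm set \<Rightarrow> ('k, 'm set) module"
  where "quot_module M H = \<lparr>carrier = a_rcosets\<^bsub>M\<^esub> H, mult = undefined, one = undefined,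
    zero = H, add = set_add M, smult = (\<lambda>c C. \<Union>x\<in>C. H +>\<^bsub>M\<^esub> (c \<odot>\<^bsub>M\<^esub> x))\<rparr>"

text \<open>Let \<open>C\<close> be a class in a quotient of the free \<open>R\<close>-module on a set \<open>X\<close>. If \<open>f\<close>, a function from
  \<open>X\<close> to the \<open>R\<close>-module \<open>N\<close>, respects the relations, then \<open>lift R N f\<close> is the linear map which
  it induces on the quotient. The value is computed on some representative of \<open>C\<close>, and is
  meaningful only if \<open>f\<close> respects the relations.\<close>

definition lift ::
  "('k, 'e) ring_scheme \<Rightarrow> ('k, 'n, 'f) module_scheme \<Rightarrow> ('x \<Rightarrow> 'n) \<Rightarrow> ('x \<Rightarrow> 'k) set \<Rightarrow> 'n"
  where "lift R N f C =
    (let a = (SOME a. a \<in> C) in \<Oplus>\<^bsub>N\<^esub>x\<in>{x. a x \<noteq> \<zero>\<^bsub>R\<^esub>}. a x \<odot>\<^bsub>N\<^esub> f x)"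

subsection \<open>Tensor powers\<close>

definition tuples :: "('m, 'e) ring_scheme \<Rightarrow> nat \<Rightarrow> 'm list set"
  where "tuples M n = {xs. length xs = n \<and> set xs \<subseteq> carrier M}"

definition multilinear_rels ::
  "('k, 'e) ring_scheme \<Rightarrow> ('k, 'm, 'f) module_scheme \<Rightarrow> nat \<Rightarrow> ('m list \<Rightarrow> 'k) set"
  where "multilinear_rels R M n = (let F = free_module R (tuples M n) in
    {delta R (xs[i := x \<oplus>\<^bsub>M\<^esub> y]) \<ominus>\<^bsub>F\<^esub> (delta R (xs[i := x]) \<oplus>\<^bsub>F\<^esub> delta R (xs[i := y])) | xs i x y.
       xs \<in> tuples M n \<and> i < n \<and> x \<in> carrier M \<and> y \<in> carrier M} \<union>
    {delta R (xs[i := c \<odot>\<^bsub>M\<^esub> x]) \<ominus>\<^bsub>F\<^esub> c \<odot>\<^bsub>F\<^esub> delta R (xs[i := x]) | xs i c x.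
       xs \<in> tuples M n \<and> i < n \<and> c \<in> carrier R \<and> x \<in> carrier M})"

definition tpow ::
  "('k, 'e) ring_scheme \<Rightarrow> ('k, 'm, 'f) module_scheme \<Rightarrow> nat \<Rightarrow> ('k, ('m list \<Rightarrow> 'k) set) module"
  where "tpow R M n = (let F = free_module R (tuples M n) in
    quot_module F (gen_submodule R F (multilinear_rels R M n)))"

text \<open>The pure tensor \<open>x\<^sub>1 \<otimes> \<dots> \<otimes> x\<^sub>n\<close>, where \<open>n\<close> is the length of the list.\<close>

definition tpure ::
  "('k, 'e) ring_scheme \<Rightarrow> ('k, 'm, 'f) module_scheme \<Rightarrow> 'm list \<Rightarrow> ('m list \<Rightarrow> 'k) set"
  where "tpure R M xs = (let F = free_module R (tuples M (length xs)) in
    gen_submodule R F (multilinear_rels R M (length xs)) +>\<^bsub>F\<^esub> delta R xs)"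

text \<open>For an endomorphism \<open>f\<close> of \<open>M \<otimes> M\<close>, the endomorphism of the \<open>n\<close>-th tensor power which is \<open>f\<close>
  on the factors \<open>i\<close> and \<open>i + 1\<close> (counted from 1) and the identity on the others. The inner
  \<open>lift\<close> is the insertion map from \<open>M \<otimes> M\<close> to the \<open>n\<close>-th tensor power determined by the
  remaining factors.\<close>

definition at_factors ::
  "('k, 'e) ring_scheme \<Rightarrow> ('k, 'm, 'f) module_scheme \<Rightarrow> nat \<Rightarrow>
   (('m list \<Rightarrow> 'k) set \<Rightarrow> ('m list \<Rightarrow> 'k) set) \<Rightarrow> nat \<Rightarrow> ('m list \<Rightarrow> 'k) set \<Rightarrow> ('m list \<Rightarrow> 'k) set"
  where "at_factors R M n f i = lift R (tpow R M n) (\<lambda>xs.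
    lift R (tpow R M n) (\<lambda>ys. tpure R M (take (i - 1) xs @ ys @ drop (i + 1) xs))
      (f (tpure R M [xs ! (i - 1), xs ! i])))"

subsection \<open>The tensor product over the integers\<close>

definition bilinear_rels ::
  "('k, 'e) ring_scheme \<Rightarrow> ('k, 'm, 'f) module_scheme \<Rightarrow> ('k, 'n, 'g) module_scheme \<Rightarrow>
   ('m \<times> 'n \<Rightarrow> 'k) set"
  where "bilinear_rels R M N = (let F = free_module R (carrier M \<times> carrier N) in
    {delta R (x \<oplus>\<^bsub>M\<^esub> x', y) \<ominus>\<^bsub>F\<^esub> (delta R (x, y) \<oplus>\<^bsub>F\<^esub> delta R (x', y)) | x x' y.
       x \<in> carrier M \<and> x' \<in> carrier M \<and> y \<in> carrier N} \<union>
    {delta R (x, y \<oplus>\<^bsub>N\<^esub> y') \<ominus>\<^bsub>F\<^esub> (delta R (x, y) \<oplus>\<^bsub>F\<^esub> delta R (x, y')) | x y y'.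
       x \<in> carrier M \<and> y \<in> carrier N \<and> y' \<in> carrier N} \<union>
    {delta R (c \<odot>\<^bsub>M\<^esub> x, y) \<ominus>\<^bsub>F\<^esub> c \<odot>\<^bsub>F\<^esub> delta R (x, y) | c x y.
       c \<in> carrier R \<and> x \<in> carrier M \<and> y \<in> carrier N} \<union>
    {delta R (x, c \<odot>\<^bsub>N\<^esub> y) \<ominus>\<^bsub>F\<^esub> c \<odot>\<^bsub>F\<^esub> delta R (x, y) | c x y.
       c \<in> carrier R \<and> x \<in> carrier M \<and> y \<in> carrier N})"

definition tensor ::
  "('k, 'e) ring_scheme \<Rightarrow> ('k, 'm, 'f) module_scheme \<Rightarrow> ('k, 'n, 'g) module_scheme \<Rightarrow>
   ('k, ('m \<times> 'n \<Rightarrow> 'k) set) module"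
  where "tensor R M N = (let F = free_module R (carrier M \<times> carrier N) in
    quot_module F (gen_submodule R F (bilinear_rels R M N)))"

definition pure ::
  "('k, 'e) ring_scheme \<Rightarrow> ('k, 'm, 'f) module_scheme \<Rightarrow> ('k, 'n, 'g) module_scheme \<Rightarrow>
   'm \<Rightarrow> 'n \<Rightarrow> ('m \<times> 'n \<Rightarrow> 'k) set"
  where "pure R M N x y = (let F = free_module R (carrier M \<times> carrier N) in
    gen_submodule R F (bilinear_rels R M N) +>\<^bsub>F\<^esub> delta R (x, y))"

definition zpure ::
  "('u, 'e) ring_scheme \<Rightarrow> ('v, 'f) ring_scheme \<Rightarrow> 'u \<Rightarrow> 'v \<Rightarrow> ('u \<times> 'v \<Rightarrow> int) set"
  where "zpure U V = pure \<Z> (zmod U) (zmod V)"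

text \<open>\<open>U \<otimes> V\<close> over the integers, for an abelian group \<open>U\<close> and a module \<open>V\<close>, with the scalars of
  \<open>V\<close> acting on the second factor.\<close>

definition ztensor ::
  "('u, 'e) ring_scheme \<Rightarrow> ('k, 'v, 'f) module_scheme \<Rightarrow> ('k, ('u \<times> 'v \<Rightarrow> int) set) module"
  where "ztensor U V = (let W = tensor \<Z> (zmod U) (zmod V) in
    \<lparr>carrier = carrier W, mult = undefined, one = undefined, zero = zero W, add = add W,
     smult = (\<lambda>c. lift \<Z> W (\<lambda>(u, v). zpure U V u (c \<odot>\<^bsub>V\<^esub> v)))\<rparr>)"

text \<open>The endomorphism \<open>f \<otimes> g\<close> of \<open>U \<otimes> V\<close>.\<close>

definition zmap ::
  "('u, 'e) ring_scheme \<Rightarrow> ('k, 'v, 'f) module_scheme \<Rightarrow> ('u \<Rightarrow> 'u) \<Rightarrow> ('v \<Rightarrow> 'v) \<Rightarrow>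
   ('u \<times> 'v \<Rightarrow> int) set \<Rightarrow> ('u \<times> 'v \<Rightarrow> int) set"
  where "zmap U V f g = lift \<Z> (zmod (ztensor U V)) (\<lambda>(u, v). zpure U V (f u) (g v))"

section \<open>Algebras given by generators and relations, and modules over them\<close>

text \<open>Noncommutative polynomials: functions on words, with the convolution product.\<close>

definition free_algebra :: "('k, 'e) ring_scheme \<Rightarrow> 'g set \<Rightarrow> ('k, 'g list \<Rightarrow> 'k) module"
  where "free_algebra R G = (free_module R (lists G))
    \<lparr>mult := (\<lambda>a b w. \<Oplus>\<^bsub>R\<^esub>k\<in>{..length w}. a (take k w) \<otimes>\<^bsub>R\<^esub> b (drop k w)),
     one := delta R []\<rparr>"

definition pres_algebra ::
  "('k, 'e) ring_scheme \<Rightarrow> 'g set \<Rightarrow> ('g list \<Rightarrow> 'k) set \<Rightarrow> ('g list \<Rightarrow> 'k) set ring"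
  where "pres_algebra R G S = free_algebra R G Quot (Idl\<^bsub>free_algebra R G\<^esub> S)"

definition pres_gen ::
  "('k, 'e) ring_scheme \<Rightarrow> 'g set \<Rightarrow> ('g list \<Rightarrow> 'k) set \<Rightarrow> 'g \<Rightarrow> ('g list \<Rightarrow> 'k) set"
  where "pres_gen R G S g =
    (Idl\<^bsub>free_algebra R G\<^esub> S) +>\<^bsub>free_algebra R G\<^esub> delta R [g]"

text \<open>The structure map from the ground ring to the algebra.\<close>

definition pres_scalar ::
  "('k, 'e) ring_scheme \<Rightarrow> 'g set \<Rightarrow> ('g list \<Rightarrow> 'k) set \<Rightarrow> 'k \<Rightarrow> ('g list \<Rightarrow> 'k) set"
  where "pres_scalar R G S c = (let F = free_algebra R G in
    (Idl\<^bsub>F\<^esub> S) +>\<^bsub>F\<^esub> (c \<odot>\<^bsub>F\<^esub> \<one>\<^bsub>F\<^esub>))"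

text \<open>\<open>M\<close> is a module over the presented algebra whose underlying \<open>R\<close>-module is \<open>N\<close> and on which
  each generator \<open>g\<close> acts by \<open>t g\<close>. On the carriers there is at most one such module structure,
  because the algebra is generated by the scalars and the generators; \<open>pres_module\<close> is this
  structure, and is meaningful only if it exists.\<close>

definition pres_structure ::
  "('k, 'e) ring_scheme \<Rightarrow> 'g set \<Rightarrow> ('g list \<Rightarrow> 'k) set \<Rightarrow> ('k, 'n) module \<Rightarrow> ('g \<Rightarrow> 'n \<Rightarrow> 'n) \<Rightarrow>
   (('g list \<Rightarrow> 'k) set, 'n) module \<Rightarrow> bool"
  where "pres_structure R G S N t M \<longleftrightarrow>
    left_module (pres_algebra R G S) M \<and>
    carrier M = carrier N \<and> zero M = zero N \<and> add M = add N \<and>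
    (\<forall>c\<in>carrier R. \<forall>x\<in>carrier N. pres_scalar R G S c \<odot>\<^bsub>M\<^esub> x = c \<odot>\<^bsub>N\<^esub> x) \<and>
    (\<forall>g\<in>G. \<forall>x\<in>carrier N. pres_gen R G S g \<odot>\<^bsub>M\<^esub> x = t g x)"

definition pres_module ::
  "('k, 'e) ring_scheme \<Rightarrow> 'g set \<Rightarrow> ('g list \<Rightarrow> 'k) set \<Rightarrow> ('k, 'n) module \<Rightarrow> ('g \<Rightarrow> 'n \<Rightarrow> 'n) \<Rightarrow>
   (('g list \<Rightarrow> 'k) set, 'n) module"
  where "pres_module R G S N t = (SOME M. pres_structure R G S N t M)"

definition underlying_module ::
  "('k, 'e) ring_scheme \<Rightarrow> 'g set \<Rightarrow> ('g list \<Rightarrow> 'k) set \<Rightarrow>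
   (('g list \<Rightarrow> 'k) set, 'n) module \<Rightarrow> ('k, 'n) module"
  where "underlying_module R G S M = \<lparr>carrier = carrier M, mult = undefined, one = undefined,
    zero = zero M, add = add M, smult = (\<lambda>c x. pres_scalar R G S c \<odot>\<^bsub>M\<^esub> x)\<rparr>"

subsection \<open>The Hecke algebra of the symmetric group\<close>

definition Hecke_rels :: "('k, 'e) ring_scheme \<Rightarrow> 'k \<Rightarrow> nat \<Rightarrow> (nat list \<Rightarrow> 'k) set"
  where "Hecke_rels R q n = (let F = free_algebra R {1..<n}; T = (\<lambda>i. delta R [i]) in
    {T i \<otimes>\<^bsub>F\<^esub> T j \<otimes>\<^bsub>F\<^esub> T i \<ominus>\<^bsub>F\<^esub> T j \<otimes>\<^bsub>F\<^esub> T i \<otimes>\<^bsub>F\<^esub> T j | i j.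
       i \<in> {1..<n} \<and> j \<in> {1..<n} \<and> \<bar>int i - int j\<bar> = 1} \<union>
    {T i \<otimes>\<^bsub>F\<^esub> T j \<ominus>\<^bsub>F\<^esub> T j \<otimes>\<^bsub>F\<^esub> T i | i j.
       i \<in> {1..<n} \<and> j \<in> {1..<n} \<and> \<bar>int i - int j\<bar> > 1} \<union>
    {T i \<otimes>\<^bsub>F\<^esub> T i \<ominus>\<^bsub>F\<^esub> ((\<one>\<^bsub>R\<^esub> \<ominus>\<^bsub>R\<^esub> q) \<odot>\<^bsub>F\<^esub> T i \<oplus>\<^bsub>F\<^esub> q \<odot>\<^bsub>F\<^esub> \<one>\<^bsub>F\<^esub>) | i.
       i \<in> {1..<n}})"

abbreviation Hecke_algebra :: "('k, 'e) ring_scheme \<Rightarrow> 'k \<Rightarrow> nat \<Rightarrow> (nat list \<Rightarrow> 'k) set ring"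
  where "Hecke_algebra R q n \<equiv> pres_algebra R {1..<n} (Hecke_rels R q n)"

abbreviation Hecke_T :: "('k, 'e) ring_scheme \<Rightarrow> 'k \<Rightarrow> nat \<Rightarrow> nat \<Rightarrow> (nat list \<Rightarrow> 'k) set"
  where "Hecke_T R q n \<equiv> pres_gen R {1..<n} (Hecke_rels R q n)"

abbreviation Hecke_module ::
  "('k, 'e) ring_scheme \<Rightarrow> 'k \<Rightarrow> nat \<Rightarrow> ('k, 'n) module \<Rightarrow> (nat \<Rightarrow> 'n \<Rightarrow> 'n) \<Rightarrow>
   ((nat list \<Rightarrow> 'k) set, 'n) module"
  where "Hecke_module R q n \<equiv> pres_module R {1..<n} (Hecke_rels R q n)"

subsection \<open>The algebra \<open>\<^bold>H(S\<^sub>n)\<close>\<close>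

datatype HS_gen = GenS nat | GenD nat

definition HS_gens :: "nat \<Rightarrow> HS_gen set"
  where "HS_gens n = GenS ` {1..<n} \<union> GenD ` {1..<n}"

definition HS_rels :: "nat \<Rightarrow> (HS_gen list \<Rightarrow> int) set"
  where "HS_rels n = (let F = free_algebra \<Z> (HS_gens n);
      s = (\<lambda>i. delta \<Z> [GenS i]); D = (\<lambda>i. delta \<Z> [GenD i]) in
    (\<Union>i\<in>{1..<n}.
      {s i \<otimes>\<^bsub>F\<^esub> s i \<ominus>\<^bsub>F\<^esub> \<one>\<^bsub>F\<^esub>,
       (s i \<otimes>\<^bsub>F\<^esub> D i \<oplus>\<^bsub>F\<^esub> D i \<otimes>\<^bsub>F\<^esub> s i) \<ominus>\<^bsub>F\<^esub> (s i \<ominus>\<^bsub>F\<^esub> \<one>\<^bsub>F\<^esub>),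
       D i \<otimes>\<^bsub>F\<^esub> D i \<ominus>\<^bsub>F\<^esub> D i}) \<union>
    (\<Union>i\<in>{1..<n}. \<Union>j\<in>{j \<in> {1..<n}. \<bar>int i - int j\<bar> > 1}.
      {s j \<otimes>\<^bsub>F\<^esub> s i \<ominus>\<^bsub>F\<^esub> s i \<otimes>\<^bsub>F\<^esub> s j,
       D j \<otimes>\<^bsub>F\<^esub> s i \<ominus>\<^bsub>F\<^esub> s i \<otimes>\<^bsub>F\<^esub> D j,
       D j \<otimes>\<^bsub>F\<^esub> D i \<ominus>\<^bsub>F\<^esub> D i \<otimes>\<^bsub>F\<^esub> D j}) \<union>
    (\<Union>i\<in>{1..<n}. \<Union>j\<in>{j \<in> {1..<n}. \<bar>int i - int j\<bar> = 1}.
      {s j \<otimes>\<^bsub>F\<^esub> s i \<otimes>\<^bsub>F\<^esub> s j \<ominus>\<^bsub>F\<^esub> s i \<otimes>\<^bsub>F\<^esub> s j \<otimes>\<^bsub>F\<^esub> s i,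
       D i \<otimes>\<^bsub>F\<^esub> s j \<otimes>\<^bsub>F\<^esub> s i \<ominus>\<^bsub>F\<^esub> s j \<otimes>\<^bsub>F\<^esub> s i \<otimes>\<^bsub>F\<^esub> D j,
       D j \<otimes>\<^bsub>F\<^esub> s i \<otimes>\<^bsub>F\<^esub> D j \<ominus>\<^bsub>F\<^esub>
         (s i \<otimes>\<^bsub>F\<^esub> D j \<otimes>\<^bsub>F\<^esub> D i \<oplus>\<^bsub>F\<^esub> D i \<otimes>\<^bsub>F\<^esub> D j \<otimes>\<^bsub>F\<^esub> s i \<oplus>\<^bsub>F\<^esub> s i \<otimes>\<^bsub>F\<^esub> D j \<otimes>\<^bsub>F\<^esub> s i)}))"

abbreviation HS_algebra :: "nat \<Rightarrow> (HS_gen list \<Rightarrow> int) set ring"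
  where "HS_algebra n \<equiv> pres_algebra \<Z> (HS_gens n) (HS_rels n)"

abbreviation HS_s :: "nat \<Rightarrow> nat \<Rightarrow> (HS_gen list \<Rightarrow> int) set"
  where "HS_s n i \<equiv> pres_gen \<Z> (HS_gens n) (HS_rels n) (GenS i)"

abbreviation HS_D :: "nat \<Rightarrow> nat \<Rightarrow> (HS_gen list \<Rightarrow> int) set"
  where "HS_D n i \<equiv> pres_gen \<Z> (HS_gens n) (HS_rels n) (GenD i)"

section \<open>Quadratic braidings and \<open>\<^bold>H(S\<^sub>3)\<close>-structures\<close>

definition quadratic_braiding ::
  "('k, 'e) ring_scheme \<Rightarrow> 'k \<Rightarrow> ('k, 'v) module \<Rightarrow>
   (('v list \<Rightarrow> 'k) set \<Rightarrow> ('v list \<Rightarrow> 'k) set) \<Rightarrow> bool"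
  where "quadratic_braiding R q V \<Psi> \<longleftrightarrow> module R V \<and>
    \<Psi> \<in> linear_maps R (tpow R V 2) (tpow R V 2) \<and>
    (let \<Psi>\<^sub>1 = at_factors R V 3 \<Psi> 1; \<Psi>\<^sub>2 = at_factors R V 3 \<Psi> 2 in
      \<forall>x\<in>carrier (tpow R V 3). \<Psi>\<^sub>1 (\<Psi>\<^sub>2 (\<Psi>\<^sub>1 x)) = \<Psi>\<^sub>2 (\<Psi>\<^sub>1 (\<Psi>\<^sub>2 x))) \<and>
    (\<forall>x\<in>carrier (tpow R V 2).
      \<Psi> (\<Psi> x) = (\<one>\<^bsub>R\<^esub> \<ominus>\<^bsub>R\<^esub> q) \<odot>\<^bsub>tpow R V 2\<^esub> \<Psi> x \<oplus>\<^bsub>tpow R V 2\<^esub> q \<odot>\<^bsub>tpow R V 2\<^esub> x)"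

definition braided_power ::
  "('k, 'e) ring_scheme \<Rightarrow> 'k \<Rightarrow> ('k, 'v) module \<Rightarrow>
   (('v list \<Rightarrow> 'k) set \<Rightarrow> ('v list \<Rightarrow> 'k) set) \<Rightarrow> nat \<Rightarrow>
   ((nat list \<Rightarrow> 'k) set, ('v list \<Rightarrow> 'k) set) module"
  where "braided_power R q V \<Psi> n = Hecke_module R q n (tpow R V n) (at_factors R V n \<Psi>)"

definition HS_action ::
  "(int, 'u) module \<Rightarrow> (('u list \<Rightarrow> int) set \<Rightarrow> ('u list \<Rightarrow> int) set) \<Rightarrow>
   (('u list \<Rightarrow> int) set \<Rightarrow> ('u list \<Rightarrow> int) set) \<Rightarrow> nat \<Rightarrow>
   HS_gen \<Rightarrow> ('u list \<Rightarrow> int) set \<Rightarrow> ('u list \<Rightarrow> int) set"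
  where "HS_action U s D n g = (case g of
      GenS i \<Rightarrow> at_factors \<Z> U n s i
    | GenD i \<Rightarrow> at_factors \<Z> U n D i)"

definition HS3_structure ::
  "(int, 'u) module \<Rightarrow> (('u list \<Rightarrow> int) set \<Rightarrow> ('u list \<Rightarrow> int) set) \<Rightarrow>
   (('u list \<Rightarrow> int) set \<Rightarrow> ('u list \<Rightarrow> int) set) \<Rightarrow> bool"
  where "HS3_structure U s D \<longleftrightarrow> module \<Z> U \<and>
    s \<in> linear_maps \<Z> (tpow \<Z> U 2) (tpow \<Z> U 2) \<and>
    D \<in> linear_maps \<Z> (tpow \<Z> U 2) (tpow \<Z> U 2) \<and>
    (\<exists>M. pres_structure \<Z> (HS_gens 3) (HS_rels 3) (tpow \<Z> U 3) (HS_action U s D 3) M)"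

definition HS_power ::
  "(int, 'u) module \<Rightarrow> (('u list \<Rightarrow> int) set \<Rightarrow> ('u list \<Rightarrow> int) set) \<Rightarrow>
   (('u list \<Rightarrow> int) set \<Rightarrow> ('u list \<Rightarrow> int) set) \<Rightarrow> nat \<Rightarrow>
   ((HS_gen list \<Rightarrow> int) set, ('u list \<Rightarrow> int) set) module"
  where "HS_power U s D n =
    pres_module \<Z> (HS_gens n) (HS_rels n) (tpow \<Z> U n) (HS_action U s D n)"

section \<open>The functor \<open>F\<^sub>M\<close> on objects\<close>

definition F_functor ::
  "('k, 'e) ring_scheme \<Rightarrow> 'k \<Rightarrow> nat \<Rightarrow> ((HS_gen list \<Rightarrow> int) set, 'm) module \<Rightarrow>
   ((nat list \<Rightarrow> 'k) set, 'x) module \<Rightarrow> ((nat list \<Rightarrow> 'k) set, ('m \<times> 'x \<Rightarrow> int) set) module"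
  where "F_functor R q n M X = (let
      X\<^sub>0 = underlying_module R {1..<n} (Hecke_rels R q n) X;
      MX = ztensor M X\<^sub>0 in
    Hecke_module R q n MX (\<lambda>i z.
      zmap M X\<^sub>0 (\<lambda>m. HS_s n i \<odot>\<^bsub>M\<^esub> m) (\<lambda>x. Hecke_T R q n i \<odot>\<^bsub>X\<^esub> x) z \<oplus>\<^bsub>MX\<^esub>
      zmap M X\<^sub>0 (\<lambda>m. HS_D n i \<odot>\<^bsub>M\<^esub> m) (\<lambda>x. (\<one>\<^bsub>R\<^esub> \<ominus>\<^bsub>R\<^esub> q) \<odot>\<^bsub>X\<^sub>0\<^esub> x) z))"

section \<open>The braiding \<open>\<Psi>\<^sub>U\<close>\<close>

definition tau23 ::
  "('k, 'e) ring_scheme \<Rightarrow> (int, 'u) module \<Rightarrow> ('k, 'v) module \<Rightarrow>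
   (('u \<times> 'v \<Rightarrow> int) set list \<Rightarrow> 'k) set \<Rightarrow>
   (('u list \<Rightarrow> int) set \<times> ('v list \<Rightarrow> 'k) set \<Rightarrow> int) set"
  where "tau23 R U V = (let U2 = tpow \<Z> U 2; V2 = tpow R V 2; W = ztensor U2 V2 in
    lift R W (\<lambda>ps.
      lift \<Z> (zmod W) (\<lambda>(u, v).
        lift \<Z> (zmod W) (\<lambda>(u', v'). zpure U2 V2 (tpure \<Z> U [u, u']) (tpure R V [v, v']))
          (ps ! 1))
        (ps ! 0)))"

definition Psi_U ::
  "('k, 'e) ring_scheme \<Rightarrow> 'k \<Rightarrow> (int, 'u) module \<Rightarrow>
   (('u list \<Rightarrow> int) set \<Rightarrow> ('u list \<Rightarrow> int) set) \<Rightarrow>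
   (('u list \<Rightarrow> int) set \<Rightarrow> ('u list \<Rightarrow> int) set) \<Rightarrow> ('k, 'v) module \<Rightarrow>
   (('v list \<Rightarrow> 'k) set \<Rightarrow> ('v list \<Rightarrow> 'k) set) \<Rightarrow>
   (('u \<times> 'v \<Rightarrow> int) set list \<Rightarrow> 'k) set \<Rightarrow> (('u \<times> 'v \<Rightarrow> int) set list \<Rightarrow> 'k) set"
  where "Psi_U R q U s D V \<Psi> = (let
      U2 = tpow \<Z> U 2; V2 = tpow R V 2; W = ztensor U2 V2;
      \<tau> = tau23 R U V;
      \<tau>_inv = inv_into (carrier (tpow R (ztensor U V) 2)) \<tau>;
      \<Phi> = (\<lambda>z. zmap U2 V2 s \<Psi> z \<oplus>\<^bsub>W\<^esub> (\<one>\<^bsub>R\<^esub> \<ominus>\<^bsub>R\<^esub> q) \<odot>\<^bsub>W\<^esub> zmap U2 V2 D (\<lambda>y. y) z)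
    in \<tau>_inv \<circ> \<Phi> \<circ> \<tau>)"

end

theory Submission
  imports Complex_Main Defs
begin

text \<open>Under the isomorphism between \<open>U\<^sup>n \<otimes> V\<^sup>n\<close> and \<open>(U \<otimes> V)\<^sup>n\<close> which regroups the factors, the operator
  \<open>\<Psi>\<^sub>U\<close> on the factors \<open>i\<close> and \<open>i + 1\<close> becomes \<open>A\<^sub>i = s\<^sub>i \<otimes> T\<^sub>i + (1 - q) D\<^sub>i \<otimes> 1\<close>. The braid relation for
  \<open>A\<^sub>1\<close> and \<open>A\<^sub>2\<close> on \<open>U\<^sup>3 \<otimes> V\<^sup>3\<close> follows by expanding both sides; besides the defining relations of
  \<open>\<^bold>H(S\<^sub>3)\<close> it uses \<open>s\<^sub>1 D\<^sub>2 s\<^sub>1 = s\<^sub>2 D\<^sub>1 s\<^sub>2\<close> and \<open>D\<^sub>1 D\<^sub>2 D\<^sub>1 = D\<^sub>2 D\<^sub>1 D\<^sub>2\<close>, which are consequences of them.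

  The quadratic relation for \<open>\<Psi>\<^sub>U\<close> needs the relations between \<open>s\<close> and \<open>D\<close> on \<open>U\<^sup>2\<close>, but they are given on
  \<open>U\<^sup>3\<close> only. They descend, because an element \<open>w\<close> of \<open>U \<otimes> U\<close> with \<open>w \<otimes> u = 0\<close> for all \<open>u\<close> is zero, for
  every abelian group \<open>U\<close>. Indeed all trilinear forms on \<open>U\<close> vanish on \<open>w\<close>. Products of characters of \<open>U\<close>
  show that \<open>w\<close> is torsion, and for \<open>w\<close> of prime order \<open>p\<close> that \<open>U = T + p\<^sup>k U\<close> for all \<open>k\<close>, where \<open>T\<close> is
  the \<open>p\<close>-primary part of \<open>U\<close>; so \<open>w\<close> is a sum of pure tensors of elements of \<open>T\<close>. A bilinear form with
  values in \<open>\<int>/p\<^sup>m\<close> becomes trilinear when it is multiplied by one of its own sections \<open>z \<mapsto> g(z, y)\<close>,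
  hence it vanishes on \<open>w\<close> if this section has a unit among its values; and with these forms one lowers the orders of the summands of \<open>w\<close> step by step.\<close>

section \<open>Linear maps\<close>

text \<open>The descent from three factors to two is the obstacle: \<open>U\<close> need not admit a
  homomorphism onto the integers by which the third factor could be removed. All tests are made with
  homomorphisms into the nonzero complex numbers. This group is divisible, so homomorphisms extend
  from subgroups, and it contains every Z/n as roots of unity. Torsion-freeness of a quotient U/T is
  used in the dual form that Hom(U/T, \<open>circle\<close>) is divisible: a map can be prescribed
  at the single element \<open>w\<close> and extended to \<open>U \<otimes> U\<close>, and a p-th
  root can be taken of a bilinear form on U/T. Orders are lowered by means of heights. If p^(k+1)
  kills \<open>x\<close> in a summand \<open>x \<otimes> y\<close>, then p^k x is killed by
  \<open>p\<close>. If p^k x is highly divisible by \<open>p\<close>, then \<open>x\<close> can be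
  changed by an element whose tensor product with \<open>y\<close> vanishes. If it has finite height
  \<open>h\<close> and equals p^h v, then \<open>v\<close> generates a pure cyclic subgroup; a
  character supplies a retraction onto it, every first factor is replaced by its component in the
  kernel, and the forms that vanish on \<open>w\<close> show that the part removed is zero.\<close>

lemma linear_mapsI:
  assumes "\<And>x. x \<in> carrier M \<Longrightarrow> f x \<in> carrier N"
    and "\<And>x y. x \<in> carrier M \<Longrightarrow> y \<in> carrier M \<Longrightarrow> f (x \<oplus>\<^bsub>M\<^esub> y) = f x \<oplus>\<^bsub>N\<^esub> f y"
    and "\<And>a x. a \<in> carrier A \<Longrightarrow> x \<in> carrier M \<Longrightarrow> f (a \<odot>\<^bsub>M\<^esub> x) = a \<odot>\<^bsub>N\<^esub> f x"
  shows "f \<in> linear_maps A M N"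
  using assms by (auto simp: linear_maps_def)

lemma
  assumes "f \<in> linear_maps A M N" "x \<in> carrier M"
  shows linear_closed: "f x \<in> carrier N"
    and linear_add: "y \<in> carrier M \<Longrightarrow> f (x \<oplus>\<^bsub>M\<^esub> y) = f x \<oplus>\<^bsub>N\<^esub> f y"
    and linear_smult: "a \<in> carrier A \<Longrightarrow> f (a \<odot>\<^bsub>M\<^esub> x) = a \<odot>\<^bsub>N\<^esub> f x"
  using assms by (auto simp: linear_maps_def)

text \<open>Operators such as \<open>Psi_U\<close> agree with a manageable formula only on the
  carrier, because \<open>inv_into\<close> and \<open>lift\<close> are arbitrary outside it;
  linearity has to be carried over from the formula.\<close>

lemma linear_maps_cong:
  assumes "f \<in> linear_maps A M N" "abelian_group M" "\<And>x. x \<in> carrier M \<Longrightarrow> g x = f x"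
    and "\<And>a x. a \<in> carrier A \<Longrightarrow> x \<in> carrier M \<Longrightarrow> a \<odot>\<^bsub>M\<^esub> x \<in> carrier M"
  shows "g \<in> linear_maps A M N"
proof -
  interpret abelian_group M by fact
  show ?thesis
    by (rule linear_mapsI)
      (simp_all add: assms(3,4) linear_closed[OF assms(1)] linear_add[OF assms(1)] linear_smult[OF assms(1)])
qed

lemma linear_comp:
  assumes "f \<in> linear_maps A M N" "g \<in> linear_maps A N P"
  shows "(\<lambda>x. g (f x)) \<in> linear_maps A M P"
  using assms by (auto simp: linear_maps_def Pi_iff)

lemma linear_zero:
  assumes "f \<in> linear_maps A M N" "abelian_group M" "abelian_group N"
  shows "f \<zero>\<^bsub>M\<^esub> = \<zero>\<^bsub>N\<^esub>"
proof -
  interpret M: abelian_group M by fact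
  interpret N: abelian_group N by fact
  have "f \<zero>\<^bsub>M\<^esub> \<oplus>\<^bsub>N\<^esub> f \<zero>\<^bsub>M\<^esub> = f \<zero>\<^bsub>M\<^esub>"
    using linear_add[OF assms(1) M.zero_closed M.zero_closed] by simp
  then show ?thesis
    using linear_closed[OF assms(1) M.zero_closed] by simp
qed

lemma linear_a_inv:
  assumes "f \<in> linear_maps A M N" "abelian_group M" "abelian_group N" "x \<in> carrier M"
  shows "f (\<ominus>\<^bsub>M\<^esub> x) = \<ominus>\<^bsub>N\<^esub> f x"
proof -
  interpret M: abelian_group M by fact
  interpret N: abelian_group N by fact
  have "f (\<ominus>\<^bsub>M\<^esub> x) \<oplus>\<^bsub>N\<^esub> f x = \<zero>\<^bsub>N\<^esub>"
    using linear_add[OF assms(1) _ assms(4), of "\<ominus>\<^bsub>M\<^esub> x"] linear_zero[OF assms(1-3)] assms(4)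
    by (simp add: M.l_neg)
  then show ?thesis
    using linear_closed[OF assms(1)] assms(4) by (simp add: N.minus_equality)
qed

lemma minus_eq_zeroD:
  assumes "abelian_group M" "x \<ominus>\<^bsub>M\<^esub> y = \<zero>\<^bsub>M\<^esub>" "x \<in> carrier M" "y \<in> carrier M"
  shows "x = y"
proof -
  interpret abelian_group M by fact
  have "x \<oplus>\<^bsub>M\<^esub> \<ominus>\<^bsub>M\<^esub> y \<oplus>\<^bsub>M\<^esub> y = y"
    using assms by (simp add: a_minus_def)
  then show ?thesis
    using assms(3,4) by (simp add: a_assoc l_neg)
qed

lemma linear_minus:
  assumes "f \<in> linear_maps A M N" "abelian_group M" "abelian_group N" "x \<in> carrier M" "y \<in> carrier M"
  shows "f (x \<ominus>\<^bsub>M\<^esub> y) = f x \<ominus>\<^bsub>N\<^esub> f y"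
proof -
  interpret M: abelian_group M by fact
  show ?thesis
    using assms by (simp add: a_minus_def linear_add[OF assms(1)] linear_a_inv[OF assms(1-3)])
qed

lemma linear_maps_add:
  assumes "f \<in> linear_maps R M N" "g \<in> linear_maps R M N" "module R M" "module R N"
  shows "(\<lambda>x. f x \<oplus>\<^bsub>N\<^esub> g x) \<in> linear_maps R M N"
proof -
  interpret M: module R M by fact
  interpret N: module R N by fact
  show ?thesis
    by (rule linear_mapsI)
      (simp_all add: linear_closed[OF assms(1)] linear_add[OF assms(1)] linear_smult[OF assms(1)]
        linear_closed[OF assms(2)] linear_add[OF assms(2)] linear_smult[OF assms(2)]
        N.smult_r_distr N.M.add.m_ac)
qed

text \<open>Commutativity of the scalars enters here: a multiple of a linear map is linear because
  \<open>a\<close> can be moved past \<open>c\<close>.\<close>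

lemma linear_maps_smult:
  assumes "f \<in> linear_maps R M N" "c \<in> carrier R" "module R M" "module R N"
  shows "(\<lambda>x. c \<odot>\<^bsub>N\<^esub> f x) \<in> linear_maps R M N"
proof -
  interpret M: module R M by fact
  interpret N: module R N by fact
  show ?thesis
    by (rule linear_mapsI)
      (simp_all add: linear_closed[OF assms(1)] linear_add[OF assms(1)] linear_smult[OF assms(1)]
        assms(2) N.smult_r_distr N.smult_assoc1[symmetric] M.R.m_comm)
qed

lemma linear_id: "(\<lambda>x. x) \<in> linear_maps A M M"
  by (rule linear_mapsI) auto

section \<open>Abelian groups as modules over the integers\<close>

lemma zmod_simps [simp]:
  "carrier (zmod M) = carrier M" "\<zero>\<^bsub>zmod M\<^esub> = \<zero>\<^bsub>M\<^esub>" "add (zmod M) = add M"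
  by (simp_all add: zmod_def)

text \<open>Integer multiples unfold to powers and inverses in the additive monoid, so they depend
  on carrier, zero and addition alone. The same abelian group occurs below in records with different
  scalars; this identifies their \<open>zmod\<close>.\<close>

lemma zmod_cong:
  assumes "carrier M = carrier N" "zero M = zero N" "add M = add N"
  shows "zmod M = zmod N"
  using assms by (simp add: zmod_def add_pow_def int_pow_def nat_pow_def m_inv_def cong: if_cong)

lemma module_zmod:
  assumes "abelian_group M"
  shows "module \<Z> (zmod M)"
proof -
  interpret M: abelian_group M by fact
  have ab: "abelian_group (zmod M)"
    by (rule abelian_groupI) (auto simp: M.add.m_ac intro: M.l_neg)
  show ?thesis
    by (rule moduleI[OF int_is_cring ab])
      (auto simp: zmod_def M.add.int_pow_mult M.add.int_pow_mult_distrib M.a_comm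
        M.add.int_pow_pow mult.commute)
qed

text \<open>Integer scalars are repeated additions, so additivity suffices; the induction runs
  upwards and downwards from 0.\<close>

lemma linear_maps_int:
  assumes "module \<Z> M" "module \<Z> N" "\<And>x. x \<in> carrier M \<Longrightarrow> f x \<in> carrier N"
    and add: "\<And>x y. x \<in> carrier M \<Longrightarrow> y \<in> carrier M \<Longrightarrow> f (x \<oplus>\<^bsub>M\<^esub> y) = f x \<oplus>\<^bsub>N\<^esub> f y"
  shows "f \<in> linear_maps \<Z> M N"
proof -
  interpret M: module \<Z> M by fact
  interpret N: module \<Z> N by fact
  have 0: "f \<zero>\<^bsub>M\<^esub> = \<zero>\<^bsub>N\<^esub>"
    using add[of "\<zero>\<^bsub>M\<^esub>" "\<zero>\<^bsub>M\<^esub>"] assms(3)[of "\<zero>\<^bsub>M\<^esub>"] by simp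
  have M1: "(i + 1) \<odot>\<^bsub>M\<^esub> x = i \<odot>\<^bsub>M\<^esub> x \<oplus>\<^bsub>M\<^esub> x" if "x \<in> carrier M" for i x
    using M.smult_l_distr[of i 1 x] M.smult_one[of x] that by simp
  have N1: "(i + 1) \<odot>\<^bsub>N\<^esub> x = i \<odot>\<^bsub>N\<^esub> x \<oplus>\<^bsub>N\<^esub> x" if "x \<in> carrier N" for i x
    using N.smult_l_distr[of i 1 x] N.smult_one[of x] that by simp
  have Mc: "i \<odot>\<^bsub>M\<^esub> x \<in> carrier M" if "x \<in> carrier M" for i x
    using M.smult_closed[of i x] that by simp
  have Nc: "i \<odot>\<^bsub>N\<^esub> x \<in> carrier N" if "x \<in> carrier N" for i x
    using N.smult_closed[of i x] that by simp
  have "f (k \<odot>\<^bsub>M\<^esub> x) = k \<odot>\<^bsub>N\<^esub> f x" if x: "x \<in> carrier M" for k :: int and x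
  proof (induction k rule: int_induct[where k = 0])
    case base
    then show ?case
      using M.smult_l_null[OF x] N.smult_l_null[OF assms(3)[OF x]] 0 by simp
  next
    case (step1 i)
    then show ?case
      by (simp add: M1 N1 x add Mc assms(3))
  next
    case (step2 i)
    have "f ((i - 1) \<odot>\<^bsub>M\<^esub> x) \<oplus>\<^bsub>N\<^esub> f x = (i - 1) \<odot>\<^bsub>N\<^esub> f x \<oplus>\<^bsub>N\<^esub> f x"
      using step2 M1[OF x, of "i - 1"] N1[OF assms(3)[OF x], of "i - 1"]
      by (simp add: add[symmetric] x Mc)
    then show ?case
      by (simp add: assms(3) x Mc Nc)
  qed
  then show ?thesis
    using assms(3) add by (intro linear_mapsI) auto
qed

section \<open>Free modules\<close>

lemma free_module_simps:
  "carrier (free_module R X) = {a. (\<forall>x. a x \<in> carrier R) \<and> (\<forall>x. x \<notin> X \<longrightarrow> a x = \<zero>\<^bsub>R\<^esub>) \<and>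
                  finite {x. a x \<noteq> \<zero>\<^bsub>R\<^esub>}}"
  "zero (free_module R X) = (\<lambda>x. \<zero>\<^bsub>R\<^esub>)"
  "add (free_module R X) = (\<lambda>a b x. a x \<oplus>\<^bsub>R\<^esub> b x)"
  "smult (free_module R X) = (\<lambda>c a x. c \<otimes>\<^bsub>R\<^esub> a x)"
  by (simp_all add: free_module_def)

lemma module_free_module:
  fixes R (structure)
  assumes "cring R"
  shows "module R (free_module R X)"
proof -
  interpret cring R by fact
  have fin_add: "finite {x. a x \<oplus> b x \<noteq> \<zero>}"
    if "finite {x. a x \<noteq> \<zero>}" "finite {x. b x \<noteq> \<zero>}" for a b :: "'c \<Rightarrow> 'a"
    by (rule finite_subset[of _ "{x. a x \<noteq> \<zero>} \<union> {x. b x \<noteq> \<zero>}"]) (use that in auto)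
  have fin_smult: "finite {x. c \<otimes> a x \<noteq> \<zero>}"
    if "finite {x. a x \<noteq> \<zero>}" "c \<in> carrier R" for c and a :: "'c \<Rightarrow> 'a"
    by (rule finite_subset[of _ "{x. a x \<noteq> \<zero>}"]) (use that in auto)
  have "abelian_group (free_module R X)"
  proof (rule abelian_groupI)
    fix a assume a: "a \<in> carrier (free_module R X)"
    then have "{x. \<ominus> a x \<noteq> \<zero>} = {x. a x \<noteq> \<zero>}"
      by (auto simp: free_module_simps)
    then have "(\<lambda>x. \<ominus> a x) \<in> carrier (free_module R X)"
      using a by (simp add: free_module_simps)
    then show "\<exists>y\<in>carrier (free_module R X). y \<oplus>\<^bsub>free_module R X\<^esub> a = \<zero>\<^bsub>free_module R X\<^esub>"
      using a by (intro bexI[of _ "\<lambda>x. \<ominus> a x"]) (auto simp: free_module_simps l_neg)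
  qed (auto simp: free_module_simps a_ac fin_add)
  then show ?thesis
    by (rule moduleI[OF assms]) (auto simp: free_module_simps fin_smult l_distr r_distr m_assoc)
qed

lemma delta_closed:
  fixes R (structure)
  assumes "cring R" "x \<in> X"
  shows "delta R x \<in> carrier (free_module R X)"
proof -
  interpret cring R by fact
  have "finite {y. delta R x y \<noteq> \<zero>}"
    by (rule finite_subset[of _ "{x}"]) (auto simp: delta_def)
  then show ?thesis
    using assms(2) by (auto simp: free_module_simps delta_def)
qed

lemma free_module_induct [consumes 2, case_names zero add delta]:
  fixes R (structure)
  assumes "cring R" "a \<in> carrier (free_module R X)"
    and zero: "P \<zero>\<^bsub>free_module R X\<^esub>"
    and add: "\<And>a b. \<lbrakk>a \<in> carrier (free_module R X); b \<in> carrier (free_module R X); P a; P b\<rbrakk> \<Longrightarrow>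
      P (a \<oplus>\<^bsub>free_module R X\<^esub> b)"
    and delta: "\<And>c x. \<lbrakk>c \<in> carrier R; x \<in> X\<rbrakk> \<Longrightarrow> P (c \<odot>\<^bsub>free_module R X\<^esub> delta R x)"
  shows "P a"
proof -
  interpret cring R by fact
  interpret F: module R "free_module R X"
    by (rule module_free_module) fact
  \<comment> \<open>\<open>A\<close> need only contain the support, so that a point can be removed
    from it even where the coefficient is already zero.\<close>
  have "P a" if "finite A" "{x. a x \<noteq> \<zero>} \<subseteq> A" "a \<in> carrier (free_module R X)" for A a
    using that
  proof (induction A arbitrary: a rule: finite_induct)
    case empty
    then have "a = \<zero>\<^bsub>free_module R X\<^esub>"
      by (auto simp: free_module_simps)
    then show ?case
      using zero by simp
  next
    case (insert x A)
    show ?case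
    proof (cases "a x = \<zero>")
      case True
      then show ?thesis
        using insert by blast
    next
      case False
      then have x: "x \<in> X" "a x \<in> carrier R"
        using insert by (auto simp: free_module_simps)
      let ?b = "a(x := \<zero>)"
      have "finite {y. ?b y \<noteq> \<zero>}"
        by (rule finite_subset[of _ "{x. a x \<noteq> \<zero>}"]) (use insert.prems in \<open>auto simp: free_module_simps\<close>)
      then have b: "?b \<in> carrier (free_module R X)"
        using insert.prems by (simp add: free_module_simps)
      have d: "a x \<odot>\<^bsub>free_module R X\<^esub> delta R x \<in> carrier (free_module R X)"
        by (rule F.smult_closed[OF x(2) delta_closed[OF assms(1) x(1)]])
      have "a = ?b \<oplus>\<^bsub>free_module R X\<^esub> a x \<odot>\<^bsub>free_module R X\<^esub> delta R x"
        using insert.prems by (auto simp: free_module_simps delta_def)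
      moreover have "P ?b"
        using insert.prems by (intro insert.IH b) auto
      ultimately show ?thesis
        using add[OF b d _ delta[OF x(2,1)]] by simp
    qed
  qed
  then show ?thesis
    using assms(2) by (auto simp: free_module_simps)
qed

text \<open>The sum inside \<open>lift\<close>, freed of the choice of a representative. That it is
  constant on classes is what makes \<open>lift\<close> meaningful.\<close>

definition lincomb ::
  "('k, 'e) ring_scheme \<Rightarrow> ('k, 'n, 'f) module_scheme \<Rightarrow> ('x \<Rightarrow> 'n) \<Rightarrow> ('x \<Rightarrow> 'k) \<Rightarrow> 'n"
  where "lincomb R N f a = (\<Oplus>\<^bsub>N\<^esub>x\<in>{x. a x \<noteq> \<zero>\<^bsub>R\<^esub>}. a x \<odot>\<^bsub>N\<^esub> f x)"

text \<open>The support of a sum can shrink by cancellation, so sums over supports do not add up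
  directly; sums over a common finite superset do.\<close>

lemma lincomb_superset:
  assumes "module R N" "f \<in> X \<rightarrow> carrier N" "a \<in> carrier (free_module R X)"
    and "finite A" "A \<subseteq> X" "{x. a x \<noteq> \<zero>\<^bsub>R\<^esub>} \<subseteq> A"
  shows "lincomb R N f a = (\<Oplus>\<^bsub>N\<^esub>x\<in>A. a x \<odot>\<^bsub>N\<^esub> f x)"
proof -
  interpret module R N by fact
  show ?thesis
    unfolding lincomb_def
    by (rule M.add.finprod_mono_neutral_cong_left) (use assms in \<open>auto simp: free_module_simps Pi_iff\<close>)
qed

lemma lincomb_linear:
  assumes "module R N" "f \<in> X \<rightarrow> carrier N"
  shows "lincomb R N f \<in> linear_maps R (free_module R X) N"
proof -
  interpret module R N by fact
  interpret F: module R "free_module R X"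
    by (rule module_free_module) (rule R.is_cring)
  have f: "f x \<in> carrier N" if "x \<in> X" for x
    using that assms(2) by auto
  note sup = lincomb_superset[OF assms]
  have fa: "a x \<odot>\<^bsub>N\<^esub> f x \<in> carrier N" if "a \<in> carrier (free_module R X)" "a x \<noteq> \<zero>\<^bsub>R\<^esub>" for a x
    using that f[of x] by (auto simp: free_module_simps)
  show ?thesis
  proof (rule linear_mapsI)
    fix a assume a: "a \<in> carrier (free_module R X)"
    then show "lincomb R N f a \<in> carrier N"
      unfolding lincomb_def by (intro M.finsum_closed) (auto intro: fa)
    fix b assume b: "b \<in> carrier (free_module R X)"
    define A where "A = {x. a x \<noteq> \<zero>\<^bsub>R\<^esub>} \<union> {x. b x \<noteq> \<zero>\<^bsub>R\<^esub>}"
    have A: "finite A" "A \<subseteq> X"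
      using a b by (auto simp: A_def free_module_simps)
    have "lincomb R N f (a \<oplus>\<^bsub>free_module R X\<^esub> b) = (\<Oplus>\<^bsub>N\<^esub>x\<in>A. (a x \<oplus>\<^bsub>R\<^esub> b x) \<odot>\<^bsub>N\<^esub> f x)"
      by (subst sup[OF F.M.a_closed[OF a b] A]) (auto simp: A_def free_module_simps)
    also have "\<dots> = (\<Oplus>\<^bsub>N\<^esub>x\<in>A. a x \<odot>\<^bsub>N\<^esub> f x \<oplus>\<^bsub>N\<^esub> b x \<odot>\<^bsub>N\<^esub> f x)"
      using a b A f by (intro M.finsum_cong') (auto simp: free_module_simps smult_l_distr)
    also have "\<dots> = (\<Oplus>\<^bsub>N\<^esub>x\<in>A. a x \<odot>\<^bsub>N\<^esub> f x) \<oplus>\<^bsub>N\<^esub> (\<Oplus>\<^bsub>N\<^esub>x\<in>A. b x \<odot>\<^bsub>N\<^esub> f x)"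
      using a b A f by (intro M.finsum_addf) (auto simp: free_module_simps)
    also have "\<dots> = lincomb R N f a \<oplus>\<^bsub>N\<^esub> lincomb R N f b"
      by (subst (1 2) sup[OF _ A]) (use a b in \<open>auto simp: A_def\<close>)
    finally show "lincomb R N f (a \<oplus>\<^bsub>free_module R X\<^esub> b) = lincomb R N f a \<oplus>\<^bsub>N\<^esub> lincomb R N f b" .
  next
    fix c a assume c: "c \<in> carrier R" and a: "a \<in> carrier (free_module R X)"
    define A where "A = {x. a x \<noteq> \<zero>\<^bsub>R\<^esub>}"
    have A: "finite A" "A \<subseteq> X"
      using a by (auto simp: A_def free_module_simps)
    have "lincomb R N f (c \<odot>\<^bsub>free_module R X\<^esub> a) = (\<Oplus>\<^bsub>N\<^esub>x\<in>A. (c \<otimes>\<^bsub>R\<^esub> a x) \<odot>\<^bsub>N\<^esub> f x)"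
      using c by (subst sup[OF F.smult_closed[OF c a] A]) (auto simp: A_def free_module_simps)
    also have "\<dots> = (\<Oplus>\<^bsub>N\<^esub>x\<in>A. c \<odot>\<^bsub>N\<^esub> (a x \<odot>\<^bsub>N\<^esub> f x))"
      using a c A f by (intro M.finsum_cong') (auto simp: free_module_simps smult_assoc1)
    also have "\<dots> = c \<odot>\<^bsub>N\<^esub> (\<Oplus>\<^bsub>N\<^esub>x\<in>A. a x \<odot>\<^bsub>N\<^esub> f x)"
      using a c A f by (intro finsum_smult_ldistr[symmetric]) (auto simp: free_module_simps)
    also have "\<dots> = c \<odot>\<^bsub>N\<^esub> lincomb R N f a"
      by (simp add: lincomb_def A_def)
    finally show "lincomb R N f (c \<odot>\<^bsub>free_module R X\<^esub> a) = c \<odot>\<^bsub>N\<^esub> lincomb R N f a" .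
  qed
qed

lemma lincomb_delta:
  assumes "module R N" "f \<in> X \<rightarrow> carrier N" "x \<in> X"
  shows "lincomb R N f (delta R x) = f x"
proof -
  interpret module R N by fact
  have f: "f x \<in> carrier N"
    using assms by auto
  have "lincomb R N f (delta R x) = (\<Oplus>\<^bsub>N\<^esub>y\<in>{x}. delta R x y \<odot>\<^bsub>N\<^esub> f y)"
    by (rule lincomb_superset[OF assms(1,2)])
      (use assms delta_closed[OF R.is_cring] in \<open>auto simp: delta_def\<close>)
  also have "\<dots> = f x"
    using f by (simp add: delta_def)
  finally show ?thesis .
qed

section \<open>Modules given by generators and relations\<close>

lemma submodule_gen_submodule:
  assumes "module R M" "S \<subseteq> carrier M"
  shows "submodule (gen_submodule R M S) R M"
proof -
  interpret module R M by fact
  have "carrier M \<in> {H. submodule H R M \<and> S \<subseteq> H}"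
    using assms carrier_is_submodule by auto
  then have "gen_submodule R M S \<subseteq> carrier M"
    unfolding gen_submodule_def by blast
  then show ?thesis
    by (rule submoduleI)
      (auto simp: gen_submodule_def submodule.smult_closed submoduleE
        dest: submodule.axioms(1) subgroup.one_closed[of _ "add_monoid M", simplified])
qed

lemma gen_submodule_incl: "S \<subseteq> gen_submodule R M S"
  by (auto simp: gen_submodule_def)

lemma gen_submodule_least: "\<lbrakk>submodule H R M; S \<subseteq> H\<rbrakk> \<Longrightarrow> gen_submodule R M S \<subseteq> H"
  by (auto simp: gen_submodule_def)

lemma submodule_kernel:
  assumes "f \<in> linear_maps R M N" "module R M" "module R N"
  shows "submodule {x \<in> carrier M. f x = \<zero>\<^bsub>N\<^esub>} R M"
proof -
  interpret M: module R M by fact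
  interpret N: module R N by fact
  note ab = M.M.abelian_group_axioms N.M.abelian_group_axioms
  show ?thesis
    by (rule M.submoduleI)
      (auto simp: linear_add[OF assms(1)] linear_smult[OF assms(1)]
       linear_zero[OF assms(1) ab] linear_a_inv[OF assms(1) ab])
qed

lemma
  assumes "module R M" "submodule H R M"
  shows module_quot_module: "module R (quot_module M H)"
    and quot_class_linear: "(\<lambda>x. H +>\<^bsub>M\<^esub> x) \<in> linear_maps R M (quot_module M H)"
    and quot_carrier: "carrier (quot_module M H) = (\<lambda>x. H +>\<^bsub>M\<^esub> x) ` carrier M"
    and quot_class_eq: "\<lbrakk>x \<in> carrier M; y \<in> H +>\<^bsub>M\<^esub> x\<rbrakk> \<Longrightarrow> y \<in> carrier M \<and> y \<ominus>\<^bsub>M\<^esub> x \<in> H"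
    and quot_class_self: "x \<in> carrier M \<Longrightarrow> x \<in> H +>\<^bsub>M\<^esub> x"
    and quot_class_zero: "x \<in> H \<Longrightarrow> H +>\<^bsub>M\<^esub> x = \<zero>\<^bsub>quot_module M H\<^esub>"
proof -
  interpret module R M by fact
  interpret S: submodule H R M by fact
  have "additive_subgroup H M"
    by (rule additive_subgroup.intro) (rule submodule.axioms(1)[OF assms(2)])
  then interpret H: abelian_subgroup H M
    by (rule abelian_subgroupI3) (rule M.abelian_group_axioms)
  let ?Q = "quot_module M H"
  have c: "carrier ?Q = (\<lambda>x. H +>\<^bsub>M\<^esub> x) ` carrier M"
    by (auto simp: quot_module_def A_RCOSETS_defs a_r_coset_def)
  then show "carrier (quot_module M H) = (\<lambda>x. H +>\<^bsub>M\<^esub> x) ` carrier M" .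
  have add: "(H +>\<^bsub>M\<^esub> x) \<oplus>\<^bsub>?Q\<^esub> (H +>\<^bsub>M\<^esub> y) = H +>\<^bsub>M\<^esub> (x \<oplus>\<^bsub>M\<^esub> y)"
    if "x \<in> carrier M" "y \<in> carrier M" for x y
    using that by (simp add: quot_module_def H.a_rcos_sum)
  have zero: "\<zero>\<^bsub>?Q\<^esub> = H +>\<^bsub>M\<^esub> \<zero>\<^bsub>M\<^esub>"
    by (simp add: quot_module_def H.a_subset)
  have self: "x \<in> H +>\<^bsub>M\<^esub> x" if "x \<in> carrier M" for x
    using that by (rule H.a_rcos_self)
  have mem: "y \<in> carrier M \<and> y \<ominus>\<^bsub>M\<^esub> x \<in> H" if "x \<in> carrier M" "y \<in> H +>\<^bsub>M\<^esub> x" for x y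
    using that H.a_elemrcos_carrier[OF that] H.a_rcos_module_imp[OF that] by (simp add: a_minus_def)
  have eq: "H +>\<^bsub>M\<^esub> x = H +>\<^bsub>M\<^esub> y" if "x \<in> carrier M" "y \<in> carrier M" "y \<ominus>\<^bsub>M\<^esub> x \<in> H" for x y
    using that H.a_rcos_module_rev[of x y] H.a_repr_independence' by (simp add: a_minus_def)
  \<comment> \<open>The scalar multiple of a coset is a union over its representatives. All members
    of this union are the same coset, since \<open>H\<close> is closed under
    \<open>c\<close>.\<close>
  have smult: "c \<odot>\<^bsub>?Q\<^esub> (H +>\<^bsub>M\<^esub> x) = H +>\<^bsub>M\<^esub> (c \<odot>\<^bsub>M\<^esub> x)"
    if "c \<in> carrier R" "x \<in> carrier M" for c x
  proof -
    have "H +>\<^bsub>M\<^esub> (c \<odot>\<^bsub>M\<^esub> y) = H +>\<^bsub>M\<^esub> (c \<odot>\<^bsub>M\<^esub> x)" if y: "y \<in> H +>\<^bsub>M\<^esub> x" for y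
    proof (rule eq[symmetric])
      have "c \<odot>\<^bsub>M\<^esub> y \<ominus>\<^bsub>M\<^esub> c \<odot>\<^bsub>M\<^esub> x = c \<odot>\<^bsub>M\<^esub> (y \<ominus>\<^bsub>M\<^esub> x)"
        using mem[OF \<open>x \<in> carrier M\<close> y] \<open>x \<in> carrier M\<close> \<open>c \<in> carrier R\<close>
        by (simp add: a_minus_def smult_r_distr smult_r_minus)
      then show "c \<odot>\<^bsub>M\<^esub> y \<ominus>\<^bsub>M\<^esub> c \<odot>\<^bsub>M\<^esub> x \<in> H"
        using mem[OF \<open>x \<in> carrier M\<close> y] S.smult_closed[OF \<open>c \<in> carrier R\<close>] by simp
    qed (use \<open>c \<in> carrier R\<close> \<open>x \<in> carrier M\<close> mem[OF \<open>x \<in> carrier M\<close> y] in auto)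
    then have "(\<Union>y\<in>H +>\<^bsub>M\<^esub> x. H +>\<^bsub>M\<^esub> (c \<odot>\<^bsub>M\<^esub> y)) = H +>\<^bsub>M\<^esub> (c \<odot>\<^bsub>M\<^esub> x)"
      using self[OF \<open>x \<in> carrier M\<close>] by blast
    then show ?thesis
      by (simp add: quot_module_def)
  qed
  have "abelian_group ?Q"
  proof (rule abelian_groupI)
    fix C assume "C \<in> carrier ?Q"
    then obtain x where "x \<in> carrier M" "C = H +>\<^bsub>M\<^esub> x"
      by (auto simp: c)
    then show "\<exists>y\<in>carrier ?Q. y \<oplus>\<^bsub>?Q\<^esub> C = \<zero>\<^bsub>?Q\<^esub>"
      by (intro bexI[of _ "H +>\<^bsub>M\<^esub> (\<ominus>\<^bsub>M\<^esub> x)"]) (auto simp: c add zero M.l_neg)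
  qed (auto simp: c add zero M.a_ac)
  then show "module R ?Q"
    by (rule moduleI[OF R.is_cring])
      (auto simp: c add smult smult_l_distr smult_r_distr smult_assoc1)
  show "(\<lambda>x. H +>\<^bsub>M\<^esub> x) \<in> linear_maps R M ?Q"
    by (rule linear_mapsI) (auto simp: c add smult)
  show "\<lbrakk>x \<in> carrier M; y \<in> H +>\<^bsub>M\<^esub> x\<rbrakk> \<Longrightarrow> y \<in> carrier M \<and> y \<ominus>\<^bsub>M\<^esub> x \<in> H"
    by (rule mem)
  show "x \<in> carrier M \<Longrightarrow> x \<in> H +>\<^bsub>M\<^esub> x"
    by (rule self)
  show "H +>\<^bsub>M\<^esub> x = \<zero>\<^bsub>?Q\<^esub>" if "x \<in> H"
    unfolding zero by (rule eq[symmetric]) (use that H.a_subset in \<open>auto simp: a_minus_def\<close>)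
qed

text \<open>The common shape of \<open>tpow\<close> and \<open>tensor\<close>; the universal
  property is proved once for it and then specialised.\<close>

definition presented_module ::
  "('k, 'e) ring_scheme \<Rightarrow> 'x set \<Rightarrow> ('x \<Rightarrow> 'k) set \<Rightarrow> ('k, ('x \<Rightarrow> 'k) set) module"
  where "presented_module R X S =
    quot_module (free_module R X) (gen_submodule R (free_module R X) S)"

definition pclass ::
  "('k, 'e) ring_scheme \<Rightarrow> 'x set \<Rightarrow> ('x \<Rightarrow> 'k) set \<Rightarrow> ('x \<Rightarrow> 'k) \<Rightarrow> ('x \<Rightarrow> 'k) set"
  where "pclass R X S a = gen_submodule R (free_module R X) S +>\<^bsub>free_module R X\<^esub> a"

locale presentation = cring R for R (structure) +
  fixes X :: "'x set" and S :: "('x \<Rightarrow> 'a) set"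
  assumes rels_closed: "S \<subseteq> carrier (free_module R X)"
begin

sublocale F: module R "free_module R X"
  by (rule module_free_module) (rule is_cring)

lemmas submodule_rels = submodule_gen_submodule[OF F.module_axioms rels_closed]

lemma module_presented_module: "module R (presented_module R X S)"
  unfolding presented_module_def
  by (rule module_quot_module[OF F.module_axioms submodule_rels])

sublocale P: module R "presented_module R X S"
  by (rule module_presented_module)

lemma pclass_linear: "pclass R X S \<in> linear_maps R (free_module R X) (presented_module R X S)"
  unfolding presented_module_def pclass_def[abs_def]
  by (rule quot_class_linear[OF F.module_axioms submodule_rels])

lemma pclass_rel: "r \<in> S \<Longrightarrow> pclass R X S r = \<zero>\<^bsub>presented_module R X S\<^esub>"
  unfolding presented_module_def pclass_def
  by (intro quot_class_zero[OF F.module_axioms submodule_rels] subsetD[OF gen_submodule_incl])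

lemma presented_ext:
  assumes g: "g \<in> linear_maps R (presented_module R X S) N"
    and h: "h \<in> linear_maps R (presented_module R X S) N"
    and N: "abelian_group N"
    and eq: "\<And>x. x \<in> X \<Longrightarrow> g (pclass R X S (delta R x)) = h (pclass R X S (delta R x))"
    and z: "z \<in> carrier (presented_module R X S)"
  shows "g z = h z"
proof -
  interpret N: abelian_group N by fact
  note ab = F.M.abelian_group_axioms N
  obtain a where "a \<in> carrier (free_module R X)" "z = pclass R X S a"
    using z quot_carrier[OF F.module_axioms submodule_rels]
    by (auto simp: presented_module_def pclass_def)
  moreover have "g (pclass R X S a) = h (pclass R X S a)" if "a \<in> carrier (free_module R X)" for a
    using is_cring that
  proof (induction a rule: free_module_induct)
    case zero
    then show ?case
      using linear_zero[OF linear_comp[OF pclass_linear g] ab]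
        linear_zero[OF linear_comp[OF pclass_linear h] ab] by simp
  next
    case (add a b)
    then show ?case
      using linear_add[OF linear_comp[OF pclass_linear g] add(1,2)]
        linear_add[OF linear_comp[OF pclass_linear h] add(1,2)] by simp
  next
    case (delta c x)
    then show ?case
      using linear_smult[OF linear_comp[OF pclass_linear g] delta_closed[OF is_cring delta(2)] delta(1)]
        linear_smult[OF linear_comp[OF pclass_linear h] delta_closed[OF is_cring delta(2)] delta(1)] eq
      by simp
  qed
  ultimately show ?thesis
    by simp
qed

text \<open>The representative chosen by \<open>lift\<close> differs from \<open>a\<close> by an
  element of the submodule generated by the relations, and this submodule lies in the kernel of the
  linear extension of \<open>f\<close>.\<close>

lemma lift_pclass:
  assumes N: "module R N" and f: "f \<in> X \<rightarrow> carrier N"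
    and S: "\<And>r. r \<in> S \<Longrightarrow> lincomb R N f r = \<zero>\<^bsub>N\<^esub>"
    and a: "a \<in> carrier (free_module R X)"
  shows "lift R N f (pclass R X S a) = lincomb R N f a"
proof -
  interpret N: module R N by fact
  note lin = lincomb_linear[OF N f]
  define b where "b = (SOME b. b \<in> pclass R X S a)"
  have "a \<in> pclass R X S a"
    using quot_class_self[OF F.module_axioms submodule_rels a] by (simp add: pclass_def)
  then have "b \<in> pclass R X S a"
    unfolding b_def by (rule someI[where P = "\<lambda>b. b \<in> _"])
  then have b: "b \<in> carrier (free_module R X)"
    "b \<ominus>\<^bsub>free_module R X\<^esub> a \<in> gen_submodule R (free_module R X) S"
    using quot_class_eq[OF F.module_axioms submodule_rels a] by (auto simp: pclass_def)
  have "gen_submodule R (free_module R X) S \<subseteq>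
      {x \<in> carrier (free_module R X). lincomb R N f x = \<zero>\<^bsub>N\<^esub>}"
    using S rels_closed by (intro gen_submodule_least submodule_kernel[OF lin F.module_axioms N]) auto
  then have "lincomb R N f b \<ominus>\<^bsub>N\<^esub> lincomb R N f a = \<zero>\<^bsub>N\<^esub>"
    using b linear_minus[OF lin F.M.abelian_group_axioms N.M.abelian_group_axioms b(1) a] by auto
  then have "lincomb R N f b = lincomb R N f a"
    by (rule minus_eq_zeroD[OF N.M.abelian_group_axioms _ linear_closed[OF lin b(1)] linear_closed[OF lin a]])
  then show ?thesis
    by (simp add: lift_def b_def[symmetric] lincomb_def)
qed

lemma
  assumes N: "module R N" and f: "f \<in> X \<rightarrow> carrier N"
    and S: "\<And>r. r \<in> S \<Longrightarrow> lincomb R N f r = \<zero>\<^bsub>N\<^esub>"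
  shows lift_linear: "lift R N f \<in> linear_maps R (presented_module R X S) N"
    and lift_delta: "x \<in> X \<Longrightarrow> lift R N f (pclass R X S (delta R x)) = f x"
proof -
  note lp = lift_pclass[OF assms]
  note lin = lincomb_linear[OF N f]
  have c: "carrier (presented_module R X S) = pclass R X S ` carrier (free_module R X)"
    using quot_carrier[OF F.module_axioms submodule_rels]
    by (auto simp: presented_module_def pclass_def)
  have ps: "pclass R X S a \<oplus>\<^bsub>presented_module R X S\<^esub> pclass R X S b = pclass R X S (a \<oplus>\<^bsub>free_module R X\<^esub> b)"
    if "a \<in> carrier (free_module R X)" "b \<in> carrier (free_module R X)" for a b
    using linear_add[OF pclass_linear that] by simp
  have pm: "k \<odot>\<^bsub>presented_module R X S\<^esub> pclass R X S a = pclass R X S (k \<odot>\<^bsub>free_module R X\<^esub> a)"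
    if "a \<in> carrier (free_module R X)" "k \<in> carrier R" for a k
    using linear_smult[OF pclass_linear that] by simp
  show "lift R N f \<in> linear_maps R (presented_module R X S) N"
    by (rule linear_mapsI)
      (auto simp: c lp ps pm linear_closed[OF lin] linear_add[OF lin] linear_smult[OF lin])
  show "x \<in> X \<Longrightarrow> lift R N f (pclass R X S (delta R x)) = f x"
    by (simp add: lp delta_closed[OF is_cring] lincomb_delta[OF N f])
qed

text \<open>Both sides are evaluated at the same chosen representative, whose support lies in
  \<open>X\<close>, so the two sums agree term by term.\<close>

lemma lift_cong:
  assumes "z \<in> carrier (presented_module R X S)"
    and "\<And>x. x \<in> X \<Longrightarrow> f x = g x" "\<And>x. x \<in> X \<Longrightarrow> g x \<in> carrier N" "module R N"
  shows "lift R N f z = lift R N g z"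
proof -
  interpret N: module R N by fact
  obtain a where a: "a \<in> carrier (free_module R X)" "z = pclass R X S a"
    using assms(1) quot_carrier[OF F.module_axioms submodule_rels]
    by (auto simp: presented_module_def pclass_def)
  define b where "b = (SOME b. b \<in> z)"
  have "a \<in> z"
    using quot_class_self[OF F.module_axioms submodule_rels a(1)] a(2) by (simp add: pclass_def)
  then have "b \<in> z"
    unfolding b_def by (rule someI[where P = "\<lambda>b. b \<in> _"])
  then have b: "b \<in> carrier (free_module R X)"
    using quot_class_eq[OF F.module_axioms submodule_rels a(1)] a(2) by (auto simp: pclass_def)
  have "(\<Oplus>\<^bsub>N\<^esub>x\<in>{x. b x \<noteq> \<zero>}. b x \<odot>\<^bsub>N\<^esub> f x) = (\<Oplus>\<^bsub>N\<^esub>x\<in>{x. b x \<noteq> \<zero>}. b x \<odot>\<^bsub>N\<^esub> g x)"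
  proof (rule N.M.finsum_cong')
    have "x \<in> X" "b x \<in> carrier R" if "b x \<noteq> \<zero>" for x
      using b that by (auto simp: free_module_simps)
    then show "(\<lambda>x. b x \<odot>\<^bsub>N\<^esub> g x) \<in> {x. b x \<noteq> \<zero>} \<rightarrow> carrier N"
      "\<And>x. x \<in> {x. b x \<noteq> \<zero>} \<Longrightarrow> b x \<odot>\<^bsub>N\<^esub> f x = b x \<odot>\<^bsub>N\<^esub> g x"
      using assms(2,3) by auto
  qed simp
  then show ?thesis
    by (simp add: lift_def b_def)
qed

end

section \<open>Tensor powers\<close>

text \<open>A slot is described by the lists around it and not by an index as in
  \<open>multilinear_rels\<close>; this form is stable under appending fixed factors on either
  side.\<close>

definition multilinear ::
  "('k, 'e) ring_scheme \<Rightarrow> ('k, 'm, 'f) module_scheme \<Rightarrow> nat \<Rightarrow> ('k, 'n, 'g) module_scheme \<Rightarrow>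
   ('m list \<Rightarrow> 'n) \<Rightarrow> bool"
  where "multilinear R M n N f \<longleftrightarrow> f \<in> tuples M n \<rightarrow> carrier N \<and>
    (\<forall>as bs. set as \<subseteq> carrier M \<longrightarrow> set bs \<subseteq> carrier M \<longrightarrow> Suc (length as + length bs) = n \<longrightarrow>
      (\<lambda>x. f (as @ x # bs)) \<in> linear_maps R M N)"

lemma multilinearI:
  assumes "\<And>xs. \<lbrakk>length xs = n; set xs \<subseteq> carrier M\<rbrakk> \<Longrightarrow> f xs \<in> carrier N"
    and "\<And>as bs. \<lbrakk>set as \<subseteq> carrier M; set bs \<subseteq> carrier M; Suc (length as + length bs) = n\<rbrakk> \<Longrightarrow>
      (\<lambda>x. f (as @ x # bs)) \<in> linear_maps R M N"
  shows "multilinear R M n N f"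
  using assms by (auto simp: multilinear_def tuples_def)

lemma multilinear_closed:
  "\<lbrakk>multilinear R M n N f; length xs = n; set xs \<subseteq> carrier M\<rbrakk> \<Longrightarrow> f xs \<in> carrier N"
  by (auto simp: multilinear_def tuples_def)

lemma multilinear_slot:
  assumes "multilinear R M n N f" "set as \<subseteq> carrier M" "set bs \<subseteq> carrier M"
    "Suc (length as + length bs) = n"
  shows "(\<lambda>x. f (as @ x # bs)) \<in> linear_maps R M N"
  using assms by (auto simp: multilinear_def)

lemma linear_comp_multilinear:
  assumes "g \<in> linear_maps R N P" "multilinear R M n N f"
  shows "multilinear R M n P (\<lambda>xs. g (f xs))"
  by (rule multilinearI)
    (auto intro: linear_comp[OF multilinear_slot[OF assms(2)] assms(1)]
      linear_closed[OF assms(1)] multilinear_closed[OF assms(2)])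

lemma tpow_eq: "tpow R M n = presented_module R (tuples M n) (multilinear_rels R M n)"
  by (simp add: tpow_def presented_module_def Let_def)

lemma tpure_eq:
  "length xs = n \<Longrightarrow> tpure R M xs = pclass R (tuples M n) (multilinear_rels R M n) (delta R xs)"
  by (auto simp: tpure_def pclass_def Let_def)

lemma list_slot:
  assumes "xs \<in> tuples M n" "i < n"
  obtains as bs where "set as \<subseteq> carrier M" "set bs \<subseteq> carrier M" "Suc (length as + length bs) = n"
    "\<And>x. xs[i := x] = as @ x # bs"
proof
  show "set (take i xs) \<subseteq> carrier M" "set (drop (Suc i) xs) \<subseteq> carrier M"
    using assms set_take_subset[of i xs] set_drop_subset[of "Suc i" xs] by (auto simp: tuples_def)
qed (use assms in \<open>auto simp: tuples_def upd_conv_take_nth_drop\<close>)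

context module
begin

lemma presentation_tpow: "presentation R (tuples M n) (multilinear_rels R M n)"
proof -
  interpret F: module R "free_module R (tuples M n)"
    by (rule module_free_module) (rule R.is_cring)
  have d: "delta R (xs[i := x]) \<in> carrier (free_module R (tuples M n))"
    if "xs \<in> tuples M n" "x \<in> carrier M" for xs i x
  proof (rule delta_closed[OF R.is_cring])
    show "xs[i := x] \<in> tuples M n"
      using that set_update_subset_insert[of xs i x] by (auto simp: tuples_def)
  qed
  show ?thesis
    by unfold_locales (auto simp: multilinear_rels_def Let_def intro!: d F.smult_closed)
qed

lemma module_tpow: "module R (tpow R M n)"
  unfolding tpow_eq by (rule presentation.module_presented_module[OF presentation_tpow])

lemma tpow_ext:
  assumes "g \<in> linear_maps R (tpow R M n) N" "h \<in> linear_maps R (tpow R M n) N" "abelian_group N"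
    and "\<And>xs. \<lbrakk>length xs = n; set xs \<subseteq> carrier M\<rbrakk> \<Longrightarrow> g (tpure R M xs) = h (tpure R M xs)"
    and "z \<in> carrier (tpow R M n)"
  shows "g z = h z"
  using assms unfolding tpow_eq
  by (elim presentation.presented_ext[OF presentation_tpow]) (auto simp: tuples_def tpure_eq)

lemma multilinear_tpure: "multilinear R M n (tpow R M n) (tpure R M)"
proof (rule multilinearI)
  interpret P: presentation R "tuples M n" "multilinear_rels R M n"
    by (rule presentation_tpow)
  note lin = P.pclass_linear[folded tpow_eq]
  have d: "delta R xs \<in> carrier (free_module R (tuples M n))"
    if "length xs = n" "set xs \<subseteq> carrier M" for xs
    using that by (intro delta_closed[OF R.is_cring]) (auto simp: tuples_def)
  show cl: "tpure R M xs \<in> carrier (tpow R M n)" if "length xs = n" "set xs \<subseteq> carrier M" for xs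
    unfolding tpure_eq[OF that(1)] by (rule linear_closed[OF lin d[OF that]])
  interpret T: module R "tpow R M n"
    by (rule module_tpow)
  note ab = P.F.M.abelian_group_axioms T.M.abelian_group_axioms
  fix as bs assume ab': "set as \<subseteq> carrier M" "set bs \<subseteq> carrier M" "Suc (length as + length bs) = n"
  let ?t = "\<lambda>x. as @ x # bs"
  have dc: "delta R (?t x) \<in> carrier (free_module R (tuples M n))" if "x \<in> carrier M" for x
    using that ab' by (intro d) auto
  show "(\<lambda>x. tpure R M (as @ x # bs)) \<in> linear_maps R M (tpow R M n)"
  proof (rule linear_mapsI)
    have tc: "tpure R M (?t x) \<in> carrier (tpow R M n)" if "x \<in> carrier M" for x
      using that ab' by (intro cl) auto
    fix x assume x: "x \<in> carrier M"
    then show "tpure R M (?t x) \<in> carrier (tpow R M n)"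
      by (rule tc)
    \<comment> \<open>The relations update a tuple at an index; updating the tuple itself at
      position \<open>length as\<close> yields the slot form.\<close>
    have u: "?t x \<in> tuples M n" "length as < n" "\<And>y. (?t x)[length as := y] = ?t y"
      using x ab' by (auto simp: tuples_def)
    have eq: "tpure R M (?t y) = pclass R (tuples M n) (multilinear_rels R M n) (delta R (?t y))" for y
      using ab' by (intro tpure_eq) simp
    {
      fix y assume y: "y \<in> carrier M"
      have "delta R (?t (x \<oplus>\<^bsub>M\<^esub> y)) \<ominus>\<^bsub>free_module R (tuples M n)\<^esub>
          (delta R (?t x) \<oplus>\<^bsub>free_module R (tuples M n)\<^esub> delta R (?t y)) \<in> multilinear_rels R M n"
        unfolding multilinear_rels_def Let_def
        by (intro UnI1 CollectI exI[of _ "?t x"] exI[of _ "length as"] exI[of _ x] exI[of _ y])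
          (use u x y in simp)
      from P.pclass_rel[OF this, folded tpow_eq]
      have "tpure R M (?t (x \<oplus>\<^bsub>M\<^esub> y)) \<ominus>\<^bsub>tpow R M n\<^esub>
          (tpure R M (?t x) \<oplus>\<^bsub>tpow R M n\<^esub> tpure R M (?t y)) = \<zero>\<^bsub>tpow R M n\<^esub>"
        using x y by (simp add: eq linear_minus[OF lin ab] linear_add[OF lin] dc)
      then show "tpure R M (?t (x \<oplus>\<^bsub>M\<^esub> y)) = tpure R M (?t x) \<oplus>\<^bsub>tpow R M n\<^esub> tpure R M (?t y)"
        by (rule minus_eq_zeroD[OF T.M.abelian_group_axioms])
          (use x y tc in simp_all)
    next
      fix c assume c: "c \<in> carrier R"
      have "delta R (?t (c \<odot>\<^bsub>M\<^esub> x)) \<ominus>\<^bsub>free_module R (tuples M n)\<^esub>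
          c \<odot>\<^bsub>free_module R (tuples M n)\<^esub> delta R (?t x) \<in> multilinear_rels R M n"
        unfolding multilinear_rels_def Let_def
        by (intro UnI2 CollectI exI[of _ "?t x"] exI[of _ "length as"] exI[of _ c] exI[of _ x])
          (use u x c in simp)
      from P.pclass_rel[OF this, folded tpow_eq]
      have "tpure R M (?t (c \<odot>\<^bsub>M\<^esub> x)) \<ominus>\<^bsub>tpow R M n\<^esub> c \<odot>\<^bsub>tpow R M n\<^esub> tpure R M (?t x) =
          \<zero>\<^bsub>tpow R M n\<^esub>"
        using x c by (simp add: eq linear_minus[OF lin ab] linear_smult[OF lin] dc P.F.smult_closed)
      then show "tpure R M (?t (c \<odot>\<^bsub>M\<^esub> x)) = c \<odot>\<^bsub>tpow R M n\<^esub> tpure R M (?t x)"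
        by (rule minus_eq_zeroD[OF T.M.abelian_group_axioms])
          (use x c tc in simp_all)
    }
  qed
qed

lemma tpure_closed:
  "\<lbrakk>length xs = n; set xs \<subseteq> carrier M\<rbrakk> \<Longrightarrow> tpure R M xs \<in> carrier (tpow R M n)"
  by (rule multilinear_closed[OF multilinear_tpure])

lemma
  assumes N: "module R N" and f: "multilinear R M n N f"
  shows tpow_lift_linear: "lift R N f \<in> linear_maps R (tpow R M n) N"
    and tpow_lift_tpure: "\<lbrakk>length xs = n; set xs \<subseteq> carrier M\<rbrakk> \<Longrightarrow> lift R N f (tpure R M xs) = f xs"
proof -
  interpret P: presentation R "tuples M n" "multilinear_rels R M n"
    by (rule presentation_tpow)
  interpret N: module R N
    by (rule N)
  have f': "f \<in> tuples M n \<rightarrow> carrier N"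
    using multilinear_closed[OF f] by (auto simp: tuples_def)
  note lin = lincomb_linear[OF N f']
  note ab = P.F.M.abelian_group_axioms N.M.abelian_group_axioms
  note lin_simps = linear_minus[OF lin ab] linear_add[OF lin] linear_smult[OF lin] lincomb_delta[OF N f']
  have self: "z \<ominus>\<^bsub>N\<^esub> z = \<zero>\<^bsub>N\<^esub>" if "z \<in> carrier N" for z
    using that by (simp add: a_minus_def N.M.r_neg)
  have rel: "lincomb R N f r = \<zero>\<^bsub>N\<^esub>" if r: "r \<in> multilinear_rels R M n" for r
  proof -
    consider xs i x y where "xs \<in> tuples M n" "i < n" "x \<in> carrier M" "y \<in> carrier M"
        "r = delta R (xs[i := x \<oplus>\<^bsub>M\<^esub> y]) \<ominus>\<^bsub>free_module R (tuples M n)\<^esub>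
          (delta R (xs[i := x]) \<oplus>\<^bsub>free_module R (tuples M n)\<^esub> delta R (xs[i := y]))"
      | xs i x c where "xs \<in> tuples M n" "i < n" "x \<in> carrier M" "c \<in> carrier R"
        "r = delta R (xs[i := c \<odot>\<^bsub>M\<^esub> x]) \<ominus>\<^bsub>free_module R (tuples M n)\<^esub>
          c \<odot>\<^bsub>free_module R (tuples M n)\<^esub> delta R (xs[i := x])"
      using r unfolding multilinear_rels_def Let_def by blast
    then show ?thesis
    proof cases
      case 1
      obtain as bs where ab': "set as \<subseteq> carrier M" "set bs \<subseteq> carrier M" "Suc (length as + length bs) = n"
        and e: "\<And>x. xs[i := x] = as @ x # bs"
        using list_slot[OF 1(1,2)] by blast
      have t: "as @ x # bs \<in> tuples M n" if "x \<in> carrier M" for x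
        using that ab' by (auto simp: tuples_def)
      note sl = multilinear_slot[OF f ab']
      show ?thesis
        using 1(3,4) t delta_closed[OF R.is_cring t] linear_closed[OF sl]
        by (simp add: 1(5) e lin_simps linear_add[OF sl] self)
    next
      case 2
      obtain as bs where ab': "set as \<subseteq> carrier M" "set bs \<subseteq> carrier M" "Suc (length as + length bs) = n"
        and e: "\<And>x. xs[i := x] = as @ x # bs"
        using list_slot[OF 2(1,2)] by blast
      have t: "as @ x # bs \<in> tuples M n" if "x \<in> carrier M" for x
        using that ab' by (auto simp: tuples_def)
      note sl = multilinear_slot[OF f ab']
      show ?thesis
        using 2(3,4) t delta_closed[OF R.is_cring t] linear_closed[OF sl]
        by (simp add: 2(5) e lin_simps linear_smult[OF sl] P.F.smult_closed self)
    qed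
  qed
  show "lift R N f \<in> linear_maps R (tpow R M n) N"
    unfolding tpow_eq by (rule P.lift_linear[OF N f' rel])
  show "lift R N f (tpure R M xs) = f xs" if "length xs = n" "set xs \<subseteq> carrier M"
    unfolding tpure_eq[OF that(1)] by (rule P.lift_delta[OF N f' rel]) (use that in \<open>auto simp: tuples_def\<close>)
qed

lemma tpow_lift_cong:
  assumes "z \<in> carrier (tpow R M n)" "module R N"
    and "\<And>xs. \<lbrakk>length xs = n; set xs \<subseteq> carrier M\<rbrakk> \<Longrightarrow> f xs = g xs"
    and "\<And>xs. \<lbrakk>length xs = n; set xs \<subseteq> carrier M\<rbrakk> \<Longrightarrow> g xs \<in> carrier N"
  shows "lift R N f z = lift R N g z"
  using assms unfolding tpow_eq
  by (elim presentation.lift_cong[OF presentation_tpow]) (auto simp: tuples_def)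

end

subsection \<open>Insertion of fixed outer factors\<close>

text \<open>Factors are counted from 1 and list positions from 0, so the factors \<open>i\<close>
  and \<open>i + 1\<close> are preceded by \<open>i - 1\<close> entries.\<close>

lemma split_at:
  assumes "length xs = n" "0 < i" "i < n"
  obtains as x y bs where "xs = as @ [x, y] @ bs" "length as = i - 1"
proof
  show "xs = take (i - 1) xs @ [xs ! (i - 1), xs ! i] @ drop (i + 1) xs"
  proof -
    have "xs = take (i - 1) xs @ xs ! (i - 1) # drop i xs"
      using assms id_take_nth_drop[of "i - 1" xs] by simp
    moreover have "drop i xs = xs ! i # drop (Suc i) xs"
      using assms by (intro Cons_nth_drop_Suc[symmetric]) simp
    ultimately show ?thesis
      by simp
  qed
qed (use assms in simp)

text \<open>For inner tensors of degree 2 this is the inner \<open>lift\<close> of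
  \<open>at_factors\<close>. Allowing every degree makes it possible to compare operators inside a
  window of factors.\<close>

definition insert_map ::
  "('k, 'e) ring_scheme \<Rightarrow> ('k, 'm, 'f) module_scheme \<Rightarrow> nat \<Rightarrow> 'm list \<Rightarrow> 'm list \<Rightarrow>
   ('m list \<Rightarrow> 'k) set \<Rightarrow> ('m list \<Rightarrow> 'k) set"
  where "insert_map R M n as bs = lift R (tpow R M n) (\<lambda>xs. tpure R M (as @ xs @ bs))"

context module
begin

lemma
  assumes "set as \<subseteq> carrier M" "set bs \<subseteq> carrier M" "length as + k + length bs = n"
  shows insert_map_linear: "insert_map R M n as bs \<in> linear_maps R (tpow R M k) (tpow R M n)"
    and insert_map_tpure: "\<lbrakk>length xs = k; set xs \<subseteq> carrier M\<rbrakk> \<Longrightarrow>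
      insert_map R M n as bs (tpure R M xs) = tpure R M (as @ xs @ bs)"
proof -
  have "multilinear R M k (tpow R M n) (\<lambda>xs. tpure R M (as @ xs @ bs))"
  proof (rule multilinearI)
    fix cs ds assume "set cs \<subseteq> carrier M" "set ds \<subseteq> carrier M" "Suc (length cs + length ds) = k"
    then show "(\<lambda>x. tpure R M (as @ (cs @ x # ds) @ bs)) \<in> linear_maps R M (tpow R M n)"
      using assms multilinear_slot[OF multilinear_tpure, of "as @ cs" "ds @ bs" n] by simp
  qed (use assms in \<open>auto intro!: tpure_closed\<close>)
  note * = tpow_lift_linear[OF module_tpow this] tpow_lift_tpure[OF module_tpow this]
  show "insert_map R M n as bs \<in> linear_maps R (tpow R M k) (tpow R M n)"
    "\<lbrakk>length xs = k; set xs \<subseteq> carrier M\<rbrakk> \<Longrightarrow>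
      insert_map R M n as bs (tpure R M xs) = tpure R M (as @ xs @ bs)"
    using * by (simp_all add: insert_map_def)
qed

lemma abelian_tpow: "abelian_group (tpow R M n)"
  using module_tpow by (rule module.axioms)

lemma insert_map_insert_map:
  assumes "set as \<subseteq> carrier M" "set bs \<subseteq> carrier M" "length as + m + length bs = n"
    and "set cs \<subseteq> carrier M" "set ds \<subseteq> carrier M" "length cs + k + length ds = m"
    and "z \<in> carrier (tpow R M k)"
  shows "insert_map R M n as bs (insert_map R M m cs ds z) = insert_map R M n (as @ cs) (ds @ bs) z"
proof -
  have 1: "insert_map R M n (as @ cs) (ds @ bs) \<in> linear_maps R (tpow R M k) (tpow R M n)"
    using assms by (intro insert_map_linear) auto
  show ?thesis
  proof (rule tpow_ext[OF linear_comp[OF insert_map_linear[OF assms(4-6)] insert_map_linear[OF assms(1-3)]]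
        1 abelian_tpow _ assms(7)])
    fix xs assume "length xs = k" "set xs \<subseteq> carrier M"
    then show "insert_map R M n as bs (insert_map R M m cs ds (tpure R M xs)) =
      insert_map R M n (as @ cs) (ds @ bs) (tpure R M xs)"
      using assms by (simp add: insert_map_tpure[where k = k] insert_map_tpure[where k = m])
  qed
qed

text \<open>For a pure tensor \<open>z\<close> this is multilinearity of \<open>tpure\<close>; each
  identity to be shown is linear in \<open>z\<close>, which gives it for all \<open>z\<close>. The
  varying outer factor stands to the left or to the right of the inserted tensor.\<close>

lemma insert_map_slot:
  assumes "set as \<subseteq> carrier M" "set bs \<subseteq> carrier M" "set cs \<subseteq> carrier M"
    and "z \<in> carrier (tpow R M k)"
  shows "length as + length bs + length cs + k + 1 = n \<Longrightarrow>
      (\<lambda>x. insert_map R M n (as @ x # bs) cs z) \<in> linear_maps R M (tpow R M n)"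
    and "length as + length bs + length cs + k + 1 = n \<Longrightarrow>
      (\<lambda>x. insert_map R M n as (bs @ x # cs) z) \<in> linear_maps R M (tpow R M n)"
proof -
  interpret T: module R "tpow R M n"
    by (rule module_tpow)
  assume n: "length as + length bs + length cs + k + 1 = n"
  let ?L = "linear_maps R (tpow R M k) (tpow R M n)"
  {
    have I: "insert_map R M n (as @ x # bs) cs \<in> ?L" if "x \<in> carrier M" for x
      using that assms n by (intro insert_map_linear) auto
    have pure: "insert_map R M n (as @ x # bs) cs (tpure R M xs) = tpure R M (as @ x # bs @ xs @ cs)"
      if "x \<in> carrier M" "length xs = k" "set xs \<subseteq> carrier M" for x xs
      using that assms n by (subst insert_map_tpure[where k = k]) auto
    have sl: "(\<lambda>x. tpure R M (as @ x # bs @ xs @ cs)) \<in> linear_maps R M (tpow R M n)"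
      if "length xs = k" "set xs \<subseteq> carrier M" for xs
      using that assms n by (intro multilinear_slot[OF multilinear_tpure]) auto
    show "(\<lambda>x. insert_map R M n (as @ x # bs) cs z) \<in> linear_maps R M (tpow R M n)"
    proof (rule linear_mapsI)
      fix x assume x: "x \<in> carrier M"
      show "insert_map R M n (as @ x # bs) cs z \<in> carrier (tpow R M n)"
        by (rule linear_closed[OF I[OF x] assms(4)])
      {
        fix y assume y: "y \<in> carrier M"
        show "insert_map R M n (as @ (x \<oplus>\<^bsub>M\<^esub> y) # bs) cs z =
          insert_map R M n (as @ x # bs) cs z \<oplus>\<^bsub>tpow R M n\<^esub> insert_map R M n (as @ y # bs) cs z"
          by (rule tpow_ext[OF I linear_maps_add[OF I I module_tpow module_tpow] abelian_tpow _ assms(4)])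
            (use x y linear_add[OF sl] in \<open>auto simp: pure\<close>)
      next
        fix c assume c: "c \<in> carrier R"
        show "insert_map R M n (as @ (c \<odot>\<^bsub>M\<^esub> x) # bs) cs z =
          c \<odot>\<^bsub>tpow R M n\<^esub> insert_map R M n (as @ x # bs) cs z"
          by (rule tpow_ext[OF I linear_maps_smult[OF I c module_tpow module_tpow] abelian_tpow _ assms(4)])
            (use x c linear_smult[OF sl] in \<open>auto simp: pure\<close>)
      }
    qed
  next
    have I: "insert_map R M n as (bs @ x # cs) \<in> ?L" if "x \<in> carrier M" for x
      using that assms n by (intro insert_map_linear) auto
    have pure: "insert_map R M n as (bs @ x # cs) (tpure R M xs) = tpure R M ((as @ xs @ bs) @ x # cs)"
      if "x \<in> carrier M" "length xs = k" "set xs \<subseteq> carrier M" for x xs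
      using that assms n by (subst insert_map_tpure[where k = k]) auto
    have sl: "(\<lambda>x. tpure R M ((as @ xs @ bs) @ x # cs)) \<in> linear_maps R M (tpow R M n)"
      if "length xs = k" "set xs \<subseteq> carrier M" for xs
      using that assms n by (intro multilinear_slot[OF multilinear_tpure]) auto
    show "(\<lambda>x. insert_map R M n as (bs @ x # cs) z) \<in> linear_maps R M (tpow R M n)"
    proof (rule linear_mapsI)
      fix x assume x: "x \<in> carrier M"
      show "insert_map R M n as (bs @ x # cs) z \<in> carrier (tpow R M n)"
        by (rule linear_closed[OF I[OF x] assms(4)])
      {
        fix y assume y: "y \<in> carrier M"
        show "insert_map R M n as (bs @ (x \<oplus>\<^bsub>M\<^esub> y) # cs) z =
          insert_map R M n as (bs @ x # cs) z \<oplus>\<^bsub>tpow R M n\<^esub> insert_map R M n as (bs @ y # cs) z"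
          by (rule tpow_ext[OF I linear_maps_add[OF I I module_tpow module_tpow] abelian_tpow _ assms(4)])
            (use x y linear_add[OF sl] in \<open>auto simp: pure simp del: append_assoc\<close>)
      next
        fix c assume c: "c \<in> carrier R"
        show "insert_map R M n as (bs @ (c \<odot>\<^bsub>M\<^esub> x) # cs) z =
          c \<odot>\<^bsub>tpow R M n\<^esub> insert_map R M n as (bs @ x # cs) z"
          by (rule tpow_ext[OF I linear_maps_smult[OF I c module_tpow module_tpow] abelian_tpow _ assms(4)])
            (use x c linear_smult[OF sl] in \<open>auto simp: pure simp del: append_assoc\<close>)
      }
    qed
  }
qed

lemma
  assumes f: "f \<in> linear_maps R (tpow R M 2) (tpow R M 2)" and i: "0 < i" "i < n"
  shows at_factors_linear: "at_factors R M n f i \<in> linear_maps R (tpow R M n) (tpow R M n)"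
    and at_factors_tpure: "\<lbrakk>set (as @ [x, y] @ bs) \<subseteq> carrier M; length as = i - 1; length bs = n - i - 1\<rbrakk> \<Longrightarrow>
      at_factors R M n f i (tpure R M (as @ [x, y] @ bs)) = insert_map R M n as bs (f (tpure R M [x, y]))"
proof -
  interpret T: module R "tpow R M n"
    by (rule module_tpow)
  define g where "g xs = insert_map R M n (take (i - 1) xs) (drop (i + 1) xs)
    (f (tpure R M [xs ! (i - 1), xs ! i]))" for xs
  have g: "g (as @ [x, y] @ bs) = insert_map R M n as bs (f (tpure R M [x, y]))"
    if "length as = i - 1" for as x y bs
  proof -
    have "i = Suc (length as)"
      using that i by simp
    then show ?thesis
      by (simp add: g_def nth_append)
  qed
  have f2: "f (tpure R M [x, y]) \<in> carrier (tpow R M 2)" if "x \<in> carrier M" "y \<in> carrier M" for x y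
    using that by (intro linear_closed[OF f] tpure_closed) auto
  have gl: "multilinear R M n (tpow R M n) g"
  proof (rule multilinearI)
    fix xs assume xs: "length xs = n" "set xs \<subseteq> carrier M"
    obtain as x y bs where s: "xs = as @ [x, y] @ bs" "length as = i - 1"
      using split_at[OF xs(1) i] .
    show "g xs \<in> carrier (tpow R M n)"
      unfolding s(1) g[OF s(2)] using xs i s by (intro linear_closed[OF insert_map_linear[where k = 2]] f2) auto
  next
    fix as bs assume s: "set as \<subseteq> carrier M" "set bs \<subseteq> carrier M" "Suc (length as + length bs) = n"
    \<comment> \<open>The varying entry stands before the two active factors, is the first or the
      second of them, or stands after them. Outside it is a parameter of the insertion, inside an
      argument of \<open>f\<close>.\<close>
    consider "Suc (length as) < i" | "Suc (length as) = i" | "length as = i" | "length as > i"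
      by linarith
    then show "(\<lambda>x. g (as @ x # bs)) \<in> linear_maps R M (tpow R M n)"
    proof cases
      case 1
      have "length bs = n - 1 - length as" "0 < i - Suc (length as)" "i - Suc (length as) < n - 1 - length as"
        using 1 i s(3) by auto
      then obtain cs u v ds where cs: "bs = cs @ [u, v] @ ds" "length cs = i - Suc (length as) - 1"
        by (rule split_at)
      have "g (as @ x # bs) = insert_map R M n (as @ x # cs) ds (f (tpure R M [u, v]))" for x
        using g[of "as @ x # cs" u v ds] cs 1 by simp
      then show ?thesis
        using s cs 1 by (auto intro!: insert_map_slot(1)[where k = 2] f2)
    next
      case 2
      then obtain u ds where u: "bs = u # ds"
        using i s(3) by (cases bs) auto
      have e: "g (as @ x # bs) = insert_map R M n as ds (f (tpure R M ([] @ x # [u])))" for x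
        using g[of as x u ds] 2 u by simp
      have "(\<lambda>x. tpure R M ([] @ x # [u])) \<in> linear_maps R M (tpow R M 2)"
        using s u by (intro multilinear_slot[OF multilinear_tpure]) auto
      from linear_comp[OF linear_comp[OF this f] insert_map_linear, of as ds n]
      show ?thesis
        unfolding e using s u by simp
    next
      case 3
      then obtain cs u where u: "as = cs @ [u]"
        using i s(3) by (cases as rule: rev_cases) auto
      have e: "g (as @ x # bs) = insert_map R M n cs bs (f (tpure R M ([u] @ x # [])))" for x
        using g[of cs u x bs] 3 u by simp
      have "(\<lambda>x. tpure R M ([u] @ x # [])) \<in> linear_maps R M (tpow R M 2)"
        using s u by (intro multilinear_slot[OF multilinear_tpure]) auto
      from linear_comp[OF linear_comp[OF this f] insert_map_linear, of cs bs n]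
      show ?thesis
        unfolding e using s u by simp
    next
      case 4
      obtain cs u v ds where cs: "as = cs @ [u, v] @ ds" "length cs = i - 1"
        using split_at[OF refl i(1) 4] .
      have "g (as @ x # bs) = insert_map R M n cs (ds @ x # bs) (f (tpure R M [u, v]))" for x
        using g[of cs u v "ds @ x # bs"] cs 4 by simp
      then show ?thesis
        using s cs 4 by (auto intro!: insert_map_slot(2)[where k = 2] f2)
    qed
  qed
  have eq: "at_factors R M n f i = lift R (tpow R M n) g"
    by (simp add: at_factors_def g_def[abs_def] insert_map_def)
  show "at_factors R M n f i \<in> linear_maps R (tpow R M n) (tpow R M n)"
    unfolding eq by (rule tpow_lift_linear[OF module_tpow gl])
  show "at_factors R M n f i (tpure R M (as @ [x, y] @ bs)) = insert_map R M n as bs (f (tpure R M [x, y]))"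
    if "set (as @ [x, y] @ bs) \<subseteq> carrier M" "length as = i - 1" "length bs = n - i - 1"
    unfolding eq g[OF that(2), symmetric] by (rule tpow_lift_tpure[OF module_tpow gl]) (use that i in auto)
qed

text \<open>An operator that acts inside the window does not see the factors inserted around it; its
  index is shifted by their number on the left. On pure tensors both sides are nested insertions of
  a value of \<open>f\<close>.\<close>

lemma at_factors_insert_map:
  assumes f: "f \<in> linear_maps R (tpow R M 2) (tpow R M 2)" and i: "0 < i" "i < k"
    and "set as \<subseteq> carrier M" "set bs \<subseteq> carrier M" "length as + k + length bs = n"
    and "z \<in> carrier (tpow R M k)"
  shows "at_factors R M n f (length as + i) (insert_map R M n as bs z) =
    insert_map R M n as bs (at_factors R M k f i z)"
proof -
  note I = insert_map_linear[OF assms(4-6)]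
  have i': "0 < length as + i" "length as + i < n"
    using i assms(6) by auto
  show ?thesis
  proof (rule tpow_ext[OF linear_comp[OF I at_factors_linear[OF f i']] linear_comp[OF at_factors_linear[OF f i] I]
        abelian_tpow _ assms(7)])
    fix xs assume xs: "length xs = k" "set xs \<subseteq> carrier M"
    obtain cs x y ds where s: "xs = cs @ [x, y] @ ds" "length cs = i - 1"
      using split_at[OF xs(1) i] .
    have f2: "f (tpure R M [x, y]) \<in> carrier (tpow R M 2)"
      using xs s by (intro linear_closed[OF f] tpure_closed) auto
    have "at_factors R M n f (length as + i) (insert_map R M n as bs (tpure R M xs)) =
        at_factors R M n f (length as + i) (tpure R M ((as @ cs) @ [x, y] @ (ds @ bs)))"
      using xs assms(4-6) s by (simp add: insert_map_tpure[where k = k])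
    also have "\<dots> = insert_map R M n (as @ cs) (ds @ bs) (f (tpure R M [x, y]))"
      using xs s assms(4-6) i by (intro at_factors_tpure[OF f i']) auto
    also have "\<dots> = insert_map R M n as bs (insert_map R M k cs ds (f (tpure R M [x, y])))"
      using xs s assms(4-6) i f2 by (intro insert_map_insert_map[where k = 2, symmetric]) auto
    also have "\<dots> = insert_map R M n as bs (at_factors R M k f i (tpure R M xs))"
      unfolding s(1) using xs s i by (subst at_factors_tpure[OF f i]) auto
    finally show "at_factors R M n f (length as + i) (insert_map R M n as bs (tpure R M xs)) =
      insert_map R M n as bs (at_factors R M k f i (tpure R M xs))" .
  qed
qed

lemma at_factors_two:
  assumes f: "f \<in> linear_maps R (tpow R M 2) (tpow R M 2)" and "z \<in> carrier (tpow R M 2)"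
  shows "at_factors R M 2 f 1 z = f z"
proof -
  have I: "insert_map R M 2 [] [] w = w" if "w \<in> carrier (tpow R M 2)" for w
    using that
    by (rule tpow_ext[OF insert_map_linear[where k = 2] linear_id abelian_tpow, rotated -1])
      (auto simp: insert_map_tpure[where k = 2])
  show ?thesis
  proof (rule tpow_ext[OF at_factors_linear[OF f] f abelian_tpow _ assms(2)])
    fix xs assume xs: "length xs = 2" "set xs \<subseteq> carrier M"
    then obtain x y where [simp]: "xs = [x, y]"
      by (auto simp: numeral_2_eq_2 length_Suc_conv)
    show "at_factors R M 2 f 1 (tpure R M xs) = f (tpure R M xs)"
      using at_factors_tpure[OF f, of 1 2 "[]" x y "[]"] xs
      by (simp add: I linear_closed[OF f] tpure_closed)
  qed auto
qed

text \<open>After the first operator the tensor is no longer pure, so the second cannot be evaluated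
  directly. Both composites are therefore identified with one bilinear expression in the values of
  \<open>f\<close> and \<open>g\<close> on the two pairs.\<close>

lemma at_factors_commute:
  assumes f: "f \<in> linear_maps R (tpow R M 2) (tpow R M 2)"
    and g: "g \<in> linear_maps R (tpow R M 2) (tpow R M 2)"
    and ij: "0 < i" "i + 1 < j" "j < n" and z: "z \<in> carrier (tpow R M n)"
  shows "at_factors R M n f i (at_factors R M n g j z) = at_factors R M n g j (at_factors R M n f i z)"
proof -
  have i': "0 < i" "i < n" and j': "0 < j" "j < n"
    using ij by auto
  note F = at_factors_linear[OF f i'] and G = at_factors_linear[OF g j']
  show ?thesis
  proof (rule tpow_ext[OF linear_comp[OF G F] linear_comp[OF F G] abelian_tpow _ z])
    fix xs assume xs: "length xs = n" "set xs \<subseteq> carrier M"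
    obtain as a b ys where s: "xs = as @ [a, b] @ ys" "length as = i - 1"
      using split_at[OF xs(1) i'] .
    have "length ys = n - i - 1" "0 < j - i - 1" "j - i - 1 < n - i - 1"
      using xs s ij by auto
    then obtain ms c d bs where s': "ys = ms @ [c, d] @ bs" "length ms = j - i - 1 - 1"
      by (rule split_at)
    have len: "length as + length ms + length bs + 4 = n" "i = length as + 1" "j = length as + length ms + 3"
      and cl: "set as \<subseteq> carrier M" "set ms \<subseteq> carrier M" "set bs \<subseteq> carrier M"
        "a \<in> carrier M" "b \<in> carrier M" "c \<in> carrier M" "d \<in> carrier M"
      using xs s s' ij by auto
    let ?T = "tpow R M 2"
    have I: "insert_map R M n as (ms @ ws @ bs) \<in> linear_maps R ?T (tpow R M n)"
      if "length ws = 2" "set ws \<subseteq> carrier M" for ws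
      using that len cl by (intro insert_map_linear) auto
    have I': "insert_map R M n (as @ ws @ ms) bs \<in> linear_maps R ?T (tpow R M n)"
      if "length ws = 2" "set ws \<subseteq> carrier M" for ws
      using that len cl by (intro insert_map_linear) auto
    have mul: "multilinear R M 2 (tpow R M n) (\<lambda>ws. insert_map R M n (as @ ws @ ms) bs w)"
      if w: "w \<in> carrier ?T" for w
    proof (rule multilinearI)
      fix cs ds assume "set cs \<subseteq> carrier M" "set ds \<subseteq> carrier M" "Suc (length cs + length ds) = 2"
      then show "(\<lambda>x. insert_map R M n (as @ (cs @ x # ds) @ ms) bs w) \<in> linear_maps R M (tpow R M n)"
        using insert_map_slot(1)[of "as @ cs" "ds @ ms" bs w 2 n] w len cl by simp
    qed (rule linear_closed[OF I'], use w in auto)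
    \<comment> \<open>\<open>J w v\<close> carries \<open>v\<close> on the factors \<open>i\<close>,
      \<open>i + 1\<close> and \<open>w\<close> on the factors \<open>j\<close>,
      \<open>j + 1\<close>; both composites turn out to be \<open>J ?g ?f\<close>.\<close>
    define J where "J w = lift R (tpow R M n) (\<lambda>ws. insert_map R M n (as @ ws @ ms) bs w)" for w
    have Jl: "J w \<in> linear_maps R ?T (tpow R M n)" if "w \<in> carrier ?T" for w
      unfolding J_def by (rule tpow_lift_linear[OF module_tpow mul[OF that]])
    have Jp: "J w (tpure R M ws) = insert_map R M n (as @ ws @ ms) bs w"
      if "w \<in> carrier ?T" "length ws = 2" "set ws \<subseteq> carrier M" for w ws
      unfolding J_def by (rule tpow_lift_tpure[OF module_tpow mul[OF that(1)] that(2,3)])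
    have J2: "J (tpure R M us) v = insert_map R M n as (ms @ us @ bs) v"
      if us: "length us = 2" "set us \<subseteq> carrier M" and v: "v \<in> carrier ?T" for us v
    proof (rule tpow_ext[OF Jl[OF tpure_closed[OF us]] I[OF us] abelian_tpow _ v])
      fix ws assume ws: "length ws = 2" "set ws \<subseteq> carrier M"
      show "J (tpure R M us) (tpure R M ws) = insert_map R M n as (ms @ us @ bs) (tpure R M ws)"
        using us ws len cl
        by (simp add: Jp tpure_closed insert_map_tpure[where k = 2])
    qed
    interpret T: module R "tpow R M n"
      by (rule module_tpow)
    interpret T2: module R ?T
      by (rule module_tpow)
    have Jadd: "J (w \<oplus>\<^bsub>?T\<^esub> w') v = J w v \<oplus>\<^bsub>tpow R M n\<^esub> J w' v"
      if w: "w \<in> carrier ?T" "w' \<in> carrier ?T" "v \<in> carrier ?T" for w w' v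
      by (rule tpow_ext[OF Jl linear_maps_add[OF Jl Jl module_tpow module_tpow] abelian_tpow _ w(3)])
        (use w linear_add[OF I'] in \<open>auto simp: Jp\<close>)
    have Jsm: "J (k \<odot>\<^bsub>?T\<^esub> w) v = k \<odot>\<^bsub>tpow R M n\<^esub> J w v"
      if w: "w \<in> carrier ?T" "k \<in> carrier R" "v \<in> carrier ?T" for w k v
      by (rule tpow_ext[OF Jl linear_maps_smult[OF Jl w(2) module_tpow module_tpow] abelian_tpow _ w(3)])
        (use w linear_smult[OF I'] in \<open>auto simp: Jp\<close>)
    have Jl2: "(\<lambda>w. J w v) \<in> linear_maps R ?T (tpow R M n)" if "v \<in> carrier ?T" for v
      by (rule linear_mapsI) (use that linear_closed[OF Jl] in \<open>auto simp: Jadd Jsm\<close>)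
    let ?f = "f (tpure R M [a, b])" and ?g = "g (tpure R M [c, d])"
    have ab: "tpure R M [a, b] \<in> carrier ?T" "tpure R M [c, d] \<in> carrier ?T"
      using cl by (auto intro!: tpure_closed)
    have fg: "?f \<in> carrier ?T" "?g \<in> carrier ?T"
      using ab linear_closed[OF f] linear_closed[OF g] by auto
    have 1: "at_factors R M n f i (insert_map R M n (as @ [a, b] @ ms) bs w) = J w ?f"
      if w: "w \<in> carrier ?T" for w
    proof (rule tpow_ext[OF linear_comp[OF I' F] Jl2[OF fg(1)] abelian_tpow _ w])
      fix ws assume ws: "length ws = 2" "set ws \<subseteq> carrier M"
      have "insert_map R M n (as @ [a, b] @ ms) bs (tpure R M ws) = tpure R M (as @ [a, b] @ (ms @ ws @ bs))"
        using ws len cl by (simp add: insert_map_tpure[where k = 2])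
      moreover have "at_factors R M n f i (tpure R M (as @ [a, b] @ (ms @ ws @ bs))) =
          insert_map R M n as (ms @ ws @ bs) ?f"
        using ws len cl by (intro at_factors_tpure[OF f i']) auto
      ultimately show "at_factors R M n f i (insert_map R M n (as @ [a, b] @ ms) bs (tpure R M ws)) =
          J (tpure R M ws) ?f"
        by (simp only: J2[OF ws fg(1)])
    qed (use cl in auto)
    have 2: "at_factors R M n g j (insert_map R M n as (ms @ [c, d] @ bs) w) = J ?g w"
      if w: "w \<in> carrier ?T" for w
    proof (rule tpow_ext[OF linear_comp[OF I G] Jl[OF fg(2)] abelian_tpow _ w])
      fix ws assume ws: "length ws = 2" "set ws \<subseteq> carrier M"
      have "insert_map R M n as (ms @ [c, d] @ bs) (tpure R M ws) = tpure R M ((as @ ws @ ms) @ [c, d] @ bs)"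
        using ws len cl by (simp add: insert_map_tpure[where k = 2])
      moreover have "at_factors R M n g j (tpure R M ((as @ ws @ ms) @ [c, d] @ bs)) =
          insert_map R M n (as @ ws @ ms) bs ?g"
        using ws len cl by (intro at_factors_tpure[OF g j']) auto
      ultimately show "at_factors R M n g j (insert_map R M n as (ms @ [c, d] @ bs) (tpure R M ws)) =
          J ?g (tpure R M ws)"
        by (simp only: Jp[OF fg(2) ws])
    qed (use cl in auto)
    have xs1: "xs = (as @ [a, b] @ ms) @ [c, d] @ bs" and xs2: "xs = as @ [a, b] @ (ms @ [c, d] @ bs)"
      using s s' by simp_all
    have "at_factors R M n g j (tpure R M xs) = insert_map R M n (as @ [a, b] @ ms) bs ?g"
      unfolding xs1 by (rule at_factors_tpure[OF g j']) (use len cl in auto)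
    moreover have "at_factors R M n f i (tpure R M xs) = insert_map R M n as (ms @ [c, d] @ bs) ?f"
      unfolding xs2 by (rule at_factors_tpure[OF f i']) (use len cl in auto)
    ultimately show "at_factors R M n f i (at_factors R M n g j (tpure R M xs)) =
      at_factors R M n g j (at_factors R M n f i (tpure R M xs))"
      using 1[OF fg(2)] 2[OF fg(1)] by simp
  qed
qed

end

section \<open>The tensor product over the integers\<close>

lemma abelian_group_cong:
  assumes "abelian_group M" "carrier N = carrier M" "zero N = zero M" "add N = add M"
  shows "abelian_group N"
proof -
  interpret M: abelian_group M by fact
  show ?thesis
    by (rule abelian_groupI) (auto simp: assms(2-4) M.add.m_ac intro: M.l_neg)
qed

lemma zmod_zmod [simp]: "zmod (zmod M) = zmod M"
  by (rule zmod_cong) simp_all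

lemma additiveI:
  assumes "abelian_group M" "abelian_group N" "\<And>x. x \<in> carrier M \<Longrightarrow> f x \<in> carrier N"
    and "\<And>x y. x \<in> carrier M \<Longrightarrow> y \<in> carrier M \<Longrightarrow> f (x \<oplus>\<^bsub>M\<^esub> y) = f x \<oplus>\<^bsub>N\<^esub> f y"
  shows "f \<in> linear_maps \<Z> (zmod M) (zmod N)"
  by (rule linear_maps_int) (auto simp: module_zmod assms)

lemma linear_imp_additive:
  assumes "f \<in> linear_maps A M N" "abelian_group M" "abelian_group N"
  shows "f \<in> linear_maps \<Z> (zmod M) (zmod N)"
  by (rule additiveI) (use assms in \<open>auto simp: linear_closed linear_add\<close>)

text \<open>The scalars of a module over the integers are determined by its addition, so replacing
  them by those of \<open>zmod\<close> changes no set of linear maps.\<close>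

lemma linear_maps_int_zmod:
  assumes "module \<Z> M" "module \<Z> N"
  shows "linear_maps \<Z> (zmod M) (zmod N) = linear_maps \<Z> M N"
proof -
  have ab: "abelian_group M" "abelian_group N"
    using assms by (auto intro: module.axioms)
  have "f \<in> linear_maps \<Z> M N" if "f \<in> linear_maps \<Z> (zmod M) (zmod N)" for f
    by (rule linear_maps_int[OF assms]) (use linear_closed[OF that] linear_add[OF that] in auto)
  then show ?thesis
    using linear_imp_additive[OF _ ab] by blast
qed

text \<open>Bilinearity over the integers. Passing through \<open>zmod\<close> lets the three groups
  carry any other scalars, or none.\<close>

definition biadditive ::
  "('u, 'e) ring_scheme \<Rightarrow> ('v, 'f) ring_scheme \<Rightarrow> ('n, 'g) ring_scheme \<Rightarrow> ('u \<Rightarrow> 'v \<Rightarrow> 'n) \<Rightarrow> bool"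
  where "biadditive U V N f \<longleftrightarrow>
    (\<forall>u\<in>carrier U. f u \<in> linear_maps \<Z> (zmod V) (zmod N)) \<and>
    (\<forall>v\<in>carrier V. (\<lambda>u. f u v) \<in> linear_maps \<Z> (zmod U) (zmod N))"

lemma
  assumes "biadditive U V N f" "u \<in> carrier U" "v \<in> carrier V"
  shows biadditive_closed: "f u v \<in> carrier N"
    and biadditive_left: "u' \<in> carrier U \<Longrightarrow> f (u \<oplus>\<^bsub>U\<^esub> u') v = f u v \<oplus>\<^bsub>N\<^esub> f u' v"
    and biadditive_right: "v' \<in> carrier V \<Longrightarrow> f u (v \<oplus>\<^bsub>V\<^esub> v') = f u v \<oplus>\<^bsub>N\<^esub> f u v'"
  using assms by (auto simp: biadditive_def linear_maps_def)

lemma biadditiveI: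
  assumes "abelian_group U" "abelian_group V" "abelian_group N"
    and "\<And>u v. \<lbrakk>u \<in> carrier U; v \<in> carrier V\<rbrakk> \<Longrightarrow> f u v \<in> carrier N"
    and "\<And>u u' v. \<lbrakk>u \<in> carrier U; u' \<in> carrier U; v \<in> carrier V\<rbrakk> \<Longrightarrow>
      f (u \<oplus>\<^bsub>U\<^esub> u') v = f u v \<oplus>\<^bsub>N\<^esub> f u' v"
    and "\<And>u v v'. \<lbrakk>u \<in> carrier U; v \<in> carrier V; v' \<in> carrier V\<rbrakk> \<Longrightarrow>
      f u (v \<oplus>\<^bsub>V\<^esub> v') = f u v \<oplus>\<^bsub>N\<^esub> f u v'"
  shows "biadditive U V N f"
  unfolding biadditive_def using assms by (auto intro!: additiveI)

lemma tensor_eq: "tensor R M N =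
    presented_module R (carrier M \<times> carrier N) (bilinear_rels R M N)"
  by (simp add: tensor_def presented_module_def Let_def)

lemma ztensor_simps:
  "carrier (ztensor U V) = carrier (tensor \<Z> (zmod U) (zmod V))"
  "zero (ztensor U V) = zero (tensor \<Z> (zmod U) (zmod V))"
  "add (ztensor U V) = add (tensor \<Z> (zmod U) (zmod V))"
  "c \<odot>\<^bsub>ztensor U V\<^esub> z =
    lift \<Z> (tensor \<Z> (zmod U) (zmod V)) (\<lambda>(u, v). zpure U V u (c \<odot>\<^bsub>V\<^esub> v)) z"
  by (simp_all add: ztensor_def Let_def)

lemma zpure_eq: "zpure U V u v =
    pclass \<Z> (carrier U \<times> carrier V) (bilinear_rels \<Z> (zmod U) (zmod V)) (delta \<Z> (u, v))"
  by (simp add: zpure_def pure_def pclass_def Let_def)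

lemma zmod_tensor: "zmod (tensor \<Z> (zmod U) (zmod V)) = zmod (ztensor U V)"
  by (rule zmod_cong) (simp_all add: ztensor_simps)

locale tensor_product = U: abelian_group U + V: module R V
  for U :: "('u, 'e) ring_scheme" and R :: "('k, 'f) ring_scheme" and V :: "('k, 'v, 'g) module_scheme"
begin

lemma zmodules: "module \<Z> (zmod U)" "module \<Z> (zmod V)"
  by (rule module_zmod, rule U.abelian_group_axioms) (rule module_zmod, rule V.M.abelian_group_axioms)

sublocale Z: presentation \<Z> "carrier U \<times> carrier V" "bilinear_rels \<Z> (zmod U) (zmod V)"
proof -
  let ?F = "free_module \<Z> (carrier U \<times> carrier V)"
  interpret F: module \<Z> ?F
    by (rule module_free_module) (rule int_is_cring)
  interpret ZU: module \<Z> "zmod U" by (rule zmodules)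
  interpret ZV: module \<Z> "zmod V" by (rule zmodules)
  have d: "delta \<Z> (u, v) \<in> carrier ?F" if "u \<in> carrier U" "v \<in> carrier V" for u v
    using that by (intro delta_closed[OF int_is_cring]) auto
  have "bilinear_rels \<Z> (zmod U) (zmod V) \<subseteq> carrier ?F"
    unfolding bilinear_rels_def Let_def
    using ZU.smult_closed ZV.smult_closed
    by (auto intro!: d F.smult_closed F.M.minus_closed F.M.a_closed)
  then show "presentation \<Z> (carrier U \<times> carrier V) (bilinear_rels \<Z> (zmod U) (zmod V))"
    by (intro presentation.intro presentation_axioms.intro int_is_cring)
qed

lemma module_tensor: "module \<Z> (tensor \<Z> (zmod U) (zmod V))"
  using Z.module_presented_module by (simp add: tensor_eq)

lemma abelian_ztensor: "abelian_group (ztensor U V)"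
  by (rule abelian_group_cong[OF module.axioms(2)[OF module_tensor]]) (simp_all add: ztensor_simps)

lemma ztensor_ext:
  assumes g: "g \<in> linear_maps \<Z> (zmod (ztensor U V)) (zmod N)"
    and h: "h \<in> linear_maps \<Z> (zmod (ztensor U V)) (zmod N)"
    and N: "abelian_group N"
    and eq: "\<And>u v. \<lbrakk>u \<in> carrier U; v \<in> carrier V\<rbrakk> \<Longrightarrow> g (zpure U V u v) = h (zpure U V u v)"
    and z: "z \<in> carrier (ztensor U V)"
  shows "g z = h z"
proof -
  have lin: "f \<in> linear_maps \<Z> (presented_module \<Z> (carrier U \<times> carrier V)
      (bilinear_rels \<Z> (zmod U) (zmod V))) (zmod N)"
    if "f \<in> linear_maps \<Z> (zmod (ztensor U V)) (zmod N)" for f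
    unfolding tensor_eq[of \<Z> "zmod U" "zmod V", unfolded zmod_simps, symmetric]
    using linear_maps_int_zmod[OF module_tensor module_zmod[OF N]] that
    by (simp add: zmod_tensor)
  show ?thesis
    by (rule Z.presented_ext[OF lin[OF g] lin[OF h] module.axioms(2)[OF module_zmod[OF N]]])
      (use z eq in \<open>auto simp: zpure_eq ztensor_simps tensor_eq\<close>)
qed

lemma lincomb_bilinear_rel:
  assumes N: "module \<Z> N" and f: "biadditive U V N f" and r: "r \<in> bilinear_rels \<Z> (zmod U) (zmod V)"
  shows "lincomb \<Z> N (\<lambda>(u, v). f u v) r = \<zero>\<^bsub>N\<^esub>"
proof -
  interpret N: module \<Z> N
    by (rule N)
  interpret ZU: module \<Z> "zmod U" by (rule zmodules)
  interpret ZV: module \<Z> "zmod V" by (rule zmodules)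
  have f': "(\<lambda>(u, v). f u v) \<in> carrier U \<times> carrier V \<rightarrow> carrier N"
    using biadditive_closed[OF f] by auto
  let ?F = "free_module \<Z> (carrier U \<times> carrier V)"
  have d: "delta \<Z> (u, v) \<in> carrier ?F" if "u \<in> carrier U" "v \<in> carrier V" for u v
    using that by (intro delta_closed[OF int_is_cring]) auto
  note lin = lincomb_linear[OF N f']
  note ab = Z.F.M.abelian_group_axioms N.M.abelian_group_axioms
  note lin_simps = linear_minus[OF lin ab] linear_add[OF lin] linear_smult[OF lin] lincomb_delta[OF N f']
  have self: "z \<ominus>\<^bsub>N\<^esub> z = \<zero>\<^bsub>N\<^esub>" if "z \<in> carrier N" for z
    using that by (simp add: a_minus_def N.M.r_neg)
  note cl = biadditive_closed[OF f]
  have sm: "f (c \<odot>\<^bsub>zmod U\<^esub> u) v = c \<odot>\<^bsub>N\<^esub> f u v" "f u (c \<odot>\<^bsub>zmod V\<^esub> v) = c \<odot>\<^bsub>N\<^esub> f u v"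
    if "u \<in> carrier U" "v \<in> carrier V" for c u v
  proof -
    have "(\<lambda>u. f u v) \<in> linear_maps \<Z> (zmod U) N" "f u \<in> linear_maps \<Z> (zmod V) N"
      using f that linear_maps_int_zmod[OF zmodules(1) N] linear_maps_int_zmod[OF zmodules(2) N]
      by (auto simp: biadditive_def)
    then show "f (c \<odot>\<^bsub>zmod U\<^esub> u) v = c \<odot>\<^bsub>N\<^esub> f u v" "f u (c \<odot>\<^bsub>zmod V\<^esub> v) = c \<odot>\<^bsub>N\<^esub> f u v"
      using that by (auto simp: linear_maps_def)
  qed
  have ZUc: "c \<odot>\<^bsub>zmod U\<^esub> u \<in> carrier U" if "u \<in> carrier U" for c u
    using ZU.smult_closed[of c u] that by simp
  have ZVc: "c \<odot>\<^bsub>zmod V\<^esub> v \<in> carrier V" if "v \<in> carrier V" for c v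
    using ZV.smult_closed[of c v] that by simp
  have Fsm: "c \<odot>\<^bsub>?F\<^esub> a \<in> carrier ?F" if "a \<in> carrier ?F" for c a
    using Z.F.smult_closed[of c a] that by simp
  from r show ?thesis
    unfolding bilinear_rels_def Let_def zmod_simps
  proof (elim UnE CollectE exE conjE, goal_cases)
    case (1 u u' v)
    then show ?case
      by (simp add: lin_simps d cl biadditive_left[OF f] self)
  next
    case (2 u v v')
    then show ?case
      by (simp add: lin_simps d cl biadditive_right[OF f] self)
  next
    case (3 c u v)
    then show ?case
      using N.smult_closed[of c "f u v"] by (simp add: lin_simps d cl sm ZUc Fsm self)
  next
    case (4 c u v)
    then show ?case
      using N.smult_closed[of c "f u v"] by (simp add: lin_simps d cl sm ZVc Fsm self)
  qed
qed

lemma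
  assumes N: "module \<Z> N" and f: "biadditive U V N f"
  shows tensor_lift_additive: "lift \<Z> N (\<lambda>(u, v). f u v) \<in> linear_maps \<Z> (zmod (ztensor U V)) (zmod N)"
    and tensor_lift_zpure:
      "\<lbrakk>u \<in> carrier U; v \<in> carrier V\<rbrakk> \<Longrightarrow> lift \<Z> N (\<lambda>(u, v). f u v) (zpure U V u v) = f u v"
proof -
  have f': "(\<lambda>(u, v). f u v) \<in> carrier U \<times> carrier V \<rightarrow> carrier N"
    using biadditive_closed[OF f] by auto
  note rel = lincomb_bilinear_rel[OF N f]
  have "lift \<Z> N (\<lambda>(u, v). f u v) \<in> linear_maps \<Z> (tensor \<Z> (zmod U) (zmod V)) N"
    unfolding tensor_eq zmod_simps by (rule Z.lift_linear[OF N f' rel])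
  then show "lift \<Z> N (\<lambda>(u, v). f u v) \<in> linear_maps \<Z> (zmod (ztensor U V)) (zmod N)"
    using linear_maps_int_zmod[OF module_tensor N] by (simp add: zmod_tensor)
  show "lift \<Z> N (\<lambda>(u, v). f u v) (zpure U V u v) = f u v" if "u \<in> carrier U" "v \<in> carrier V"
    unfolding zpure_eq by (subst Z.lift_delta[OF N f' rel]) (use that in auto)
qed

lemma biadditive_zpure: "biadditive U V (ztensor U V) (zpure U V)"
proof -
  note lin = Z.pclass_linear
  note ab = Z.F.M.abelian_group_axioms Z.P.M.abelian_group_axioms
  let ?F = "free_module \<Z> (carrier U \<times> carrier V)"
  have d: "delta \<Z> (u, v) \<in> carrier ?F" if "u \<in> carrier U" "v \<in> carrier V" for u v
    using that by (intro delta_closed[OF int_is_cring]) auto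
  note lin_simps = linear_minus[OF lin ab] linear_add[OF lin]
  have ws: "carrier (ztensor U V) = carrier (presented_module \<Z> (carrier U \<times> carrier V) (bilinear_rels \<Z> (zmod U) (zmod V)))"
    "add (ztensor U V) = add (presented_module \<Z> (carrier U \<times> carrier V) (bilinear_rels \<Z> (zmod U) (zmod V)))"
    by (simp_all add: ztensor_simps tensor_eq)
  note cl = linear_closed[OF lin d]
  show ?thesis
  proof (rule biadditiveI[OF U.abelian_group_axioms V.M.abelian_group_axioms abelian_ztensor])
    show "zpure U V u v \<in> carrier (ztensor U V)" if "u \<in> carrier U" "v \<in> carrier V" for u v
      unfolding ws zpure_eq by (rule cl[OF that])
  next
    fix u u' v assume *: "u \<in> carrier U" "u' \<in> carrier U" "v \<in> carrier V"
    have "delta \<Z> (u \<oplus>\<^bsub>U\<^esub> u', v) \<ominus>\<^bsub>?F\<^esub> (delta \<Z> (u, v) \<oplus>\<^bsub>?F\<^esub> delta \<Z> (u', v))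
        \<in> bilinear_rels \<Z> (zmod U) (zmod V)"
      unfolding bilinear_rels_def Let_def zmod_simps using * by blast
    note rel = Z.pclass_rel[OF this]
    show "zpure U V (u \<oplus>\<^bsub>U\<^esub> u') v = zpure U V u v \<oplus>\<^bsub>ztensor U V\<^esub> zpure U V u' v"
      unfolding ws zpure_eq
      by (rule minus_eq_zeroD[OF ab(2)]) (use rel * in \<open>simp_all add: lin_simps d cl\<close>)
  next
    fix u v v' assume *: "u \<in> carrier U" "v \<in> carrier V" "v' \<in> carrier V"
    have "delta \<Z> (u, v \<oplus>\<^bsub>V\<^esub> v') \<ominus>\<^bsub>?F\<^esub> (delta \<Z> (u, v) \<oplus>\<^bsub>?F\<^esub> delta \<Z> (u, v'))
        \<in> bilinear_rels \<Z> (zmod U) (zmod V)"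
      unfolding bilinear_rels_def Let_def zmod_simps using * by blast
    note rel = Z.pclass_rel[OF this]
    show "zpure U V u (v \<oplus>\<^bsub>V\<^esub> v') = zpure U V u v \<oplus>\<^bsub>ztensor U V\<^esub> zpure U V u v'"
      unfolding ws zpure_eq
      by (rule minus_eq_zeroD[OF ab(2)]) (use rel * in \<open>simp_all add: lin_simps d cl\<close>)
  qed
qed

lemmas zpure_closed = biadditive_closed[OF biadditive_zpure]

lemma biadditive_smult:
  assumes "biadditive U V N f" "c \<in> carrier R" "abelian_group N"
  shows "biadditive U V N (\<lambda>u v. f u (c \<odot>\<^bsub>V\<^esub> v))"
  by (rule biadditiveI[OF U.abelian_group_axioms V.M.abelian_group_axioms assms(3)])
    (use assms(2) in \<open>auto simp: V.smult_r_distr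
      biadditive_closed[OF assms(1)] biadditive_left[OF assms(1)] biadditive_right[OF assms(1)]\<close>)

lemma
  assumes "c \<in> carrier R"
  shows ztensor_smult_additive: "(\<lambda>z. c \<odot>\<^bsub>ztensor U V\<^esub> z) \<in> linear_maps \<Z> (zmod (ztensor U V)) (zmod (ztensor U V))"
    and ztensor_smult_zpure: "\<lbrakk>u \<in> carrier U; v \<in> carrier V\<rbrakk> \<Longrightarrow>
      c \<odot>\<^bsub>ztensor U V\<^esub> zpure U V u v = zpure U V u (c \<odot>\<^bsub>V\<^esub> v)"
proof -
  have "biadditive U V (tensor \<Z> (zmod U) (zmod V)) (\<lambda>u v. zpure U V u (c \<odot>\<^bsub>V\<^esub> v))"
    using biadditive_smult[OF biadditive_zpure assms abelian_ztensor]
    by (simp add: biadditive_def zmod_tensor)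
  note * = tensor_lift_additive[OF module_tensor this] tensor_lift_zpure[OF module_tensor this]
  show "(\<lambda>z. c \<odot>\<^bsub>ztensor U V\<^esub> z) \<in> linear_maps \<Z> (zmod (ztensor U V)) (zmod (ztensor U V))"
    using *(1) by (simp add: ztensor_simps(4) zmod_tensor)
  show "\<lbrakk>u \<in> carrier U; v \<in> carrier V\<rbrakk> \<Longrightarrow>
      c \<odot>\<^bsub>ztensor U V\<^esub> zpure U V u v = zpure U V u (c \<odot>\<^bsub>V\<^esub> v)"
    using *(2) by (simp add: ztensor_simps(4))
qed

text \<open>The axioms that involve two scalars, and the one for the unit, compare additive maps of
  \<open>z\<close>; they are checked on pure tensors.\<close>

lemma module_ztensor: "module R (ztensor U V)"
proof -
  interpret W: abelian_group "ztensor U V"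
    by (rule abelian_ztensor)
  let ?W = "ztensor U V"
  note sa = ztensor_smult_additive
  have cl: "c \<odot>\<^bsub>?W\<^esub> z \<in> carrier ?W" if "c \<in> carrier R" "z \<in> carrier ?W" for c z
    using linear_closed[OF sa[OF that(1)]] that(2) by simp
  have add: "c \<odot>\<^bsub>?W\<^esub> (y \<oplus>\<^bsub>?W\<^esub> z) = c \<odot>\<^bsub>?W\<^esub> y \<oplus>\<^bsub>?W\<^esub> c \<odot>\<^bsub>?W\<^esub> z"
    if "c \<in> carrier R" "y \<in> carrier ?W" "z \<in> carrier ?W" for c y z
    using linear_add[OF sa[OF that(1)]] that(2,3) by simp
  note zsimps = ztensor_smult_zpure biadditive_right[OF biadditive_zpure] zpure_closed
  show ?thesis
  proof (rule moduleI[OF V.R.is_cring abelian_ztensor cl _ add])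
    fix a b z assume *: "a \<in> carrier R" "b \<in> carrier R" and z: "z \<in> carrier ?W"
    show "(a \<oplus>\<^bsub>R\<^esub> b) \<odot>\<^bsub>?W\<^esub> z = a \<odot>\<^bsub>?W\<^esub> z \<oplus>\<^bsub>?W\<^esub> b \<odot>\<^bsub>?W\<^esub> z"
    proof (rule ztensor_ext[OF sa _ abelian_ztensor _ z])
      show "(\<lambda>z. a \<odot>\<^bsub>?W\<^esub> z \<oplus>\<^bsub>?W\<^esub> b \<odot>\<^bsub>?W\<^esub> z) \<in> linear_maps \<Z> (zmod ?W) (zmod ?W)"
        by (rule additiveI[OF abelian_ztensor abelian_ztensor])
          (use * cl in \<open>auto simp: add W.add.m_ac\<close>)
    qed (use * in \<open>auto simp: zsimps V.smult_l_distr\<close>)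
    show "(a \<otimes>\<^bsub>R\<^esub> b) \<odot>\<^bsub>?W\<^esub> z = a \<odot>\<^bsub>?W\<^esub> (b \<odot>\<^bsub>?W\<^esub> z)"
      by (rule ztensor_ext[OF sa linear_comp[OF sa sa] abelian_ztensor _ z])
        (use * in \<open>auto simp: zsimps V.smult_assoc1\<close>)
  next
    fix z assume z: "z \<in> carrier ?W"
    show "\<one>\<^bsub>R\<^esub> \<odot>\<^bsub>?W\<^esub> z = z"
      by (rule ztensor_ext[OF sa linear_id abelian_ztensor _ z]) (auto simp: zsimps)
  qed
qed

text \<open>The scalars of \<open>ztensor U V\<close> act through the second factor, so
  compatibility of \<open>f\<close> with them there is inherited from pure tensors.\<close>

lemma ztensor_lift_linear:
  assumes N: "module R N" and f: "biadditive U V N f"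
    and s: "\<And>c u v. \<lbrakk>c \<in> carrier R; u \<in> carrier U; v \<in> carrier V\<rbrakk> \<Longrightarrow> f u (c \<odot>\<^bsub>V\<^esub> v) = c \<odot>\<^bsub>N\<^esub> f u v"
  shows "lift \<Z> (zmod N) (\<lambda>(u, v). f u v) \<in> linear_maps R (ztensor U V) N"
proof -
  interpret N: module R N
    by (rule N)
  have f': "biadditive U V (zmod N) f"
    using f by (simp add: biadditive_def)
  have zN: "module \<Z> (zmod N)"
    by (rule module_zmod) (rule N.M.abelian_group_axioms)
  note l = tensor_lift_additive[OF zN f', simplified]
  note z = tensor_lift_zpure[OF zN f']
  let ?l = "lift \<Z> (zmod N) (\<lambda>(u, v). f u v)"
  show ?thesis
  proof (rule linear_mapsI)
    fix c x assume c: "c \<in> carrier R" and x: "x \<in> carrier (ztensor U V)"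
    have "(\<lambda>x. c \<odot>\<^bsub>N\<^esub> ?l x) \<in> linear_maps \<Z> (zmod (ztensor U V)) (zmod N)"
      by (rule additiveI[OF abelian_ztensor N.M.abelian_group_axioms])
        (use c linear_closed[OF l] linear_add[OF l] in \<open>auto simp: N.smult_r_distr\<close>)
    then show "?l (c \<odot>\<^bsub>ztensor U V\<^esub> x) = c \<odot>\<^bsub>N\<^esub> ?l x"
      by (rule ztensor_ext[OF linear_comp[OF ztensor_smult_additive[OF c] l] _ N.M.abelian_group_axioms _ x])
        (use c in \<open>auto simp: ztensor_smult_zpure z s\<close>)
  qed (use linear_closed[OF l] linear_add[OF l] in auto)
qed

lemma ztensor_lift_zpure:
  assumes N: "abelian_group N" and f: "biadditive U V N f" "u \<in> carrier U" "v \<in> carrier V"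
  shows "lift \<Z> (zmod N) (\<lambda>(u, v). f u v) (zpure U V u v) = f u v"
  by (rule tensor_lift_zpure[OF module_zmod[OF N]]) (use f in \<open>simp_all add: biadditive_def\<close>)

lemma ztensor_lift_closed:
  assumes N: "abelian_group N" and f: "biadditive U V N f" "z \<in> carrier (ztensor U V)"
  shows "lift \<Z> (zmod N) (\<lambda>(u, v). f u v) z \<in> carrier N"
  using linear_closed[OF tensor_lift_additive[OF module_zmod[OF N], of f], of z] f
  by (simp add: biadditive_def)

lemma ztensor_lift_cong:
  assumes "z \<in> carrier (ztensor U V)" "abelian_group N"
    and "\<And>u v. \<lbrakk>u \<in> carrier U; v \<in> carrier V\<rbrakk> \<Longrightarrow> f u v = g u v"
    and "\<And>u v. \<lbrakk>u \<in> carrier U; v \<in> carrier V\<rbrakk> \<Longrightarrow> g u v \<in> carrier N"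
  shows "lift \<Z> (zmod N) (\<lambda>(u, v). f u v) z = lift \<Z> (zmod N) (\<lambda>(u, v). g u v) z"
  using assms(1) unfolding ztensor_simps tensor_eq zmod_simps
  by (rule Z.lift_cong) (use assms in \<open>auto simp: module_zmod\<close>)

text \<open>The exchange maps are iterated lifts, in which the function to be lifted itself depends
  on further tensor factors; this keeps that dependence linear.\<close>

lemma ztensor_lift_parameter:
  assumes P: "module A P" and N: "module A N"
    and bi: "\<And>p. p \<in> carrier P \<Longrightarrow> biadditive U V N (f p)"
    and lin: "\<And>u v. \<lbrakk>u \<in> carrier U; v \<in> carrier V\<rbrakk> \<Longrightarrow> (\<lambda>p. f p u v) \<in> linear_maps A P N"
    and z: "z \<in> carrier (ztensor U V)"
  shows "(\<lambda>p. lift \<Z> (zmod N) (\<lambda>(u, v). f p u v) z) \<in> linear_maps A P N"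
proof -
  interpret P: module A P by (rule P)
  interpret N: module A N by (rule N)
  note abN = N.M.abelian_group_axioms
  have L: "lift \<Z> (zmod N) (\<lambda>(u, v). f p u v) \<in> linear_maps \<Z> (zmod (ztensor U V)) (zmod N)"
    if "p \<in> carrier P" for p
    using tensor_lift_additive[OF module_zmod[OF abN], of "f p"] bi[OF that] by (simp add: biadditive_def)
  note pure = ztensor_lift_zpure[OF abN bi]
  note Lc = linear_closed[OF L, simplified] and La = linear_add[OF L, simplified]
  show ?thesis
  proof (rule linear_mapsI)
    fix p assume p: "p \<in> carrier P"
    show "lift \<Z> (zmod N) (\<lambda>(u, v). f p u v) z \<in> carrier N"
      by (rule Lc[OF p z])
    fix p' assume p': "p' \<in> carrier P"
    show "lift \<Z> (zmod N) (\<lambda>(u, v). f (p \<oplus>\<^bsub>P\<^esub> p') u v) z =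
      lift \<Z> (zmod N) (\<lambda>(u, v). f p u v) z \<oplus>\<^bsub>N\<^esub> lift \<Z> (zmod N) (\<lambda>(u, v). f p' u v) z"
    proof (rule ztensor_ext[OF L _ abN _ z])
      show "(\<lambda>z. lift \<Z> (zmod N) (\<lambda>(u, v). f p u v) z \<oplus>\<^bsub>N\<^esub> lift \<Z> (zmod N) (\<lambda>(u, v). f p' u v) z)
        \<in> linear_maps \<Z> (zmod (ztensor U V)) (zmod N)"
        by (rule additiveI[OF abelian_ztensor abN]) (use p p' Lc in \<open>auto simp: La N.M.add.m_ac\<close>)
    qed (use p p' linear_add[OF lin] in \<open>auto simp: pure\<close>)
  next
    fix c p assume c: "c \<in> carrier A" and p: "p \<in> carrier P"
    show "lift \<Z> (zmod N) (\<lambda>(u, v). f (c \<odot>\<^bsub>P\<^esub> p) u v) z =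
      c \<odot>\<^bsub>N\<^esub> lift \<Z> (zmod N) (\<lambda>(u, v). f p u v) z"
    proof (rule ztensor_ext[OF L _ abN _ z])
      show "(\<lambda>z. c \<odot>\<^bsub>N\<^esub> lift \<Z> (zmod N) (\<lambda>(u, v). f p u v) z)
        \<in> linear_maps \<Z> (zmod (ztensor U V)) (zmod N)"
        by (rule additiveI[OF abelian_ztensor abN]) (use p c Lc in \<open>auto simp: La N.smult_r_distr\<close>)
    qed (use p c linear_smult[OF lin] in \<open>auto simp: pure\<close>)
  qed
qed

lemma
  assumes f: "f \<in> linear_maps \<Z> (zmod U) (zmod U)" and g: "g \<in> linear_maps R V V"
  shows zmap_linear: "zmap U V f g \<in> linear_maps R (ztensor U V) (ztensor U V)"
    and zmap_zpure: "\<lbrakk>u \<in> carrier U; v \<in> carrier V\<rbrakk> \<Longrightarrow>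
      zmap U V f g (zpure U V u v) = zpure U V (f u) (g v)"
proof -
  note fs = linear_closed[OF f, simplified] linear_add[OF f, simplified]
  note gs = linear_closed[OF g] linear_add[OF g] linear_smult[OF g]
  have bi: "biadditive U V (ztensor U V) (\<lambda>u v. zpure U V (f u) (g v))"
    by (rule biadditiveI[OF U.abelian_group_axioms V.M.abelian_group_axioms abelian_ztensor])
      (auto simp: fs gs zpure_closed biadditive_left[OF biadditive_zpure] biadditive_right[OF biadditive_zpure])
  show "zmap U V f g \<in> linear_maps R (ztensor U V) (ztensor U V)"
    unfolding zmap_def
    by (rule ztensor_lift_linear[OF module_ztensor bi]) (auto simp: fs gs ztensor_smult_zpure)
  show "\<lbrakk>u \<in> carrier U; v \<in> carrier V\<rbrakk> \<Longrightarrow> zmap U V f g (zpure U V u v) = zpure U V (f u) (g v)"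
    unfolding zmap_def by (rule ztensor_lift_zpure[OF abelian_ztensor bi])
qed

end

context tensor_product
begin

lemma zpure_left_linear: "v \<in> carrier V \<Longrightarrow> (\<lambda>u. zpure U V u v) \<in> linear_maps \<Z> (zmod U) (zmod (ztensor U V))"
  using biadditive_zpure by (simp add: biadditive_def)

lemma zpure_right_linear: "u \<in> carrier U \<Longrightarrow> (\<lambda>v. zpure U V u v) \<in> linear_maps R V (ztensor U V)"
  by (rule linear_mapsI)
    (auto simp: zpure_closed biadditive_right[OF biadditive_zpure] ztensor_smult_zpure)

end

text \<open>The shape shared by the middle factor of \<open>Psi_U\<close> and by the action in
  \<open>F_functor\<close>, with \<open>a\<close> in place of \<open>1 - q\<close>, so that both can
  be treated at once.\<close>

definition twist ::
  "('u, 'e) ring_scheme \<Rightarrow> ('k, 'v, 'f) module_scheme \<Rightarrow> ('u \<Rightarrow> 'u) \<Rightarrow> ('v \<Rightarrow> 'v) \<Rightarrow> ('u \<Rightarrow> 'u) \<Rightarrow> 'k \<Rightarrow>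
   ('u \<times> 'v \<Rightarrow> int) set \<Rightarrow> ('u \<times> 'v \<Rightarrow> int) set"
  where "twist U V f g d a z =
    zmap U V f g z \<oplus>\<^bsub>ztensor U V\<^esub> zmap U V d (\<lambda>v. a \<odot>\<^bsub>V\<^esub> v) z"

context tensor_product
begin

lemma
  assumes f: "f \<in> linear_maps \<Z> (zmod U) (zmod U)" and g: "g \<in> linear_maps R V V"
    and d: "d \<in> linear_maps \<Z> (zmod U) (zmod U)" and a: "a \<in> carrier R"
  shows twist_linear: "twist U V f g d a \<in> linear_maps R (ztensor U V) (ztensor U V)"
    and twist_zpure: "\<lbrakk>u \<in> carrier U; v \<in> carrier V\<rbrakk> \<Longrightarrow> twist U V f g d a (zpure U V u v) =
      zpure U V (f u) (g v) \<oplus>\<^bsub>ztensor U V\<^esub> zpure U V (d u) (a \<odot>\<^bsub>V\<^esub> v)"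
proof -
  have am: "(\<lambda>v. a \<odot>\<^bsub>V\<^esub> v) \<in> linear_maps R V V"
    by (rule linear_maps_smult[OF linear_id a V.module_axioms V.module_axioms])
  show "twist U V f g d a \<in> linear_maps R (ztensor U V) (ztensor U V)"
    unfolding twist_def[abs_def]
    by (rule linear_maps_add[OF zmap_linear[OF f g] zmap_linear[OF d am] module_ztensor module_ztensor])
  show "\<lbrakk>u \<in> carrier U; v \<in> carrier V\<rbrakk> \<Longrightarrow> twist U V f g d a (zpure U V u v) =
      zpure U V (f u) (g v) \<oplus>\<^bsub>ztensor U V\<^esub> zpure U V (d u) (a \<odot>\<^bsub>V\<^esub> v)"
    by (simp add: twist_def zmap_zpure[OF f g] zmap_zpure[OF d am])
qed

end

section \<open>Exchanging tensor products and tensor powers\<close>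

text \<open>Three lifts are nested because the power of \<open>V\<close> is taken over
  \<open>R\<close>, while the power of \<open>U\<close> and the product of the two powers are taken
  over the integers.\<close>

definition merge_tensors ::
  "('k, 'e) ring_scheme \<Rightarrow> (int, 'u) module \<Rightarrow> ('k, 'v) module \<Rightarrow> nat \<Rightarrow>
   (('u list \<Rightarrow> int) set \<times> ('v list \<Rightarrow> 'k) set \<Rightarrow> int) set \<Rightarrow>
   (('u \<times> 'v \<Rightarrow> int) set list \<Rightarrow> 'k) set"
  where "merge_tensors R U V n = (let T = tpow R (ztensor U V) n in
    lift \<Z> (zmod T) (\<lambda>(x, y). lift R T (\<lambda>vs.
      lift \<Z> (zmod T) (\<lambda>us. tpure R (ztensor U V) (map2 (zpure U V) us vs)) x) y))"

text \<open>The lists \<open>us\<close> and \<open>vs\<close> accumulate the factors of the tensors which have been split already.\<close>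

primrec split_tensors ::
  "('k, 'e) ring_scheme \<Rightarrow> (int, 'u) module \<Rightarrow> ('k, 'v) module \<Rightarrow> nat \<Rightarrow>
   ('u \<times> 'v \<Rightarrow> int) set list \<Rightarrow> 'u list \<Rightarrow> 'v list \<Rightarrow>
   (('u list \<Rightarrow> int) set \<times> ('v list \<Rightarrow> 'k) set \<Rightarrow> int) set"
  where
    "split_tensors R U V n [] = (\<lambda>us vs.
      zpure (tpow \<Z> U n) (tpow R V n) (tpure \<Z> U us) (tpure R V vs))"
  | "split_tensors R U V n (w # ws) = (\<lambda>us vs.
      lift \<Z> (zmod (ztensor (tpow \<Z> U n) (tpow R V n)))
        (\<lambda>(u, v). split_tensors R U V n ws (us @ [u]) (vs @ [v])) w)"

definition unmerge_tensors ::
  "('k, 'e) ring_scheme \<Rightarrow> (int, 'u) module \<Rightarrow> ('k, 'v) module \<Rightarrow> nat \<Rightarrow>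
   (('u \<times> 'v \<Rightarrow> int) set list \<Rightarrow> 'k) set \<Rightarrow>
   (('u list \<Rightarrow> int) set \<times> ('v list \<Rightarrow> 'k) set \<Rightarrow> int) set"
  where "unmerge_tensors R U V n =
    lift R (ztensor (tpow \<Z> U n) (tpow R V n)) (\<lambda>ws. split_tensors R U V n ws [] [])"

lemma biadditive_zmod [simp]: "biadditive U V (zmod N) f = biadditive U V N f"
  by (simp add: biadditive_def)

locale tensor_powers = U: module \<Z> U + V: module R V
  for R :: "('k, 'e) ring_scheme" and U :: "(int, 'u) module" and V :: "('k, 'v) module"
begin

sublocale T: tensor_product U R V
  by (rule tensor_product.intro) (rule U.M.abelian_group_axioms, rule V.module_axioms)

lemma tensor_product_tpow: "tensor_product (tpow \<Z> U n) R (tpow R V n)"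
  by (rule tensor_product.intro) (rule U.abelian_tpow, rule V.module_tpow)

sublocale P: tensor_product "tpow \<Z> U n" R "tpow R V n" for n
  by (rule tensor_product_tpow)

sublocale TV: module R "ztensor U V"
  by (rule T.module_ztensor)

abbreviation "Upow n \<equiv> tpow \<Z> U n"
abbreviation "Vpow n \<equiv> tpow R V n"
abbreviation "Wpow n \<equiv> ztensor (tpow \<Z> U n) (tpow R V n)"
abbreviation "Tpow n \<equiv> tpow R (ztensor U V) n"
abbreviation "merge \<equiv> merge_tensors R U V"
abbreviation "unmerge \<equiv> unmerge_tensors R U V"

text \<open>The lift is over the integers, but the dependence on the parameter may be linear over
  another ring \<open>A\<close>; this is how the scalars of \<open>V\<close> pass through the power
  of \<open>U\<close>.\<close>

lemma tpow_lift_parameter: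
  assumes P: "module A P" and N: "module A N"
    and mul: "\<And>p. p \<in> carrier P \<Longrightarrow> multilinear \<Z> U n (zmod N) (f p)"
    and lin: "\<And>us. \<lbrakk>length us = n; set us \<subseteq> carrier U\<rbrakk> \<Longrightarrow> (\<lambda>p. f p us) \<in> linear_maps A P N"
    and z: "z \<in> carrier (Upow n)"
  shows "(\<lambda>p. lift \<Z> (zmod N) (f p) z) \<in> linear_maps A P N"
proof -
  interpret P: module A P by (rule P)
  interpret N: module A N by (rule N)
  have zN: "module \<Z> (zmod N)"
    by (rule module_zmod) (rule N.M.abelian_group_axioms)
  have L: "lift \<Z> (zmod N) (f p) \<in> linear_maps \<Z> (Upow n) (zmod N)" if "p \<in> carrier P" for p
    by (rule U.tpow_lift_linear[OF zN mul[OF that]])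
  have pure: "lift \<Z> (zmod N) (f p) (tpure \<Z> U us) = f p us"
    if "p \<in> carrier P" "length us = n" "set us \<subseteq> carrier U" for p us
    by (rule U.tpow_lift_tpure[OF zN mul[OF that(1)] that(2,3)])
  note Lc = linear_closed[OF L, simplified] and La = linear_add[OF L, simplified]
  note ext = U.tpow_ext[OF L _ module.axioms(2)[OF zN] _ z]
  show ?thesis
  proof (rule linear_mapsI)
    fix p assume p: "p \<in> carrier P"
    show "lift \<Z> (zmod N) (f p) z \<in> carrier N"
      by (rule Lc[OF p z])
    fix p' assume p': "p' \<in> carrier P"
    have "(\<lambda>z. lift \<Z> (zmod N) (f p) z \<oplus>\<^bsub>N\<^esub> lift \<Z> (zmod N) (f p') z) \<in> linear_maps \<Z> (Upow n) (zmod N)"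
      using linear_maps_add[OF L[OF p] L[OF p'] U.module_tpow zN] by simp
    then show "lift \<Z> (zmod N) (f (p \<oplus>\<^bsub>P\<^esub> p')) z =
      lift \<Z> (zmod N) (f p) z \<oplus>\<^bsub>N\<^esub> lift \<Z> (zmod N) (f p') z"
      by (rule ext[rotated]) (use p p' linear_add[OF lin] in \<open>auto simp: pure\<close>)
  next
    fix c p assume c: "c \<in> carrier A" and p: "p \<in> carrier P"
    have "(\<lambda>z. c \<odot>\<^bsub>N\<^esub> lift \<Z> (zmod N) (f p) z) \<in> linear_maps \<Z> (Upow n) (zmod N)"
      by (rule linear_maps_int[OF U.module_tpow zN])
        (use p c Lc in \<open>auto simp: La N.smult_r_distr\<close>)
    then show "lift \<Z> (zmod N) (f (c \<odot>\<^bsub>P\<^esub> p)) z = c \<odot>\<^bsub>N\<^esub> lift \<Z> (zmod N) (f p) z"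
      by (rule ext[rotated]) (use p c linear_smult[OF lin] in \<open>auto simp: pure\<close>)
  qed
qed

section \<open>From the product of the tensor powers to the tensor power of the product\<close>

lemma set_map2_zpure:
  "\<lbrakk>set us \<subseteq> carrier U; set vs \<subseteq> carrier V\<rbrakk> \<Longrightarrow> set (map2 (zpure U V) us vs) \<subseteq> carrier (ztensor U V)"
  by (auto intro!: T.zpure_closed dest: set_zip_leftD set_zip_rightD)

lemma tpure_map2_closed:
  assumes "length us = n" "length vs = n" "set us \<subseteq> carrier U" "set vs \<subseteq> carrier V"
  shows "tpure R (ztensor U V) (map2 (zpure U V) us vs) \<in> carrier (Tpow n)"
  by (rule TV.tpure_closed) (use assms set_map2_zpure in auto)

lemma module_zmod_Tn: "module \<Z> (zmod (Tpow n))"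
  by (rule module_zmod) (rule TV.abelian_tpow)

lemma zipped_slot:
  assumes "length vs = n" "set vs \<subseteq> carrier V" "Suc (length as + length bs) = n"
    "set as \<subseteq> carrier U" "set bs \<subseteq> carrier U"
  shows "(\<lambda>u. tpure R (ztensor U V) (map2 (zpure U V) (as @ u # bs) vs)) \<in> linear_maps \<Z> U (zmod (Tpow n))"
proof -
  have "length as < length vs"
    using assms by simp
  then obtain cs v ds where vs: "vs = cs @ v # ds" "length cs = length as"
    using id_take_nth_drop[of "length as" vs] by (metis length_take less_imp_le_nat min.absorb2)
  let ?f = "\<lambda>z. tpure R (ztensor U V) (map2 (zpure U V) as cs @ z # map2 (zpure U V) bs ds)"
  have "?f \<in> linear_maps R (ztensor U V) (Tpow n)"
    using assms vs set_map2_zpure by (intro multilinear_slot[OF TV.multilinear_tpure]) auto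
  then have f: "?f \<in> linear_maps \<Z> (zmod (ztensor U V)) (zmod (Tpow n))"
    by (rule linear_imp_additive) (rule T.abelian_ztensor, rule TV.abelian_tpow)
  have "(\<lambda>u. zpure U V u v) \<in> linear_maps \<Z> (zmod U) (zmod (ztensor U V))"
    using assms vs by (intro T.zpure_left_linear) auto
  from linear_comp[OF this f] have "(\<lambda>u. ?f (zpure U V u v)) \<in> linear_maps \<Z> U (zmod (Tpow n))"
    using linear_maps_int_zmod[OF U.module_axioms module_zmod_Tn] by simp
  then show ?thesis
    using vs by simp
qed

lemma zipped_slot':
  assumes "length us = n" "set us \<subseteq> carrier U" "Suc (length cs + length ds) = n"
    "set cs \<subseteq> carrier V" "set ds \<subseteq> carrier V"
  shows "(\<lambda>v. tpure R (ztensor U V) (map2 (zpure U V) us (cs @ v # ds))) \<in> linear_maps R V (Tpow n)"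
proof -
  have "length cs < length us"
    using assms by simp
  then obtain as u bs where us: "us = as @ u # bs" "length as = length cs"
    using id_take_nth_drop[of "length cs" us] by (metis length_take less_imp_le_nat min.absorb2)
  let ?f = "\<lambda>z. tpure R (ztensor U V) (map2 (zpure U V) as cs @ z # map2 (zpure U V) bs ds)"
  have f: "?f \<in> linear_maps R (ztensor U V) (Tpow n)"
    using assms us set_map2_zpure by (intro multilinear_slot[OF TV.multilinear_tpure]) auto
  have "(\<lambda>v. zpure U V u v) \<in> linear_maps R V (ztensor U V)"
    using assms us by (intro T.zpure_right_linear) auto
  from linear_comp[OF this f] show ?thesis
    using us by simp
qed

lemma
  shows merge_linear: "merge n \<in> linear_maps R (Wpow n) (Tpow n)"
    and merge_tpure: "\<lbrakk>length us = n; length vs = n; set us \<subseteq> carrier U; set vs \<subseteq> carrier V\<rbrakk> \<Longrightarrow>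
      merge n (zpure (Upow n) (Vpow n) (tpure \<Z> U us) (tpure R V vs)) =
      tpure R (ztensor U V) (map2 (zpure U V) us vs)"
proof -
  note ab = TV.abelian_tpow[of n]
  have mul: "multilinear \<Z> U n (zmod (Tpow n)) (\<lambda>us. tpure R (ztensor U V) (map2 (zpure U V) us vs))"
    if "length vs = n" "set vs \<subseteq> carrier V" for vs
    by (rule multilinearI) (use that zipped_slot in \<open>auto intro!: tpure_map2_closed\<close>)
  define m1 where "m1 vs = lift \<Z> (zmod (Tpow n)) (\<lambda>us. tpure R (ztensor U V) (map2 (zpure U V) us vs))" for vs
  have m1: "m1 vs \<in> linear_maps \<Z> (Upow n) (zmod (Tpow n))" if "length vs = n" "set vs \<subseteq> carrier V" for vs
    unfolding m1_def by (rule U.tpow_lift_linear[OF module_zmod_Tn mul[OF that]])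
  have m1p: "m1 vs (tpure \<Z> U us) = tpure R (ztensor U V) (map2 (zpure U V) us vs)"
    if "length vs = n" "set vs \<subseteq> carrier V" "length us = n" "set us \<subseteq> carrier U" for us vs
    unfolding m1_def by (rule U.tpow_lift_tpure[OF module_zmod_Tn mul[OF that(1,2)] that(3,4)])
  have mul2: "multilinear R V n (Tpow n) (\<lambda>vs. m1 vs x)" if x: "x \<in> carrier (Upow n)" for x
  proof (rule multilinearI)
    show "m1 vs x \<in> carrier (Tpow n)" if "length vs = n" "set vs \<subseteq> carrier V" for vs
      using linear_closed[OF m1[OF that] x] by simp
    fix cs ds assume "set cs \<subseteq> carrier V" "set ds \<subseteq> carrier V" "Suc (length cs + length ds) = n"
    then show "(\<lambda>v. m1 (cs @ v # ds) x) \<in> linear_maps R V (Tpow n)"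
      unfolding m1_def
      by (intro tpow_lift_parameter[OF V.module_axioms TV.module_tpow _ _ x] mul zipped_slot') auto
  qed
  define m2 where "m2 x = lift R (Tpow n) (\<lambda>vs. m1 vs x)" for x
  have m2: "m2 x \<in> linear_maps R (Vpow n) (Tpow n)" if "x \<in> carrier (Upow n)" for x
    unfolding m2_def by (rule V.tpow_lift_linear[OF TV.module_tpow mul2[OF that]])
  have m2p: "m2 x (tpure R V vs) = m1 vs x" if "x \<in> carrier (Upow n)" "length vs = n" "set vs \<subseteq> carrier V" for x vs
    unfolding m2_def by (rule V.tpow_lift_tpure[OF TV.module_tpow mul2[OF that(1)] that(2,3)])
  have bi: "biadditive (Upow n) (Vpow n) (Tpow n) m2"
  proof (rule biadditiveI[OF U.abelian_tpow V.abelian_tpow ab])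
    interpret Un: abelian_group "Upow n" by (rule U.abelian_tpow)
    fix x x' y assume x: "x \<in> carrier (Upow n)" "x' \<in> carrier (Upow n)" and y: "y \<in> carrier (Vpow n)"
    show "m2 (x \<oplus>\<^bsub>Upow n\<^esub> x') y = m2 x y \<oplus>\<^bsub>Tpow n\<^esub> m2 x' y"
      by (rule V.tpow_ext[OF m2 linear_maps_add[OF m2 m2 V.module_tpow TV.module_tpow] ab _ y])
        (use x linear_add[OF m1] in \<open>auto simp: m2p\<close>)
  qed (auto simp: linear_closed[OF m2] linear_add[OF m2])
  have eq: "merge n = lift \<Z> (zmod (Tpow n)) (\<lambda>(x, y). m2 x y)"
    by (simp add: merge_tensors_def m1_def m2_def Let_def)
  show "merge n \<in> linear_maps R (Wpow n) (Tpow n)"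
    unfolding eq by (rule P.ztensor_lift_linear[OF TV.module_tpow bi]) (rule linear_smult[OF m2])
  show "merge n (zpure (Upow n) (Vpow n) (tpure \<Z> U us) (tpure R V vs)) =
      tpure R (ztensor U V) (map2 (zpure U V) us vs)"
    if "length us = n" "length vs = n" "set us \<subseteq> carrier U" "set vs \<subseteq> carrier V"
    unfolding eq using that
    by (simp add: P.ztensor_lift_zpure[OF ab bi] U.tpure_closed V.tpure_closed m2p m1p)
qed

section \<open>The inverse exchange map, which splits one factor at a time\<close>

lemma split_tensors_biadditive:
  assumes mU: "\<And>vs. \<lbrakk>length vs = Suc m; set vs \<subseteq> carrier V\<rbrakk> \<Longrightarrow>
      multilinear \<Z> U (Suc m) (zmod (Wpow n)) (\<lambda>us. split_tensors R U V n ws us vs)"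
    and mV: "\<And>us. \<lbrakk>length us = Suc m; set us \<subseteq> carrier U\<rbrakk> \<Longrightarrow>
      multilinear R V (Suc m) (Wpow n) (\<lambda>vs. split_tensors R U V n ws us vs)"
    and us: "length us = m" "set us \<subseteq> carrier U" and vs: "length vs = m" "set vs \<subseteq> carrier V"
  shows "biadditive U V (Wpow n) (\<lambda>u v. split_tensors R U V n ws (us @ [u]) (vs @ [v]))"
    and "\<lbrakk>c \<in> carrier R; u \<in> carrier U; v \<in> carrier V\<rbrakk> \<Longrightarrow>
      split_tensors R U V n ws (us @ [u]) (vs @ [c \<odot>\<^bsub>V\<^esub> v]) =
      c \<odot>\<^bsub>Wpow n\<^esub> split_tensors R U V n ws (us @ [u]) (vs @ [v])"
proof -
  have lU: "(\<lambda>u. split_tensors R U V n ws (us @ [u]) (vs @ [v])) \<in> linear_maps \<Z> U (zmod (Wpow n))"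
    if "v \<in> carrier V" for v
    by (rule multilinear_slot[OF mU]) (use that us vs in auto)
  have lV: "(\<lambda>v. split_tensors R U V n ws (us @ [u]) (vs @ [v])) \<in> linear_maps R V (Wpow n)"
    if "u \<in> carrier U" for u
    by (rule multilinear_slot[OF mV]) (use that us vs in auto)
  show "biadditive U V (Wpow n) (\<lambda>u v. split_tensors R U V n ws (us @ [u]) (vs @ [v]))"
    by (rule biadditiveI[OF U.M.abelian_group_axioms V.M.abelian_group_axioms P.abelian_ztensor])
      (auto simp: linear_closed[OF lV] linear_add[OF lV] linear_add[OF lU, simplified])
  show "\<lbrakk>c \<in> carrier R; u \<in> carrier U; v \<in> carrier V\<rbrakk> \<Longrightarrow>
      split_tensors R U V n ws (us @ [u]) (vs @ [c \<odot>\<^bsub>V\<^esub> v]) =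
      c \<odot>\<^bsub>Wpow n\<^esub> split_tensors R U V n ws (us @ [u]) (vs @ [v])"
    by (rule linear_smult[OF lV])
qed

text \<open>Multilinearity in \<open>us\<close> and in \<open>vs\<close> is proved in one induction:
  to split the next factor, the function of the new pair must be biadditive, which needs both
  statements one step further on.\<close>

lemma split_tensors_multilinear:
  assumes "m + length ws = n" "set ws \<subseteq> carrier (ztensor U V)"
  shows "(\<forall>vs. length vs = m \<longrightarrow> set vs \<subseteq> carrier V \<longrightarrow>
      multilinear \<Z> U m (zmod (Wpow n)) (\<lambda>us. split_tensors R U V n ws us vs)) \<and>
    (\<forall>us. length us = m \<longrightarrow> set us \<subseteq> carrier U \<longrightarrow>
      multilinear R V m (Wpow n) (\<lambda>vs. split_tensors R U V n ws us vs))"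
  using assms
proof (induction ws arbitrary: m)
  case Nil
  have 1: "(\<lambda>x. zpure (Upow n) (Vpow n) x (tpure R V vs)) \<in> linear_maps \<Z> (Upow n) (zmod (Wpow n))"
    if "length vs = n" "set vs \<subseteq> carrier V" for vs
    using P.zpure_left_linear[of "tpure R V vs" n] that
      linear_maps_int_zmod[OF U.module_tpow module_zmod[OF P.abelian_ztensor]]
    by (simp add: V.tpure_closed)
  have 2: "(\<lambda>y. zpure (Upow n) (Vpow n) (tpure \<Z> U us) y) \<in> linear_maps R (Vpow n) (Wpow n)"
    if "length us = n" "set us \<subseteq> carrier U" for us
    using that by (intro P.zpure_right_linear U.tpure_closed) auto
  show ?case
    using Nil linear_comp_multilinear[OF 1 U.multilinear_tpure]
      linear_comp_multilinear[OF 2 V.multilinear_tpure] by simp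
next
  case (Cons w ws)
  note ab = P.abelian_ztensor[of n]
  have w: "w \<in> carrier (ztensor U V)" and len: "Suc m + length ws = n"
    using Cons.prems by auto
  have mU: "multilinear \<Z> U (Suc m) (zmod (Wpow n)) (\<lambda>us. split_tensors R U V n ws us vs)"
    if "length vs = Suc m" "set vs \<subseteq> carrier V" for vs
    using Cons.IH[OF len] Cons.prems that by auto
  have mV: "multilinear R V (Suc m) (Wpow n) (\<lambda>vs. split_tensors R U V n ws us vs)"
    if "length us = Suc m" "set us \<subseteq> carrier U" for us
    using Cons.IH[OF len] Cons.prems that by auto
  note bi = split_tensors_biadditive(1)[OF mU mV]
  have cl: "split_tensors R U V n (w # ws) us vs \<in> carrier (Wpow n)"
    if "length us = m" "set us \<subseteq> carrier U" "length vs = m" "set vs \<subseteq> carrier V" for us vs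
    using T.ztensor_lift_closed[OF ab bi w] that by simp
  have 1: "multilinear \<Z> U m (zmod (Wpow n)) (\<lambda>us. split_tensors R U V n (w # ws) us vs)"
    if vs: "length vs = m" "set vs \<subseteq> carrier V" for vs
  proof (rule multilinearI)
    fix as bs assume s: "set as \<subseteq> carrier U" "set bs \<subseteq> carrier U" "Suc (length as + length bs) = m"
    \<comment> \<open>The doubled \<open>zmod\<close> comes from taking \<open>zmod (Wpow n)\<close>
      as the target of the lift; \<open>zmod_zmod\<close> removes it.\<close>
    have "(\<lambda>x. lift \<Z> (zmod (zmod (Wpow n)))
        (\<lambda>(u, v). split_tensors R U V n ws ((as @ x # bs) @ [u]) (vs @ [v])) w) \<in> linear_maps \<Z> U (zmod (Wpow n))"
    proof (rule T.ztensor_lift_parameter[OF U.module_axioms module_zmod[OF ab] _ _ w])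
      fix u v assume "u \<in> carrier U" "v \<in> carrier V"
      then show "(\<lambda>x. split_tensors R U V n ws ((as @ x # bs) @ [u]) (vs @ [v])) \<in> linear_maps \<Z> U (zmod (Wpow n))"
        using multilinear_slot[OF mU, of "vs @ [v]" as "bs @ [u]"] s vs by simp
    next
      show "biadditive U V (zmod (Wpow n)) (\<lambda>u v. split_tensors R U V n ws ((as @ x # bs) @ [u]) (vs @ [v]))"
        if "x \<in> carrier U" for x
        unfolding biadditive_zmod by (rule bi) (use that s vs in auto)
    qed
    then show "(\<lambda>x. split_tensors R U V n (w # ws) (as @ x # bs) vs) \<in> linear_maps \<Z> U (zmod (Wpow n))"
      by simp
  qed (use cl[OF _ _ vs] in simp)
  have 2: "multilinear R V m (Wpow n) (\<lambda>vs. split_tensors R U V n (w # ws) us vs)"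
    if us: "length us = m" "set us \<subseteq> carrier U" for us
  proof (rule multilinearI)
    fix cs ds assume s: "set cs \<subseteq> carrier V" "set ds \<subseteq> carrier V" "Suc (length cs + length ds) = m"
    have "(\<lambda>x. lift \<Z> (zmod (Wpow n))
        (\<lambda>(u, v). split_tensors R U V n ws (us @ [u]) ((cs @ x # ds) @ [v])) w) \<in> linear_maps R V (Wpow n)"
    proof (rule T.ztensor_lift_parameter[OF V.module_axioms P.module_ztensor _ _ w])
      fix u v assume "u \<in> carrier U" "v \<in> carrier V"
      then show "(\<lambda>x. split_tensors R U V n ws (us @ [u]) ((cs @ x # ds) @ [v])) \<in> linear_maps R V (Wpow n)"
        using multilinear_slot[OF mV, of "us @ [u]" cs "ds @ [v]"] s us by simp
    next
      show "biadditive U V (Wpow n) (\<lambda>u v. split_tensors R U V n ws (us @ [u]) ((cs @ x # ds) @ [v]))"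
        if "x \<in> carrier V" for x
        by (rule bi) (use that s us in auto)
    qed
    then show "(\<lambda>x. split_tensors R U V n (w # ws) us (cs @ x # ds)) \<in> linear_maps R V (Wpow n)"
      by simp
  qed (use cl[OF us] in simp)
  show ?case
    using 1 2 by blast
qed

lemma
  assumes "length us = m" "length vs = m" "Suc m + length ws = n"
    and "set us \<subseteq> carrier U" "set vs \<subseteq> carrier V" "set ws \<subseteq> carrier (ztensor U V)"
  shows split_tensors_bi: "biadditive U V (Wpow n) (\<lambda>u v. split_tensors R U V n ws (us @ [u]) (vs @ [v]))"
    and split_tensors_smult: "\<lbrakk>c \<in> carrier R; u \<in> carrier U; v \<in> carrier V\<rbrakk> \<Longrightarrow>
      split_tensors R U V n ws (us @ [u]) (vs @ [c \<odot>\<^bsub>V\<^esub> v]) =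
      c \<odot>\<^bsub>Wpow n\<^esub> split_tensors R U V n ws (us @ [u]) (vs @ [v])"
proof -
  have mU: "multilinear \<Z> U (Suc m) (zmod (Wpow n)) (\<lambda>us. split_tensors R U V n ws us vs)"
    if "length vs = Suc m" "set vs \<subseteq> carrier V" for vs
    using split_tensors_multilinear[OF assms(3,6)] that by blast
  have mV: "multilinear R V (Suc m) (Wpow n) (\<lambda>vs. split_tensors R U V n ws us vs)"
    if "length us = Suc m" "set us \<subseteq> carrier U" for us
    using split_tensors_multilinear[OF assms(3,6)] that by blast
  note * = split_tensors_biadditive[OF mU mV assms(1,4,2,5)]
  show "biadditive U V (Wpow n) (\<lambda>u v. split_tensors R U V n ws (us @ [u]) (vs @ [v]))"
    by (rule *(1))
  show "\<lbrakk>c \<in> carrier R; u \<in> carrier U; v \<in> carrier V\<rbrakk> \<Longrightarrow>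
      split_tensors R U V n ws (us @ [u]) (vs @ [c \<odot>\<^bsub>V\<^esub> v]) =
      c \<odot>\<^bsub>Wpow n\<^esub> split_tensors R U V n ws (us @ [u]) (vs @ [v])"
    by (rule *(2))
qed

text \<open>The factors \<open>es\<close> in front of \<open>w\<close> are split before it, so the
  induction goes over \<open>es\<close>; its base is linearity of a lift and its step is linear
  dependence of a lift on a parameter.\<close>

lemma split_tensors_slot:
  assumes "length us = m" "length vs = m" "Suc m + length es + length fs = n"
    and "set us \<subseteq> carrier U" "set vs \<subseteq> carrier V"
    and "set es \<subseteq> carrier (ztensor U V)" "set fs \<subseteq> carrier (ztensor U V)"
  shows "(\<lambda>w. split_tensors R U V n (es @ w # fs) us vs) \<in> linear_maps R (ztensor U V) (Wpow n)"
  using assms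
proof (induction es arbitrary: m us vs)
  case Nil
  have "lift \<Z> (zmod (Wpow n)) (\<lambda>(u, v). split_tensors R U V n fs (us @ [u]) (vs @ [v])) \<in>
      linear_maps R (ztensor U V) (Wpow n)"
    by (rule T.ztensor_lift_linear[OF P.module_ztensor split_tensors_bi split_tensors_smult])
      (use Nil in auto)
  then show ?case
    by simp
next
  case (Cons e es)
  have "(\<lambda>w. lift \<Z> (zmod (Wpow n)) (\<lambda>(u, v). split_tensors R U V n (es @ w # fs) (us @ [u]) (vs @ [v])) e)
      \<in> linear_maps R (ztensor U V) (Wpow n)"
  proof (rule T.ztensor_lift_parameter[OF T.module_ztensor P.module_ztensor])
    show "(\<lambda>w. split_tensors R U V n (es @ w # fs) (us @ [u]) (vs @ [v])) \<in>
        linear_maps R (ztensor U V) (Wpow n)" if "u \<in> carrier U" "v \<in> carrier V" for u v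
      using that Cons.prems by (intro Cons.IH[of _ "Suc m"]) auto
    show "biadditive U V (Wpow n) (\<lambda>u v. split_tensors R U V n (es @ w # fs) (us @ [u]) (vs @ [v]))"
      if "w \<in> carrier (ztensor U V)" for w
      using that Cons.prems by (intro split_tensors_bi[where m = m]) auto
  qed (use Cons.prems in simp)
  then show ?case
    by simp
qed

lemma split_tensors_map2:
  assumes "length us' = length vs'" "length us = m" "length vs = m" "m + length us' = n"
    and "set us \<subseteq> carrier U" "set vs \<subseteq> carrier V" "set us' \<subseteq> carrier U" "set vs' \<subseteq> carrier V"
  shows "split_tensors R U V n (map2 (zpure U V) us' vs') us vs =
    zpure (Upow n) (Vpow n) (tpure \<Z> U (us @ us')) (tpure R V (vs @ vs'))"
  using assms
proof (induction us' vs' arbitrary: m us vs rule: list_induct2)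
  case Nil
  then show ?case by simp
next
  case (Cons u us' v vs')
  have bi: "biadditive U V (Wpow n)
      (\<lambda>u v. split_tensors R U V n (map2 (zpure U V) us' vs') (us @ [u]) (vs @ [v]))"
    by (rule split_tensors_bi[where m = m]) (use Cons.hyps Cons.prems set_map2_zpure in auto)
  show ?case
    using Cons.IH[of "us @ [u]" "Suc m" "vs @ [v]"] Cons.prems
      T.ztensor_lift_zpure[OF P.abelian_ztensor bi, of u v]
    by simp
qed

lemma multilinear_split_tensors: "multilinear R (ztensor U V) n (Wpow n) (\<lambda>ws. split_tensors R U V n ws [] [])"
proof (rule multilinearI)
  fix ws assume "length ws = n" "set ws \<subseteq> carrier (ztensor U V)"
  then have "multilinear R V 0 (Wpow n) (\<lambda>vs. split_tensors R U V n ws [] vs)"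
    using split_tensors_multilinear[of 0 ws n] by simp
  from multilinear_closed[OF this, of "[]"]
  show "split_tensors R U V n ws [] [] \<in> carrier (Wpow n)"
    by simp
qed (auto intro!: split_tensors_slot[where m = 0])

lemma unmerge_linear: "unmerge n \<in> linear_maps R (Tpow n) (Wpow n)"
  unfolding unmerge_tensors_def
  by (rule TV.tpow_lift_linear[OF P.module_ztensor multilinear_split_tensors])

lemma unmerge_tpure:
  assumes "length us = n" "length vs = n" "set us \<subseteq> carrier U" "set vs \<subseteq> carrier V"
  shows "unmerge n (tpure R (ztensor U V) (map2 (zpure U V) us vs)) =
    zpure (Upow n) (Vpow n) (tpure \<Z> U us) (tpure R V vs)"
  unfolding unmerge_tensors_def
  using assms set_map2_zpure[OF assms(3,4)] split_tensors_map2[of us vs "[]" 0 "[]" n]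
  by (subst TV.tpow_lift_tpure[OF P.module_ztensor multilinear_split_tensors]) auto

section \<open>The exchange of factors as an isomorphism\<close>

lemma Wpow_ext:
  assumes g: "g \<in> linear_maps R (Wpow n) N" and h: "h \<in> linear_maps R (Wpow n) N" and N: "module R N"
    and eq: "\<And>us vs. \<lbrakk>length us = n; length vs = n; set us \<subseteq> carrier U; set vs \<subseteq> carrier V\<rbrakk> \<Longrightarrow>
      g (zpure (Upow n) (Vpow n) (tpure \<Z> U us) (tpure R V vs)) =
      h (zpure (Upow n) (Vpow n) (tpure \<Z> U us) (tpure R V vs))"
    and z: "z \<in> carrier (Wpow n)"
  shows "g z = h z"
proof -
  interpret N: module R N by (rule N)
  note abN = N.M.abelian_group_axioms
  have ga: "g \<in> linear_maps \<Z> (zmod (Wpow n)) (zmod N)" and ha: "h \<in> linear_maps \<Z> (zmod (Wpow n)) (zmod N)"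
    using linear_imp_additive[OF g P.abelian_ztensor abN] linear_imp_additive[OF h P.abelian_ztensor abN]
    by auto
  have 1: "g (zpure (Upow n) (Vpow n) (tpure \<Z> U us) y) = h (zpure (Upow n) (Vpow n) (tpure \<Z> U us) y)"
    if us: "length us = n" "set us \<subseteq> carrier U" and y: "y \<in> carrier (Vpow n)" for us y
  proof -
    note l = P.zpure_right_linear[OF U.tpure_closed[OF us]]
    show ?thesis
      by (rule V.tpow_ext[OF linear_comp[OF l g] linear_comp[OF l h] abN _ y]) (simp add: eq us)
  qed
  have 2: "g (zpure (Upow n) (Vpow n) x y) = h (zpure (Upow n) (Vpow n) x y)"
    if x: "x \<in> carrier (Upow n)" and y: "y \<in> carrier (Vpow n)" for x y
  proof -
    note l = P.zpure_left_linear[OF y]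
    have lin: "(\<lambda>x. f (zpure (Upow n) (Vpow n) x y)) \<in> linear_maps \<Z> (Upow n) (zmod N)"
      if "f \<in> linear_maps \<Z> (zmod (Wpow n)) (zmod N)" for f
      using linear_comp[OF l that] linear_maps_int_zmod[OF U.module_tpow module_zmod[OF abN]] by simp
    show ?thesis
      by (rule U.tpow_ext[OF lin[OF ga] lin[OF ha] _ _ x])
        (simp_all add: 1 y module.axioms(2)[OF module_zmod[OF abN]])
  qed
  show ?thesis
    by (rule P.ztensor_ext[OF ga ha abN 2 z])
qed

lemma Tpow_ext:
  assumes g: "g \<in> linear_maps R (Tpow n) N" and h: "h \<in> linear_maps R (Tpow n) N" and N: "module R N"
    and eq: "\<And>us vs. \<lbrakk>length us = n; length vs = n; set us \<subseteq> carrier U; set vs \<subseteq> carrier V\<rbrakk> \<Longrightarrow>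
      g (tpure R (ztensor U V) (map2 (zpure U V) us vs)) = h (tpure R (ztensor U V) (map2 (zpure U V) us vs))"
    and z: "z \<in> carrier (Tpow n)"
  shows "g z = h z"
proof -
  interpret N: module R N by (rule N)
  note abN = N.M.abelian_group_axioms
  let ?t = "tpure R (ztensor U V)"
  \<comment> \<open>A pure tensor over \<open>ztensor U V\<close> still has arbitrary factors. They
    are replaced by pure tensors from left to right: those done are recorded in \<open>us\<close>
    and \<open>vs\<close>, the others remain in \<open>ws\<close>.\<close>
  have *: "g (?t (map2 (zpure U V) us vs @ ws)) = h (?t (map2 (zpure U V) us vs @ ws))"
    if "length us = m" "length vs = m" "m + length ws = n" "set us \<subseteq> carrier U" "set vs \<subseteq> carrier V"
      "set ws \<subseteq> carrier (ztensor U V)" for us vs ws m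
    using that
  proof (induction ws arbitrary: m us vs)
    case Nil
    then show ?case
      using eq[of us vs] by simp
  next
    case (Cons w ws)
    have "(\<lambda>w. ?t (map2 (zpure U V) us vs @ w # ws)) \<in> linear_maps R (ztensor U V) (Tpow n)"
      by (rule multilinear_slot[OF TV.multilinear_tpure]) (use Cons.prems set_map2_zpure in auto)
    note l = linear_comp[OF this]
    have a: "(\<lambda>w. f (?t (map2 (zpure U V) us vs @ w # ws))) \<in> linear_maps \<Z> (zmod (ztensor U V)) (zmod N)"
      if "f \<in> linear_maps R (Tpow n) N" for f
      by (rule linear_imp_additive[OF l[OF that] T.abelian_ztensor abN])
    show ?case
    proof (rule T.ztensor_ext[OF a[OF g] a[OF h] abN])
      show "g (?t (map2 (zpure U V) us vs @ zpure U V u v # ws)) =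
        h (?t (map2 (zpure U V) us vs @ zpure U V u v # ws))"
        if "u \<in> carrier U" "v \<in> carrier V" for u v
        using Cons.IH[of "us @ [u]" "Suc m" "vs @ [v]"] Cons.prems that by simp
    qed (use Cons.prems in simp)
  qed
  show ?thesis
    by (rule TV.tpow_ext[OF g h abN _ z]) (use *[of "[]" 0 "[]"] in simp)
qed

lemma unmerge_merge: "z \<in> carrier (Wpow n) \<Longrightarrow> unmerge n (merge n z) = z"
  by (rule Wpow_ext[OF linear_comp[OF merge_linear unmerge_linear] linear_id P.module_ztensor])
    (auto simp: merge_tpure unmerge_tpure)

lemma merge_unmerge: "z \<in> carrier (Tpow n) \<Longrightarrow> merge n (unmerge n z) = z"
  by (rule Tpow_ext[OF linear_comp[OF unmerge_linear merge_linear] linear_id TV.module_tpow])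
    (auto simp: merge_tpure unmerge_tpure)

lemma bij_betw_merge: "bij_betw (merge n) (carrier (Wpow n)) (carrier (Tpow n))"
  by (rule bij_betw_byWitness[where f' = "unmerge n"])
    (auto simp: unmerge_merge merge_unmerge linear_closed[OF merge_linear] linear_closed[OF unmerge_linear])

text \<open>For two factors the recursion in \<open>split_tensors\<close> unfolds to the nested
  lifts of \<open>tau23\<close>.\<close>

lemma tau23_eq_unmerge:
  assumes "z \<in> carrier (Tpow 2)"
  shows "tau23 R U V z = unmerge 2 z"
  unfolding tau23_def unmerge_tensors_def Let_def
proof (rule TV.tpow_lift_cong[OF assms P.module_ztensor])
  fix ws :: "('u \<times> 'v \<Rightarrow> int) set list"
  assume ws: "length ws = 2" "set ws \<subseteq> carrier (ztensor U V)"
  then obtain w w' where [simp]: "ws = [w, w']"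
    by (auto simp: numeral_2_eq_2 length_Suc_conv)
  show "lift \<Z> (zmod (Wpow 2)) (\<lambda>(u, v).
      lift \<Z> (zmod (Wpow 2)) (\<lambda>(u', v'). zpure (Upow 2) (Vpow 2) (tpure \<Z> U [u, u']) (tpure R V [v, v']))
        (ws ! 1)) (ws ! 0) = split_tensors R U V 2 ws [] []"
    by simp
  show "split_tensors R U V 2 ws [] [] \<in> carrier (Wpow 2)"
    by (rule multilinear_closed[OF multilinear_split_tensors ws])
qed

text \<open>\<open>merge 2\<close> supplies a preimage in the carrier, and \<open>tau23\<close> is
  injective there, so \<open>inv_into\<close> has no other choice.\<close>

lemma inv_tau23:
  assumes "z \<in> carrier (Wpow 2)"
  shows "inv_into (carrier (Tpow 2)) (tau23 R U V) z = merge 2 z"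
proof -
  have "inj_on (tau23 R U V) (carrier (Tpow 2))"
    by (rule inj_on_inverseI[where g = "merge 2"]) (simp add: tau23_eq_unmerge merge_unmerge)
  then show ?thesis
    using assms by (intro inv_into_f_eq)
      (auto simp: tau23_eq_unmerge unmerge_merge linear_closed[OF merge_linear])
qed

end

section \<open>Transport of twisted operators through the exchange of factors\<close>

context tensor_product
begin

text \<open>\<open>Psi_U\<close> multiplies by \<open>1 - q\<close> outside the tensor product and
  \<open>F_functor\<close> inside, on the second factor; this reconciles the two.\<close>

lemma zmap_smult:
  assumes d: "d \<in> linear_maps \<Z> (zmod U) (zmod U)" and a: "a \<in> carrier R" and z: "z \<in> carrier (ztensor U V)"
  shows "zmap U V d (\<lambda>v. a \<odot>\<^bsub>V\<^esub> v) z = a \<odot>\<^bsub>ztensor U V\<^esub> zmap U V d (\<lambda>v. v) z"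
proof -
  have am: "(\<lambda>v. a \<odot>\<^bsub>V\<^esub> v) \<in> linear_maps R V V"
    by (rule linear_maps_smult[OF linear_id a V.module_axioms V.module_axioms])
  note lin = linear_imp_additive[OF _ abelian_ztensor abelian_ztensor]
  show ?thesis
    by (rule ztensor_ext[OF lin[OF zmap_linear[OF d am]]
        lin[OF linear_maps_smult[OF zmap_linear[OF d linear_id] a module_ztensor module_ztensor]]
        abelian_ztensor _ z])
      (use linear_closed[OF d] a in \<open>simp add: zmap_zpure[OF d am] zmap_zpure[OF d linear_id] ztensor_smult_zpure\<close>)
qed

end

text \<open>\<open>B\<close> stands for \<open>Psi_U\<close> and \<open>a\<close> for
  \<open>1 - q\<close>. Only the conjugation formula for \<open>B\<close> on the carrier enters
  here; the relations come in later.\<close>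

locale twisted_powers = tensor_powers R U V
  for R :: "('k, 'e) ring_scheme" and U :: "(int, 'u) module" and V :: "('k, 'v) module" +
  fixes s D :: "('u list \<Rightarrow> int) set \<Rightarrow> ('u list \<Rightarrow> int) set"
    and \<Psi> :: "('v list \<Rightarrow> 'k) set \<Rightarrow> ('v list \<Rightarrow> 'k) set" and a :: 'k
    and B :: "(('u \<times> 'v \<Rightarrow> int) set list \<Rightarrow> 'k) set \<Rightarrow> (('u \<times> 'v \<Rightarrow> int) set list \<Rightarrow> 'k) set"
  assumes s: "s \<in> linear_maps \<Z> (tpow \<Z> U 2) (tpow \<Z> U 2)"
    and D: "D \<in> linear_maps \<Z> (tpow \<Z> U 2) (tpow \<Z> U 2)"
    and \<Psi>: "\<Psi> \<in> linear_maps R (tpow R V 2) (tpow R V 2)"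
    and a: "a \<in> carrier R"
    and B: "\<And>z. z \<in> carrier (tpow R (ztensor U V) 2) \<Longrightarrow> B z = merge_tensors R U V 2
      (twist (tpow \<Z> U 2) (tpow R V 2) s \<Psi> D a (unmerge_tensors R U V 2 z))"
begin

lemma additive_Upow: "f \<in> linear_maps \<Z> (Upow n) (Upow n) \<Longrightarrow> f \<in> linear_maps \<Z> (zmod (Upow n)) (zmod (Upow n))"
  using linear_maps_int_zmod[OF U.module_tpow U.module_tpow] by simp

abbreviation "twist_at n i \<equiv> twist (Upow n) (Vpow n)
  (at_factors \<Z> U n s i) (at_factors R V n \<Psi> i) (at_factors \<Z> U n D i) a"

lemmas twist2_linear = P.twist_linear[OF additive_Upow[OF s] \<Psi> additive_Upow[OF D] a]
lemmas twist2_zpure = P.twist_zpure[OF additive_Upow[OF s] \<Psi> additive_Upow[OF D] a]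

lemma B_linear: "B \<in> linear_maps R (Tpow 2) (Tpow 2)"
proof (rule linear_maps_cong[OF _ TV.abelian_tpow B])
  show "(\<lambda>z. merge 2 (twist (Upow 2) (Vpow 2) s \<Psi> D a (unmerge 2 z))) \<in> linear_maps R (Tpow 2) (Tpow 2)"
    by (rule linear_comp[OF linear_comp[OF unmerge_linear twist2_linear] merge_linear])
  interpret T2: module R "Tpow 2" by (rule TV.module_tpow)
  show "\<And>c x. \<lbrakk>c \<in> carrier R; x \<in> carrier (Tpow 2)\<rbrakk> \<Longrightarrow> c \<odot>\<^bsub>Tpow 2\<^esub> x \<in> carrier (Tpow 2)"
    by simp
qed

lemma
  assumes "0 < i" "i < n"
  shows twist_at_linear: "twist_at n i \<in> linear_maps R (Wpow n) (Wpow n)"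
    and twist_at_zpure: "\<lbrakk>x \<in> carrier (Upow n); y \<in> carrier (Vpow n)\<rbrakk> \<Longrightarrow>
      twist_at n i (zpure (Upow n) (Vpow n) x y) =
      zpure (Upow n) (Vpow n) (at_factors \<Z> U n s i x) (at_factors R V n \<Psi> i y) \<oplus>\<^bsub>Wpow n\<^esub>
      zpure (Upow n) (Vpow n) (at_factors \<Z> U n D i x) (a \<odot>\<^bsub>Vpow n\<^esub> y)"
proof -
  note l = additive_Upow[OF U.at_factors_linear[OF s assms]] V.at_factors_linear[OF \<Psi> assms]
    additive_Upow[OF U.at_factors_linear[OF D assms]] a
  show "twist_at n i \<in> linear_maps R (Wpow n) (Wpow n)"
    by (rule P.twist_linear[OF l])
  show "\<lbrakk>x \<in> carrier (Upow n); y \<in> carrier (Vpow n)\<rbrakk> \<Longrightarrow>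
      twist_at n i (zpure (Upow n) (Vpow n) x y) =
      zpure (Upow n) (Vpow n) (at_factors \<Z> U n s i x) (at_factors R V n \<Psi> i y) \<oplus>\<^bsub>Wpow n\<^esub>
      zpure (Upow n) (Vpow n) (at_factors \<Z> U n D i x) (a \<odot>\<^bsub>Vpow n\<^esub> y)"
    by (rule P.twist_zpure[OF l])
qed

text \<open>Both sides extend to linear maps of the middle part in
  \<open>ztensor (Upow 2) (Vpow 2)\<close>, and for pure tensors both give the same list of zipped
  factors.\<close>

lemma merge_insert_map:
  assumes "length as = length cs" "length bs = length ds" "length as + 2 + length bs = n"
    and "set as \<subseteq> carrier U" "set bs \<subseteq> carrier U" "set cs \<subseteq> carrier V" "set ds \<subseteq> carrier V"
    and x: "x \<in> carrier (Upow 2)" and y: "y \<in> carrier (Vpow 2)"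
  shows "merge n (zpure (Upow n) (Vpow n) (insert_map \<Z> U n as bs x) (insert_map R V n cs ds y)) =
    insert_map R (ztensor U V) n (map2 (zpure U V) as cs) (map2 (zpure U V) bs ds)
      (merge 2 (zpure (Upow 2) (Vpow 2) x y))"
proof -
  define IU where "IU = insert_map \<Z> U n as bs"
  define IV where "IV = insert_map R V n cs ds"
  define IT where "IT = insert_map R (ztensor U V) n (map2 (zpure U V) as cs) (map2 (zpure U V) bs ds)"
  have IU: "IU \<in> linear_maps \<Z> (Upow 2) (Upow n)"
    unfolding IU_def using assms by (intro U.insert_map_linear) auto
  have IUp: "IU (tpure \<Z> U us) = tpure \<Z> U (as @ us @ bs)" if "length us = 2" "set us \<subseteq> carrier U" for us
    unfolding IU_def using assms that U.insert_map_tpure[of as bs 2 n us] by simp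
  have IV: "IV \<in> linear_maps R (Vpow 2) (Vpow n)"
    unfolding IV_def using assms by (intro V.insert_map_linear) auto
  have IVp: "IV (tpure R V vs) = tpure R V (cs @ vs @ ds)" if "length vs = 2" "set vs \<subseteq> carrier V" for vs
    unfolding IV_def using assms that V.insert_map_tpure[of cs ds 2 n vs] by simp
  have IT: "IT \<in> linear_maps R (Tpow 2) (Tpow n)"
    unfolding IT_def using assms set_map2_zpure by (intro TV.insert_map_linear) auto
  have ITp: "IT (tpure R (ztensor U V) ws) =
      tpure R (ztensor U V) (map2 (zpure U V) as cs @ ws @ map2 (zpure U V) bs ds)"
    if "length ws = 2" "set ws \<subseteq> carrier (ztensor U V)" for ws
    unfolding IT_def using assms that set_map2_zpure[of as cs] set_map2_zpure[of bs ds]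
      TV.insert_map_tpure[of "map2 (zpure U V) as cs" "map2 (zpure U V) bs ds" 2 n ws] by simp
  define f where "f x y = merge n (zpure (Upow n) (Vpow n) (IU x) (IV y))" for x y
  note cl = linear_closed[OF IU] linear_closed[OF IV] P.zpure_closed linear_closed[OF merge_linear]
  have bi: "biadditive (Upow 2) (Vpow 2) (Tpow n) f"
    by (rule biadditiveI[OF U.abelian_tpow V.abelian_tpow TV.abelian_tpow])
      (simp_all add: f_def cl linear_add[OF IU] linear_add[OF IV] linear_add[OF merge_linear]
        biadditive_left[OF P.biadditive_zpure] biadditive_right[OF P.biadditive_zpure])
  have sm: "f x (c \<odot>\<^bsub>Vpow 2\<^esub> y) = c \<odot>\<^bsub>Tpow n\<^esub> f x y"
    if "c \<in> carrier R" "x \<in> carrier (Upow 2)" "y \<in> carrier (Vpow 2)" for c x y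
    using that by (simp add: f_def linear_smult[OF IV] P.ztensor_smult_zpure[symmetric] cl
        linear_smult[OF merge_linear])
  note lin = P.ztensor_lift_linear[OF TV.module_tpow bi sm]
  note pure = P.ztensor_lift_zpure[OF TV.abelian_tpow bi]
  have "lift \<Z> (zmod (Tpow n)) (\<lambda>(x, y). f x y) z = IT (merge 2 z)" if z: "z \<in> carrier (Wpow 2)" for z
  proof (rule Wpow_ext[OF lin linear_comp[OF merge_linear IT] TV.module_tpow _ z])
    fix us vs assume *: "length us = 2" "length vs = 2" "set us \<subseteq> carrier U" "set vs \<subseteq> carrier V"
    have "f (tpure \<Z> U us) (tpure R V vs) =
        tpure R (ztensor U V) (map2 (zpure U V) as cs @ map2 (zpure U V) us vs @ map2 (zpure U V) bs ds)"
      using * assms by (simp add: f_def IUp IVp merge_tpure)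
    then show "lift \<Z> (zmod (Tpow n)) (\<lambda>(x, y). f x y) (zpure (Upow 2) (Vpow 2) (tpure \<Z> U us) (tpure R V vs)) =
      IT (merge 2 (zpure (Upow 2) (Vpow 2) (tpure \<Z> U us) (tpure R V vs)))"
      using * set_map2_zpure by (simp add: pure U.tpure_closed V.tpure_closed merge_tpure ITp)
  qed
  from this[OF P.zpure_closed[OF x y]] show ?thesis
    unfolding pure[OF x y] by (simp only: f_def IU_def IV_def IT_def)
qed

text \<open>On pure tensors both sides reduce to two insertions, one for each summand of
  \<open>twist\<close>, and \<open>merge_insert_map\<close> matches them. This intertwining carries
  relations and module structures from one side to the other.\<close>

lemma merge_twist_at:
  assumes i: "0 < i" "i < n" and z: "z \<in> carrier (Wpow n)"
  shows "merge n (twist_at n i z) = at_factors R (ztensor U V) n B i (merge n z)"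
proof (rule Wpow_ext[OF linear_comp[OF twist_at_linear[OF i] merge_linear]
      linear_comp[OF merge_linear TV.at_factors_linear[OF B_linear i]] TV.module_tpow _ z])
  fix us vs assume *: "length us = n" "length vs = n" "set us \<subseteq> carrier U" "set vs \<subseteq> carrier V"
  obtain as u u' bs where us: "us = as @ [u, u'] @ bs" "length as = i - 1"
    using split_at[OF *(1) i] .
  obtain cs v v' ds where vs: "vs = cs @ [v, v'] @ ds" "length cs = i - 1"
    using split_at[OF *(2) i] .
  have U': "set as \<subseteq> carrier U" "u \<in> carrier U" "u' \<in> carrier U" "set bs \<subseteq> carrier U"
    "length as + 2 + length bs = n" "length bs = n - i - 1"
    using * us i by auto
  have V': "set cs \<subseteq> carrier V" "v \<in> carrier V" "v' \<in> carrier V" "set ds \<subseteq> carrier V"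
    "length cs + 2 + length ds = n" "length ds = n - i - 1"
    using * vs i by auto
  have len: "length as = length cs" "length bs = length ds"
    using us vs U' V' by auto
  let ?x = "tpure \<Z> U [u, u']" and ?y = "tpure R V [v, v']"
  have x: "?x \<in> carrier (Upow 2)" and y: "?y \<in> carrier (Vpow 2)"
    using U' V' by (auto intro!: U.tpure_closed V.tpure_closed)
  let ?IU = "insert_map \<Z> U n as bs" and ?IV = "insert_map R V n cs ds"
  let ?IT = "insert_map R (ztensor U V) n (map2 (zpure U V) as cs) (map2 (zpure U V) bs ds)"
  let ?p = "zpure (Upow n) (Vpow n)" and ?q = "zpure (Upow 2) (Vpow 2)"
  have IU: "?IU \<in> linear_maps \<Z> (Upow 2) (Upow n)"
    using U' by (intro U.insert_map_linear) auto
  have IV: "?IV \<in> linear_maps R (Vpow 2) (Vpow n)"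
    using V' by (intro V.insert_map_linear) auto
  have IT: "?IT \<in> linear_maps R (Tpow 2) (Tpow n)"
    using U' V' len set_map2_zpure by (intro TV.insert_map_linear) auto
  have yV: "tpure R V vs = ?IV ?y"
    using V' vs by (simp add: V.insert_map_tpure[where k = 2])
  note fcl = linear_closed[OF s x] linear_closed[OF D x] linear_closed[OF \<Psi> y] P.V.smult_closed[OF a y]
  have "at_factors \<Z> U n s i (tpure \<Z> U us) = ?IU (s ?x)" "at_factors \<Z> U n D i (tpure \<Z> U us) = ?IU (D ?x)"
    unfolding us(1)
    by (rule U.at_factors_tpure[OF s i] U.at_factors_tpure[OF D i]; use U' us(2) in simp)+
  moreover have "at_factors R V n \<Psi> i (tpure R V vs) = ?IV (\<Psi> ?y)"
    unfolding vs(1) by (rule V.at_factors_tpure[OF \<Psi> i]) (use V' vs(2) in simp_all)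
  moreover have "a \<odot>\<^bsub>Vpow n\<^esub> tpure R V vs = ?IV (a \<odot>\<^bsub>Vpow 2\<^esub> ?y)"
    unfolding yV by (rule linear_smult[OF IV y a, symmetric])
  ultimately have "twist_at n i (?p (tpure \<Z> U us) (tpure R V vs)) =
      ?p (?IU (s ?x)) (?IV (\<Psi> ?y)) \<oplus>\<^bsub>Wpow n\<^esub> ?p (?IU (D ?x)) (?IV (a \<odot>\<^bsub>Vpow 2\<^esub> ?y))"
    using * by (simp add: twist_at_zpure[OF i] U.tpure_closed V.tpure_closed)
  then have "merge n (twist_at n i (?p (tpure \<Z> U us) (tpure R V vs))) =
      merge n (?p (?IU (s ?x)) (?IV (\<Psi> ?y))) \<oplus>\<^bsub>Tpow n\<^esub>
      merge n (?p (?IU (D ?x)) (?IV (a \<odot>\<^bsub>Vpow 2\<^esub> ?y)))"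
    by (simp add: linear_add[OF merge_linear] P.zpure_closed linear_closed[OF IU] linear_closed[OF IV] fcl)
  also have "\<dots> = ?IT (merge 2 (?q (s ?x) (\<Psi> ?y))) \<oplus>\<^bsub>Tpow n\<^esub> ?IT (merge 2 (?q (D ?x) (a \<odot>\<^bsub>Vpow 2\<^esub> ?y)))"
    using merge_insert_map[OF len U'(5,1,4) V'(1,4)] fcl by simp
  also have "\<dots> = ?IT (merge 2 (twist (Upow 2) (Vpow 2) s \<Psi> D a (?q ?x ?y)))"
    by (simp add: twist2_zpure x y linear_add[OF merge_linear] linear_add[OF IT]
        linear_closed[OF merge_linear] P.zpure_closed fcl)
  also have "\<dots> = ?IT (B (tpure R (ztensor U V) [zpure U V u v, zpure U V u' v']))"
    using unmerge_tpure[of "[u, u']" 2 "[v, v']"] U' V'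
    by (subst B) (auto intro!: TV.tpure_closed T.zpure_closed)
  also have "\<dots> = at_factors R (ztensor U V) n B i
      (tpure R (ztensor U V) (map2 (zpure U V) as cs @ [zpure U V u v, zpure U V u' v'] @ map2 (zpure U V) bs ds))"
    using U' V' us vs set_map2_zpure[OF U'(1) V'(1)] set_map2_zpure[OF U'(4) V'(4)]
    by (intro TV.at_factors_tpure[OF B_linear i, symmetric]) (auto simp: T.zpure_closed)
  also have "map2 (zpure U V) as cs @ [zpure U V u v, zpure U V u' v'] @ map2 (zpure U V) bs ds =
      map2 (zpure U V) us vs"
    using us vs len by simp
  finally show "merge n (twist_at n i (?p (tpure \<Z> U us) (tpure R V vs))) =
      at_factors R (ztensor U V) n B i (merge n (?p (tpure \<Z> U us) (tpure R V vs)))"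
    using * by (simp add: merge_tpure)
qed

end

section \<open>Modules over presented algebras\<close>

lemma free_module_ext:
  assumes "cring R" "g \<in> linear_maps R (free_module R X) N" "h \<in> linear_maps R (free_module R X) N"
    and "abelian_group N" and eq: "\<And>x. x \<in> X \<Longrightarrow> g (delta R x) = h (delta R x)"
    and "a \<in> carrier (free_module R X)"
  shows "g a = h a"
proof -
  interpret F: module R "free_module R X"
    by (rule module_free_module) fact
  note ab = F.M.abelian_group_axioms assms(4)
  show ?thesis
    using assms(1,6)
  proof (induction a rule: free_module_induct)
    case zero
    then show ?case
      using linear_zero[OF assms(2) ab] linear_zero[OF assms(3) ab] by simp
  next
    case (add a b)
    then show ?case
      by (simp add: linear_add[OF assms(2)] linear_add[OF assms(3)])
  next
    case (delta c x)
    then show ?case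
      by (simp add: linear_smult[OF assms(2)] linear_smult[OF assms(3)] delta_closed[OF assms(1)] eq)
  qed
qed

lemma free_algebra_simps:
  "carrier (free_algebra R G) = carrier (free_module R (lists G))"
  "zero (free_algebra R G) = zero (free_module R (lists G))"
  "add (free_algebra R G) = add (free_module R (lists G))"
  "smult (free_algebra R G) = smult (free_module R (lists G))"
  "one (free_algebra R G) = delta R []"
  "a \<otimes>\<^bsub>free_algebra R G\<^esub> b = (\<lambda>w. \<Oplus>\<^bsub>R\<^esub>k\<in>{..length w}. a (take k w) \<otimes>\<^bsub>R\<^esub> b (drop k w))"
  by (simp_all add: free_algebra_def free_module_def)

section \<open>The ring of noncommutative polynomials\<close>

locale free_algebra_over = cring R for R (structure) +
  fixes G :: "'g set"
begin

abbreviation "FA \<equiv> free_algebra R G"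
abbreviation "FM \<equiv> free_module R (lists G)"

sublocale F: module R FM
  by (rule module_free_module) (rule is_cring)

lemma delta_word: "w \<in> lists G \<Longrightarrow> delta R w \<in> carrier FM"
  by (rule delta_closed[OF is_cring])

lemma coeff_closed: "a \<in> carrier FM \<Longrightarrow> a w \<in> carrier R"
  by (simp add: free_module_simps)

text \<open>A word in the support of a product is a concatenation of words from the two supports, so
  there are only finitely many.\<close>

lemma mult_closed:
  assumes a: "a \<in> carrier FM" and b: "b \<in> carrier FM"
  shows "a \<otimes>\<^bsub>FA\<^esub> b \<in> carrier FM"
proof -
  have nz: "\<exists>k\<le>length w. a (take k w) \<noteq> \<zero> \<and> b (drop k w) \<noteq> \<zero>" if "(a \<otimes>\<^bsub>FA\<^esub> b) w \<noteq> \<zero>" for w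
  proof (rule ccontr)
    assume *: "\<not> ?thesis"
    have "(\<Oplus>k\<in>{..length w}. a (take k w) \<otimes> b (drop k w)) = \<zero>"
      by (rule add.finprod_one_eqI) (use * coeff_closed a b in \<open>auto\<close>)
    then show False
      using that by (simp add: free_algebra_simps)
  qed
  let ?A = "{w. a w \<noteq> \<zero>}" and ?B = "{w. b w \<noteq> \<zero>}"
  have AB: "finite ?A" "finite ?B" "?A \<subseteq> lists G" "?B \<subseteq> lists G"
    using a b by (auto simp: free_module_simps)
  have "{w. (a \<otimes>\<^bsub>FA\<^esub> b) w \<noteq> \<zero>} \<subseteq> (\<lambda>(u, v). u @ v) ` (?A \<times> ?B)"
  proof
    fix w assume "w \<in> {w. (a \<otimes>\<^bsub>FA\<^esub> b) w \<noteq> \<zero>}"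
    then obtain k where "a (take k w) \<noteq> \<zero>" "b (drop k w) \<noteq> \<zero>"
      using nz by auto
    then show "w \<in> (\<lambda>(u, v). u @ v) ` (?A \<times> ?B)"
      by (intro image_eqI[of _ _ "(take k w, drop k w)"]) auto
  qed
  moreover have "(\<lambda>(u, v). u @ v) ` (?A \<times> ?B) \<subseteq> lists G"
  proof (rule image_subsetI)
    fix p assume "p \<in> ?A \<times> ?B"
    then obtain u v where "p = (u, v)" "u \<in> lists G" "v \<in> lists G"
      using AB(3,4) by blast
    then show "(\<lambda>(u, v). u @ v) p \<in> lists G"
      by simp
  qed
  ultimately have "finite {w. (a \<otimes>\<^bsub>FA\<^esub> b) w \<noteq> \<zero>}" "{w. (a \<otimes>\<^bsub>FA\<^esub> b) w \<noteq> \<zero>} \<subseteq> lists G"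
    using AB(1,2) finite_subset by (blast, blast)
  moreover have "(a \<otimes>\<^bsub>FA\<^esub> b) w \<in> carrier R" for w
    unfolding free_algebra_simps using coeff_closed a b by (intro finsum_closed) auto
  ultimately show ?thesis
    by (auto simp: free_module_simps)
qed

lemma mult_left_linear: "b \<in> carrier FM \<Longrightarrow> (\<lambda>a. a \<otimes>\<^bsub>FA\<^esub> b) \<in> linear_maps R FM FM"
proof (rule linear_mapsI)
  assume b: "b \<in> carrier FM"
  fix a assume a: "a \<in> carrier FM"
  show "a \<otimes>\<^bsub>FA\<^esub> b \<in> carrier FM"
    by (rule mult_closed[OF a b])
  note cl = coeff_closed[OF a] coeff_closed[OF b]
  {
    fix a' assume a': "a' \<in> carrier FM"
    show "(a \<oplus>\<^bsub>FM\<^esub> a') \<otimes>\<^bsub>FA\<^esub> b = a \<otimes>\<^bsub>FA\<^esub> b \<oplus>\<^bsub>FM\<^esub> a' \<otimes>\<^bsub>FA\<^esub> b"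
      by (rule ext) (simp add: free_algebra_simps free_module_simps(3) cl coeff_closed[OF a'] l_distr
          finsum_addf)
  next
    fix c assume c: "c \<in> carrier R"
    show "(c \<odot>\<^bsub>FM\<^esub> a) \<otimes>\<^bsub>FA\<^esub> b = c \<odot>\<^bsub>FM\<^esub> (a \<otimes>\<^bsub>FA\<^esub> b)"
      by (rule ext) (simp add: free_algebra_simps free_module_simps(4) cl c m_assoc finsum_rdistr)
  }
qed

lemma mult_right_linear: "a \<in> carrier FM \<Longrightarrow> (\<lambda>b. a \<otimes>\<^bsub>FA\<^esub> b) \<in> linear_maps R FM FM"
proof (rule linear_mapsI)
  assume a: "a \<in> carrier FM"
  fix b assume b: "b \<in> carrier FM"
  show "a \<otimes>\<^bsub>FA\<^esub> b \<in> carrier FM"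
    by (rule mult_closed[OF a b])
  note cl = coeff_closed[OF a] coeff_closed[OF b]
  {
    fix b' assume b': "b' \<in> carrier FM"
    show "a \<otimes>\<^bsub>FA\<^esub> (b \<oplus>\<^bsub>FM\<^esub> b') = a \<otimes>\<^bsub>FA\<^esub> b \<oplus>\<^bsub>FM\<^esub> a \<otimes>\<^bsub>FA\<^esub> b'"
      by (rule ext) (simp add: free_algebra_simps free_module_simps(3) cl coeff_closed[OF b'] r_distr
          finsum_addf)
  next
    fix c assume c: "c \<in> carrier R"
    show "a \<otimes>\<^bsub>FA\<^esub> (c \<odot>\<^bsub>FM\<^esub> b) = c \<odot>\<^bsub>FM\<^esub> (a \<otimes>\<^bsub>FA\<^esub> b)"
      by (rule ext) (simp add: free_algebra_simps free_module_simps(4) cl c m_lcomm finsum_rdistr)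
  }
qed

text \<open>In the convolution only the cut after \<open>length u\<close> letters can contribute,
  and only for the word \<open>u @ v\<close>.\<close>

lemma delta_mult_delta: "delta R u \<otimes>\<^bsub>FA\<^esub> delta R v = delta R (u @ v)"
proof (rule ext)
  fix w
  show "(delta R u \<otimes>\<^bsub>FA\<^esub> delta R v) w = delta R (u @ v) w"
  proof (cases "w = u @ v")
    case True
    have "(\<Oplus>k\<in>{..length w}. delta R u (take k w) \<otimes> delta R v (drop k w)) =
        (\<Oplus>k\<in>{..length w}. if length u = k then \<one> else \<zero>)"
    proof (rule finsum_cong')
      fix k assume "k \<in> {..length w}"
      moreover have "take k w = u \<longleftrightarrow> length u = k" if "k \<le> length w"
        using that True by (metis append_eq_conv_conj length_take min.absorb2)
      ultimately show "delta R u (take k w) \<otimes> delta R v (drop k w) = (if length u = k then \<one> else \<zero>)"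
        using True by (auto simp: delta_def)
    qed auto
    also have "\<dots> = \<one>"
      by (rule add.finprod_singleton) (auto simp: True)
    finally show ?thesis
      by (simp add: free_algebra_simps delta_def True)
  next
    case False
    have "(\<Oplus>k\<in>{..length w}. delta R u (take k w) \<otimes> delta R v (drop k w)) = \<zero>"
      by (rule add.finprod_one_eqI) (use False in \<open>auto simp: delta_def\<close>)
    with False show ?thesis
      by (simp add: free_algebra_simps delta_def)
  qed
qed

lemma ring_free_algebra: "ring FA"
proof (rule ringI)
  note ext = free_module_ext[OF is_cring _ _ F.M.abelian_group_axioms]
  note L = mult_left_linear and M = mult_right_linear
  show "abelian_group FA"
    by (rule abelian_group_cong[OF F.M.abelian_group_axioms]) (simp_all add: free_algebra_simps(1-5))
  have one: "delta R [] \<in> carrier FM"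
    by (rule delta_word) simp
  show "monoid FA"
  proof (rule monoidI)
    fix a b c assume "a \<in> carrier FA" "b \<in> carrier FA" "c \<in> carrier FA"
    then have a: "a \<in> carrier FM" and b: "b \<in> carrier FM" and c: "c \<in> carrier FM"
      by (simp_all add: free_algebra_simps(1))
    \<comment> \<open>On words associativity is that of concatenation; linearity extends it to
      \<open>c\<close>, then to \<open>b\<close>, then to \<open>a\<close>.\<close>
    have 1: "delta R u \<otimes>\<^bsub>FA\<^esub> delta R v \<otimes>\<^bsub>FA\<^esub> c = delta R u \<otimes>\<^bsub>FA\<^esub> (delta R v \<otimes>\<^bsub>FA\<^esub> c)"
      if uv: "u \<in> lists G" "v \<in> lists G" for u v
      by (rule ext[OF M[OF mult_closed] linear_comp[OF M M] _ c])
        (use uv delta_word in \<open>auto simp: delta_mult_delta\<close>)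
    have 2: "delta R u \<otimes>\<^bsub>FA\<^esub> b \<otimes>\<^bsub>FA\<^esub> c = delta R u \<otimes>\<^bsub>FA\<^esub> (b \<otimes>\<^bsub>FA\<^esub> c)"
      if u: "u \<in> lists G" for u
      by (rule ext[OF linear_comp[OF M L] linear_comp[OF L M] _ b])
        (use u c delta_word 1 in auto)
    show "a \<otimes>\<^bsub>FA\<^esub> b \<otimes>\<^bsub>FA\<^esub> c = a \<otimes>\<^bsub>FA\<^esub> (b \<otimes>\<^bsub>FA\<^esub> c)"
      by (rule ext[OF linear_comp[OF L L] L[OF mult_closed] _ a]) (use b c 2 in auto)
  next
    fix a assume "a \<in> carrier FA"
    then have a: "a \<in> carrier FM"
      by (simp add: free_algebra_simps(1))
    show "\<one>\<^bsub>FA\<^esub> \<otimes>\<^bsub>FA\<^esub> a = a"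
      unfolding free_algebra_simps(5)
      by (rule ext[OF M[OF one] linear_id _ a]) (auto simp: delta_mult_delta)
    show "a \<otimes>\<^bsub>FA\<^esub> \<one>\<^bsub>FA\<^esub> = a"
      unfolding free_algebra_simps(5)
      by (rule ext[OF L[OF one] linear_id _ a]) (auto simp: delta_mult_delta)
  qed (use one mult_closed in \<open>simp_all add: free_algebra_simps(1,5)\<close>)
qed (use linear_add[OF mult_left_linear] linear_add[OF mult_right_linear] in \<open>simp_all add: free_algebra_simps(1-4)\<close>)

lemma free_algebra_induct [consumes 1, case_names scalar gen add mult]:
  assumes "a \<in> carrier FM"
    and scalar: "\<And>c. c \<in> carrier R \<Longrightarrow> P (c \<odot>\<^bsub>FM\<^esub> delta R [])"
    and gen: "\<And>g. g \<in> G \<Longrightarrow> P (delta R [g])"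
    and add: "\<And>a b. \<lbrakk>a \<in> carrier FM; b \<in> carrier FM; P a; P b\<rbrakk> \<Longrightarrow> P (a \<oplus>\<^bsub>FM\<^esub> b)"
    and mult: "\<And>a b. \<lbrakk>a \<in> carrier FM; b \<in> carrier FM; P a; P b\<rbrakk> \<Longrightarrow> P (a \<otimes>\<^bsub>FA\<^esub> b)"
  shows "P a"
  using is_cring assms(1)
proof (induction a rule: free_module_induct)
  case zero
  have "\<zero>\<^bsub>FM\<^esub> = \<zero> \<odot>\<^bsub>FM\<^esub> delta R []"
    using F.smult_l_null delta_word by simp
  then show ?case
    using scalar[OF zero_closed] by simp
next
  case (add a b)
  then show ?case
    by (rule assms(4))
next
  case (delta c w)
  have one: "delta R [] \<in> carrier FM"
    by (rule delta_word) simp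
  have "P (delta R w)"
    using delta(2)
  proof (induction w)
    case Nil
    then show ?case
      using scalar[OF one_closed] F.smult_one[OF one] by simp
  next
    case (Cons g w)
    then have "P (delta R [g] \<otimes>\<^bsub>FA\<^esub> delta R w)"
      by (intro mult gen delta_word) auto
    then show ?case
      by (simp add: delta_mult_delta)
  qed
  then have "P ((c \<odot>\<^bsub>FM\<^esub> delta R []) \<otimes>\<^bsub>FA\<^esub> delta R w)"
    using delta one by (intro mult scalar F.smult_closed delta_word) auto
  then show ?case
    using linear_smult[OF mult_left_linear[OF delta_word[OF delta(2)]] one delta(1)]
    by (simp add: delta_mult_delta)
qed

end

section \<open>Action of noncommutative polynomials through operators\<close>

definition evaluate ::
  "('k, 'e) ring_scheme \<Rightarrow> ('k, 'n, 'f) module_scheme \<Rightarrow> ('g \<Rightarrow> 'n \<Rightarrow> 'n) \<Rightarrow> ('g list \<Rightarrow> 'k) \<Rightarrow> 'n \<Rightarrow> 'n"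
  where "evaluate R N t a x = lincomb R N (\<lambda>w. foldr t w x) a"

locale generator_action = free_algebra_over R G + N: module R N
  for R (structure) and G :: "'g set" and N (structure) +
  fixes t :: "'g \<Rightarrow> 'c \<Rightarrow> 'c"
  assumes action_linear: "g \<in> G \<Longrightarrow> t g \<in> linear_maps R N N"
begin

lemma foldr_linear: "w \<in> lists G \<Longrightarrow> foldr t w \<in> linear_maps R N N"
proof (induction w)
  case Nil
  then show ?case
    using linear_id by (simp add: id_def)
next
  case (Cons g w)
  then show ?case
    using linear_comp[OF Cons.IH action_linear] by (simp add: comp_def)
qed

lemma foldr_funcset: "x \<in> carrier N \<Longrightarrow> (\<lambda>w. foldr t w x) \<in> lists G \<rightarrow> carrier N"
  using linear_closed[OF foldr_linear] by auto

lemma evaluate_linear_left: "x \<in> carrier N \<Longrightarrow> (\<lambda>a. evaluate R N t a x) \<in> linear_maps R FM N"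
  unfolding evaluate_def by (rule lincomb_linear[OF N.module_axioms foldr_funcset])

lemma evaluate_delta: "\<lbrakk>x \<in> carrier N; w \<in> lists G\<rbrakk> \<Longrightarrow> evaluate R N t (delta R w) x = foldr t w x"
  unfolding evaluate_def by (rule lincomb_delta[OF N.module_axioms foldr_funcset])

lemma evaluate_closed: "\<lbrakk>a \<in> carrier FM; x \<in> carrier N\<rbrakk> \<Longrightarrow> evaluate R N t a x \<in> carrier N"
  by (rule linear_closed[OF evaluate_linear_left])

lemma evaluate_linear:
  assumes a: "a \<in> carrier FM"
  shows "evaluate R N t a \<in> linear_maps R N N"
proof (rule linear_mapsI)
  note E = evaluate_linear_left
  note ext = free_module_ext[OF is_cring _ _ N.M.abelian_group_axioms _ a]
  fix x assume x: "x \<in> carrier N"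
  show "evaluate R N t a x \<in> carrier N"
    by (rule evaluate_closed[OF a x])
  {
    fix y assume y: "y \<in> carrier N"
    show "evaluate R N t a (x \<oplus>\<^bsub>N\<^esub> y) = evaluate R N t a x \<oplus>\<^bsub>N\<^esub> evaluate R N t a y"
      by (rule ext[OF E linear_maps_add[OF E E F.module_axioms N.module_axioms]])
        (use x y linear_add[OF foldr_linear] in \<open>auto simp: evaluate_delta\<close>)
  next
    fix c assume c: "c \<in> carrier R"
    show "evaluate R N t a (c \<odot>\<^bsub>N\<^esub> x) = c \<odot>\<^bsub>N\<^esub> evaluate R N t a x"
      by (rule ext[OF E linear_maps_smult[OF E c F.module_axioms N.module_axioms]])
        (use x c linear_smult[OF foldr_linear] in \<open>auto simp: evaluate_delta\<close>)
  }
qed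

text \<open>In a word the leftmost letter acts last, so concatenation becomes composition; linearity
  in each polynomial extends this from words.\<close>

lemma evaluate_mult:
  assumes a: "a \<in> carrier FM" and b: "b \<in> carrier FM" and x: "x \<in> carrier N"
  shows "evaluate R N t (a \<otimes>\<^bsub>FA\<^esub> b) x = evaluate R N t a (evaluate R N t b x)"
proof -
  note E = evaluate_linear_left
  note ext = free_module_ext[OF is_cring _ _ N.M.abelian_group_axioms]
  have 1: "evaluate R N t (delta R u \<otimes>\<^bsub>FA\<^esub> b) x = foldr t u (evaluate R N t b x)" if u: "u \<in> lists G" for u
    by (rule ext[OF linear_comp[OF mult_right_linear E] linear_comp[OF E foldr_linear] _ b])
      (use u x delta_word in \<open>auto simp: delta_mult_delta evaluate_delta\<close>)
  show ?thesis
    by (rule ext[OF linear_comp[OF mult_left_linear E] E _ a])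
      (use b x evaluate_closed 1 in \<open>auto simp: evaluate_delta\<close>)
qed

end

section \<open>Uniqueness and existence of module structures over a presented algebra\<close>

locale algebra_presentation = free_algebra_over R G for R (structure) and G :: "'g set" +
  fixes S :: "('g list \<Rightarrow> 'a) set"
  assumes rels: "S \<subseteq> carrier (free_algebra R G)"
begin

abbreviation "I \<equiv> Idl\<^bsub>FA\<^esub> S"

lemma ideal_rels: "ideal I FA"
  by (rule ring.genideal_ideal[OF ring_free_algebra rels])

lemma ring_pres_algebra: "ring (pres_algebra R G S)"
  unfolding pres_algebra_def by (rule ideal.quotient_is_ring[OF ideal_rels])

definition cls :: "('g list \<Rightarrow> 'a) \<Rightarrow> ('g list \<Rightarrow> 'a) set"
  where "cls a = I +>\<^bsub>FA\<^esub> a"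

lemma cls_hom: "cls \<in> ring_hom FA (pres_algebra R G S)"
  unfolding pres_algebra_def cls_def[abs_def] by (rule ideal.rcos_ring_hom[OF ideal_rels])

lemma cls_hom_simps:
  "a \<in> carrier FM \<Longrightarrow> cls a \<in> carrier (pres_algebra R G S)"
  "\<lbrakk>a \<in> carrier FM; b \<in> carrier FM\<rbrakk> \<Longrightarrow> cls (a \<oplus>\<^bsub>FM\<^esub> b) = cls a \<oplus>\<^bsub>pres_algebra R G S\<^esub> cls b"
  "\<lbrakk>a \<in> carrier FM; b \<in> carrier FM\<rbrakk> \<Longrightarrow> cls (a \<otimes>\<^bsub>FA\<^esub> b) = cls a \<otimes>\<^bsub>pres_algebra R G S\<^esub> cls b"
  "cls (delta R []) = \<one>\<^bsub>pres_algebra R G S\<^esub>"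
  using ring_hom_closed[OF cls_hom] ring_hom_add[OF cls_hom] ring_hom_mult[OF cls_hom]
    ring_hom_one[OF cls_hom]
  by (simp_all add: free_algebra_simps(1-5))

lemma carrier_pres_algebra: "carrier (pres_algebra R G S) = cls ` carrier FM"
  by (auto simp: pres_algebra_def cls_def FactRing_def A_RCOSETS_defs a_r_coset_def free_algebra_simps(1-5))

lemma pres_gen_eq: "pres_gen R G S g = cls (delta R [g])"
  by (simp add: pres_gen_def cls_def)

lemma pres_scalar_eq: "pres_scalar R G S c = cls (c \<odot>\<^bsub>FM\<^esub> delta R [])"
  by (simp add: pres_scalar_def cls_def Let_def free_algebra_simps(1-5))

lemma cls_rel:
  assumes "r \<in> S"
  shows "cls r = \<zero>\<^bsub>pres_algebra R G S\<^esub>"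
proof -
  interpret I: ideal I FA
    by (rule ideal_rels)
  have "r \<in> I"
    using ring.genideal_self[OF ring_free_algebra rels] assms by auto
  then show ?thesis
    by (simp add: cls_def pres_algebra_def FactRing_def I.a_rcos_const)
qed

end

locale presented_action = generator_action R G N t + algebra_presentation R G S
  for R (structure) and G :: "'g set" and N :: "('a, 'n) module" (structure) and t S
begin

text \<open>Scalars and generators generate the algebra, so every admissible structure acts by
  evaluation. This makes the choice in \<open>pres_module\<close> harmless on the carriers.\<close>

lemma pres_structure_smult:
  assumes M: "pres_structure R G S N t M" and a: "a \<in> carrier FM" and x: "x \<in> carrier N"
  shows "cls a \<odot>\<^bsub>M\<^esub> x = evaluate R N t a x"
proof -
  let ?A = "pres_algebra R G S"
  interpret M: left_module ?A M
    using M by (simp add: pres_structure_def)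
  have M': "carrier M = carrier N" "zero M = zero N" "add M = add N"
    "\<And>c x. \<lbrakk>c \<in> carrier R; x \<in> carrier N\<rbrakk> \<Longrightarrow> pres_scalar R G S c \<odot>\<^bsub>M\<^esub> x = c \<odot>\<^bsub>N\<^esub> x"
    "\<And>g x. \<lbrakk>g \<in> G; x \<in> carrier N\<rbrakk> \<Longrightarrow> pres_gen R G S g \<odot>\<^bsub>M\<^esub> x = t g x"
    using M by (simp_all add: pres_structure_def)
  have one: "delta R [] \<in> carrier FM"
    by (rule delta_word) simp
  have "\<forall>x\<in>carrier N. cls a \<odot>\<^bsub>M\<^esub> x = evaluate R N t a x"
    using a
  proof (induction a rule: free_algebra_induct)
    case (scalar c)
    then show ?case
      using M'(4) by (simp add: pres_scalar_eq linear_smult[OF evaluate_linear_left] one evaluate_delta)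
  next
    case (gen g)
    then show ?case
      using M'(5) by (simp add: pres_gen_eq evaluate_delta)
  next
    case (add a b)
    then show ?case
      using M.smult_l_distr[of "cls a" "cls b"]
      by (simp add: cls_hom_simps M' linear_add[OF evaluate_linear_left])
  next
    case (mult a b)
    then show ?case
      using M.smult_assoc[of "cls a" "cls b"]
      by (simp add: cls_hom_simps M' evaluate_mult evaluate_closed)
  qed
  then show ?thesis
    using x by blast
qed

text \<open>The class of a relation is zero, and zero acts as zero. In this way the operator
  identities are recovered from a module structure of which only the existence is known.\<close>

lemma pres_structure_rel:
  assumes M: "pres_structure R G S N t M" and r: "r \<in> S" and x: "x \<in> carrier N"
  shows "evaluate R N t r x = \<zero>\<^bsub>N\<^esub>"
proof -
  let ?A = "pres_algebra R G S"
  interpret M: left_module ?A M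
    using M by (simp add: pres_structure_def)
  have M': "carrier M = carrier N" "zero M = zero N"
    using M by (simp_all add: pres_structure_def)
  have x': "x \<in> carrier M"
    using x M' by simp
  have "\<zero>\<^bsub>?A\<^esub> \<odot>\<^bsub>M\<^esub> x \<oplus>\<^bsub>M\<^esub> \<zero>\<^bsub>?A\<^esub> \<odot>\<^bsub>M\<^esub> x = \<zero>\<^bsub>?A\<^esub> \<odot>\<^bsub>M\<^esub> x"
    using M.smult_l_distr[OF M.A.zero_closed M.A.zero_closed x'] by simp
  then have "\<zero>\<^bsub>?A\<^esub> \<odot>\<^bsub>M\<^esub> x = \<zero>\<^bsub>M\<^esub>"
    using M.smult_closed[OF M.A.zero_closed x'] by simp
  moreover have "r \<in> carrier FM"
    using r rels by (auto simp: free_algebra_simps(1))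
  ultimately show ?thesis
    using pres_structure_smult[OF M _ x, of r] cls_rel[OF r] M' by simp
qed

text \<open>The polynomials that act as zero form a two-sided ideal \<open>K\<close>. It contains
  the relations, hence the ideal they generate, and so the action of a class is independent of the
  representative chosen for it.\<close>

lemma pres_structure_exists:
  assumes rel: "\<And>r x. \<lbrakk>r \<in> S; x \<in> carrier N\<rbrakk> \<Longrightarrow> evaluate R N t r x = \<zero>\<^bsub>N\<^esub>"
  shows "\<exists>M. pres_structure R G S N t M"
proof -
  interpret FAr: ring FA
    by (rule ring_free_algebra)
  interpret I: ideal I FA
    by (rule ideal_rels)
  let ?E = "evaluate R N t"
  let ?A = "pres_algebra R G S"
  note E = evaluate_linear_left
  note ab = F.M.abelian_group_axioms N.M.abelian_group_axioms
  have E0: "?E a \<zero>\<^bsub>N\<^esub> = \<zero>\<^bsub>N\<^esub>" if "a \<in> carrier FM" for a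
    by (rule linear_zero[OF evaluate_linear[OF that] ab(2,2)])
  define K where "K = {a \<in> carrier FM. \<forall>x\<in>carrier N. ?E a x = \<zero>\<^bsub>N\<^esub>}"
  have "ideal K FA"
  proof (rule idealI[OF ring_free_algebra])
    have "submodule {a \<in> carrier FM. ?E a x = \<zero>\<^bsub>N\<^esub>} R FM" if "x \<in> carrier N" for x
      by (rule submodule_kernel[OF E[OF that] F.module_axioms N.module_axioms])
    have "subgroup K (add_monoid FM)"
    proof (rule F.M.add.subgroupI)
      have "\<zero>\<^bsub>FM\<^esub> \<in> K"
        using linear_zero[OF E ab] by (simp add: K_def)
      then show "K \<noteq> {}"
        by blast
    qed (auto simp: K_def linear_add[OF E] linear_a_inv[OF E ab])
    moreover have "subgroup K (add_monoid FA) = subgroup K (add_monoid FM)"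
      by (simp add: subgroup_def free_algebra_simps(1-5) m_inv_def)
    ultimately show "subgroup K (add_monoid FA)"
      by simp
  qed (auto simp: K_def free_algebra_simps(1) mult_closed evaluate_mult evaluate_closed E0)
  moreover have "S \<subseteq> K"
    using rels rel by (auto simp: K_def free_algebra_simps(1))
  ultimately have IK: "I \<subseteq> K"
    by (rule FAr.genideal_minimal)
  define M :: "(('g list \<Rightarrow> 'a) set, 'n) module" where "M = \<lparr>carrier = carrier N, mult = undefined, one = undefined, zero = zero N, add = add N,
    smult = (\<lambda>C x. ?E (SOME a. a \<in> C) x)\<rparr>"
  have Ms: "carrier M = carrier N" "zero M = zero N" "add M = add N"
    by (simp_all add: M_def)
  have sm: "cls a \<odot>\<^bsub>M\<^esub> x = ?E a x" if a: "a \<in> carrier FM" and x: "x \<in> carrier N" for a x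
  proof -
    define b where "b = (SOME b. b \<in> cls a)"
    have a': "a \<in> carrier FA"
      using a by (simp add: free_algebra_simps(1))
    have "a \<in> cls a"
      unfolding cls_def by (rule I.a_rcos_self[OF a'])
    then have "b \<in> cls a"
      unfolding b_def by (rule someI[where P = "\<lambda>b. b \<in> cls a"])
    then obtain h where h: "h \<in> I" "b = h \<oplus>\<^bsub>FM\<^esub> a"
      by (auto simp: cls_def a_r_coset_def r_coset_def free_algebra_simps(1-5))
    then have "h \<in> K"
      using IK by blast
    then have "?E b x = ?E a x"
      using a x h(2) evaluate_closed[OF a x] by (simp add: K_def linear_add[OF E])
    then show ?thesis
      by (simp add: M_def b_def)
  qed
  have "left_module ?A M"
  proof (intro left_module.intro left_module_axioms.intro ring_pres_algebra)
    show "abelian_group M"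
      by (rule abelian_group_cong[OF N.M.abelian_group_axioms]) (simp_all add: Ms)
  qed (auto simp: carrier_pres_algebra Ms sm evaluate_closed linear_add[OF E] linear_add[OF evaluate_linear]
      cls_hom_simps(2,3,4)[symmetric] evaluate_mult mult_closed evaluate_delta delta_word)
  then have "pres_structure R G S N t M"
    by (auto simp: pres_structure_def Ms pres_scalar_eq pres_gen_eq sm delta_word F.smult_closed
        linear_smult[OF E] evaluate_delta)
  then show ?thesis
    by blast
qed

lemma pres_structure_pres_module:
  assumes "\<And>r x. \<lbrakk>r \<in> S; x \<in> carrier N\<rbrakk> \<Longrightarrow> evaluate R N t r x = \<zero>\<^bsub>N\<^esub>"
  shows "pres_structure R G S N t (pres_module R G S N t)"
  unfolding pres_module_def by (rule someI_ex) (rule pres_structure_exists[OF assms])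

end

text \<open>A map that is linear over \<open>R\<close> and commutes with the generators commutes
  with all words and therefore with every polynomial.\<close>

lemma pres_structure_linear:
  assumes "presented_action R G N t S" "presented_action R G N' t' S"
    and M: "pres_structure R G S N t M" and M': "pres_structure R G S N' t' M'"
    and f: "f \<in> linear_maps R N N'"
    and comm: "\<And>g x. \<lbrakk>g \<in> G; x \<in> carrier N\<rbrakk> \<Longrightarrow> f (t g x) = t' g (f x)"
  shows "f \<in> linear_maps (pres_algebra R G S) M M'"
proof -
  interpret A: presented_action R G N t S by fact
  interpret A': presented_action R G N' t' S by fact
  have Ms: "carrier M = carrier N" "add M = add N" "carrier M' = carrier N'" "add M' = add N'"
    using M M' by (simp_all add: pres_structure_def)
  have fold: "f (foldr t w x) = foldr t' w (f x)" if "w \<in> lists G" "x \<in> carrier N" for w x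
    using that
    by (induction w) (simp_all add: comm linear_closed[OF A.foldr_linear])
  have "f (evaluate R N t a x) = evaluate R N' t' a (f x)"
    if a: "a \<in> carrier (free_module R (lists G))" and x: "x \<in> carrier N" for a x
    by (rule free_module_ext[OF A.is_cring linear_comp[OF A.evaluate_linear_left f]
          A'.evaluate_linear_left A'.N.M.abelian_group_axioms _ a])
      (use x linear_closed[OF f] in \<open>auto simp: A.evaluate_delta A'.evaluate_delta fold\<close>)
  then show ?thesis
    by (intro linear_mapsI)
      (auto simp: Ms linear_closed[OF f] linear_add[OF f] A.carrier_pres_algebra
        A.pres_structure_smult[OF M] A'.pres_structure_smult[OF M'])
qed

section \<open>Extension of homomorphisms into divisible groups\<close>

locale int_module = module \<Z> M for M :: "(int, 'm) module" (structure)
begin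

lemma
  shows int_smult_closed [simp]: "x \<in> carrier M \<Longrightarrow> k \<odot> x \<in> carrier M"
    and int_smult_left: "x \<in> carrier M \<Longrightarrow> (k + l) \<odot> x = k \<odot> x \<oplus> l \<odot> x"
    and int_smult_right: "\<lbrakk>x \<in> carrier M; y \<in> carrier M\<rbrakk> \<Longrightarrow> k \<odot> (x \<oplus> y) = k \<odot> x \<oplus> k \<odot> y"
    and int_smult_assoc: "x \<in> carrier M \<Longrightarrow> (k * l) \<odot> x = k \<odot> (l \<odot> x)"
    and int_smult_1 [simp]: "x \<in> carrier M \<Longrightarrow> 1 \<odot> x = x"
    and int_smult_0 [simp]: "x \<in> carrier M \<Longrightarrow> 0 \<odot> x = \<zero>"
    and int_smult_zero [simp]: "k \<odot> \<zero> = \<zero>"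
  using smult_closed[of k x] smult_l_distr[of k l x] smult_r_distr[of k x y] smult_assoc1[of k l x]
    smult_one[of x] smult_l_null[of x] smult_r_null[of k] by simp_all

lemma int_smult_minus: "x \<in> carrier M \<Longrightarrow> (- k) \<odot> x = \<ominus> (k \<odot> x)"
  using int_smult_left[of x "- k" k] by (intro M.minus_equality[symmetric]) simp_all

lemma int_smult_neg_1: "x \<in> carrier M \<Longrightarrow> \<ominus> x = (- 1) \<odot> x"
  by (simp add: int_smult_minus)

lemma int_smult_diff: "x \<in> carrier M \<Longrightarrow> (k - l) \<odot> x = k \<odot> x \<ominus> l \<odot> x"
  using int_smult_left[of x k "- l"] by (simp add: int_smult_minus a_minus_def)

lemma int_smult_minus_right: "\<lbrakk>x \<in> carrier M; y \<in> carrier M\<rbrakk> \<Longrightarrow> k \<odot> (x \<ominus> y) = k \<odot> x \<ominus> k \<odot> y"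
  by (simp add: a_minus_def int_smult_right int_smult_neg_1 int_smult_assoc[symmetric] mult.commute)

lemma int_smult_commute: "x \<in> carrier M \<Longrightarrow> k \<odot> (l \<odot> x) = l \<odot> (k \<odot> x)"
  by (simp add: int_smult_assoc[symmetric] mult.commute)

end

text \<open>The graph of a homomorphism from a subgroup of \<open>G\<close> to \<open>Y\<close>.\<close>

definition partial_linear :: "(int, 'g) module \<Rightarrow> (int, 'y) module \<Rightarrow> ('g \<times> 'y) set \<Rightarrow> bool"
  where "partial_linear G Y r \<longleftrightarrow> r \<subseteq> carrier G \<times> carrier Y \<and> (\<zero>\<^bsub>G\<^esub>, \<zero>\<^bsub>Y\<^esub>) \<in> r \<and>
    (\<forall>a b c d. (a, b) \<in> r \<longrightarrow> (c, d) \<in> r \<longrightarrow> (a \<oplus>\<^bsub>G\<^esub> c, b \<oplus>\<^bsub>Y\<^esub> d) \<in> r) \<and>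
    (\<forall>k a b. (a, b) \<in> r \<longrightarrow> (k \<odot>\<^bsub>G\<^esub> a, k \<odot>\<^bsub>Y\<^esub> b) \<in> r) \<and>
    (\<forall>b. (\<zero>\<^bsub>G\<^esub>, b) \<in> r \<longrightarrow> b = \<zero>\<^bsub>Y\<^esub>)"

locale hom_extension = G: int_module G + Y: int_module Y
  for G :: "(int, 'g) module" and Y :: "(int, 'y) module"
begin

lemma partial_linearD:
  assumes "partial_linear G Y r"
  shows "(a, b) \<in> r \<Longrightarrow> a \<in> carrier G" "(a, b) \<in> r \<Longrightarrow> b \<in> carrier Y"
    "(\<zero>\<^bsub>G\<^esub>, \<zero>\<^bsub>Y\<^esub>) \<in> r"
    "\<lbrakk>(a, b) \<in> r; (c, d) \<in> r\<rbrakk> \<Longrightarrow> (a \<oplus>\<^bsub>G\<^esub> c, b \<oplus>\<^bsub>Y\<^esub> d) \<in> r"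
    "(a, b) \<in> r \<Longrightarrow> (k \<odot>\<^bsub>G\<^esub> a, k \<odot>\<^bsub>Y\<^esub> b) \<in> r"
    "(\<zero>\<^bsub>G\<^esub>, b) \<in> r \<Longrightarrow> b = \<zero>\<^bsub>Y\<^esub>"
  using assms by (auto simp: partial_linear_def)

lemma partial_linear_unique:
  assumes r: "partial_linear G Y r" and "(a, b) \<in> r" "(a, b') \<in> r"
  shows "b = b'"
proof -
  note D = partial_linearD[OF r]
  have cl: "a \<in> carrier G" "b \<in> carrier Y" "b' \<in> carrier Y"
    using D(1,2) assms by auto
  have "(a \<oplus>\<^bsub>G\<^esub> (- 1) \<odot>\<^bsub>G\<^esub> a, b \<oplus>\<^bsub>Y\<^esub> (- 1) \<odot>\<^bsub>Y\<^esub> b') \<in> r"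
    by (rule D(4)[OF assms(2) D(5)[OF assms(3)]])
  then have "(\<zero>\<^bsub>G\<^esub>, b \<ominus>\<^bsub>Y\<^esub> b') \<in> r"
    using cl by (simp add: G.int_smult_minus Y.int_smult_minus a_minus_def G.M.r_neg)
  then show ?thesis
    using minus_eq_zeroD[OF Y.M.abelian_group_axioms D(6)] cl by blast
qed

text \<open>By \<open>compat\<close> the value \<open>y\<close> proposed at \<open>g\<close> agrees
  with \<open>r\<close> on those multiples of \<open>g\<close> where \<open>r\<close> is already
  defined; this is what keeps the enlarged graph single-valued.\<close>

lemma partial_linear_adjoin:
  assumes r: "partial_linear G Y r" and g: "g \<in> carrier G" and y: "y \<in> carrier Y"
    and compat: "\<And>k b. (k \<odot>\<^bsub>G\<^esub> g, b) \<in> r \<Longrightarrow> b = k \<odot>\<^bsub>Y\<^esub> y"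
  shows "partial_linear G Y {(a \<oplus>\<^bsub>G\<^esub> k \<odot>\<^bsub>G\<^esub> g, b \<oplus>\<^bsub>Y\<^esub> k \<odot>\<^bsub>Y\<^esub> y) | a b k. (a, b) \<in> r}" (is "partial_linear G Y ?r'")
    and "r \<subseteq> {(a \<oplus>\<^bsub>G\<^esub> k \<odot>\<^bsub>G\<^esub> g, b \<oplus>\<^bsub>Y\<^esub> k \<odot>\<^bsub>Y\<^esub> y) | a b k. (a, b) \<in> r}"
    and "(g, y) \<in> {(a \<oplus>\<^bsub>G\<^esub> k \<odot>\<^bsub>G\<^esub> g, b \<oplus>\<^bsub>Y\<^esub> k \<odot>\<^bsub>Y\<^esub> y) | a b k. (a, b) \<in> r}"
proof -
  note D = partial_linearD[OF r]
  have mem: "(a \<oplus>\<^bsub>G\<^esub> k \<odot>\<^bsub>G\<^esub> g, b \<oplus>\<^bsub>Y\<^esub> k \<odot>\<^bsub>Y\<^esub> y) \<in> ?r'" if "(a, b) \<in> r" for a b k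
    using that by blast
  show sub: "r \<subseteq> ?r'"
  proof clarify
    fix a b assume ab: "(a, b) \<in> r"
    show "\<exists>a' b' k. (a, b) = (a' \<oplus>\<^bsub>G\<^esub> k \<odot>\<^bsub>G\<^esub> g, b' \<oplus>\<^bsub>Y\<^esub> k \<odot>\<^bsub>Y\<^esub> y) \<and> (a', b') \<in> r"
      using ab D(1,2)[OF ab] g y by (intro exI[of _ a] exI[of _ b] exI[of _ 0]) simp
  qed
  show "(g, y) \<in> ?r'"
    using mem[OF D(3), of 1] g y by simp
  show "partial_linear G Y ?r'"
    unfolding partial_linear_def
  proof (intro conjI allI impI)
    show "?r' \<subseteq> carrier G \<times> carrier Y"
      using D(1,2) g y by auto
    show "(\<zero>\<^bsub>G\<^esub>, \<zero>\<^bsub>Y\<^esub>) \<in> ?r'"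
      using sub D(3) by blast
  next
    fix a b c d assume "(a, b) \<in> ?r'" "(c, d) \<in> ?r'"
    then obtain a' b' k c' d' l where *: "(a', b') \<in> r" "(c', d') \<in> r"
      "a = a' \<oplus>\<^bsub>G\<^esub> k \<odot>\<^bsub>G\<^esub> g" "b = b' \<oplus>\<^bsub>Y\<^esub> k \<odot>\<^bsub>Y\<^esub> y"
      "c = c' \<oplus>\<^bsub>G\<^esub> l \<odot>\<^bsub>G\<^esub> g" "d = d' \<oplus>\<^bsub>Y\<^esub> l \<odot>\<^bsub>Y\<^esub> y"
      by auto
    have "a \<oplus>\<^bsub>G\<^esub> c = (a' \<oplus>\<^bsub>G\<^esub> c') \<oplus>\<^bsub>G\<^esub> (k + l) \<odot>\<^bsub>G\<^esub> g"
      "b \<oplus>\<^bsub>Y\<^esub> d = (b' \<oplus>\<^bsub>Y\<^esub> d') \<oplus>\<^bsub>Y\<^esub> (k + l) \<odot>\<^bsub>Y\<^esub> y"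
      using * D(1,2) g y by (simp_all add: G.int_smult_left Y.int_smult_left G.M.add.m_ac Y.M.add.m_ac)
    then show "(a \<oplus>\<^bsub>G\<^esub> c, b \<oplus>\<^bsub>Y\<^esub> d) \<in> ?r'"
      using mem[OF D(4)[OF *(1,2)]] by simp
  next
    fix l a b assume "(a, b) \<in> ?r'"
    then obtain a' b' k where *: "(a', b') \<in> r"
      "a = a' \<oplus>\<^bsub>G\<^esub> k \<odot>\<^bsub>G\<^esub> g" "b = b' \<oplus>\<^bsub>Y\<^esub> k \<odot>\<^bsub>Y\<^esub> y"
      by auto
    have "l \<odot>\<^bsub>G\<^esub> a = l \<odot>\<^bsub>G\<^esub> a' \<oplus>\<^bsub>G\<^esub> (l * k) \<odot>\<^bsub>G\<^esub> g" "l \<odot>\<^bsub>Y\<^esub> b = l \<odot>\<^bsub>Y\<^esub> b' \<oplus>\<^bsub>Y\<^esub> (l * k) \<odot>\<^bsub>Y\<^esub> y"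
      using * D(1,2) g y by (simp_all add: G.int_smult_right Y.int_smult_right G.int_smult_assoc Y.int_smult_assoc)
    then show "(l \<odot>\<^bsub>G\<^esub> a, l \<odot>\<^bsub>Y\<^esub> b) \<in> ?r'"
      using mem[OF D(5)[OF *(1)]] by simp
  next
    fix b assume "(\<zero>\<^bsub>G\<^esub>, b) \<in> ?r'"
    then obtain a' b' k where *: "(a', b') \<in> r"
      "\<zero>\<^bsub>G\<^esub> = a' \<oplus>\<^bsub>G\<^esub> k \<odot>\<^bsub>G\<^esub> g" "b = b' \<oplus>\<^bsub>Y\<^esub> k \<odot>\<^bsub>Y\<^esub> y"
      by auto
    have cl: "a' \<in> carrier G" "b' \<in> carrier Y"
      using D(1,2) *(1) by auto
    have "a' = (- k) \<odot>\<^bsub>G\<^esub> g"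
      using *(2) cl g by (simp add: G.int_smult_minus G.M.minus_equality)
    then have "b' = (- k) \<odot>\<^bsub>Y\<^esub> y"
      using compat *(1) by blast
    then show "b = \<zero>\<^bsub>Y\<^esub>"
      using y by (simp add: *(3) Y.int_smult_minus Y.M.l_neg)
  qed
qed

text \<open>The generator is the least positive element, by division with remainder, or 0 for the
  zero subgroup.\<close>

lemma int_subgroup_generator:
  fixes K :: "int set"
  assumes "0 \<in> K" "\<And>k l. \<lbrakk>k \<in> K; l \<in> K\<rbrakk> \<Longrightarrow> k - l \<in> K" "\<And>k l. k \<in> K \<Longrightarrow> l * k \<in> K"
  obtains n where "n \<ge> 0" "n \<in> K" "\<And>k. k \<in> K \<Longrightarrow> n dvd k"
proof (cases "K \<subseteq> {0}")
  case True
  then show ?thesis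
    using that[of 0] assms(1) by auto
next
  case False
  then obtain k where k: "k \<in> K" "k \<noteq> 0"
    by auto
  then have "\<exists>m::nat. m > 0 \<and> int m \<in> K"
    using assms(3)[of k "- 1"] by (intro exI[of _ "nat \<bar>k\<bar>"]) (auto simp: abs_if)
  define m where "m = (LEAST m::nat. m > 0 \<and> int m \<in> K)"
  have m: "m > 0" "int m \<in> K" "\<And>l::nat. \<lbrakk>l > 0; int l \<in> K\<rbrakk> \<Longrightarrow> m \<le> l"
    using LeastI_ex[OF \<open>\<exists>m::nat. m > 0 \<and> int m \<in> K\<close>] Least_le[of "\<lambda>m. m > 0 \<and> int m \<in> K"]
    by (auto simp: m_def)
  have "int m dvd l" if "l \<in> K" for l
  proof -
    have "l mod int m \<in> K"
      using assms(2)[OF that assms(3)[OF m(2), of "l div int m"]] by (simp add: minus_div_mult_eq_mod)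
    moreover have "0 \<le> l mod int m" "l mod int m < int m"
      using m(1) by auto
    ultimately have "l mod int m = 0"
      using m(3)[of "nat (l mod int m)"] by (cases "l mod int m = 0") auto
    then show ?thesis
      by auto
  qed
  then show ?thesis
    using that[of "int m"] m by auto
qed

text \<open>With \<open>e = 0\<close> this is the injectivity of divisible groups.\<close>

lemma partial_linear_extend:
  assumes r: "partial_linear G Y r" and e: "\<And>g. g \<in> carrier G \<Longrightarrow> \<exists>b. (e \<odot>\<^bsub>G\<^esub> g, b) \<in> r"
    and div: "\<And>n y. \<lbrakk>n > 0; n dvd e; y \<in> carrier Y\<rbrakk> \<Longrightarrow> \<exists>y'\<in>carrier Y. n \<odot>\<^bsub>Y\<^esub> y' = y"
  obtains f where "f \<in> linear_maps \<Z> G Y" "\<And>a b. (a, b) \<in> r \<Longrightarrow> f a = b"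
proof -
  let ?A = "{r'. partial_linear G Y r' \<and> r \<subseteq> r'}"
  have "\<exists>M\<in>?A. \<forall>X\<in>?A. M \<subseteq> X \<longrightarrow> X = M"
  proof (rule subset_Zorn_nonempty)
    show "?A \<noteq> {}"
      using r by blast
    fix C assume C: "C \<noteq> {}" "subset.chain ?A C"
    then have pl: "partial_linear G Y c" "r \<subseteq> c" if "c \<in> C" for c
      using that C(2) unfolding subset_chain_def by blast+
    have two: "\<exists>c\<in>C. p \<in> c \<and> q \<in> c" if pq: "p \<in> \<Union>C" "q \<in> \<Union>C" for p q
    proof -
      obtain c d where "c \<in> C" "p \<in> c" "d \<in> C" "q \<in> d"
        using pq by blast
      then show ?thesis
        using C(2) unfolding subset_chain_def by blast
    qed
    have "partial_linear G Y (\<Union>C)"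
      unfolding partial_linear_def
    proof (intro conjI allI impI)
      show "\<Union>C \<subseteq> carrier G \<times> carrier Y"
        by (rule Union_least) (drule pl(1), simp add: partial_linear_def)
      show "(\<zero>\<^bsub>G\<^esub>, \<zero>\<^bsub>Y\<^esub>) \<in> \<Union>C"
        using C(1) partial_linearD(3)[OF pl(1)] by blast
      show "(a \<oplus>\<^bsub>G\<^esub> c, b \<oplus>\<^bsub>Y\<^esub> d) \<in> \<Union>C" if "(a, b) \<in> \<Union>C" "(c, d) \<in> \<Union>C" for a b c d
        using two[OF that] partial_linearD(4)[OF pl(1)] by blast
      show "(k \<odot>\<^bsub>G\<^esub> a, k \<odot>\<^bsub>Y\<^esub> b) \<in> \<Union>C" if "(a, b) \<in> \<Union>C" for k a b
        using that partial_linearD(5)[OF pl(1)] by blast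
      show "b = \<zero>\<^bsub>Y\<^esub>" if "(\<zero>\<^bsub>G\<^esub>, b) \<in> \<Union>C" for b
        using that partial_linearD(6)[OF pl(1)] by blast
    qed
    moreover have "r \<subseteq> \<Union>C"
      using C(1) pl(2) by blast
    ultimately show "\<Union>C \<in> ?A"
      by blast
  qed
  then obtain m where m': "m \<in> ?A" and max': "\<forall>X\<in>?A. m \<subseteq> X \<longrightarrow> X = m"
    by (rule bexE)
  then have m: "partial_linear G Y m" "r \<subseteq> m"
    by simp_all
  have max: "m' = m" if "partial_linear G Y m'" "m \<subseteq> m'" for m'
    using bspec[OF max', of m'] that m(2) by auto
  note D = partial_linearD[OF m(1)]
  have total: "\<exists>b. (g, b) \<in> m" if g: "g \<in> carrier G" for g
  proof -
    \<comment> \<open>The multiples of \<open>g\<close> on which the maximal extension is already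
      defined. By assumption \<open>e\<close> is one of them, so the generator \<open>n\<close>
      divides \<open>e\<close>.\<close>
    define K where "K = {k. \<exists>b. (k \<odot>\<^bsub>G\<^esub> g, b) \<in> m}"
    obtain n where n: "n \<ge> 0" "n \<in> K" "\<And>k. k \<in> K \<Longrightarrow> n dvd k"
    proof (rule int_subgroup_generator[of K])
      show "0 \<in> K"
        using D(3) g by (auto simp: K_def)
      show "l * k \<in> K" if "k \<in> K" for k l
        using that D(5) g by (auto simp: K_def G.int_smult_assoc)
      show "k - l \<in> K" if kl: "k \<in> K" "l \<in> K" for k l
      proof -
        obtain b c where "(k \<odot>\<^bsub>G\<^esub> g, b) \<in> m" "(l \<odot>\<^bsub>G\<^esub> g, c) \<in> m"
          using kl by (auto simp: K_def)
        from D(4)[OF this(1) D(5)[OF this(2), of "- 1"]] show ?thesis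
          using g by (auto simp: K_def G.int_smult_diff G.int_smult_minus a_minus_def)
      qed
    qed blast
    obtain b where b: "(n \<odot>\<^bsub>G\<^esub> g, b) \<in> m"
      using n(2) by (auto simp: K_def)
    have "e \<in> K"
      using e[OF g] m(2) by (auto simp: K_def)
    \<comment> \<open>The value at \<open>g\<close> must be an n-th part of \<open>b\<close>. For
      \<open>n = 0\<close> also \<open>b\<close> is zero; otherwise \<open>n\<close> is a positive
      divisor of \<open>e\<close>, and for these division in \<open>Y\<close> is assumed.\<close>
    have "\<exists>y\<in>carrier Y. n \<odot>\<^bsub>Y\<^esub> y = b"
    proof (cases "n = 0")
      case True
      then have "b = \<zero>\<^bsub>Y\<^esub>"
        using b D(6) g by simp
      with True show ?thesis
        by (intro bexI[of _ "\<zero>\<^bsub>Y\<^esub>"]) simp_all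
    next
      case False
      then show ?thesis
        using n(1,3) \<open>e \<in> K\<close> D(2)[OF b] by (intro div) auto
    qed
    then obtain y where y: "y \<in> carrier Y" "n \<odot>\<^bsub>Y\<^esub> y = b"
      by blast
    have compat: "c = k \<odot>\<^bsub>Y\<^esub> y" if c: "(k \<odot>\<^bsub>G\<^esub> g, c) \<in> m" for k c
    proof -
      have "n dvd k"
        using c by (intro n(3)) (auto simp: K_def)
      then obtain l where l: "k = l * n"
        by (metis dvd_def mult.commute)
      have "(k \<odot>\<^bsub>G\<^esub> g, l \<odot>\<^bsub>Y\<^esub> b) \<in> m"
        using D(5)[OF b, of l] g by (simp add: l G.int_smult_assoc)
      then have "c = l \<odot>\<^bsub>Y\<^esub> b"
        using partial_linear_unique[OF m(1) c] by blast
      then show ?thesis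
        using y by (simp add: l Y.int_smult_assoc)
    qed
    note adj = partial_linear_adjoin[OF m(1) g y(1) compat]
    from max[OF adj(1,2)] adj(3) show ?thesis
      by blast
  qed
  define f where "f a = (THE b. (a, b) \<in> m)" for a
  have f: "f a = b" if "(a, b) \<in> m" for a b
    unfolding f_def using that partial_linear_unique[OF m(1)] by blast
  have fm: "(a, f a) \<in> m" if "a \<in> carrier G" for a
    using total[OF that] f by auto
  have "f \<in> linear_maps \<Z> G Y"
    by (rule linear_mapsI) (auto intro!: f D(2)[OF fm] D(4,5) fm)
  moreover have "f a = b" if "(a, b) \<in> r" for a b
    using that m(2) f by blast
  ultimately show ?thesis
    using that by blast
qed

end

text \<open>The group of nonzero complex numbers, with integer powers as scalar multiples. It is
  divisible and contains all roots of unity, so it tests abelian groups in the way Q/Z does.\<close>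

definition circle :: "(int, complex) module"
  where "circle = \<lparr>carrier = - {0}, mult = undefined, one = undefined, zero = 1, add = (*),
    smult = (\<lambda>k z. z powi k)\<rparr>"

lemma circle_simps [simp]:
  "carrier circle = - {0}" "zero circle = 1" "add circle = (*)" "smult circle k z = z powi k"
  by (simp_all add: circle_def)

interpretation circle: int_module circle
proof -
  have "abelian_group circle"
    by (rule abelian_groupI) (auto intro!: bexI[of _ "inverse x" for x] simp: field_simps)
  then show "int_module circle"
    by (intro int_module.intro moduleI[OF int_is_cring])
      (auto simp: power_int_add power_int_mult_distrib power_int_mult[symmetric] mult.commute)
qed

lemma circle_divisible:
  assumes "n > 0" "y \<in> carrier circle"
  shows "\<exists>y'\<in>carrier circle. n \<odot>\<^bsub>circle\<^esub> y' = y"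
proof -
  define m where "m = nat n"
  have m: "m > 0" "n = int m"
    using assms by (auto simp: m_def)
  define z where "z = rcis (root m (cmod y)) (Arg y / real m)"
  have "z ^ m = y"
    using m(1) assms by (simp add: z_def DeMoivre2 rcis_cmod_Arg)
  then show ?thesis
    using m assms by (intro bexI[of _ z]) (auto simp: power_int_def)
qed

text \<open>The embedding of Z/n into \<open>circle\<close>; the exponent is an integer read modulo
  \<open>n\<close>.\<close>

definition root_of_unity :: "nat \<Rightarrow> int \<Rightarrow> complex"
  where "root_of_unity n k = cis (2 * pi * of_int k / of_nat n)"

lemma root_of_unity_add: "root_of_unity n (k + l) = root_of_unity n k * root_of_unity n l"
  by (simp add: root_of_unity_def cis_mult add_divide_distrib distrib_left)

lemma root_of_unity_nonzero [simp]: "root_of_unity n k \<noteq> 0"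
  by (simp add: root_of_unity_def)

lemma root_of_unity_powi: "root_of_unity n k powi l = root_of_unity n (l * k)"
  by (simp add: root_of_unity_def cis_power_int mult_ac)

lemma root_of_unity_eq_1_iff:
  assumes "n > 0"
  shows "root_of_unity n k = 1 \<longleftrightarrow> int n dvd k"
proof -
  have mult: "root_of_unity n (int n * l) = 1" for l
  proof -
    have "2 * pi * of_int (int n * l) / of_nat n = 2 * pi * of_int l"
      using assms by simp
    then show ?thesis
      unfolding root_of_unity_def by (simp only: cis_multiple_2pi Ints_of_int)
  qed
  have "root_of_unity n k = root_of_unity n (k mod int n)"
    using root_of_unity_add[of n "int n * (k div int n)" "k mod int n"] by (simp add: mult)
  also have "\<dots> = 1 \<longleftrightarrow> k mod int n = 0"
  proof
    assume *: "root_of_unity n (k mod int n) = 1"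
    define j where "j = nat (k mod int n)"
    have j: "j < n" "k mod int n = int j"
      using assms by (auto simp: j_def nat_less_iff)
    have "inj_on (\<lambda>k. cis (2 * pi * real k / real n)) {..<n}"
      using bij_betw_roots_unity[OF assms] by (rule bij_betw_imp_inj_on)
    then have "j = 0"
      using * j assms by (auto simp: root_of_unity_def dest!: inj_onD[of _ _ j 0])
    then show "k mod int n = 0"
      using j by simp
  qed (simp add: root_of_unity_def)
  finally show ?thesis
    by auto
qed

lemma root_of_unity_exists:
  assumes "n > 0" "z ^ n = 1"
  shows "\<exists>k. z = root_of_unity n k"
proof -
  have "z \<in> (\<lambda>k. cis (2 * pi * real k / real n)) ` {..<n}"
    using bij_betw_roots_unity[OF assms(1)] assms(2) by (auto simp: bij_betw_def)
  then obtain k where "z = cis (2 * pi * real k / real n)"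
    by blast
  then have "z = root_of_unity n (int k)"
    by (simp add: root_of_unity_def)
  then show ?thesis ..
qed

context int_module
begin

text \<open>It is enough to find a nontrivial value for \<open>g\<close> that is consistent with
  \<open>H\<close>; the character so defined on the subgroup generated by \<open>H\<close> and
  \<open>g\<close> extends because \<open>circle\<close> is divisible.\<close>

lemma character_separation:
  assumes H: "submodule H \<Z> M" and g: "g \<in> carrier M" "g \<notin> H"
  obtains f where "f \<in> linear_maps \<Z> M circle" "\<And>h. h \<in> H \<Longrightarrow> f h = 1" "f g \<noteq> 1"
proof -
  interpret E: hom_extension M circle ..
  note HE = submoduleE[OF H]
  have zero: "\<zero> \<in> H"
    using HE(2) HE(3) HE(5) by (metis HE(1) M.r_neg equals0I subsetD)
  define r where "r = H \<times> {1::complex}"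
  have r: "partial_linear M circle r"
    unfolding partial_linear_def r_def using HE(1,5) HE(4)[of _ _] zero by auto
  have "\<exists>y::complex. y \<noteq> 0 \<and> y \<noteq> 1 \<and> (\<forall>k. k \<odot> g \<in> H \<longrightarrow> y powi k = 1)"
  proof -
    obtain n where n: "n \<ge> 0" "n \<odot> g \<in> H" "\<And>k. k \<odot> g \<in> H \<Longrightarrow> n dvd k"
    proof (rule E.int_subgroup_generator[of "{k. k \<odot> g \<in> H}"])
      show "k - l \<in> {k. k \<odot> g \<in> H}" if "k \<in> {k. k \<odot> g \<in> H}" "l \<in> {k. k \<odot> g \<in> H}" for k l
        using that HE(3)[of "l \<odot> g"] HE(5)[of "k \<odot> g" "\<ominus> (l \<odot> g)"] g by (simp add: int_smult_diff a_minus_def)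
      show "l * k \<in> {k. k \<odot> g \<in> H}" if "k \<in> {k. k \<odot> g \<in> H}" for k l
        using that HE(4)[of l] g by (simp add: int_smult_assoc)
      show "0 \<in> {k. k \<odot> g \<in> H}"
        using zero g by simp
    qed blast
    show ?thesis
    proof (cases "n = 0")
      \<comment> \<open>No nonzero multiple of \<open>g\<close> lies in \<open>H\<close>, so the
        value at \<open>g\<close> is unconstrained; \<open>- 1\<close> serves as a nonzero number
        other than 1.\<close>
      case True
      have 0: "k = 0" if "k \<odot> g \<in> H" for k
        using n(3)[OF that] True by simp
      show ?thesis
        by (intro exI[of _ "- 1"]) (auto dest: 0)
    next
      case False
      define m where "m = nat n"
      have m: "m > 0" "n = int m"
        using False n(1) by (auto simp: m_def)
      \<comment> \<open>\<open>m\<close> is the order of \<open>g\<close> modulo \<open>H\<close>,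
        and \<open>m = 1\<close> would put \<open>g\<close> into \<open>H\<close>; a primitive m-th
        root of unity is then consistent and nontrivial.\<close>
      have "m \<noteq> 1"
        using n(2) g m by auto
      then have "root_of_unity m 1 \<noteq> 1"
        using root_of_unity_eq_1_iff[OF m(1), of 1] m(1) by auto
      moreover have "root_of_unity m 1 powi k = 1" if "k \<odot> g \<in> H" for k
        using n(3)[OF that] m by (simp add: root_of_unity_powi root_of_unity_eq_1_iff)
      ultimately show ?thesis
        by (intro exI[of _ "root_of_unity m 1"]) auto
    qed
  qed
  then obtain y :: complex where y: "y \<noteq> 0" "y \<noteq> 1" "\<And>k. k \<odot> g \<in> H \<Longrightarrow> y powi k = 1"
    by blast
  have "b = k \<odot>\<^bsub>circle\<^esub> y" if "(k \<odot> g, b) \<in> r" for k b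
    using that y(3) by (auto simp: r_def)
  then have adj: "partial_linear M circle {(a \<oplus> k \<odot> g, b \<oplus>\<^bsub>circle\<^esub> k \<odot>\<^bsub>circle\<^esub> y) | a b k. (a, b) \<in> r}"
    "r \<subseteq> {(a \<oplus> k \<odot> g, b \<oplus>\<^bsub>circle\<^esub> k \<odot>\<^bsub>circle\<^esub> y) | a b k. (a, b) \<in> r}"
    "(g, y) \<in> {(a \<oplus> k \<odot> g, b \<oplus>\<^bsub>circle\<^esub> k \<odot>\<^bsub>circle\<^esub> y) | a b k. (a, b) \<in> r}"
    using E.partial_linear_adjoin[OF r g(1), of y] y(1) by simp_all
  obtain f where f: "f \<in> linear_maps \<Z> M circle"
    "\<And>a b. (a, b) \<in> {(a \<oplus> k \<odot> g, b \<oplus>\<^bsub>circle\<^esub> k \<odot>\<^bsub>circle\<^esub> y) | a b k. (a, b) \<in> r} \<Longrightarrow> f a = b"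
  proof (rule E.partial_linear_extend[OF adj(1), of 0])
    show "\<exists>b. (0 \<odot> g', b) \<in> {(a \<oplus> k \<odot> g, b \<oplus>\<^bsub>circle\<^esub> k \<odot>\<^bsub>circle\<^esub> y) | a b k. (a, b) \<in> r}"
      if "g' \<in> carrier M" for g'
      using E.partial_linearD(3)[OF adj(1)] that by (intro exI[of _ 1]) simp
  qed (use circle_divisible in auto)
  show ?thesis
  proof (rule that[OF f(1)])
    show "f h = 1" if "h \<in> H" for h
      by (rule f(2), rule subsetD[OF adj(2)]) (simp add: r_def that)
    show "f g \<noteq> 1"
      using f(2)[OF adj(3)] y(2) by simp
  qed
qed

end

section \<open>The tensor square is faithful in the tensor cube\<close>

definition hom_module :: "(int, 'u) module \<Rightarrow> 'u set \<Rightarrow> (int, 'u \<Rightarrow> complex) module"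
  where "hom_module U T = \<lparr>
    carrier = {f \<in> linear_maps \<Z> U circle. f \<in> extensional (carrier U) \<and> (\<forall>t\<in>T. f t = 1)},
    mult = undefined, one = undefined, zero = (\<lambda>x\<in>carrier U. 1),
    add = (\<lambda>f g. \<lambda>x\<in>carrier U. f x * g x), smult = (\<lambda>k f. \<lambda>x\<in>carrier U. f x powi k)\<rparr>"

lemma hom_module_simps:
  "carrier (hom_module U T) = {f \<in> linear_maps \<Z> U circle. f \<in> extensional (carrier U) \<and> (\<forall>t\<in>T. f t = 1)}"
  "zero (hom_module U T) = (\<lambda>x\<in>carrier U. 1)"
  "add (hom_module U T) f g = (\<lambda>x\<in>carrier U. f x * g x)"
  "smult (hom_module U T) k f = (\<lambda>x\<in>carrier U. f x powi k)"
  by (simp_all add: hom_module_def)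

locale char_module = int_module U for U :: "(int, 'u) module" +
  fixes T :: "'u set"
  assumes T: "submodule T \<Z> U"
begin

lemma T_subset: "t \<in> T \<Longrightarrow> t \<in> carrier U"
  using submoduleE(1)[OF T] by auto

lemma hom_moduleI:
  assumes "f \<in> linear_maps \<Z> U circle" "\<And>t. t \<in> T \<Longrightarrow> f t = 1"
  shows "restrict f (carrier U) \<in> carrier (hom_module U T)"
proof -
  have "restrict f (carrier U) \<in> linear_maps \<Z> U circle"
    by (rule linear_maps_cong[OF assms(1) M.abelian_group_axioms]) simp_all
  then show ?thesis
    using assms(2) T_subset by (auto simp: hom_module_simps)
qed

lemma
  assumes "f \<in> carrier (hom_module U T)"
  shows char_linear: "f \<in> linear_maps \<Z> U circle"
    and char_nonzero: "x \<in> carrier U \<Longrightarrow> f x \<noteq> 0"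
    and char_add: "\<lbrakk>x \<in> carrier U; y \<in> carrier U\<rbrakk> \<Longrightarrow> f (x \<oplus>\<^bsub>U\<^esub> y) = f x * f y"
    and char_smult: "x \<in> carrier U \<Longrightarrow> f (k \<odot>\<^bsub>U\<^esub> x) = f x powi k"
    and char_trivial: "t \<in> T \<Longrightarrow> f t = 1"
  using assms by (auto simp: hom_module_simps linear_maps_def)

lemma char_eqI:
  assumes "f \<in> carrier (hom_module U T)" "g \<in> carrier (hom_module U T)" "\<And>x. x \<in> carrier U \<Longrightarrow> f x = g x"
  shows "f = g"
  using assms by (auto simp: hom_module_simps intro: extensionalityI)

lemma hom_module_closed:
  assumes "f \<in> carrier (hom_module U T)" "g \<in> carrier (hom_module U T)"
  shows "f \<oplus>\<^bsub>hom_module U T\<^esub> g \<in> carrier (hom_module U T)"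
    and "k \<odot>\<^bsub>hom_module U T\<^esub> f \<in> carrier (hom_module U T)"
proof -
  have "(\<lambda>x. f x * g x) \<in> linear_maps \<Z> U circle"
    using linear_maps_add[OF char_linear[OF assms(1)] char_linear[OF assms(2)] module_axioms circle.module_axioms] by simp
  then show "f \<oplus>\<^bsub>hom_module U T\<^esub> g \<in> carrier (hom_module U T)"
    unfolding hom_module_simps(3)
    by (intro hom_moduleI) (simp_all add: char_trivial[OF assms(1)] char_trivial[OF assms(2)])
  have "(\<lambda>x. f x powi k) \<in> linear_maps \<Z> U circle"
    using linear_maps_smult[OF char_linear[OF assms(1)] _ module_axioms circle.module_axioms, of k] by simp
  then show "k \<odot>\<^bsub>hom_module U T\<^esub> f \<in> carrier (hom_module U T)"
    unfolding hom_module_simps(4) by (intro hom_moduleI) (simp_all add: char_trivial[OF assms(1)])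
qed

lemma hom_module_zero_closed: "\<zero>\<^bsub>hom_module U T\<^esub> \<in> carrier (hom_module U T)"
proof -
  have "(\<lambda>x. 1) \<in> linear_maps \<Z> U circle"
    by (rule linear_mapsI) auto
  then show ?thesis
    unfolding hom_module_simps(2) by (intro hom_moduleI) auto
qed

lemma module_hom_module: "module \<Z> (hom_module U T)"
proof -
  let ?X = "hom_module U T"
  note cl = hom_module_closed and cl0 = hom_module_zero_closed
  note eqI = char_eqI
  have ab: "abelian_group ?X"
  proof (rule abelian_groupI)
    fix f assume f: "f \<in> carrier ?X"
    show "\<exists>g\<in>carrier ?X. g \<oplus>\<^bsub>?X\<^esub> f = \<zero>\<^bsub>?X\<^esub>"
    proof -
      have "(- 1) \<odot>\<^bsub>?X\<^esub> f \<oplus>\<^bsub>?X\<^esub> f = \<zero>\<^bsub>?X\<^esub>"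
        by (rule eqI[OF cl(1)[OF cl(2)[OF f f] f] cl0])
          (simp add: hom_module_simps(2-4) power_int_minus char_nonzero[OF f])
      then show ?thesis
        using cl(2)[OF f f, of "- 1"] by blast
    qed
    show "\<zero>\<^bsub>?X\<^esub> \<oplus>\<^bsub>?X\<^esub> f = f"
      using f by (intro eqI cl cl0) (auto simp: hom_module_simps(2-4))
    fix g assume g: "g \<in> carrier ?X"
    show "f \<oplus>\<^bsub>?X\<^esub> g = g \<oplus>\<^bsub>?X\<^esub> f"
      using f g by (intro eqI cl) (auto simp: hom_module_simps(2-4))
    fix h assume h: "h \<in> carrier ?X"
    show "f \<oplus>\<^bsub>?X\<^esub> g \<oplus>\<^bsub>?X\<^esub> h = f \<oplus>\<^bsub>?X\<^esub> (g \<oplus>\<^bsub>?X\<^esub> h)"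
      using f g h by (intro eqI cl) (auto simp: hom_module_simps(2-4))
  qed (use cl cl0 in auto)
  show ?thesis
  proof (rule moduleI[OF int_is_cring ab])
    fix k l and f g assume f: "f \<in> carrier ?X" and g: "g \<in> carrier ?X"
    show "(k \<oplus>\<^bsub>\<Z>\<^esub> l) \<odot>\<^bsub>?X\<^esub> f = k \<odot>\<^bsub>?X\<^esub> f \<oplus>\<^bsub>?X\<^esub> l \<odot>\<^bsub>?X\<^esub> f"
      using f by (intro eqI cl) (auto simp: hom_module_simps(2-4) power_int_add char_nonzero)
    show "k \<odot>\<^bsub>?X\<^esub> (f \<oplus>\<^bsub>?X\<^esub> g) = k \<odot>\<^bsub>?X\<^esub> f \<oplus>\<^bsub>?X\<^esub> k \<odot>\<^bsub>?X\<^esub> g"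
      using f g by (intro eqI cl) (auto simp: hom_module_simps(2-4) power_int_mult_distrib)
    show "(k \<otimes>\<^bsub>\<Z>\<^esub> l) \<odot>\<^bsub>?X\<^esub> f = k \<odot>\<^bsub>?X\<^esub> (l \<odot>\<^bsub>?X\<^esub> f)"
      using f by (intro eqI cl) (auto simp: hom_module_simps(2-4) power_int_mult[symmetric] mult.commute)
    show "\<one>\<^bsub>\<Z>\<^esub> \<odot>\<^bsub>?X\<^esub> f = f"
      using f by (intro eqI cl) (auto simp: hom_module_simps(2-4))
  qed (use cl in auto)
qed

sublocale X: int_module "hom_module U T"
  by (rule int_module.intro) (rule module_hom_module)

text \<open>If multiplication by \<open>n\<close> is injective on U/T, then a character
  \<open>f\<close> of U/T can be moved to the image of this multiplication, as a character of
  n(U/T). Extending it to all of \<open>U\<close> gives an n-th root of \<open>f\<close>.\<close>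

lemma hom_module_divisible:
  assumes n: "n > 0" and tf: "\<And>x. \<lbrakk>x \<in> carrier U; n \<odot>\<^bsub>U\<^esub> x \<in> T\<rbrakk> \<Longrightarrow> x \<in> T"
    and f: "f \<in> carrier (hom_module U T)"
  shows "\<exists>g\<in>carrier (hom_module U T). n \<odot>\<^bsub>hom_module U T\<^esub> g = f"
proof -
  interpret E: hom_extension U circle ..
  note TE = submoduleE[OF T]
  \<comment> \<open>The graph of \<open>n \<odot> x + t \<mapsto> f x\<close> on nU + T; it is
    single-valued because \<open>n \<odot> x\<close> lies in \<open>T\<close> only if
    \<open>x\<close> does.\<close>
  define r where "r = {(n \<odot>\<^bsub>U\<^esub> x \<oplus>\<^bsub>U\<^esub> t, f x) | x t. x \<in> carrier U \<and> t \<in> T}"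
  have r: "partial_linear U circle r"
    unfolding partial_linear_def
  proof (intro conjI allI impI)
    show "r \<subseteq> carrier U \<times> carrier circle"
      using T_subset char_nonzero[OF f] by (auto simp: r_def)
    have z: "\<zero>\<^bsub>U\<^esub> \<in> T"
      using TE(4)[of 0] TE(2) T_subset by force
    then show "(\<zero>\<^bsub>U\<^esub>, \<zero>\<^bsub>circle\<^esub>) \<in> r"
      unfolding r_def using char_trivial[OF f z] by (intro CollectI exI[of _ "\<zero>\<^bsub>U\<^esub>"]) simp
  next
    fix a b c d assume "(a, b) \<in> r" "(c, d) \<in> r"
    then obtain x t x' t' where *: "a = n \<odot>\<^bsub>U\<^esub> x \<oplus>\<^bsub>U\<^esub> t" "b = f x" "c = n \<odot>\<^bsub>U\<^esub> x' \<oplus>\<^bsub>U\<^esub> t'" "d = f x'"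
      "x \<in> carrier U" "x' \<in> carrier U" "t \<in> T" "t' \<in> T"
      by (auto simp: r_def)
    then show "(a \<oplus>\<^bsub>U\<^esub> c, b \<oplus>\<^bsub>circle\<^esub> d) \<in> r"
      unfolding r_def using T_subset TE(5)
      by (intro CollectI exI[of _ "x \<oplus>\<^bsub>U\<^esub> x'"] exI[of _ "t \<oplus>\<^bsub>U\<^esub> t'"])
        (simp add: char_add[OF f] int_smult_right M.add.m_ac)
  next
    fix k a b assume "(a, b) \<in> r"
    then obtain x t where *: "a = n \<odot>\<^bsub>U\<^esub> x \<oplus>\<^bsub>U\<^esub> t" "b = f x" "x \<in> carrier U" "t \<in> T"
      by (auto simp: r_def)
    then show "(k \<odot>\<^bsub>U\<^esub> a, k \<odot>\<^bsub>circle\<^esub> b) \<in> r"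
      unfolding r_def using T_subset TE(4)[of k t]
      by (intro CollectI exI[of _ "k \<odot>\<^bsub>U\<^esub> x"] exI[of _ "k \<odot>\<^bsub>U\<^esub> t"])
        (simp add: char_smult[OF f] int_smult_right int_smult_commute[of x k n])
  next
    fix b assume "(\<zero>\<^bsub>U\<^esub>, b) \<in> r"
    then obtain x t where *: "\<zero>\<^bsub>U\<^esub> = n \<odot>\<^bsub>U\<^esub> x \<oplus>\<^bsub>U\<^esub> t" "b = f x" "x \<in> carrier U" "t \<in> T"
      by (auto simp: r_def)
    have "n \<odot>\<^bsub>U\<^esub> x = \<ominus>\<^bsub>U\<^esub> t"
      using * T_subset by (intro M.minus_equality[symmetric]) auto
    then have "n \<odot>\<^bsub>U\<^esub> x \<in> T"
      using TE(3)[OF *(4)] by simp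
    then show "b = \<zero>\<^bsub>circle\<^esub>"
      using tf[OF *(3)] char_trivial[OF f] *(2) by simp
  qed
  obtain g where g: "g \<in> linear_maps \<Z> U circle" "\<And>a b. (a, b) \<in> r \<Longrightarrow> g a = b"
  proof (rule E.partial_linear_extend[OF r, of 0])
    show "\<exists>b. (0 \<odot>\<^bsub>U\<^esub> x, b) \<in> r" if "x \<in> carrier U" for x
      using E.partial_linearD(3)[OF r] that by (intro exI[of _ 1]) simp
  qed (use circle_divisible in auto)
  have gn: "g (n \<odot>\<^bsub>U\<^esub> x \<oplus>\<^bsub>U\<^esub> t) = f x" if "x \<in> carrier U" "t \<in> T" for x t
    using g(2) that by (auto simp: r_def)
  have z: "\<zero>\<^bsub>U\<^esub> \<in> T"
    using TE(4)[of 0] TE(2) T_subset by force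
  have "g t = 1" if "t \<in> T" for t
    using gn[OF M.zero_closed that] T_subset[OF that] char_trivial[OF f z] by simp
  then have gX: "restrict g (carrier U) \<in> carrier (hom_module U T)"
    by (intro hom_moduleI g(1))
  moreover have "n \<odot>\<^bsub>hom_module U T\<^esub> restrict g (carrier U) = f"
  proof (rule char_eqI[OF hom_module_closed(2)[OF gX gX] f])
    fix x assume x: "x \<in> carrier U"
    have "g x powi n = g (n \<odot>\<^bsub>U\<^esub> x)"
      using linear_smult[OF g(1) x, of n] by simp
    then show "(n \<odot>\<^bsub>hom_module U T\<^esub> restrict g (carrier U)) x = f x"
      using gn[OF x z] x by (simp add: hom_module_simps(4))
  qed
  ultimately show ?thesis
    by blast
qed

end

section \<open>Bilinear and trilinear forms as homomorphisms from tensor powers\<close>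

lemma multilinear2I:
  assumes U: "module \<Z> U" and N: "module \<Z> N"
    and cl: "\<And>x y. \<lbrakk>x \<in> carrier U; y \<in> carrier U\<rbrakk> \<Longrightarrow> h x y \<in> carrier N"
    and 1: "\<And>x x' y. \<lbrakk>x \<in> carrier U; x' \<in> carrier U; y \<in> carrier U\<rbrakk> \<Longrightarrow>
      h (x \<oplus>\<^bsub>U\<^esub> x') y = h x y \<oplus>\<^bsub>N\<^esub> h x' y"
    and 2: "\<And>x y y'. \<lbrakk>x \<in> carrier U; y \<in> carrier U; y' \<in> carrier U\<rbrakk> \<Longrightarrow>
      h x (y \<oplus>\<^bsub>U\<^esub> y') = h x y \<oplus>\<^bsub>N\<^esub> h x y'"
  shows "multilinear \<Z> U 2 N (\<lambda>xs. h (xs ! 0) (xs ! 1))"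
proof (rule multilinearI)
  show "h (xs ! 0) (xs ! 1) \<in> carrier N" if "length xs = 2" "set xs \<subseteq> carrier U" for xs
    using that by (intro cl) (auto dest: nth_mem)
  fix as bs assume s: "set as \<subseteq> carrier U" "set bs \<subseteq> carrier U" "Suc (length as + length bs) = 2"
  then consider b where "as = []" "bs = [b]" "b \<in> carrier U" | a where "as = [a]" "bs = []" "a \<in> carrier U"
    by (cases as; cases bs) auto
  then show "(\<lambda>x. h ((as @ x # bs) ! 0) ((as @ x # bs) ! 1)) \<in> linear_maps \<Z> U N"
    by cases (auto intro!: linear_maps_int[OF U N] cl 1 2)
qed

lemma multilinear3I:
  assumes U: "module \<Z> U" and N: "module \<Z> N"
    and cl: "\<And>x y z. \<lbrakk>x \<in> carrier U; y \<in> carrier U; z \<in> carrier U\<rbrakk> \<Longrightarrow> h x y z \<in> carrier N"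
    and 1: "\<And>x x' y z. \<lbrakk>x \<in> carrier U; x' \<in> carrier U; y \<in> carrier U; z \<in> carrier U\<rbrakk> \<Longrightarrow>
      h (x \<oplus>\<^bsub>U\<^esub> x') y z = h x y z \<oplus>\<^bsub>N\<^esub> h x' y z"
    and 2: "\<And>x y y' z. \<lbrakk>x \<in> carrier U; y \<in> carrier U; y' \<in> carrier U; z \<in> carrier U\<rbrakk> \<Longrightarrow>
      h x (y \<oplus>\<^bsub>U\<^esub> y') z = h x y z \<oplus>\<^bsub>N\<^esub> h x y' z"
    and 3: "\<And>x y z z'. \<lbrakk>x \<in> carrier U; y \<in> carrier U; z \<in> carrier U; z' \<in> carrier U\<rbrakk> \<Longrightarrow>
      h x y (z \<oplus>\<^bsub>U\<^esub> z') = h x y z \<oplus>\<^bsub>N\<^esub> h x y z'"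
  shows "multilinear \<Z> U 3 N (\<lambda>xs. h (xs ! 0) (xs ! 1) (xs ! 2))"
proof (rule multilinearI)
  show "h (xs ! 0) (xs ! 1) (xs ! 2) \<in> carrier N" if "length xs = 3" "set xs \<subseteq> carrier U" for xs
    using that by (intro cl) (auto dest: nth_mem)
  fix as bs assume s: "set as \<subseteq> carrier U" "set bs \<subseteq> carrier U" "Suc (length as + length bs) = 3"
  have "length as = 0 \<and> length bs = 2 \<or> length as = 1 \<and> length bs = 1 \<or> length as = 2 \<and> length bs = 0"
    using s(3) by linarith
  then consider b c where "as = []" "bs = [b, c]" "b \<in> carrier U" "c \<in> carrier U"
    | a c where "as = [a]" "bs = [c]" "a \<in> carrier U" "c \<in> carrier U"
    | a b where "as = [a, b]" "bs = []" "a \<in> carrier U" "b \<in> carrier U"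
    using s(1,2) by (auto simp: numeral_2_eq_2 length_Suc_conv)
  then show "(\<lambda>x. h ((as @ x # bs) ! 0) ((as @ x # bs) ! 1) ((as @ x # bs) ! 2)) \<in> linear_maps \<Z> U N"
    by cases (auto intro!: linear_maps_int[OF U N] cl 1 2 3)
qed

locale tensor_square = int_module U for U :: "(int, 'u) module"
begin

abbreviation "W \<equiv> tpow \<Z> U 2"
abbreviation "tens x y \<equiv> tpure \<Z> U [x, y]"

sublocale W: int_module W
  by (rule int_module.intro) (rule module_tpow)

lemma tens_closed [simp]: "\<lbrakk>x \<in> carrier U; y \<in> carrier U\<rbrakk> \<Longrightarrow> tens x y \<in> carrier W"
  by (rule tpure_closed) auto

lemma tens_left: "y \<in> carrier U \<Longrightarrow> (\<lambda>x. tens x y) \<in> linear_maps \<Z> U W"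
  using multilinear_slot[OF multilinear_tpure, of "[]" "[y]" 2] by simp

lemma tens_right: "x \<in> carrier U \<Longrightarrow> (\<lambda>y. tens x y) \<in> linear_maps \<Z> U W"
  using multilinear_slot[OF multilinear_tpure, of "[x]" "[]" 2] by simp

lemma tens_add:
  "\<lbrakk>x \<in> carrier U; x' \<in> carrier U; y \<in> carrier U\<rbrakk> \<Longrightarrow> tens (x \<oplus>\<^bsub>U\<^esub> x') y = tens x y \<oplus>\<^bsub>W\<^esub> tens x' y"
  "\<lbrakk>x \<in> carrier U; y \<in> carrier U; y' \<in> carrier U\<rbrakk> \<Longrightarrow> tens x (y \<oplus>\<^bsub>U\<^esub> y') = tens x y \<oplus>\<^bsub>W\<^esub> tens x y'"
  using linear_add[OF tens_left] linear_add[OF tens_right] by auto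

lemma tens_smult:
  "\<lbrakk>x \<in> carrier U; y \<in> carrier U\<rbrakk> \<Longrightarrow> tens (k \<odot>\<^bsub>U\<^esub> x) y = k \<odot>\<^bsub>W\<^esub> tens x y"
  "\<lbrakk>x \<in> carrier U; y \<in> carrier U\<rbrakk> \<Longrightarrow> tens x (k \<odot>\<^bsub>U\<^esub> y) = k \<odot>\<^bsub>W\<^esub> tens x y"
  using linear_smult[OF tens_left, of y x k] linear_smult[OF tens_right, of x y k] by auto

lemma tens_zero:
  "y \<in> carrier U \<Longrightarrow> tens \<zero>\<^bsub>U\<^esub> y = \<zero>\<^bsub>W\<^esub>" "x \<in> carrier U \<Longrightarrow> tens x \<zero>\<^bsub>U\<^esub> = \<zero>\<^bsub>W\<^esub>"
  using linear_zero[OF tens_left M.abelian_group_axioms W.M.abelian_group_axioms]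
    linear_zero[OF tens_right M.abelian_group_axioms W.M.abelian_group_axioms] by auto

lemma square_ext:
  assumes "g \<in> linear_maps \<Z> W N" "h \<in> linear_maps \<Z> W N" "abelian_group N"
    and "\<And>x y. \<lbrakk>x \<in> carrier U; y \<in> carrier U\<rbrakk> \<Longrightarrow> g (tens x y) = h (tens x y)"
    and "z \<in> carrier W"
  shows "g z = h z"
proof (rule tpow_ext[OF assms(1-3) _ assms(5)])
  fix xs assume "length xs = 2" "set xs \<subseteq> carrier U"
  then show "g (tpure \<Z> U xs) = h (tpure \<Z> U xs)"
    using assms(4) by (auto simp: numeral_2_eq_2 length_Suc_conv)
qed

lemma bilinear_form:
  assumes N: "module \<Z> N"
    and cl: "\<And>x y. \<lbrakk>x \<in> carrier U; y \<in> carrier U\<rbrakk> \<Longrightarrow> h x y \<in> carrier N"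
    and 1: "\<And>x x' y. \<lbrakk>x \<in> carrier U; x' \<in> carrier U; y \<in> carrier U\<rbrakk> \<Longrightarrow>
      h (x \<oplus>\<^bsub>U\<^esub> x') y = h x y \<oplus>\<^bsub>N\<^esub> h x' y"
    and 2: "\<And>x y y'. \<lbrakk>x \<in> carrier U; y \<in> carrier U; y' \<in> carrier U\<rbrakk> \<Longrightarrow>
      h x (y \<oplus>\<^bsub>U\<^esub> y') = h x y \<oplus>\<^bsub>N\<^esub> h x y'"
  obtains g where "g \<in> linear_maps \<Z> W N" "\<And>x y. \<lbrakk>x \<in> carrier U; y \<in> carrier U\<rbrakk> \<Longrightarrow> g (tens x y) = h x y"
proof -
  note m = multilinear2I[OF module_axioms N cl 1 2]
  show ?thesis
  proof (rule that)
    show "lift \<Z> N (\<lambda>xs. h (xs ! 0) (xs ! 1)) \<in> linear_maps \<Z> W N"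
      by (rule tpow_lift_linear[OF N m])
    show "lift \<Z> N (\<lambda>xs. h (xs ! 0) (xs ! 1)) (tens x y) = h x y" if "x \<in> carrier U" "y \<in> carrier U" for x y
      using tpow_lift_tpure[OF N m, of "[x, y]"] that by simp
  qed
qed

definition annihilates :: "('u list \<Rightarrow> int) set \<Rightarrow> bool"
  where "annihilates w \<longleftrightarrow> w \<in> carrier W \<and>
    (\<forall>u\<in>carrier U. insert_map \<Z> U 3 [] [u] w = \<zero>\<^bsub>tpow \<Z> U 3\<^esub>)"

text \<open>A trilinear form factors through the tensor cube, so with its last argument fixed at
  \<open>z\<close> it is evaluated at \<open>w \<otimes> z\<close>, which is zero. The form
  \<open>g\<close> with \<open>z\<close> fixed is an argument of its own, because the applications
  already have it in closed form.\<close>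

lemma trilinear_form_vanishes:
  assumes w: "annihilates w" and z: "z \<in> carrier U" and N: "module \<Z> N"
    and cl: "\<And>x y z. \<lbrakk>x \<in> carrier U; y \<in> carrier U; z \<in> carrier U\<rbrakk> \<Longrightarrow> h x y z \<in> carrier N"
    and 1: "\<And>x x' y z. \<lbrakk>x \<in> carrier U; x' \<in> carrier U; y \<in> carrier U; z \<in> carrier U\<rbrakk> \<Longrightarrow>
      h (x \<oplus>\<^bsub>U\<^esub> x') y z = h x y z \<oplus>\<^bsub>N\<^esub> h x' y z"
    and 2: "\<And>x y y' z. \<lbrakk>x \<in> carrier U; y \<in> carrier U; y' \<in> carrier U; z \<in> carrier U\<rbrakk> \<Longrightarrow>
      h x (y \<oplus>\<^bsub>U\<^esub> y') z = h x y z \<oplus>\<^bsub>N\<^esub> h x y' z"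
    and 3: "\<And>x y z z'. \<lbrakk>x \<in> carrier U; y \<in> carrier U; z \<in> carrier U; z' \<in> carrier U\<rbrakk> \<Longrightarrow>
      h x y (z \<oplus>\<^bsub>U\<^esub> z') = h x y z \<oplus>\<^bsub>N\<^esub> h x y z'"
    and g: "g \<in> linear_maps \<Z> W N" "\<And>x y. \<lbrakk>x \<in> carrier U; y \<in> carrier U\<rbrakk> \<Longrightarrow> g (tens x y) = h x y z"
  shows "g w = \<zero>\<^bsub>N\<^esub>"
proof -
  note m = multilinear3I[OF module_axioms N cl 1 2 3]
  define G where "G = lift \<Z> N (\<lambda>xs. h (xs ! 0) (xs ! 1) (xs ! 2))"
  have G: "G \<in> linear_maps \<Z> (tpow \<Z> U 3) N"
    unfolding G_def by (rule tpow_lift_linear[OF N m])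
  have Gp: "G (tpure \<Z> U [x, y, z]) = h x y z" if "x \<in> carrier U" "y \<in> carrier U" for x y
    unfolding G_def using tpow_lift_tpure[OF N m, of "[x, y, z]"] that z by simp
  have I: "insert_map \<Z> U 3 [] [z] \<in> linear_maps \<Z> W (tpow \<Z> U 3)"
    using z by (intro insert_map_linear) auto
  have "g w = G (insert_map \<Z> U 3 [] [z] w)"
  proof (rule square_ext[OF g(1) linear_comp[OF I G] module.axioms(2)[OF N]])
    show "g (tens x y) = G (insert_map \<Z> U 3 [] [z] (tens x y))" if "x \<in> carrier U" "y \<in> carrier U" for x y
      using that z insert_map_tpure[of "[]" "[z]" 2 3 "[x, y]"] by (simp add: g(2) Gp)
    show "w \<in> carrier W"
      using w by (simp add: annihilates_def)
  qed
  also have "\<dots> = \<zero>\<^bsub>N\<^esub>"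
    using w z linear_zero[OF G abelian_tpow module.axioms(2)[OF N]] by (simp add: annihilates_def)
  finally show ?thesis .
qed

text \<open>A character separating \<open>w\<close> from \<open>H\<close> would be trivial on all
  pure tensors and hence everywhere.\<close>

lemma square_span:
  assumes H: "submodule H \<Z> W" and t: "\<And>x y. \<lbrakk>x \<in> carrier U; y \<in> carrier U\<rbrakk> \<Longrightarrow> tens x y \<in> H"
    and w: "w \<in> carrier W"
  shows "w \<in> H"
proof (rule ccontr)
  assume "w \<notin> H"
  then obtain f where f: "f \<in> linear_maps \<Z> W circle" "\<And>h. h \<in> H \<Longrightarrow> f h = 1" "f w \<noteq> 1"
    using W.character_separation[OF H w] by blast
  have "(\<lambda>x. 1) \<in> linear_maps \<Z> W circle"
    by (rule linear_mapsI) auto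
  from square_ext[OF f(1) this circle.M.abelian_group_axioms _ w] f t show False
    by auto
qed

end

section \<open>Torsion, primary elements and discrete logarithms of characters\<close>

definition torsion :: "(int, 'u) module \<Rightarrow> 'u set"
  where "torsion U = {x \<in> carrier U. \<exists>n>0. n \<odot>\<^bsub>U\<^esub> x = \<zero>\<^bsub>U\<^esub>}"

definition primary :: "(int, 'u) module \<Rightarrow> int \<Rightarrow> 'u set"
  where "primary U p = {x \<in> carrier U. \<exists>k. p ^ k \<odot>\<^bsub>U\<^esub> x = \<zero>\<^bsub>U\<^esub>}"

context int_module
begin

lemma int_submoduleI:
  assumes "H \<subseteq> carrier M" "\<zero> \<in> H" "\<And>a b. \<lbrakk>a \<in> H; b \<in> H\<rbrakk> \<Longrightarrow> a \<oplus> b \<in> H"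
    "\<And>k a. a \<in> H \<Longrightarrow> k \<odot> a \<in> H"
  shows "submodule H \<Z> M"
  by (rule submoduleI) (use assms assms(4)[of _ "- 1"] in \<open>auto simp: int_smult_neg_1\<close>)

lemma submodule_torsion: "submodule (torsion M) \<Z> M"
proof (rule int_submoduleI)
  show "\<zero> \<in> torsion M"
    by (auto simp: torsion_def intro: exI[of _ 1])
  show "a \<oplus> b \<in> torsion M" if ab: "a \<in> torsion M" "b \<in> torsion M" for a b
  proof -
    obtain m n where *: "m > 0" "m \<odot> a = \<zero>" "n > 0" "n \<odot> b = \<zero>" "a \<in> carrier M" "b \<in> carrier M"
      using ab by (auto simp: torsion_def)
    have "(m * n) \<odot> (a \<oplus> b) = n \<odot> (m \<odot> a) \<oplus> m \<odot> (n \<odot> b)"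
      using *(5,6) by (simp add: int_smult_right int_smult_assoc int_smult_commute[of a n m])
    then show ?thesis
      using * by (auto simp: torsion_def intro!: exI[of _ "m * n"])
  qed
  show "k \<odot> a \<in> torsion M" if "a \<in> torsion M" for k a
    using that by (auto simp: torsion_def int_smult_commute[of a _ k])
qed (auto simp: torsion_def)

lemma submodule_primary: "submodule (primary M p) \<Z> M"
proof (rule int_submoduleI)
  show "\<zero> \<in> primary M p"
    by (auto simp: primary_def)
  show "a \<oplus> b \<in> primary M p" if ab: "a \<in> primary M p" "b \<in> primary M p" for a b
  proof -
    obtain k l where *: "p ^ k \<odot> a = \<zero>" "p ^ l \<odot> b = \<zero>" "a \<in> carrier M" "b \<in> carrier M"
      using ab by (auto simp: primary_def)
    have "p ^ (k + l) \<odot> (a \<oplus> b) = p ^ l \<odot> (p ^ k \<odot> a) \<oplus> p ^ k \<odot> (p ^ l \<odot> b)"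
      using *(3,4) by (simp add: power_add int_smult_right int_smult_assoc int_smult_commute[of a "p ^ l"])
    then have "p ^ (k + l) \<odot> (a \<oplus> b) = \<zero>"
      using * by simp
    then show ?thesis
      using * unfolding primary_def by blast
  qed
  show "k \<odot> a \<in> primary M p" if a: "a \<in> primary M p" for k a
  proof -
    obtain l where "p ^ l \<odot> a = \<zero>" "a \<in> carrier M"
      using a by (auto simp: primary_def)
    then show ?thesis
      using int_smult_commute[of a "p ^ l" k] by (auto simp: primary_def)
  qed
qed (auto simp: primary_def)

lemma torsion_divisor:
  assumes "x \<in> carrier M" "n > 0" "n \<odot> x \<in> torsion M"
  shows "x \<in> torsion M"
proof -
  obtain m where "m > 0" "m \<odot> (n \<odot> x) = \<zero>"
    using assms(3) by (auto simp: torsion_def)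
  then have "m * n > 0" "(m * n) \<odot> x = \<zero>"
    using assms by (simp_all add: int_smult_assoc)
  then show ?thesis
    using assms(1) unfolding torsion_def by blast
qed

lemma primary_divisor:
  assumes "x \<in> carrier M" "p \<odot> x \<in> primary M p"
  shows "x \<in> primary M p"
proof -
  obtain k where "p ^ k \<odot> (p \<odot> x) = \<zero>"
    using assms(2) by (auto simp: primary_def)
  then have "p ^ Suc k \<odot> x = \<zero>"
    using assms(1) by (simp add: int_smult_assoc int_smult_commute[of x p])
  then show ?thesis
    using assms(1) unfolding primary_def by blast
qed

text \<open>Write an annihilator of \<open>x\<close> as a power of \<open>p\<close> times
  \<open>m\<close> with \<open>m\<close> prime to \<open>p\<close>. In
  \<open>b * m + c * p ^ k = 1\<close> the first summand takes \<open>x\<close> to a primary element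
  and the second to a multiple of \<open>p ^ k\<close>.\<close>

lemma bezout_primary:
  assumes "prime p" "x \<in> torsion M"
  shows "\<exists>t\<in>primary M p. \<exists>y\<in>carrier M. x = t \<oplus> p ^ k \<odot> y"
proof -
  obtain n where n: "n > 0" "n \<odot> x = \<zero>" and x: "x \<in> carrier M"
    using assms(2) by (auto simp: torsion_def)
  obtain m where m: "n = p ^ multiplicity p n * m" "\<not> p dvd m"
  proof (rule multiplicity_decompose'[of n p])
    show "\<not> is_unit p"
      using assms(1) not_prime_unit by blast
  qed (use n(1) in auto)
  have "coprime m p"
    using prime_imp_coprime[OF assms(1) m(2)] by (simp add: coprime_commute)
  then have "coprime m (p ^ k)"
    by simp
  then obtain b c where "b * m + c * p ^ k = 1"
    using bezout_int[of m "p ^ k"] by auto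
  then have "x = (b * m + c * p ^ k) \<odot> x"
    using x by simp
  also have "\<dots> = (b * m) \<odot> x \<oplus> p ^ k \<odot> (c \<odot> x)"
    using x by (simp add: int_smult_left int_smult_assoc[symmetric] mult.commute)
  finally have "x = (b * m) \<odot> x \<oplus> p ^ k \<odot> (c \<odot> x)" .
  moreover have "p ^ multiplicity p n \<odot> ((b * m) \<odot> x) = b \<odot> (n \<odot> x)"
    using x by (subst m(1)) (simp add: int_smult_assoc[symmetric] mult_ac)
  then have "(b * m) \<odot> x \<in> primary M p"
    using n x by (auto simp: primary_def)
  ultimately show ?thesis
    using x by (intro bexI[of _ "(b * m) \<odot> x"] bexI[of _ "c \<odot> x"]) auto
qed

text \<open>A character of exponent \<open>q\<close> has values in the q-th roots of unity, that is
  in Z/q. The integers \<open>e x\<close> are chosen lifts, so \<open>e\<close> is additive only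
  modulo \<open>q\<close>.\<close>

lemma character_logarithm:
  assumes f: "f \<in> linear_maps \<Z> M circle" and q: "q > 0" "\<And>x. x \<in> carrier M \<Longrightarrow> f x ^ q = 1"
  obtains e where "\<And>x. x \<in> carrier M \<Longrightarrow> f x = root_of_unity q (e x)"
    "\<And>x y. \<lbrakk>x \<in> carrier M; y \<in> carrier M\<rbrakk> \<Longrightarrow> int q dvd e (x \<oplus> y) - (e x + e y)"
    "\<And>k x. x \<in> carrier M \<Longrightarrow> int q dvd e (k \<odot> x) - k * e x"
proof -
  have "\<forall>x\<in>carrier M. \<exists>k. f x = root_of_unity q k"
    using root_of_unity_exists[OF q(1)] q(2) by blast
  then obtain e where e: "\<And>x. x \<in> carrier M \<Longrightarrow> f x = root_of_unity q (e x)"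
    by metis
  have dvd: "int q dvd a - b" if "root_of_unity q a = root_of_unity q b" for a b
    using that root_of_unity_add[of q "a - b" b] root_of_unity_eq_1_iff[OF q(1), of "a - b"] by simp
  show ?thesis
  proof (rule that[OF e])
    show "int q dvd e (x \<oplus> y) - (e x + e y)" if "x \<in> carrier M" "y \<in> carrier M" for x y
      using that linear_add[OF f that] by (intro dvd) (simp add: e root_of_unity_add)
    show "int q dvd e (k \<odot> x) - k * e x" if "x \<in> carrier M" for k x
      using that linear_smult[OF f that, of k] by (intro dvd) (simp add: e root_of_unity_powi)
  qed
qed

end

lemma powi_eq_if_dvd:
  assumes "z \<noteq> (0::complex)" "z ^ q = 1" "int q dvd a - b"
  shows "z powi a = z powi b"
proof -
  obtain c where "a - b = int q * c"
    using assms(3) by (rule dvdE)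
  then have "a = b + int q * c"
    by simp
  then show ?thesis
    using assms(1,2) by (simp add: power_int_add power_int_mult)
qed

section \<open>Annihilating elements: torsion, and divisibility modulo torsion\<close>

context tensor_square
begin

lemma annihilates_smult:
  assumes "annihilates w"
  shows "annihilates (k \<odot>\<^bsub>W\<^esub> w)"
proof -
  interpret T3: int_module "tpow \<Z> U 3"
    by (rule int_module.intro) (rule module_tpow)
  have wW: "w \<in> carrier W"
    using assms by (simp add: annihilates_def)
  have "insert_map \<Z> U 3 [] [u] (k \<odot>\<^bsub>W\<^esub> w) = \<zero>\<^bsub>tpow \<Z> U 3\<^esub>" if u: "u \<in> carrier U" for u
  proof -
    have "insert_map \<Z> U 3 [] [u] \<in> linear_maps \<Z> W (tpow \<Z> U 3)"
      using u by (intro insert_map_linear) auto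
    from linear_smult[OF this wW, of k] show ?thesis
      using assms u by (simp add: annihilates_def)
  qed
  then show ?thesis
    using wW by (simp add: annihilates_def)
qed

text \<open>By \<open>compat\<close> the assignment \<open>w \<mapsto> f\<close> is consistent on
  the cyclic group of \<open>w\<close>. Since \<open>U\<close> modulo torsion is torsion-free, its
  character group is divisible and the assignment extends to a homomorphism \<open>c\<close> on
  \<open>U \<otimes> U\<close>. The trilinear form \<open>c (x \<otimes> y) z\<close> then vanishes
  at \<open>w\<close>, where it has the value \<open>f z\<close>.\<close>

lemma annihilates_character:
  assumes w: "annihilates w" and f: "f \<in> carrier (hom_module U (torsion U))"
    and compat: "\<And>n x. \<lbrakk>n \<odot>\<^bsub>W\<^esub> w = \<zero>\<^bsub>W\<^esub>; x \<in> carrier U\<rbrakk> \<Longrightarrow> f x powi n = 1"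
    and z: "z \<in> carrier U"
  shows "f z = 1"
proof -
  interpret C: char_module U "torsion U"
    by (intro char_module.intro char_module_axioms.intro submodule_torsion int_module_axioms)
  let ?X = "hom_module U (torsion U)"
  interpret E: hom_extension W ?X ..
  have wW: "w \<in> carrier W"
    using w by (simp add: annihilates_def)
  have n0: "n \<odot>\<^bsub>?X\<^esub> f = \<zero>\<^bsub>?X\<^esub>" if "n \<odot>\<^bsub>W\<^esub> w = \<zero>\<^bsub>W\<^esub>" for n
    by (rule C.char_eqI[OF C.hom_module_closed(2)[OF f f] C.hom_module_zero_closed])
      (simp add: hom_module_simps(2,4) compat[OF that])
  define r where "r = {(k \<odot>\<^bsub>W\<^esub> w, k \<odot>\<^bsub>?X\<^esub> f) | k. True}"
  have rI: "(k \<odot>\<^bsub>W\<^esub> w, k \<odot>\<^bsub>?X\<^esub> f) \<in> r" for k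
    by (auto simp: r_def)
  have r: "partial_linear W ?X r"
    unfolding partial_linear_def
  proof (intro conjI allI impI)
    show "r \<subseteq> carrier W \<times> carrier ?X"
      using wW f by (auto simp: r_def)
    show "(\<zero>\<^bsub>W\<^esub>, \<zero>\<^bsub>?X\<^esub>) \<in> r"
      using rI[of 0] wW f by simp
    show "(a \<oplus>\<^bsub>W\<^esub> c, b \<oplus>\<^bsub>?X\<^esub> d) \<in> r" if abcd: "(a, b) \<in> r" "(c, d) \<in> r" for a b c d
    proof -
      obtain k l where "a = k \<odot>\<^bsub>W\<^esub> w" "b = k \<odot>\<^bsub>?X\<^esub> f" "c = l \<odot>\<^bsub>W\<^esub> w" "d = l \<odot>\<^bsub>?X\<^esub> f"
        using abcd by (auto simp: r_def)
      then show ?thesis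
        using rI[of "k + l"] wW f by (simp add: W.int_smult_left C.X.int_smult_left)
    qed
    show "(k \<odot>\<^bsub>W\<^esub> a, k \<odot>\<^bsub>?X\<^esub> b) \<in> r" if ab: "(a, b) \<in> r" for k a b
    proof -
      obtain l where "a = l \<odot>\<^bsub>W\<^esub> w" "b = l \<odot>\<^bsub>?X\<^esub> f"
        using ab by (auto simp: r_def)
      then show ?thesis
        using rI[of "k * l"] wW f by (simp add: W.int_smult_assoc C.X.int_smult_assoc)
    qed
    show "b = \<zero>\<^bsub>?X\<^esub>" if "(\<zero>\<^bsub>W\<^esub>, b) \<in> r" for b
      using that n0 by (auto simp: r_def)
  qed
  obtain c where c: "c \<in> linear_maps \<Z> W ?X" "\<And>a b. (a, b) \<in> r \<Longrightarrow> c a = b"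
  proof (rule E.partial_linear_extend[OF r, of 0])
    show "\<exists>b. (0 \<odot>\<^bsub>W\<^esub> g, b) \<in> r" if "g \<in> carrier W" for g
      using rI[of 0] wW that by auto
    show "\<exists>y'\<in>carrier ?X. n \<odot>\<^bsub>?X\<^esub> y' = y" if "n > 0" "n dvd 0" "y \<in> carrier ?X" for n y
      by (rule C.hom_module_divisible[OF that(1) torsion_divisor that(3)]) (use that(1) in auto)
  qed blast
  note cX = linear_closed[OF c(1)]
  have "c w z = \<zero>\<^bsub>circle\<^esub>"
  proof (rule trilinear_form_vanishes[OF w z circle.module_axioms, where h = "\<lambda>x y z. c (tens x y) z"])
    show "(\<lambda>v. c v z) \<in> linear_maps \<Z> W circle"
      by (rule linear_mapsI)
        (use z C.char_nonzero[OF cX] linear_add[OF c(1)] linear_smult[OF c(1)] in \<open>auto simp: hom_module_simps(3,4)\<close>)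
  qed (use C.char_nonzero[OF cX] linear_add[OF c(1)] C.char_add[OF cX] in
      \<open>auto simp: tens_add hom_module_simps(3)\<close>)
  moreover have "c w = f"
    using c(2)[OF rI[of 1]] wW f by simp
  ultimately show ?thesis
    by simp
qed

lemma torsion_square: "torsion U = carrier U \<Longrightarrow> torsion W = carrier W"
proof
  assume U: "torsion U = carrier U"
  show "carrier W \<subseteq> torsion W"
  proof
    fix w assume w: "w \<in> carrier W"
    show "w \<in> torsion W"
    proof (rule square_span[OF W.submodule_torsion _ w])
      fix x y assume xy: "x \<in> carrier U" "y \<in> carrier U"
      then obtain n where "n > 0" "n \<odot>\<^bsub>U\<^esub> x = \<zero>\<^bsub>U\<^esub>"
        using U by (auto simp: torsion_def)
      then have "n \<odot>\<^bsub>W\<^esub> tens x y = \<zero>\<^bsub>W\<^esub>"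
        using tens_smult(1)[OF xy, of n] tens_zero(1)[OF xy(2)] by simp
      then show "tens x y \<in> torsion W"
        using \<open>n > 0\<close> xy by (auto simp: torsion_def)
    qed
  qed
qed (auto simp: torsion_def)

text \<open>If \<open>w\<close> had infinite order, every character of \<open>U\<close> modulo
  torsion could be assigned to it and would be trivial. Then \<open>U\<close> would be torsion, and
  \<open>U \<otimes> U\<close> with it.\<close>

lemma annihilates_torsion:
  assumes w: "annihilates w"
  shows "w \<in> torsion W"
proof (rule ccontr)
  interpret C: char_module U "torsion U"
    by (intro char_module.intro char_module_axioms.intro submodule_torsion int_module_axioms)
  assume nt: "w \<notin> torsion W"
  have wW: "w \<in> carrier W"
    using w by (simp add: annihilates_def)
  have n0: "n = 0" if "n \<odot>\<^bsub>W\<^esub> w = \<zero>\<^bsub>W\<^esub>" for n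
  proof (rule ccontr)
    assume "n \<noteq> 0"
    have "\<bar>n\<bar> \<odot>\<^bsub>W\<^esub> w = \<zero>\<^bsub>W\<^esub>"
      using that wW by (simp add: abs_if W.int_smult_minus)
    then show False
      using nt wW \<open>n \<noteq> 0\<close> by (auto simp: torsion_def)
  qed
  have "carrier U \<subseteq> torsion U"
  proof (rule ccontr)
    assume "\<not> carrier U \<subseteq> torsion U"
    then obtain g where g: "g \<in> carrier U" "g \<notin> torsion U"
      by blast
    obtain f where f: "f \<in> linear_maps \<Z> U circle" "\<And>h. h \<in> torsion U \<Longrightarrow> f h = 1" "f g \<noteq> 1"
      using character_separation[OF submodule_torsion g] by blast
    have "restrict f (carrier U) g = 1"
      by (rule annihilates_character[OF w C.hom_moduleI[OF f(1,2)] _ g(1)]) (auto dest: n0)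
    with f(3) g(1) show False
      by simp
  qed
  then have "torsion U = carrier U"
    by (auto simp: torsion_def)
  with torsion_square nt wW show False
    by simp
qed

text \<open>A character that kills torsion and all multiples of \<open>p\<close> has exponent
  \<open>p\<close>, so it can be assigned to \<open>w\<close> of order \<open>p\<close> and is
  trivial. Hence torsion and the multiples of \<open>p\<close> together exhaust
  \<open>U\<close>.\<close>

lemma annihilates_divisible:
  assumes w: "annihilates w" "w \<noteq> \<zero>\<^bsub>W\<^esub>" and p: "prime p" "p \<odot>\<^bsub>W\<^esub> w = \<zero>\<^bsub>W\<^esub>" and x: "x \<in> carrier U"
  shows "\<exists>t\<in>torsion U. \<exists>y\<in>carrier U. x = t \<oplus>\<^bsub>U\<^esub> p \<odot>\<^bsub>U\<^esub> y"
proof (rule ccontr)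
  interpret C: char_module U "torsion U"
    by (intro char_module.intro char_module_axioms.intro submodule_torsion int_module_axioms)
  assume no: "\<not> ?thesis"
  have wW: "w \<in> carrier W"
    using w by (simp add: annihilates_def)
  note TE = submoduleE[OF submodule_torsion]
  have z: "\<zero>\<^bsub>U\<^esub> \<in> torsion U"
    by (auto simp: torsion_def intro: exI[of _ 1])
  have tc: "t \<in> carrier U" if "t \<in> torsion U" for t
    using that by (simp add: torsion_def)
  let ?H = "{t \<oplus>\<^bsub>U\<^esub> p \<odot>\<^bsub>U\<^esub> y | t y. t \<in> torsion U \<and> y \<in> carrier U}"
  have HI: "t \<oplus>\<^bsub>U\<^esub> p \<odot>\<^bsub>U\<^esub> y \<in> ?H" if "t \<in> torsion U" "y \<in> carrier U" for t y
    using that by blast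
  have H: "submodule ?H \<Z> U"
  proof (rule int_submoduleI)
    show "?H \<subseteq> carrier U"
      using tc by auto
    show "\<zero>\<^bsub>U\<^esub> \<in> ?H"
      using HI[OF z M.zero_closed] by simp
  next
    fix a b assume "a \<in> ?H" "b \<in> ?H"
    then obtain t y t' y' where *: "a = t \<oplus>\<^bsub>U\<^esub> p \<odot>\<^bsub>U\<^esub> y" "b = t' \<oplus>\<^bsub>U\<^esub> p \<odot>\<^bsub>U\<^esub> y'"
      "t \<in> torsion U" "y \<in> carrier U" "t' \<in> torsion U" "y' \<in> carrier U"
      by blast
    then have "a \<oplus>\<^bsub>U\<^esub> b = (t \<oplus>\<^bsub>U\<^esub> t') \<oplus>\<^bsub>U\<^esub> p \<odot>\<^bsub>U\<^esub> (y \<oplus>\<^bsub>U\<^esub> y')"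
      using tc by (simp add: int_smult_right M.add.m_ac)
    then show "a \<oplus>\<^bsub>U\<^esub> b \<in> ?H"
      using HI[OF TE(5)[OF *(3,5)] M.a_closed[OF *(4,6)]] by simp
  next
    fix k a assume "a \<in> ?H"
    then obtain t y where *: "a = t \<oplus>\<^bsub>U\<^esub> p \<odot>\<^bsub>U\<^esub> y" "t \<in> torsion U" "y \<in> carrier U"
      by blast
    then have "k \<odot>\<^bsub>U\<^esub> a = k \<odot>\<^bsub>U\<^esub> t \<oplus>\<^bsub>U\<^esub> p \<odot>\<^bsub>U\<^esub> (k \<odot>\<^bsub>U\<^esub> y)"
      using tc by (simp add: int_smult_right int_smult_commute[of y k p])
    then show "k \<odot>\<^bsub>U\<^esub> a \<in> ?H"
      using HI[OF TE(4)[of k, OF _ *(2)] int_smult_closed[OF *(3), of k]] by simp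
  qed
  have "x \<notin> ?H"
    using no by blast
  then obtain f where f: "f \<in> linear_maps \<Z> U circle" "\<And>h. h \<in> ?H \<Longrightarrow> f h = 1" "f x \<noteq> 1"
    using character_separation[OF H x] by blast
  have ft: "f t = 1" if "t \<in> torsion U" for t
    using f(2)[OF HI[OF that M.zero_closed]] tc[OF that] by simp
  have fp: "f y powi p = 1" if "y \<in> carrier U" for y
    using f(2)[OF HI[OF z that]] linear_smult[OF f(1) that, of p] that by simp
  have "restrict f (carrier U) x = 1"
  proof (rule annihilates_character[OF w(1) C.hom_moduleI[OF f(1) ft] _ x])
    fix n y assume n: "n \<odot>\<^bsub>W\<^esub> w = \<zero>\<^bsub>W\<^esub>" and y: "y \<in> carrier U"
    \<comment> \<open>The integers that kill \<open>w\<close> are multiples of \<open>p\<close>: one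
      prime to \<open>p\<close> would kill \<open>w\<close> together with \<open>p\<close> and give
      \<open>w = 0\<close>.\<close>
    have "p dvd n"
    proof (rule ccontr)
      assume "\<not> p dvd n"
      then have "coprime n p"
        using prime_imp_coprime[OF p(1)] by (simp add: coprime_commute)
      then obtain b c where "b * n + c * p = 1"
        using bezout_int[of n p] by auto
      then have "w = (b * n + c * p) \<odot>\<^bsub>W\<^esub> w"
        using wW by simp
      then show False
        using w(2) wW n p(2) by (simp add: W.int_smult_left W.int_smult_assoc)
    qed
    then obtain c where "n = p * c"
      by (rule dvdE)
    then show "restrict f (carrier U) y powi n = 1"
      using fp[OF y] y by (simp add: power_int_mult)
  qed
  with f(3) x show False
    by simp
qed

text \<open>Iterating the decomposition yields a torsion element plus a multiple of
  \<open>p ^ k\<close>; the part of the torsion element prime to \<open>p\<close> is itself a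
  multiple of \<open>p ^ k\<close> and is absorbed.\<close>

lemma annihilates_primary_divisible:
  assumes w: "annihilates w" "w \<noteq> \<zero>\<^bsub>W\<^esub>" and p: "prime p" "p \<odot>\<^bsub>W\<^esub> w = \<zero>\<^bsub>W\<^esub>" and x: "x \<in> carrier U"
  shows "\<exists>t\<in>primary U p. \<exists>y\<in>carrier U. x = t \<oplus>\<^bsub>U\<^esub> p ^ k \<odot>\<^bsub>U\<^esub> y"
proof -
  have tc: "t \<in> carrier U" if "t \<in> torsion U" for t
    using that by (simp add: torsion_def)
  note TE = submoduleE[OF submodule_torsion]
  have "\<exists>t\<in>torsion U. \<exists>y\<in>carrier U. x = t \<oplus>\<^bsub>U\<^esub> p ^ k \<odot>\<^bsub>U\<^esub> y" if "x \<in> carrier U" for x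
    using that
  proof (induction k arbitrary: x)
    case 0
    then show ?case
      by (intro bexI[of _ "\<zero>\<^bsub>U\<^esub>"] bexI[of _ x]) (auto simp: torsion_def intro: exI[of _ 1])
  next
    case (Suc k)
    obtain t y where *: "t \<in> torsion U" "y \<in> carrier U" "x = t \<oplus>\<^bsub>U\<^esub> p \<odot>\<^bsub>U\<^esub> y"
      using annihilates_divisible[OF w p Suc.prems] by blast
    obtain t' y' where **: "t' \<in> torsion U" "y' \<in> carrier U" "y = t' \<oplus>\<^bsub>U\<^esub> p ^ k \<odot>\<^bsub>U\<^esub> y'"
      using Suc.IH[OF *(2)] by blast
    have "x = (t \<oplus>\<^bsub>U\<^esub> p \<odot>\<^bsub>U\<^esub> t') \<oplus>\<^bsub>U\<^esub> p ^ Suc k \<odot>\<^bsub>U\<^esub> y'"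
      using * ** tc by (simp add: int_smult_right int_smult_assoc M.a_assoc)
    moreover have "t \<oplus>\<^bsub>U\<^esub> p \<odot>\<^bsub>U\<^esub> t' \<in> torsion U"
      using TE(5)[OF *(1) TE(4)[of p, OF _ **(1)]] by simp
    ultimately show ?case
      using **(2) by blast
  qed
  then obtain t y where *: "t \<in> torsion U" "y \<in> carrier U" "x = t \<oplus>\<^bsub>U\<^esub> p ^ k \<odot>\<^bsub>U\<^esub> y"
    using x by blast
  obtain t' y' where **: "t' \<in> primary U p" "y' \<in> carrier U" "t = t' \<oplus>\<^bsub>U\<^esub> p ^ k \<odot>\<^bsub>U\<^esub> y'"
    using bezout_primary[OF p(1) *(1), of k] by blast
  have "x = t' \<oplus>\<^bsub>U\<^esub> p ^ k \<odot>\<^bsub>U\<^esub> (y' \<oplus>\<^bsub>U\<^esub> y)"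
    using * ** by (simp add: int_smult_right M.a_assoc primary_def)
  then show ?thesis
    using ** *(2) by blast
qed

text \<open>With \<open>T\<close> the primary part, the tensor square of U/T has no elements killed
  by \<open>p\<close>. Dually: a character \<open>b\<close> of \<open>U \<otimes> U\<close> that is
  trivial on \<open>H\<close> is a bilinear form on U/T, this form is the p-th power of another form
  \<open>g\<close>, and so \<open>b w\<close> is the value of \<open>g\<close> at
  \<open>p \<odot> w = 0\<close>.\<close>

lemma prime_order_span:
  assumes H: "submodule H \<Z> W" and p: "p > 0"
    and t: "\<And>x y. \<lbrakk>x \<in> carrier U; y \<in> carrier U; x \<in> primary U p \<or> y \<in> primary U p\<rbrakk> \<Longrightarrow> tens x y \<in> H"
    and w: "w \<in> carrier W" "p \<odot>\<^bsub>W\<^esub> w = \<zero>\<^bsub>W\<^esub>"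
  shows "w \<in> H"
proof (rule ccontr)
  assume "w \<notin> H"
  then obtain b where b: "b \<in> linear_maps \<Z> W circle" "\<And>h. h \<in> H \<Longrightarrow> b h = 1" "b w \<noteq> 1"
    using W.character_separation[OF H w(1)] by blast
  let ?T = "primary U p"
  interpret C: char_module U ?T
    by (intro char_module.intro char_module_axioms.intro submodule_primary int_module_axioms)
  let ?X = "hom_module U ?T"
  interpret E: hom_extension U ?X ..
  note TE = submoduleE[OF submodule_primary[of p]]
  have zT: "\<zero>\<^bsub>U\<^esub> \<in> ?T"
    by (auto simp: primary_def)
  define \<beta> where "\<beta> x = (\<lambda>y\<in>carrier U. b (tens x y))" for x
  have bX: "\<beta> x \<in> carrier ?X" if "x \<in> carrier U" for x
    unfolding \<beta>_def
    by (rule C.hom_moduleI[OF linear_comp[OF tens_right[OF that] b(1)]])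
      (use that C.T_subset in \<open>auto intro!: b(2) t\<close>)
  have b_add: "\<beta> (x \<oplus>\<^bsub>U\<^esub> x') = \<beta> x \<oplus>\<^bsub>?X\<^esub> \<beta> x'" if "x \<in> carrier U" "x' \<in> carrier U" for x x'
    by (rule C.char_eqI[OF bX C.hom_module_closed(1)[OF bX bX]])
      (use that in \<open>auto simp: \<beta>_def hom_module_simps(3) tens_add linear_add[OF b(1)]\<close>)
  have b_smult: "\<beta> (k \<odot>\<^bsub>U\<^esub> x) = k \<odot>\<^bsub>?X\<^esub> \<beta> x" if x: "x \<in> carrier U" for k x
    by (rule C.char_eqI[OF bX C.hom_module_closed(2)[OF bX[OF x] bX[OF x]]])
      (use x linear_smult[OF b(1) tens_closed[OF x], of _ k] in \<open>auto simp: \<beta>_def hom_module_simps(4) tens_smult\<close>)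
  have b_triv: "\<beta> x = \<zero>\<^bsub>?X\<^esub>" if x: "x \<in> ?T" for x
    by (rule C.char_eqI[OF bX[OF C.T_subset[OF x]] C.X.M.zero_closed])
      (use x C.T_subset in \<open>auto simp: \<beta>_def hom_module_simps(2) intro!: b(2) t\<close>)
  \<comment> \<open>The graph of \<open>p \<odot> x + s \<mapsto> \<beta> x\<close> on pU + T. An
    extension of it to \<open>U\<close> is a p-th root of \<open>\<beta>\<close>.\<close>
  define r where "r = {(p \<odot>\<^bsub>U\<^esub> x \<oplus>\<^bsub>U\<^esub> s, \<beta> x) | x s. x \<in> carrier U \<and> s \<in> ?T}"
  have rI: "(p \<odot>\<^bsub>U\<^esub> x \<oplus>\<^bsub>U\<^esub> s, \<beta> x) \<in> r" if "x \<in> carrier U" "s \<in> ?T" for x s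
    using that by (auto simp: r_def)
  have r: "partial_linear U ?X r"
    unfolding partial_linear_def
  proof (intro conjI allI impI)
    show "r \<subseteq> carrier U \<times> carrier ?X"
      using C.T_subset bX by (auto simp: r_def)
    show "(\<zero>\<^bsub>U\<^esub>, \<zero>\<^bsub>?X\<^esub>) \<in> r"
      using rI[OF M.zero_closed zT] b_triv[OF zT] by simp
  next
    fix a b' c d assume "(a, b') \<in> r" "(c, d) \<in> r"
    then obtain x s x' s' where *: "a = p \<odot>\<^bsub>U\<^esub> x \<oplus>\<^bsub>U\<^esub> s" "b' = \<beta> x" "c = p \<odot>\<^bsub>U\<^esub> x' \<oplus>\<^bsub>U\<^esub> s'" "d = \<beta> x'"
      "x \<in> carrier U" "x' \<in> carrier U" "s \<in> ?T" "s' \<in> ?T"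
      by (auto simp: r_def)
    have "a \<oplus>\<^bsub>U\<^esub> c = p \<odot>\<^bsub>U\<^esub> (x \<oplus>\<^bsub>U\<^esub> x') \<oplus>\<^bsub>U\<^esub> (s \<oplus>\<^bsub>U\<^esub> s')"
      using * C.T_subset by (simp add: int_smult_right M.add.m_ac)
    then show "(a \<oplus>\<^bsub>U\<^esub> c, b' \<oplus>\<^bsub>?X\<^esub> d) \<in> r"
      using rI[OF M.a_closed[OF *(5,6)] TE(5)[OF *(7,8)]] * by (simp add: b_add)
  next
    fix k a b' assume "(a, b') \<in> r"
    then obtain x s where *: "a = p \<odot>\<^bsub>U\<^esub> x \<oplus>\<^bsub>U\<^esub> s" "b' = \<beta> x" "x \<in> carrier U" "s \<in> ?T"
      by (auto simp: r_def)
    then show "(k \<odot>\<^bsub>U\<^esub> a, k \<odot>\<^bsub>?X\<^esub> b') \<in> r"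
      using rI[OF int_smult_closed[OF *(3), of k] TE(4)[of k, OF _ *(4)]] C.T_subset
      by (simp add: b_smult int_smult_right int_smult_commute[of x k p])
  next
    fix b' assume "(\<zero>\<^bsub>U\<^esub>, b') \<in> r"
    then obtain x s where *: "\<zero>\<^bsub>U\<^esub> = p \<odot>\<^bsub>U\<^esub> x \<oplus>\<^bsub>U\<^esub> s" "b' = \<beta> x" "x \<in> carrier U" "s \<in> ?T"
      by (auto simp: r_def)
    have "p \<odot>\<^bsub>U\<^esub> x = \<ominus>\<^bsub>U\<^esub> s"
      using * C.T_subset by (intro M.minus_equality[symmetric]) auto
    then have "p \<odot>\<^bsub>U\<^esub> x \<in> ?T"
      using TE(3)[OF *(4)] by simp
    then show "b' = \<zero>\<^bsub>?X\<^esub>"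
      using primary_divisor[OF *(3)] b_triv *(2) by simp
  qed
  \<comment> \<open>U/T may have torsion prime to \<open>p\<close>, so its characters need not be
    divisible by all integers. As \<open>r\<close> is defined on all multiples of \<open>p\<close>,
    the extension with \<open>e = p\<close> requires only the divisors of \<open>p\<close>.\<close>
  have div: "\<exists>y'\<in>carrier ?X. n \<odot>\<^bsub>?X\<^esub> y' = y" if n: "n > 0" "n dvd p" "y \<in> carrier ?X" for n y
  proof (rule C.hom_module_divisible[OF n(1) _ n(3)])
    fix x assume x: "x \<in> carrier U" "n \<odot>\<^bsub>U\<^esub> x \<in> ?T"
    obtain m where "p = n * m"
      using n(2) by (rule dvdE)
    then have "p \<odot>\<^bsub>U\<^esub> x \<in> ?T"
      using TE(4)[of m, OF _ x(2)] x(1) by (simp add: int_smult_assoc int_smult_commute[of x n m])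
    then show "x \<in> ?T"
      by (rule primary_divisor[OF x(1)])
  qed
  obtain c where c: "c \<in> linear_maps \<Z> U ?X" "\<And>x y. (x, y) \<in> r \<Longrightarrow> c x = y"
  proof (rule E.partial_linear_extend[OF r, of p])
    show "\<exists>b. (p \<odot>\<^bsub>U\<^esub> g, b) \<in> r" if "g \<in> carrier U" for g
      using rI[OF that zT] that by auto
  qed (use div in auto)
  note cX = linear_closed[OF c(1)]
  obtain g where g: "g \<in> linear_maps \<Z> W circle"
    "\<And>x y. \<lbrakk>x \<in> carrier U; y \<in> carrier U\<rbrakk> \<Longrightarrow> g (tens x y) = c x y"
    by (rule bilinear_form[OF circle.module_axioms, of "\<lambda>x y. c x y"])
      (use C.char_nonzero[OF cX] linear_add[OF c(1)] C.char_add[OF cX] in \<open>auto simp: hom_module_simps(3)\<close>)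
  have pl: "(\<lambda>v. p \<odot>\<^bsub>W\<^esub> v) \<in> linear_maps \<Z> W W"
    by (rule linear_maps_smult[OF linear_id _ W.module_axioms W.module_axioms]) simp
  have "b w = g (p \<odot>\<^bsub>W\<^esub> w)"
  proof (rule square_ext[OF b(1) linear_comp[OF pl g(1)] circle.M.abelian_group_axioms _ w(1)])
    fix x y assume xy: "x \<in> carrier U" "y \<in> carrier U"
    have "g (p \<odot>\<^bsub>W\<^esub> tens x y) = c (p \<odot>\<^bsub>U\<^esub> x) y"
      using xy by (simp add: tens_smult[symmetric] g(2))
    also have "c (p \<odot>\<^bsub>U\<^esub> x) = \<beta> x"
      using c(2)[OF rI[OF xy(1) zT]] xy(1) by simp
    finally show "b (tens x y) = g (p \<odot>\<^bsub>W\<^esub> tens x y)"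
      using xy by (simp add: \<beta>_def)
  qed
  also have "\<dots> = 1"
    using linear_zero[OF g(1) W.M.abelian_group_axioms circle.M.abelian_group_axioms] w(2) by simp
  finally show False
    using b(3) by simp
qed

end

section \<open>Forms with values in roots of unity of prime power order\<close>

context int_module
begin

lemma int_smult_cong:
  assumes "y \<in> carrier M" "q \<odot> y = \<zero>" "q dvd a - b"
  shows "a \<odot> y = b \<odot> y"
proof -
  obtain c where "a - b = q * c"
    using assms(3) by (rule dvdE)
  then have "a = c * q + b"
    by (simp add: mult.commute)
  then have "a \<odot> y = c \<odot> (q \<odot> y) \<oplus> b \<odot> y"
    using assms(1) by (simp add: int_smult_left int_smult_assoc)
  then show ?thesis
    using assms(1,2) by simp
qed

lemma submodule_multiples: "submodule ((\<lambda>y. q \<odot> y) ` carrier M) \<Z> M"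
proof (rule int_submoduleI)
  show "\<zero> \<in> (\<lambda>y. q \<odot> y) ` carrier M"
    by (rule image_eqI[of _ _ \<zero>]) simp_all
  show "a \<oplus> b \<in> (\<lambda>y. q \<odot> y) ` carrier M"
    if "a \<in> (\<lambda>y. q \<odot> y) ` carrier M" "b \<in> (\<lambda>y. q \<odot> y) ` carrier M" for a b
    using that by (auto simp: int_smult_right[symmetric])
  show "k \<odot> a \<in> (\<lambda>y. q \<odot> y) ` carrier M" if "a \<in> (\<lambda>y. q \<odot> y) ` carrier M" for k a
    using that by (auto simp: int_smult_commute[of _ k q])
qed auto

end

lemma coprime_root_eq_1:
  assumes "z \<noteq> (0::complex)" "z powi a = 1" "z powi b = 1" "coprime a b"
  shows "z = 1"
proof -
  obtain c d where "c * a + d * b = 1"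
    using bezout_int[of a b] assms(4) by auto
  then have "z = z powi (a * c + b * d)"
    by (simp add: mult.commute)
  also have "\<dots> = 1"
    using assms by (simp add: power_int_add power_int_mult)
  finally show ?thesis .
qed

context tensor_square
begin

text \<open>With the discrete logarithm \<open>e\<close> of a section \<open>z \<mapsto> g (z \<otimes> y\<^sub>0)\<close>, the function \<open>g (x \<otimes> y) powi e z\<close> is
  a trilinear form.\<close>

lemma bounded_form_vanishes:
  assumes w: "annihilates w" and p: "prime p" and g: "g \<in> linear_maps \<Z> W circle"
    and "\<And>v. v \<in> carrier W \<Longrightarrow> g v ^ (p ^ m) = 1"
  shows "g w = 1"
  using assms(4)
proof (induction m)
  case 0
  then show ?case
    using w by (simp add: annihilates_def)
next
  case (Suc m)
  have p0: "p > 0"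
    using p by (simp add: prime_gt_0_nat)
  \<comment> \<open>If all values have the smaller exponent, the induction hypothesis applies.
    Otherwise some value at a pure tensor \<open>x0 \<otimes> y0\<close> does not, and the section
    through \<open>y0\<close> has a logarithm whose value at \<open>x0\<close> is a unit modulo
    \<open>p\<close>.\<close>
  show ?case
  proof (cases "\<forall>v\<in>carrier W. g v ^ (p ^ m) = 1")
    case True
    then show ?thesis
      by (intro Suc.IH) blast
  next
    case False
    then obtain v where v: "v \<in> carrier W" "g v ^ (p ^ m) \<noteq> 1"
      by blast
    have "(\<lambda>v. g v ^ (p ^ m)) \<in> linear_maps \<Z> W circle"
      using linear_maps_smult[OF g _ W.module_axioms circle.module_axioms, of "int (p ^ m)"]
      by (simp del: of_nat_power)
    moreover have "(\<lambda>v. 1) \<in> linear_maps \<Z> W circle"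
      by (rule linear_mapsI) auto
    ultimately have "\<exists>x\<in>carrier U. \<exists>y\<in>carrier U. g (tens x y) ^ (p ^ m) \<noteq> 1"
      using square_ext[OF _ _ circle.M.abelian_group_axioms _ v(1)] v(2) by blast
    then obtain x0 y0 where xy: "x0 \<in> carrier U" "y0 \<in> carrier U" "g (tens x0 y0) ^ (p ^ m) \<noteq> 1"
      by blast
    define q where "q = p ^ Suc m"
    have q: "q > 0" "int q = int p ^ Suc m"
      using p0 by (simp_all add: q_def)
    have gq: "g v ^ q = 1" if "v \<in> carrier W" for v
      using Suc.prems[OF that] by (simp only: q_def)
    note gc = linear_closed[OF g, simplified]
    define f where "f z = g (tens z y0)" for z
    have f: "f \<in> linear_maps \<Z> U circle"
      unfolding f_def by (rule linear_comp[OF tens_left[OF xy(2)] g])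
    obtain e where e: "\<And>x. x \<in> carrier U \<Longrightarrow> f x = root_of_unity q (e x)"
      "\<And>x y. \<lbrakk>x \<in> carrier U; y \<in> carrier U\<rbrakk> \<Longrightarrow> int q dvd e (x \<oplus>\<^bsub>U\<^esub> y) - (e x + e y)"
    proof (rule character_logarithm[OF f q(1)])
      show "f x ^ q = 1" if "x \<in> carrier U" for x
        using gq[OF tens_closed[OF that xy(2)]] by (simp add: f_def)
    qed blast
    \<comment> \<open>The trilinear form is evaluated with its third argument at \<open>x0\<close>.
      Together with the exponent \<open>q\<close> this forces \<open>g w = 1\<close>, once
      \<open>e x0\<close> is prime to \<open>q\<close>.\<close>
    have "g w powi e x0 = \<zero>\<^bsub>circle\<^esub>"
    proof (rule trilinear_form_vanishes[OF w xy(1) circle.module_axioms, where h = "\<lambda>x y z. g (tens x y) powi e z"])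
      show "g (tens x y) powi e (z \<oplus>\<^bsub>U\<^esub> z') = g (tens x y) powi e z \<oplus>\<^bsub>circle\<^esub> g (tens x y) powi e z'"
        if "x \<in> carrier U" "y \<in> carrier U" "z \<in> carrier U" "z' \<in> carrier U" for x y z z'
        using powi_eq_if_dvd[OF gc gq e(2)[OF that(3,4)]] that gc by (simp add: power_int_add)
      show "(\<lambda>v. g v powi e x0) \<in> linear_maps \<Z> W circle"
        using linear_maps_smult[OF g _ W.module_axioms circle.module_axioms, of "e x0"] by simp
    qed (use gc linear_add[OF g] in \<open>auto simp: tens_add power_int_mult_distrib\<close>)
    \<comment> \<open>Otherwise the value at \<open>x0 \<otimes> y0\<close> would already have
      exponent \<open>p ^ m\<close>.\<close>
    moreover have "\<not> int p dvd e x0"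
    proof
      assume "int p dvd e x0"
      then obtain c where c: "e x0 = int p * c"
        by (rule dvdE)
      have "f x0 ^ (p ^ m) = f x0 powi int (p ^ m)"
        by (simp del: of_nat_power)
      also have "\<dots> = root_of_unity q (int (p ^ m) * e x0)"
        by (simp only: e(1)[OF xy(1)] root_of_unity_powi)
      also have "int (p ^ m) * e x0 = int q * c"
        by (simp add: c q_def)
      also have "root_of_unity q (int q * c) = 1"
        using root_of_unity_eq_1_iff[OF q(1)] by simp
      finally show False
        using xy(3) by (simp add: f_def)
    qed
    then have "coprime (int p) (e x0)"
      using p by (intro prime_imp_coprime) simp_all
    then have "coprime (e x0) (int q)"
      by (simp add: q(2) coprime_commute)
    moreover have wW: "w \<in> carrier W"
      using w by (simp add: annihilates_def)
    ultimately show ?thesis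
      using gq[OF wW] gc[OF wW] by (intro coprime_root_eq_1[of "g w" "e x0" "int q"]) simp_all
  qed
qed

section \<open>Reduction of sums of pure tensors of primary elements\<close>

primrec tensor_sum :: "(nat \<times> 'u \<times> 'u) list \<Rightarrow> ('u list \<Rightarrow> int) set" where
  "tensor_sum [] = \<zero>\<^bsub>W\<^esub>"
| "tensor_sum (a # as) = tens (fst (snd a)) (snd (snd a)) \<oplus>\<^bsub>W\<^esub> tensor_sum as"

text \<open>In a triple \<open>(k, x, y)\<close> the number \<open>k\<close> bounds the order of \<open>x\<close>.\<close>

definition primary_list :: "int \<Rightarrow> (nat \<times> 'u \<times> 'u) list \<Rightarrow> bool"
  where "primary_list p as \<longleftrightarrow>
    (\<forall>(k, x, y)\<in>set as. x \<in> carrier U \<and> y \<in> primary U p \<and> p ^ k \<odot>\<^bsub>U\<^esub> x = \<zero>\<^bsub>U\<^esub>)"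

lemma primary_carrier: "y \<in> primary U p \<Longrightarrow> y \<in> carrier U"
  by (simp add: primary_def)

lemma primary_list_simps [simp]:
  "primary_list p []"
  "primary_list p ((k, x, y) # as) \<longleftrightarrow>
    x \<in> carrier U \<and> y \<in> primary U p \<and> p ^ k \<odot>\<^bsub>U\<^esub> x = \<zero>\<^bsub>U\<^esub> \<and> primary_list p as"
  "primary_list p (as @ bs) \<longleftrightarrow> primary_list p as \<and> primary_list p bs"
  by (simp_all add: primary_list_def ball_Un)

lemma tensor_sum_closed: "primary_list p as \<Longrightarrow> tensor_sum as \<in> carrier W"
  by (induction as) (auto simp: primary_carrier)

lemma tensor_sum_append:
  "\<lbrakk>primary_list p as; primary_list p bs\<rbrakk> \<Longrightarrow> tensor_sum (as @ bs) = tensor_sum as \<oplus>\<^bsub>W\<^esub> tensor_sum bs"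
  by (induction as) (auto simp: primary_carrier tensor_sum_closed W.M.a_assoc)

lemma tensor_sum_trivial:
  assumes "primary_list p as" "\<And>a. a \<in> set as \<Longrightarrow> fst a = 0"
  shows "tensor_sum as = \<zero>\<^bsub>W\<^esub>"
  using assms
proof (induction as)
  case (Cons a as)
  obtain k x y where a: "a = (k, x, y)"
    by (cases a)
  have "k = 0"
    using Cons.prems(2)[of a] by (simp add: a)
  moreover have "tensor_sum as = \<zero>\<^bsub>W\<^esub>"
    using Cons.prems by (intro Cons.IH) (auto simp: a)
  moreover have "x = \<zero>\<^bsub>U\<^esub>" "y \<in> carrier U"
    using Cons.prems(1) \<open>k = 0\<close> by (auto simp: a primary_carrier)
  ultimately show ?case
    by (simp add: a tens_zero)
qed simp

text \<open>Each first factor splits as \<open>x = (x - e x \<odot> y) + e x \<odot> y\<close>. The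
  second parts all have \<open>y\<close> as first factor after the scalars are moved across, so they
  collect in the single tensor \<open>y \<otimes> V\<close>. The form with values
  \<open>f z powi e x\<close> on pure tensors detects this \<open>V\<close>.\<close>

lemma tensor_sum_eliminate:
  assumes p: "prime p" and as: "primary_list p as"
    and y: "y \<in> carrier U" "q \<odot>\<^bsub>U\<^esub> y = \<zero>\<^bsub>U\<^esub>"
    and e: "\<forall>k. \<forall>x\<in>carrier U. q dvd e (k \<odot>\<^bsub>U\<^esub> x) - k * e x"
  defines "shift \<equiv> \<lambda>(k, x, z). (k, x \<ominus>\<^bsub>U\<^esub> e x \<odot>\<^bsub>U\<^esub> y, z)"
    and "V \<equiv> foldr (\<lambda>(k, x, z) s. e x \<odot>\<^bsub>U\<^esub> z \<oplus>\<^bsub>U\<^esub> s) as \<zero>\<^bsub>U\<^esub>"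
  shows "primary_list p (map shift as)" "V \<in> carrier U"
    "tensor_sum as = tensor_sum (map shift as) \<oplus>\<^bsub>W\<^esub> tens y V"
    "\<And>f g. \<lbrakk>f \<in> linear_maps \<Z> U circle; g \<in> linear_maps \<Z> W circle;
      \<And>x z. \<lbrakk>x \<in> carrier U; z \<in> carrier U\<rbrakk> \<Longrightarrow> g (tens x z) = f z powi e x\<rbrakk> \<Longrightarrow> g (tensor_sum as) = f V"
proof -
  define V' where "V' as = foldr (\<lambda>(k, x, z) s. e x \<odot>\<^bsub>U\<^esub> z \<oplus>\<^bsub>U\<^esub> s) as \<zero>\<^bsub>U\<^esub>" for as :: "(nat \<times> 'u \<times> 'u) list"
  \<comment> \<open>The projection respects the recorded order bounds: if \<open>p ^ k\<close> kills
    \<open>x\<close>, then \<open>q\<close> divides \<open>p ^ k * e x\<close>, and \<open>q\<close>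
    kills \<open>y\<close>.\<close>
  have ord: "p ^ k \<odot>\<^bsub>U\<^esub> (x \<ominus>\<^bsub>U\<^esub> e x \<odot>\<^bsub>U\<^esub> y) = \<zero>\<^bsub>U\<^esub>" if x: "x \<in> carrier U" "p ^ k \<odot>\<^bsub>U\<^esub> x = \<zero>\<^bsub>U\<^esub>" for k x
  proof -
    have "q dvd e \<zero>\<^bsub>U\<^esub>"
      using e[rule_format, OF y(1), of 0] y(1) by simp
    then have "q dvd p ^ k * e x"
      using e[rule_format, OF x(1), of "p ^ k"] x(2) by (simp add: dvd_diff_right_iff)
    then have "(p ^ k * e x) \<odot>\<^bsub>U\<^esub> y = \<zero>\<^bsub>U\<^esub>"
      using int_smult_cong[OF y, of "p ^ k * e x" 0] y(1) by simp
    moreover have "p ^ k \<odot>\<^bsub>U\<^esub> (x \<ominus>\<^bsub>U\<^esub> e x \<odot>\<^bsub>U\<^esub> y) =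
        p ^ k \<odot>\<^bsub>U\<^esub> x \<ominus>\<^bsub>U\<^esub> (p ^ k * e x) \<odot>\<^bsub>U\<^esub> y"
      using x y(1) by (simp add: int_smult_minus_right int_smult_assoc)
    ultimately show ?thesis
      using x by (simp add: a_minus_def)
  qed
  have main: "primary_list p (map shift as) \<and> V' as \<in> carrier U \<and>
      tensor_sum as = tensor_sum (map shift as) \<oplus>\<^bsub>W\<^esub> tens y (V' as)"
    if "primary_list p as" for as
    using that
  proof (induction as)
    case Nil
    then show ?case
      using y(1) by (simp add: V'_def tens_zero)
  next
    case (Cons a as)
    obtain k x z where a: "a = (k, x, z)"
      by (cases a)
    have as: "x \<in> carrier U" "z \<in> primary U p" "p ^ k \<odot>\<^bsub>U\<^esub> x = \<zero>\<^bsub>U\<^esub>" "primary_list p as" "z \<in> carrier U"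
      using Cons.prems by (auto simp: a primary_carrier)
    note IH = Cons.IH[OF as(4)]
    have V: "V' (a # as) = e x \<odot>\<^bsub>U\<^esub> z \<oplus>\<^bsub>U\<^esub> V' as"
      by (simp add: V'_def a)
    have "x = (x \<ominus>\<^bsub>U\<^esub> e x \<odot>\<^bsub>U\<^esub> y) \<oplus>\<^bsub>U\<^esub> e x \<odot>\<^bsub>U\<^esub> y"
      using as(1) y(1) by (simp add: a_minus_def M.a_assoc M.l_neg)
    then have "tens x z = tens (x \<ominus>\<^bsub>U\<^esub> e x \<odot>\<^bsub>U\<^esub> y) z \<oplus>\<^bsub>W\<^esub> tens (e x \<odot>\<^bsub>U\<^esub> y) z"
      using as y(1) tens_add(1)[of "x \<ominus>\<^bsub>U\<^esub> e x \<odot>\<^bsub>U\<^esub> y" "e x \<odot>\<^bsub>U\<^esub> y" z] by simp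
    also have "tens (e x \<odot>\<^bsub>U\<^esub> y) z = tens y (e x \<odot>\<^bsub>U\<^esub> z)"
      using as y(1) by (simp add: tens_smult)
    finally have "tens x z = tens (x \<ominus>\<^bsub>U\<^esub> e x \<odot>\<^bsub>U\<^esub> y) z \<oplus>\<^bsub>W\<^esub> tens y (e x \<odot>\<^bsub>U\<^esub> z)" .
    then show ?case
      using IH as y(1) ord[OF as(1,3)] tensor_sum_closed[of p "map shift as"]
      by (simp add: V[unfolded a] a shift_def tens_add(2) W.M.add.m_ac)
  qed
  have V: "V = V' as"
    by (simp add: V_def V'_def)
  show "primary_list p (map shift as)" "V \<in> carrier U"
    "tensor_sum as = tensor_sum (map shift as) \<oplus>\<^bsub>W\<^esub> tens y V"
    using main[OF as] by (simp_all add: V)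
  fix f g assume f: "f \<in> linear_maps \<Z> U circle" and g: "g \<in> linear_maps \<Z> W circle"
    and fg: "\<And>x z. \<lbrakk>x \<in> carrier U; z \<in> carrier U\<rbrakk> \<Longrightarrow> g (tens x z) = f z powi e x"
  have "g (tensor_sum as) = f (V' as)" if "primary_list p as" for as
    using that
  proof (induction as)
    case Nil
    then show ?case
      using linear_zero[OF f M.abelian_group_axioms circle.M.abelian_group_axioms]
        linear_zero[OF g W.M.abelian_group_axioms circle.M.abelian_group_axioms] by (simp add: V'_def)
  next
    case (Cons a as)
    obtain k x z where a: "a = (k, x, z)"
      by (cases a)
    have as: "x \<in> carrier U" "z \<in> carrier U" "primary_list p as"
      using Cons.prems by (auto simp: a primary_carrier)
    have "V' (a # as) = e x \<odot>\<^bsub>U\<^esub> z \<oplus>\<^bsub>U\<^esub> V' as"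
      by (simp add: V'_def a)
    then show ?case
      using Cons.IH[OF as(3)] as main[OF as(3)] tensor_sum_closed[OF as(3)]
      by (simp add: a linear_add[OF g] linear_add[OF f] linear_smult[OF f] fg)
  qed
  then show "g (tensor_sum as) = f V"
    using as by (simp add: V)
qed

text \<open>Induction on the sum of the recorded exponents: one entry with exponent
  \<open>Suc k\<close> is replaced by one with exponent \<open>k\<close>, and no other exponent
  changes. The height of \<open>u = p ^ k \<odot> x\<close> in \<open>U\<close> decides how this is
  done.\<close>

lemma primary_tensor_sum_zero:
  assumes p: "prime p" and as: "primary_list (int p) as"
    and vanish: "\<And>m g. \<lbrakk>g \<in> linear_maps \<Z> W circle; \<And>v. v \<in> carrier W \<Longrightarrow> g v ^ (p ^ m) = 1\<rbrakk> \<Longrightarrow>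
      g (tensor_sum as) = 1"
  shows "tensor_sum as = \<zero>\<^bsub>W\<^esub>"
  using as vanish
proof (induction "sum_list (map fst as)" arbitrary: as rule: less_induct)
  case less
  note as = less.prems(1) and vanish = less.prems(2)
  have p': "prime (int p)" and p0: "p > 0"
    using p by (simp_all add: prime_gt_0_nat)
  show ?case
  proof (cases "\<forall>a\<in>set as. fst a = 0")
    case True
    then show ?thesis
      by (intro tensor_sum_trivial[OF as]) blast
  next
    case False
    then obtain a where a: "a \<in> set as" "fst a \<noteq> 0"
      by blast
    then obtain qs rs where "as = qs @ a # rs"
      by (meson split_list)
    moreover obtain k x y where "a = (Suc k, x, y)"
      using a(2) by (metis not0_implies_Suc prod.collapse)
    ultimately have split: "as = qs @ (Suc k, x, y) # rs"
      by simp
    have c: "x \<in> carrier U" "y \<in> primary U (int p)" "y \<in> carrier U" "int p ^ Suc k \<odot>\<^bsub>U\<^esub> x = \<zero>\<^bsub>U\<^esub>"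
      "primary_list (int p) qs" "primary_list (int p) rs"
      using as by (auto simp: split primary_carrier)
    define u where "u = int p ^ k \<odot>\<^bsub>U\<^esub> x"
    have u: "u \<in> carrier U" "int p \<odot>\<^bsub>U\<^esub> u = \<zero>\<^bsub>U\<^esub>"
      using c(1,4) by (simp_all add: u_def int_smult_assoc[symmetric])
    obtain N where N: "int p ^ N \<odot>\<^bsub>U\<^esub> y = \<zero>\<^bsub>U\<^esub>"
      using c(2) by (auto simp: primary_def)
    let ?H = "\<lambda>h. (\<lambda>y. int p ^ h \<odot>\<^bsub>U\<^esub> y) ` carrier U"
    show ?thesis
    proof (cases "u \<in> ?H (k + N)")
      \<comment> \<open>\<open>p ^ N\<close> kills \<open>y\<close>, so subtracting
        \<open>p ^ N \<odot> v\<close> from \<open>x\<close> does not change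
        \<open>x \<otimes> y\<close>. With height at least \<open>k + N\<close> such a
        \<open>v\<close> can be chosen so that \<open>p ^ k\<close> kills the difference.\<close>
      case True
      then obtain v where v: "v \<in> carrier U" "u = int p ^ (k + N) \<odot>\<^bsub>U\<^esub> v"
        by blast
      define x' where "x' = x \<ominus>\<^bsub>U\<^esub> int p ^ N \<odot>\<^bsub>U\<^esub> v"
      have x': "x' \<in> carrier U" "int p ^ k \<odot>\<^bsub>U\<^esub> x' = \<zero>\<^bsub>U\<^esub>"
      proof -
        have "int p ^ k \<odot>\<^bsub>U\<^esub> x' = u \<ominus>\<^bsub>U\<^esub> int p ^ (k + N) \<odot>\<^bsub>U\<^esub> v"
          using c(1) v(1) by (simp add: x'_def int_smult_minus_right u_def int_smult_assoc power_add)
        then show "int p ^ k \<odot>\<^bsub>U\<^esub> x' = \<zero>\<^bsub>U\<^esub>"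
          using v(1) by (simp add: v(2) a_minus_def M.r_neg)
        show "x' \<in> carrier U"
          using c(1) v(1) by (simp add: x'_def)
      qed
      have "tens (int p ^ N \<odot>\<^bsub>U\<^esub> v) y = tens v (int p ^ N \<odot>\<^bsub>U\<^esub> y)"
        using v(1) c(3) by (simp add: tens_smult)
      then have "tens (int p ^ N \<odot>\<^bsub>U\<^esub> v) y = \<zero>\<^bsub>W\<^esub>"
        using v(1) by (simp add: N tens_zero)
      moreover have "x = x' \<oplus>\<^bsub>U\<^esub> int p ^ N \<odot>\<^bsub>U\<^esub> v"
        using c(1) v(1) by (simp add: x'_def a_minus_def M.a_assoc M.l_neg)
      then have "tens x y = tens x' y \<oplus>\<^bsub>W\<^esub> tens (int p ^ N \<odot>\<^bsub>U\<^esub> v) y"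
        using tens_add(1)[of x' "int p ^ N \<odot>\<^bsub>U\<^esub> v" y] x'(1) v(1) c(3) by simp
      ultimately have "tens x' y = tens x y"
        using x'(1) c(3) by simp
      moreover have as': "primary_list (int p) (qs @ (k, x', y) # rs)"
        using c x' by simp
      ultimately have eq: "tensor_sum (qs @ (k, x', y) # rs) = tensor_sum as"
        using c x' by (simp add: split tensor_sum_append[where p = "int p"])
      have "tensor_sum (qs @ (k, x', y) # rs) = \<zero>\<^bsub>W\<^esub>"
      proof (rule less.hyps[OF _ as'])
        fix m g assume "g \<in> linear_maps \<Z> W circle" "\<And>v. v \<in> carrier W \<Longrightarrow> g v ^ (p ^ m) = 1"
        then show "g (tensor_sum (qs @ (k, x', y) # rs)) = 1"
          unfolding eq by (rule vanish)
      qed (simp add: split)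
      then show ?thesis
        by (simp add: eq)
    next
      \<comment> \<open>Now \<open>u\<close> is nonzero of finite height \<open>h\<close>. An
        element \<open>v\<close> with \<open>p ^ h \<odot> v = u\<close> has order
        \<open>p ^ Suc h\<close> and generates a pure subgroup, onto which a retraction is
        constructed.\<close>
      case False
      define j where "j = (LEAST j. u \<notin> ?H j)"
      have j: "u \<notin> ?H j" "\<And>i. i < j \<Longrightarrow> u \<in> ?H i"
        using LeastI[of "\<lambda>j. u \<notin> ?H j", OF False] not_less_Least[of _ "\<lambda>j. u \<notin> ?H j"] by (auto simp: j_def)
      have "u \<in> ?H 0"
        using u(1) by (auto intro!: image_eqI[of _ _ u])
      with j(1) obtain h where h: "j = Suc h"
        by (cases j) auto
      obtain v where v: "v \<in> carrier U" "u = int p ^ h \<odot>\<^bsub>U\<^esub> v"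
        using j(2)[of h] h by auto
      define q where "q = p ^ Suc h"
      have q: "q > 0" "int q = int p ^ Suc h"
        using p0 by (simp_all add: q_def)
      have qv: "int q \<odot>\<^bsub>U\<^esub> v = \<zero>\<^bsub>U\<^esub>"
        using u(2) v by (simp add: q(2) int_smult_assoc)
      have char_q: "f z ^ q = 1"
        if f: "f \<in> linear_maps \<Z> U circle" "\<And>z. z \<in> ?H (Suc h) \<Longrightarrow> f z = 1" and z: "z \<in> carrier U" for f z
      proof -
        have "f z ^ q = f (int q \<odot>\<^bsub>U\<^esub> z)"
          using linear_smult[OF f(1) z, of "int q"] by simp
        then show ?thesis
          using f(2)[of "int q \<odot>\<^bsub>U\<^esub> z"] z by (simp add: q(2))
      qed
      \<comment> \<open>A character that is trivial on multiples of \<open>q\<close> has exponent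
        \<open>q\<close>. Being nontrivial at \<open>u\<close>, it has at \<open>v\<close> a
        logarithm prime to \<open>p\<close>.\<close>
      obtain f where f: "f \<in> linear_maps \<Z> U circle" "\<And>z. z \<in> ?H (Suc h) \<Longrightarrow> f z = 1" "f u \<noteq> 1"
        using character_separation[OF submodule_multiples u(1), of "int p ^ Suc h"] j(1) h by blast
      obtain e0 where e0: "\<And>z. z \<in> carrier U \<Longrightarrow> f z = root_of_unity q (e0 z)"
        "\<And>z z'. \<lbrakk>z \<in> carrier U; z' \<in> carrier U\<rbrakk> \<Longrightarrow> int q dvd e0 (z \<oplus>\<^bsub>U\<^esub> z') - (e0 z + e0 z')"
        "\<And>k z. z \<in> carrier U \<Longrightarrow> int q dvd e0 (k \<odot>\<^bsub>U\<^esub> z) - k * e0 z"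
        using character_logarithm[OF f(1) q(1) char_q[OF f(1,2)]] by blast
      have "\<not> int p dvd e0 v"
      proof
        assume "int p dvd e0 v"
        then have "int q dvd int p ^ h * e0 v"
          by (auto simp: q(2) mult.commute)
        then have "int q dvd e0 u"
          using e0(3)[OF v(1), of "int p ^ h"] v(2) by (simp add: dvd_diff_left_iff)
        then show False
          using f(3) e0(1)[OF u(1)] root_of_unity_eq_1_iff[OF q(1)] by simp
      qed
      then have "coprime (int p) (e0 v)"
        using p' by (intro prime_imp_coprime)
      then have "coprime (e0 v) (int q)"
        by (simp add: q(2) coprime_commute)
      then obtain b d where bd: "b * e0 v + d * int q = 1"
        using bezout_int[of "e0 v" "int q"] by auto
      \<comment> \<open>The logarithm is normalised by an inverse \<open>b\<close> of its value at
        \<open>v\<close> modulo \<open>q\<close>, so that \<open>e v\<close> is 1 modulo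
        \<open>q\<close>: this is the retraction onto the cyclic group of \<open>v\<close>.\<close>
      define e where "e z = b * e0 z" for z
      have e: "int q dvd e (z \<oplus>\<^bsub>U\<^esub> z') - (e z + e z')" if "z \<in> carrier U" "z' \<in> carrier U" for z z'
        using dvd_mult[OF e0(2)[OF that], of b] by (simp add: e_def algebra_simps)
      have e': "int q dvd e (k \<odot>\<^bsub>U\<^esub> z) - k * e z" if "z \<in> carrier U" for k z
        using dvd_mult[OF e0(3)[OF that, of k], of b] by (simp add: e_def algebra_simps)
      have e'': "\<forall>k. \<forall>z\<in>carrier U. int q dvd e (k \<odot>\<^bsub>U\<^esub> z) - k * e z"
        using e' by blast
      have ev: "int q dvd e v - 1"
        using bd by (simp add: e_def) (metis add_diff_cancel_left' diff_minus_eq_add dvd_minus_iff dvd_triv_right minus_diff_eq)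
      define shift where "shift = (\<lambda>(k::nat, x, z::'u). (k, x \<ominus>\<^bsub>U\<^esub> e x \<odot>\<^bsub>U\<^esub> v, z))"
      define V where "V = foldr (\<lambda>(k, x, z) s. e x \<odot>\<^bsub>U\<^esub> z \<oplus>\<^bsub>U\<^esub> s) as \<zero>\<^bsub>U\<^esub>"
      note elim = tensor_sum_eliminate[OF p' as v(1) qv e'', folded shift_def V_def]
      \<comment> \<open>Otherwise some character \<open>\<psi>\<close> of exponent \<open>q\<close>
        is nontrivial at \<open>V\<close>. The form with values \<open>\<psi> z powi e x\<close>
        also has exponent \<open>q\<close>, so it vanishes on the sum by hypothesis, although its
        value there is \<open>\<psi> V\<close>.\<close>
      have "V \<in> ?H (Suc h)"
      proof (rule ccontr)
        assume "V \<notin> ?H (Suc h)"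
        then obtain \<psi> where \<psi>: "\<psi> \<in> linear_maps \<Z> U circle" "\<And>z. z \<in> ?H (Suc h) \<Longrightarrow> \<psi> z = 1" "\<psi> V \<noteq> 1"
          using character_separation[OF submodule_multiples elim(2), of "int p ^ Suc h"] by blast
        note \<psi>c = linear_closed[OF \<psi>(1), simplified]
        obtain g where g: "g \<in> linear_maps \<Z> W circle"
          "\<And>x z. \<lbrakk>x \<in> carrier U; z \<in> carrier U\<rbrakk> \<Longrightarrow> g (tens x z) = \<psi> z powi e x"
        proof (rule bilinear_form[OF circle.module_axioms, of "\<lambda>x z. \<psi> z powi e x"])
          show "\<psi> z powi e (x \<oplus>\<^bsub>U\<^esub> x') = \<psi> z powi e x \<oplus>\<^bsub>circle\<^esub> \<psi> z powi e x'"
            if "x \<in> carrier U" "x' \<in> carrier U" "z \<in> carrier U" for x x' z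
            using powi_eq_if_dvd[OF \<psi>c[OF that(3)] char_q[OF \<psi>(1,2) that(3)] e[OF that(1,2)]] \<psi>c[OF that(3)]
            by (simp add: power_int_add)
        qed (use \<psi>c linear_add[OF \<psi>(1)] in \<open>auto simp: power_int_mult_distrib\<close>)
        have "(\<lambda>v. g v ^ q) \<in> linear_maps \<Z> W circle"
          using linear_maps_smult[OF g(1) _ W.module_axioms circle.module_axioms, of "int q"] by simp
        moreover have "(\<lambda>v. 1) \<in> linear_maps \<Z> W circle"
          by (rule linear_mapsI) auto
        moreover have "g (tens x z) ^ q = 1" if "x \<in> carrier U" "z \<in> carrier U" for x z
        proof -
          have "g (tens x z) ^ q = (\<psi> z powi int q) powi e x"
            using that by (simp add: g(2) power_int_power power_int_power' mult.commute)
          then show ?thesis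
            using char_q[OF \<psi>(1,2) that(2)] by simp
        qed
        ultimately have "g z ^ q = 1" if "z \<in> carrier W" for z
          using square_ext[OF _ _ circle.M.abelian_group_axioms _ that, of "\<lambda>v. g v ^ q" "\<lambda>v. 1"] by simp
        then have "g (tensor_sum as) = 1"
          unfolding q_def by (rule vanish[OF g(1)])
        with elim(4)[OF \<psi>(1) g] \<psi>(3) show False
          by simp
      qed
      then obtain V' where V': "V' \<in> carrier U" "V = int q \<odot>\<^bsub>U\<^esub> V'"
        by (auto simp: q(2))
      \<comment> \<open>\<open>V\<close> is a multiple of \<open>q\<close>, and moving
        \<open>q\<close> to the other factor kills \<open>v\<close>, so the part removed by the
        projection is zero.\<close>
      have "tens v V = tens (int q \<odot>\<^bsub>U\<^esub> v) V'"
        unfolding V'(2) using V'(1) v(1) by (simp add: tens_smult)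
      then have "tens v V = \<zero>\<^bsub>W\<^esub>"
        using V'(1) by (simp add: qv tens_zero)
      then have eq1: "tensor_sum as = tensor_sum (map shift as)"
        using elim(3) tensor_sum_closed[OF elim(1)] by simp
      define x' where "x' = x \<ominus>\<^bsub>U\<^esub> e x \<odot>\<^bsub>U\<^esub> v"
      have sh: "map shift as = map shift qs @ (Suc k, x', y) # map shift rs"
        by (simp add: split shift_def x'_def)
      have x': "x' \<in> carrier U" "int p ^ k \<odot>\<^bsub>U\<^esub> x' = \<zero>\<^bsub>U\<^esub>"
      proof -
        \<comment> \<open>Modulo \<open>q\<close> the value \<open>e u\<close> equals both
          \<open>p ^ k * e x\<close> and \<open>p ^ h * e v\<close>, hence \<open>p ^ h\<close>.
          Therefore \<open>p ^ k\<close> times the removed part of \<open>x\<close> is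
          \<open>p ^ h \<odot> v = u\<close>, and \<open>p ^ k\<close> kills what remains.\<close>
        have "int q dvd e u - int p ^ k * e x" "int q dvd e u - int p ^ h * e v"
          using e'[OF c(1), of "int p ^ k"] e'[OF v(1), of "int p ^ h"] v(2) by (simp_all add: u_def)
        then have "int q dvd (e u - int p ^ h * e v) - (e u - int p ^ k * e x)"
          by (rule dvd_diff[rotated])
        moreover have "int q dvd int p ^ h * (e v - 1)"
          using ev by simp
        ultimately have "int q dvd ((e u - int p ^ h * e v) - (e u - int p ^ k * e x)) + int p ^ h * (e v - 1)"
          by (rule dvd_add)
        then have "int q dvd int p ^ k * e x - int p ^ h"
          by (simp add: algebra_simps)
        then have *: "(int p ^ k * e x) \<odot>\<^bsub>U\<^esub> v = u"
          using int_smult_cong[OF v(1) qv] v(2) by simp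
        show "int p ^ k \<odot>\<^bsub>U\<^esub> x' = \<zero>\<^bsub>U\<^esub>"
        proof -
          have "int p ^ k \<odot>\<^bsub>U\<^esub> x' = u \<ominus>\<^bsub>U\<^esub> (int p ^ k * e x) \<odot>\<^bsub>U\<^esub> v"
            using c(1) v(1) by (simp add: x'_def int_smult_minus_right u_def int_smult_assoc)
          with * show ?thesis
            using u(1) by (simp add: a_minus_def M.r_neg)
        qed
        show "x' \<in> carrier U"
          using c(1) v(1) by (simp add: x'_def)
      qed
      have as': "primary_list (int p) (map shift qs @ (k, x', y) # map shift rs)"
        using elim(1) x' c(2) by (simp add: sh)
      have eq: "tensor_sum (map shift qs @ (k, x', y) # map shift rs) = tensor_sum as"
        using elim(1) as' by (simp add: eq1 sh tensor_sum_append[where p = "int p"])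
      have fst_shift: "map fst (map shift bs) = map fst bs" for bs
        by (auto simp: shift_def)
      have "tensor_sum (map shift qs @ (k, x', y) # map shift rs) = \<zero>\<^bsub>W\<^esub>"
      proof (rule less.hyps[OF _ as'])
        show "sum_list (map fst (map shift qs @ (k, x', y) # map shift rs)) < sum_list (map fst as)"
          by (simp add: split fst_shift del: map_map)
        fix m g assume "g \<in> linear_maps \<Z> W circle" "\<And>v. v \<in> carrier W \<Longrightarrow> g v ^ (p ^ m) = 1"
        then show "g (tensor_sum (map shift qs @ (k, x', y) # map shift rs)) = 1"
          unfolding eq by (rule vanish)
      qed
      then show ?thesis
        by (simp add: eq)
    qed
  qed
qed

text \<open>A nonzero annihilating \<open>w\<close> is torsion, so it has a multiple
  \<open>v\<close> of prime order. All forms with values of p-power order vanish on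
  \<open>v\<close>, and \<open>v\<close> is a sum of tensors of primary elements; the reduction of
  such sums gives \<open>v = 0\<close>.\<close>

lemma annihilates_imp_zero:
  assumes w: "annihilates w"
  shows "w = \<zero>\<^bsub>W\<^esub>"
proof (rule ccontr)
  assume nz: "w \<noteq> \<zero>\<^bsub>W\<^esub>"
  have wW: "w \<in> carrier W"
    using w by (simp add: annihilates_def)
  define n where "n = (LEAST n::nat. n > 0 \<and> int n \<odot>\<^bsub>W\<^esub> w = \<zero>\<^bsub>W\<^esub>)"
  obtain n' where "n' > 0" "n' \<odot>\<^bsub>W\<^esub> w = \<zero>\<^bsub>W\<^esub>"
    using annihilates_torsion[OF w] by (auto simp: torsion_def)
  then have "nat n' > 0 \<and> int (nat n') \<odot>\<^bsub>W\<^esub> w = \<zero>\<^bsub>W\<^esub>"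
    by simp
  from LeastI[of "\<lambda>n::nat. n > 0 \<and> int n \<odot>\<^bsub>W\<^esub> w = \<zero>\<^bsub>W\<^esub>", OF this]
  have n: "n > 0" "int n \<odot>\<^bsub>W\<^esub> w = \<zero>\<^bsub>W\<^esub>"
    by (auto simp: n_def)
  have n_min: "int m \<odot>\<^bsub>W\<^esub> w \<noteq> \<zero>\<^bsub>W\<^esub>" if "m > 0" "m < n" for m
    using not_less_Least[of m "\<lambda>n::nat. n > 0 \<and> int n \<odot>\<^bsub>W\<^esub> w = \<zero>\<^bsub>W\<^esub>"] that by (auto simp: n_def)
  have "n \<noteq> 1"
  proof
    assume "n = 1"
    with n(2) have "1 \<odot>\<^bsub>W\<^esub> w = \<zero>\<^bsub>W\<^esub>"
      by simp
    with nz wW show False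
      by simp
  qed
  then obtain p where p: "prime p" "p dvd n"
    using prime_factor_nat by blast
  then obtain m where m: "n = p * m"
    by (auto elim: dvdE)
  have m0: "m > 0" "m < n"
    using n(1) m p(1) prime_gt_1_nat[OF p(1)] by (auto simp: m)
  \<comment> \<open>\<open>n\<close> is the exact order of \<open>w\<close>, so its quotient by a
    prime factor \<open>p\<close> leaves a nonzero multiple of order \<open>p\<close>.\<close>
  define v where "v = int m \<odot>\<^bsub>W\<^esub> w"
  have v: "annihilates v" "v \<noteq> \<zero>\<^bsub>W\<^esub>" "int p \<odot>\<^bsub>W\<^esub> v = \<zero>\<^bsub>W\<^esub>" "v \<in> carrier W"
    using annihilates_smult[OF w] n_min[OF m0] n(2) wW
    by (auto simp: v_def W.int_smult_assoc[symmetric] m)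
  have p': "prime (int p)"
    using p(1) by simp
  let ?S = "{tensor_sum as | as. primary_list (int p) as}"
  have SI: "tensor_sum as \<in> ?S" if "primary_list (int p) as" for as
    using that by blast
  have sub: "submodule ?S \<Z> W"
  proof (rule W.int_submoduleI)
    show "?S \<subseteq> carrier W"
      using tensor_sum_closed by blast
    show "\<zero>\<^bsub>W\<^esub> \<in> ?S"
      using SI[of "[]"] by simp
    show "a \<oplus>\<^bsub>W\<^esub> b \<in> ?S" if ab: "a \<in> ?S" "b \<in> ?S" for a b
    proof -
      obtain as bs where "a = tensor_sum as" "b = tensor_sum bs" "primary_list (int p) as" "primary_list (int p) bs"
        using ab by blast
      then show ?thesis
        using SI[of "as @ bs"] by (simp add: tensor_sum_append[where p = "int p"])
    qed
    show "k \<odot>\<^bsub>W\<^esub> a \<in> ?S" if a: "a \<in> ?S" for k a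
    proof -
      let ?f = "\<lambda>(j::nat, x, y). (j, k \<odot>\<^bsub>U\<^esub> x, y)"
      have "primary_list (int p) (map ?f as) \<and> tensor_sum (map ?f as) = k \<odot>\<^bsub>W\<^esub> tensor_sum as"
        if "primary_list (int p) as" for as
        using that
        by (induction as)
          (auto simp: tens_smult primary_carrier W.int_smult_right tensor_sum_closed int_smult_commute[of _ _ k])
      then show ?thesis
        using a by blast
    qed
  qed
  \<comment> \<open>If \<open>p ^ k\<close> kills the primary factor, the other factor is written as
    a primary element plus a multiple of \<open>p ^ k\<close>, and that multiple contributes
    nothing.\<close>
  have gen: "tens x y \<in> ?S"
    if xy: "x \<in> carrier U" "y \<in> carrier U" "x \<in> primary U (int p) \<or> y \<in> primary U (int p)" for x y
    using xy(3)
  proof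
    assume "x \<in> primary U (int p)"
    then obtain k where k: "int p ^ k \<odot>\<^bsub>U\<^esub> x = \<zero>\<^bsub>U\<^esub>"
      by (auto simp: primary_def)
    obtain t z where t: "t \<in> primary U (int p)" "z \<in> carrier U" "y = t \<oplus>\<^bsub>U\<^esub> int p ^ k \<odot>\<^bsub>U\<^esub> z"
      using annihilates_primary_divisible[OF v(1,2) p' v(3) xy(2), of k] by blast
    have "tens x (int p ^ k \<odot>\<^bsub>U\<^esub> z) = tens (int p ^ k \<odot>\<^bsub>U\<^esub> x) z"
      using xy(1) t(2) by (simp add: tens_smult)
    then have "tens x y = tens x t"
      using xy(1) t primary_carrier[OF t(1)] k by (simp add: tens_add tens_zero)
    then show ?thesis
      using SI[of "[(k, x, t)]"] xy(1) k t(1) primary_carrier[OF t(1)] by simp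
  next
    assume y: "y \<in> primary U (int p)"
    then obtain k where k: "int p ^ k \<odot>\<^bsub>U\<^esub> y = \<zero>\<^bsub>U\<^esub>"
      by (auto simp: primary_def)
    obtain t z where t: "t \<in> primary U (int p)" "z \<in> carrier U" "x = t \<oplus>\<^bsub>U\<^esub> int p ^ k \<odot>\<^bsub>U\<^esub> z"
      using annihilates_primary_divisible[OF v(1,2) p' v(3) xy(1), of k] by blast
    have "tens (int p ^ k \<odot>\<^bsub>U\<^esub> z) y = tens z (int p ^ k \<odot>\<^bsub>U\<^esub> y)"
      using xy(2) t(2) by (simp add: tens_smult)
    then have "tens x y = tens t y"
      using xy(2) t primary_carrier[OF t(1)] k by (simp add: tens_add tens_zero)
    moreover obtain j where "int p ^ j \<odot>\<^bsub>U\<^esub> t = \<zero>\<^bsub>U\<^esub>"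
      using t(1) by (auto simp: primary_def)
    ultimately show ?thesis
      using SI[of "[(j, t, y)]"] y xy(2) primary_carrier[OF t(1)] by simp
  qed
  have "v \<in> ?S"
    by (rule prime_order_span[OF sub _ gen v(4,3)]) (simp_all add: prime_gt_0_nat[OF p(1)])
  then obtain as where as: "v = tensor_sum as" "primary_list (int p) as"
    by blast
  have "tensor_sum as = \<zero>\<^bsub>W\<^esub>"
    by (rule primary_tensor_sum_zero[OF p(1) as(2)])
      (use bounded_form_vanishes[OF v(1) p(1)] as(1) in blast)
  with as(1) v(2) show False
    by simp
qed

end

section \<open>Modules over the Hecke algebra and over \<open>\<^bold>H(S\<^sub>n)\<close>\<close>

lemma linear_maps_minus:
  assumes "f \<in> linear_maps R M N" "g \<in> linear_maps R M N" "module R M" "module R N"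
  shows "(\<lambda>x. f x \<ominus>\<^bsub>N\<^esub> g x) \<in> linear_maps R M N"
proof -
  interpret M: module R M by fact
  interpret N: module R N by fact
  show ?thesis
    by (rule linear_mapsI)
      (simp_all add: linear_closed[OF assms(1)] linear_add[OF assms(1)] linear_smult[OF assms(1)]
        linear_closed[OF assms(2)] linear_add[OF assms(2)] linear_smult[OF assms(2)]
        N.smult_r_distr N.smult_r_minus a_minus_def N.M.minus_add N.M.add.m_ac)
qed

section \<open>Relations as identities of operators\<close>

context generator_action
begin

interpretation FAr: ring FA
  by (rule ring_free_algebra)

lemma FA_closed:
  "g \<in> G \<Longrightarrow> delta R [g] \<in> carrier FA"
  "\<lbrakk>a \<in> carrier FA; b \<in> carrier FA\<rbrakk> \<Longrightarrow> a \<otimes>\<^bsub>FA\<^esub> b \<in> carrier FA"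
  "\<lbrakk>a \<in> carrier FA; b \<in> carrier FA\<rbrakk> \<Longrightarrow> a \<oplus>\<^bsub>FA\<^esub> b \<in> carrier FA"
  "\<lbrakk>a \<in> carrier FA; b \<in> carrier FA\<rbrakk> \<Longrightarrow> a \<ominus>\<^bsub>FA\<^esub> b \<in> carrier FA"
  "\<lbrakk>c \<in> carrier R; a \<in> carrier FA\<rbrakk> \<Longrightarrow> c \<odot>\<^bsub>FA\<^esub> a \<in> carrier FA"
  "\<one>\<^bsub>FA\<^esub> \<in> carrier FA"
proof -
  show "delta R [g] \<in> carrier FA" if "g \<in> G"
    using delta_word[of "[g]"] that by (simp add: free_algebra_simps(1))
  show "c \<odot>\<^bsub>FA\<^esub> a \<in> carrier FA" if "c \<in> carrier R" "a \<in> carrier FA"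
    using F.smult_closed that by (simp add: free_algebra_simps(1,4))
qed simp_all

lemma evaluate_FA:
  assumes "x \<in> carrier N"
  shows "\<lbrakk>a \<in> carrier FA; b \<in> carrier FA\<rbrakk> \<Longrightarrow>
      evaluate R N t (a \<otimes>\<^bsub>FA\<^esub> b) x = evaluate R N t a (evaluate R N t b x)"
    and "\<lbrakk>a \<in> carrier FA; b \<in> carrier FA\<rbrakk> \<Longrightarrow>
      evaluate R N t (a \<oplus>\<^bsub>FA\<^esub> b) x = evaluate R N t a x \<oplus>\<^bsub>N\<^esub> evaluate R N t b x"
    and "\<lbrakk>a \<in> carrier FA; b \<in> carrier FA\<rbrakk> \<Longrightarrow>
      evaluate R N t (a \<ominus>\<^bsub>FA\<^esub> b) x = evaluate R N t a x \<ominus>\<^bsub>N\<^esub> evaluate R N t b x"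
    and "\<lbrakk>c \<in> carrier R; a \<in> carrier FA\<rbrakk> \<Longrightarrow> evaluate R N t (c \<odot>\<^bsub>FA\<^esub> a) x = c \<odot>\<^bsub>N\<^esub> evaluate R N t a x"
    and "evaluate R N t \<one>\<^bsub>FA\<^esub> x = x"
    and "g \<in> G \<Longrightarrow> evaluate R N t (delta R [g]) x = t g x"
    and "a \<in> carrier FA \<Longrightarrow> evaluate R N t a x \<in> carrier N"
    and "g \<in> G \<Longrightarrow> t g x \<in> carrier N"
proof -
  have "(\<lambda>a. evaluate R N t a x) \<in> linear_maps R FA N"
    using evaluate_linear_left[OF assms] by (simp add: linear_maps_def free_algebra_simps(1-4))
  note E = this
  show "\<lbrakk>a \<in> carrier FA; b \<in> carrier FA\<rbrakk> \<Longrightarrow>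
      evaluate R N t (a \<ominus>\<^bsub>FA\<^esub> b) x = evaluate R N t a x \<ominus>\<^bsub>N\<^esub> evaluate R N t b x"
    by (rule linear_minus[OF E FAr.abelian_group_axioms N.M.abelian_group_axioms])
  show "\<lbrakk>a \<in> carrier FA; b \<in> carrier FA\<rbrakk> \<Longrightarrow>
      evaluate R N t (a \<oplus>\<^bsub>FA\<^esub> b) x = evaluate R N t a x \<oplus>\<^bsub>N\<^esub> evaluate R N t b x"
    by (rule linear_add[OF E])
  show "\<lbrakk>c \<in> carrier R; a \<in> carrier FA\<rbrakk> \<Longrightarrow> evaluate R N t (c \<odot>\<^bsub>FA\<^esub> a) x = c \<odot>\<^bsub>N\<^esub> evaluate R N t a x"
    by (rule linear_smult[OF E])
qed (use assms evaluate_mult evaluate_delta evaluate_closed linear_closed[OF action_linear] in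
    \<open>simp_all add: free_algebra_simps(1,5)\<close>)

lemma minus_eq_zero_iff:
  assumes "x \<in> carrier N" "y \<in> carrier N"
  shows "x \<ominus>\<^bsub>N\<^esub> y = \<zero>\<^bsub>N\<^esub> \<longleftrightarrow> x = y"
  using minus_eq_zeroD[OF N.M.abelian_group_axioms _ assms] assms by (auto simp: a_minus_def N.M.r_neg)

end

definition Hecke_action ::
  "('k, 'e) ring_scheme \<Rightarrow> 'k \<Rightarrow> nat \<Rightarrow> ('k, 'n, 'f) module_scheme \<Rightarrow> (nat \<Rightarrow> 'n \<Rightarrow> 'n) \<Rightarrow> bool"
  where "Hecke_action R q n N t \<longleftrightarrow> (\<forall>x\<in>carrier N. \<forall>i\<in>{1..<n}.
    t i (t i x) = (\<one>\<^bsub>R\<^esub> \<ominus>\<^bsub>R\<^esub> q) \<odot>\<^bsub>N\<^esub> t i x \<oplus>\<^bsub>N\<^esub> q \<odot>\<^bsub>N\<^esub> x \<and>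
    (\<forall>j\<in>{1..<n}. (\<bar>int i - int j\<bar> = 1 \<longrightarrow> t i (t j (t i x)) = t j (t i (t j x))) \<and>
      (\<bar>int i - int j\<bar> > 1 \<longrightarrow> t i (t j x) = t j (t i x))))"

definition HS_single :: "('n, 'f) ring_scheme \<Rightarrow> ('n \<Rightarrow> 'n) \<Rightarrow> ('n \<Rightarrow> 'n) \<Rightarrow> bool"
  where "HS_single N s D \<longleftrightarrow> (\<forall>x\<in>carrier N.
    s (s x) = x \<and> s (D x) \<oplus>\<^bsub>N\<^esub> D (s x) = s x \<ominus>\<^bsub>N\<^esub> x \<and> D (D x) = D x)"

definition HS_far ::
  "('n, 'f) ring_scheme \<Rightarrow> ('n \<Rightarrow> 'n) \<Rightarrow> ('n \<Rightarrow> 'n) \<Rightarrow> ('n \<Rightarrow> 'n) \<Rightarrow> ('n \<Rightarrow> 'n) \<Rightarrow> bool"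
  where "HS_far N s D s' D' \<longleftrightarrow> (\<forall>x\<in>carrier N.
    s' (s x) = s (s' x) \<and> D' (s x) = s (D' x) \<and> D' (D x) = D (D' x))"

definition HS_braid ::
  "('n, 'f) ring_scheme \<Rightarrow> ('n \<Rightarrow> 'n) \<Rightarrow> ('n \<Rightarrow> 'n) \<Rightarrow> ('n \<Rightarrow> 'n) \<Rightarrow> ('n \<Rightarrow> 'n) \<Rightarrow> bool"
  where "HS_braid N s D s' D' \<longleftrightarrow> (\<forall>x\<in>carrier N.
    s' (s (s' x)) = s (s' (s x)) \<and> D (s' (s x)) = s' (s (D' x)) \<and>
    D' (s (D' x)) = s (D' (D x)) \<oplus>\<^bsub>N\<^esub> D (D' (s x)) \<oplus>\<^bsub>N\<^esub> s (D' (s x)))"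

definition HS_action_on :: "('n, 'f) ring_scheme \<Rightarrow> nat \<Rightarrow> (nat \<Rightarrow> 'n \<Rightarrow> 'n) \<Rightarrow> (nat \<Rightarrow> 'n \<Rightarrow> 'n) \<Rightarrow> bool"
  where "HS_action_on N n s D \<longleftrightarrow> (\<forall>i\<in>{1..<n}. HS_single N (s i) (D i) \<and>
    (\<forall>j\<in>{1..<n}. (\<bar>int i - int j\<bar> > 1 \<longrightarrow> HS_far N (s i) (D i) (s j) (D j)) \<and>
      (\<bar>int i - int j\<bar> = 1 \<longrightarrow> HS_braid N (s i) (D i) (s j) (D j))))"

lemma Hecke_rels_closed:
  assumes "cring R" "q \<in> carrier R"
  shows "Hecke_rels R q n \<subseteq> carrier (free_algebra R {1..<n})"
proof -
  interpret C: cring R by fact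
  interpret free_algebra_over R "{1..<n}"
    by (rule free_algebra_over.intro) fact
  interpret ring FA
    by (rule ring_free_algebra)
  have d: "delta R [i] \<in> carrier FA" if "i \<in> {1..<n}" for i
    using delta_word[of "[i]"] that by (simp add: free_algebra_simps(1))
  have s: "c \<odot>\<^bsub>FA\<^esub> a \<in> carrier FA" if "c \<in> carrier R" "a \<in> carrier FA" for c a
    using that F.smult_closed by (simp add: free_algebra_simps(1,4))
  have a: "\<one>\<^bsub>R\<^esub> \<ominus>\<^bsub>R\<^esub> q \<in> carrier R"
    using assms(2) C.minus_closed by simp
  show ?thesis
    unfolding Hecke_rels_def Let_def using assms(2) a
    by (auto intro!: minus_closed m_closed a_closed d s simp del: One_nat_def)
qed

lemma HS_rels_closed: "HS_rels n \<subseteq> carrier (free_algebra \<Z> (HS_gens n))"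
proof -
  interpret free_algebra_over \<Z> "HS_gens n"
    by (rule free_algebra_over.intro) (rule int_is_cring)
  interpret ring FA
    by (rule ring_free_algebra)
  have d: "delta \<Z> [GenS i] \<in> carrier FA" "delta \<Z> [GenD i] \<in> carrier FA" if "i \<in> {1..<n}" for i
    using delta_word[of "[GenS i]"] delta_word[of "[GenD i]"] that
    by (auto simp: free_algebra_simps(1) HS_gens_def)
  show ?thesis
    unfolding HS_rels_def Let_def
    by (intro Un_least UN_least insert_subsetI empty_subsetI minus_closed m_closed a_closed one_closed)
      (simp_all add: d)
qed

lemma Hecke_action_evaluate:
  assumes "generator_action R {1..<n} N t" "q \<in> carrier R" and H: "Hecke_action R q n N t"
    and r: "r \<in> Hecke_rels R q n" and x: "x \<in> carrier N"
  shows "evaluate R N t r x = \<zero>\<^bsub>N\<^esub>"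
proof -
  interpret generator_action R "{1..<n}" N t by fact
  have a: "\<one>\<^bsub>R\<^esub> \<ominus>\<^bsub>R\<^esub> q \<in> carrier R"
    using assms(2) by (simp add: minus_closed)
  note [simp] = FA_closed evaluate_FA minus_eq_zero_iff
  from r show ?thesis
    unfolding Hecke_rels_def Let_def
  proof (elim UnE CollectE exE conjE, goal_cases)
    case (1 i j)
    then show ?case
      using x H by (simp add: Hecke_action_def del: One_nat_def)
  next
    case (2 i j)
    then show ?case
      using x H by (simp add: Hecke_action_def del: One_nat_def)
  next
    case (3 i)
    then show ?case
      using x H a assms(2) by (simp add: Hecke_action_def del: One_nat_def)
  qed
qed

text \<open>An equivalence, because both directions are used: for three factors the identities are
  extracted from a given module structure, for \<open>n\<close> factors the structure is built from
  the identities.\<close>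

lemma HS_action_evaluate:
  assumes "generator_action \<Z> (HS_gens n) N t"
  shows "(\<forall>r\<in>HS_rels n. \<forall>x\<in>carrier N. evaluate \<Z> N t r x = \<zero>\<^bsub>N\<^esub>) \<longleftrightarrow>
    HS_action_on N n (\<lambda>i. t (GenS i)) (\<lambda>i. t (GenD i))"
proof -
  interpret generator_action \<Z> "HS_gens n" N t by fact
  have g [simp]: "GenS i \<in> HS_gens n" "GenD i \<in> HS_gens n" if "i \<in> {1..<n}" for i
    using that by (auto simp: HS_gens_def)
  note [simp] = FA_closed evaluate_FA minus_eq_zero_iff
  have single: "(\<forall>r\<in>{delta \<Z> [GenS i] \<otimes>\<^bsub>FA\<^esub> delta \<Z> [GenS i] \<ominus>\<^bsub>FA\<^esub> \<one>\<^bsub>FA\<^esub>,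
       (delta \<Z> [GenS i] \<otimes>\<^bsub>FA\<^esub> delta \<Z> [GenD i] \<oplus>\<^bsub>FA\<^esub> delta \<Z> [GenD i] \<otimes>\<^bsub>FA\<^esub> delta \<Z> [GenS i]) \<ominus>\<^bsub>FA\<^esub>
         (delta \<Z> [GenS i] \<ominus>\<^bsub>FA\<^esub> \<one>\<^bsub>FA\<^esub>),
       delta \<Z> [GenD i] \<otimes>\<^bsub>FA\<^esub> delta \<Z> [GenD i] \<ominus>\<^bsub>FA\<^esub> delta \<Z> [GenD i]}.
      \<forall>x\<in>carrier N. evaluate \<Z> N t r x = \<zero>\<^bsub>N\<^esub>) \<longleftrightarrow> HS_single N (t (GenS i)) (t (GenD i))"
    if i: "i \<in> {1..<n}" for i
    unfolding HS_single_def using i by (auto cong: ball_cong)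
  have far: "(\<forall>r\<in>{delta \<Z> [GenS j] \<otimes>\<^bsub>FA\<^esub> delta \<Z> [GenS i] \<ominus>\<^bsub>FA\<^esub> delta \<Z> [GenS i] \<otimes>\<^bsub>FA\<^esub> delta \<Z> [GenS j],
       delta \<Z> [GenD j] \<otimes>\<^bsub>FA\<^esub> delta \<Z> [GenS i] \<ominus>\<^bsub>FA\<^esub> delta \<Z> [GenS i] \<otimes>\<^bsub>FA\<^esub> delta \<Z> [GenD j],
       delta \<Z> [GenD j] \<otimes>\<^bsub>FA\<^esub> delta \<Z> [GenD i] \<ominus>\<^bsub>FA\<^esub> delta \<Z> [GenD i] \<otimes>\<^bsub>FA\<^esub> delta \<Z> [GenD j]}.
      \<forall>x\<in>carrier N. evaluate \<Z> N t r x = \<zero>\<^bsub>N\<^esub>) \<longleftrightarrow>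
      HS_far N (t (GenS i)) (t (GenD i)) (t (GenS j)) (t (GenD j))"
    if ij: "i \<in> {1..<n}" "j \<in> {j \<in> {1..<n}. \<bar>int i - int j\<bar> > 1}" for i j
    unfolding HS_far_def using ij by (auto cong: ball_cong)
  have braid: "(\<forall>r\<in>{delta \<Z> [GenS j] \<otimes>\<^bsub>FA\<^esub> delta \<Z> [GenS i] \<otimes>\<^bsub>FA\<^esub> delta \<Z> [GenS j] \<ominus>\<^bsub>FA\<^esub>
         delta \<Z> [GenS i] \<otimes>\<^bsub>FA\<^esub> delta \<Z> [GenS j] \<otimes>\<^bsub>FA\<^esub> delta \<Z> [GenS i],
       delta \<Z> [GenD i] \<otimes>\<^bsub>FA\<^esub> delta \<Z> [GenS j] \<otimes>\<^bsub>FA\<^esub> delta \<Z> [GenS i] \<ominus>\<^bsub>FA\<^esub>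
         delta \<Z> [GenS j] \<otimes>\<^bsub>FA\<^esub> delta \<Z> [GenS i] \<otimes>\<^bsub>FA\<^esub> delta \<Z> [GenD j],
       delta \<Z> [GenD j] \<otimes>\<^bsub>FA\<^esub> delta \<Z> [GenS i] \<otimes>\<^bsub>FA\<^esub> delta \<Z> [GenD j] \<ominus>\<^bsub>FA\<^esub>
         (delta \<Z> [GenS i] \<otimes>\<^bsub>FA\<^esub> delta \<Z> [GenD j] \<otimes>\<^bsub>FA\<^esub> delta \<Z> [GenD i] \<oplus>\<^bsub>FA\<^esub>
          delta \<Z> [GenD i] \<otimes>\<^bsub>FA\<^esub> delta \<Z> [GenD j] \<otimes>\<^bsub>FA\<^esub> delta \<Z> [GenS i] \<oplus>\<^bsub>FA\<^esub>
          delta \<Z> [GenS i] \<otimes>\<^bsub>FA\<^esub> delta \<Z> [GenD j] \<otimes>\<^bsub>FA\<^esub> delta \<Z> [GenS i])}.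
      \<forall>x\<in>carrier N. evaluate \<Z> N t r x = \<zero>\<^bsub>N\<^esub>) \<longleftrightarrow>
      HS_braid N (t (GenS i)) (t (GenD i)) (t (GenS j)) (t (GenD j))"
    if ij: "i \<in> {1..<n}" "j \<in> {j \<in> {1..<n}. \<bar>int i - int j\<bar> = 1}" for i j
    unfolding HS_braid_def using ij by (auto cong: ball_cong)
  show ?thesis
    unfolding HS_rels_def Let_def HS_action_on_def ball_Un ball_UN
    by (simp only: single far braid cong: ball_cong) blast
qed

subsection \<open>Local operators on tensor powers\<close>

context module
begin

lemma at_factors_window:
  assumes "f \<in> linear_maps R (tpow R M 2) (tpow R M 2)" "0 < i" "i < k" "j = p + i"
    "length as = p" "length bs = n - p - k" "p + k \<le> n" "set as \<subseteq> carrier M" "set bs \<subseteq> carrier M"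
    "z \<in> carrier (tpow R M k)"
  shows "at_factors R M n f j (insert_map R M n as bs z) = insert_map R M n as bs (at_factors R M k f i z)"
  using at_factors_insert_map[OF assms(1-3,8,9) _ assms(10), of n] assms by simp

text \<open>Every pure tensor is an insertion of its \<open>k\<close> factors after the first
  \<open>p\<close>, so an identity of linear operators can be checked on such insertions.\<close>

lemma local_relation:
  assumes g: "g \<in> linear_maps R (tpow R M n) (tpow R M n)" and h: "h \<in> linear_maps R (tpow R M n) (tpow R M n)"
    and pk: "p + k \<le> n"
    and G: "\<And>as bs z. \<lbrakk>length as = p; length bs = n - p - k; set as \<subseteq> carrier M; set bs \<subseteq> carrier M;
      insert_map R M n as bs \<in> linear_maps R (tpow R M k) (tpow R M n); z \<in> carrier (tpow R M k)\<rbrakk> \<Longrightarrow>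
      g (insert_map R M n as bs z) = h (insert_map R M n as bs z)"
    and z: "z \<in> carrier (tpow R M n)"
  shows "g z = h z"
proof (rule tpow_ext[OF g h abelian_tpow _ z])
  fix xs assume xs: "length xs = n" "set xs \<subseteq> carrier M"
  define as where "as = take p xs"
  define ys where "ys = take k (drop p xs)"
  define bs where "bs = drop (p + k) xs"
  have s: "xs = as @ ys @ bs" "length as = p" "length ys = k" "length bs = n - p - k"
    using xs(1) pk by (simp_all add: as_def ys_def bs_def drop_drop[symmetric] add.commute del: drop_drop)
  have c: "set as \<subseteq> carrier M" "set ys \<subseteq> carrier M" "set bs \<subseteq> carrier M"
    using xs(2) by (auto simp: s(1))
  have l: "length as + k + length bs = n"
    using s pk by simp
  have "tpure R M xs = insert_map R M n as bs (tpure R M ys)"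
    using insert_map_tpure[OF c(1,3) l s(3) c(2)] s(1) by simp
  then show "g (tpure R M xs) = h (tpure R M xs)"
    using G[OF s(2,4) c(1,3) insert_map_linear[OF c(1,3) l] tpure_closed[OF s(3) c(2)]] by simp
qed

end

text \<open>The braid relation is local on three consecutive factors and the quadratic one on two;
  distant operators commute by \<open>at_factors_commute\<close>.\<close>

lemma Hecke_action_at_factors:
  fixes M :: "('k, 'v) module"
  assumes "module R M" and B: "quadratic_braiding R q M f" and q: "q \<in> carrier R"
  shows "Hecke_action R q n (tpow R M n) (at_factors R M n f)"
proof -
  interpret module R M by fact
  have f: "f \<in> linear_maps R (tpow R M 2) (tpow R M 2)"
    and yb: "\<And>x. x \<in> carrier (tpow R M 3) \<Longrightarrow>
      at_factors R M 3 f 1 (at_factors R M 3 f 2 (at_factors R M 3 f 1 x)) =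
      at_factors R M 3 f 2 (at_factors R M 3 f 1 (at_factors R M 3 f 2 x))"
    and quad: "\<And>x. x \<in> carrier (tpow R M 2) \<Longrightarrow>
      f (f x) = (\<one>\<^bsub>R\<^esub> \<ominus>\<^bsub>R\<^esub> q) \<odot>\<^bsub>tpow R M 2\<^esub> f x \<oplus>\<^bsub>tpow R M 2\<^esub> q \<odot>\<^bsub>tpow R M 2\<^esub> x"
    using B by (auto simp: quadratic_braiding_def Let_def)
  have a: "\<one>\<^bsub>R\<^esub> \<ominus>\<^bsub>R\<^esub> q \<in> carrier R"
    using q by simp
  note L = at_factors_linear[OF f]
  note cl = linear_closed[OF L]
  interpret T2: module R "tpow R M 2" by (rule module_tpow)
  interpret Tn: module R "tpow R M n" by (rule module_tpow)
  have braid: "at_factors R M n f i (at_factors R M n f (i + 1) (at_factors R M n f i x)) =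
      at_factors R M n f (i + 1) (at_factors R M n f i (at_factors R M n f (i + 1) x))"
    if i: "0 < i" "i + 1 < n" and x: "x \<in> carrier (tpow R M n)" for i x
  proof (rule local_relation[of _ n _ "i - 1" 3, OF linear_comp[OF linear_comp[OF L L] L]
        linear_comp[OF linear_comp[OF L L] L] _ _ x])
    fix as bs z assume *: "length as = i - 1" "length bs = n - (i - 1) - 3" "set as \<subseteq> carrier M" "set bs \<subseteq> carrier M"
      "insert_map R M n as bs \<in> linear_maps R (tpow R M 3) (tpow R M n)" "z \<in> carrier (tpow R M 3)"
    have w: "at_factors R M n f i (insert_map R M n as bs v) = insert_map R M n as bs (at_factors R M 3 f 1 v)"
      "at_factors R M n f (i + 1) (insert_map R M n as bs v) = insert_map R M n as bs (at_factors R M 3 f 2 v)"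
      if "v \<in> carrier (tpow R M 3)" for v
      using that * i by (intro at_factors_window[OF f, where p = "i - 1"]; simp)+
    show "at_factors R M n f i (at_factors R M n f (i + 1) (at_factors R M n f i (insert_map R M n as bs z))) =
      at_factors R M n f (i + 1) (at_factors R M n f i (at_factors R M n f (i + 1) (insert_map R M n as bs z)))"
      using *(6) by (simp add: w cl yb del: One_nat_def)
  qed (use i in auto)
  have single: "at_factors R M n f i (at_factors R M n f i x) =
      (\<one>\<^bsub>R\<^esub> \<ominus>\<^bsub>R\<^esub> q) \<odot>\<^bsub>tpow R M n\<^esub> at_factors R M n f i x \<oplus>\<^bsub>tpow R M n\<^esub> q \<odot>\<^bsub>tpow R M n\<^esub> x"
    if i: "0 < i" "i < n" and x: "x \<in> carrier (tpow R M n)" for i x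
  proof (rule local_relation[of _ n _ "i - 1" 2, OF linear_comp[OF L L] _ _ _ x])
    show "(\<lambda>x. (\<one>\<^bsub>R\<^esub> \<ominus>\<^bsub>R\<^esub> q) \<odot>\<^bsub>tpow R M n\<^esub> at_factors R M n f i x \<oplus>\<^bsub>tpow R M n\<^esub> q \<odot>\<^bsub>tpow R M n\<^esub> x)
      \<in> linear_maps R (tpow R M n) (tpow R M n)"
      by (intro linear_maps_add linear_maps_smult L linear_id module_tpow i q a)
    fix as bs z assume *: "length as = i - 1" "length bs = n - (i - 1) - 2" "set as \<subseteq> carrier M" "set bs \<subseteq> carrier M"
      "insert_map R M n as bs \<in> linear_maps R (tpow R M 2) (tpow R M n)" "z \<in> carrier (tpow R M 2)"
    have w: "at_factors R M n f i (insert_map R M n as bs v) = insert_map R M n as bs (f v)"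
      if "v \<in> carrier (tpow R M 2)" for v
      using at_factors_window[OF f, where p = "i - 1" and i = 1 and k = 2 and j = i and n = n and as = as and bs = bs and z = v]
        at_factors_two[OF f that] that * i by simp
    show "at_factors R M n f i (at_factors R M n f i (insert_map R M n as bs z)) =
      (\<one>\<^bsub>R\<^esub> \<ominus>\<^bsub>R\<^esub> q) \<odot>\<^bsub>tpow R M n\<^esub> at_factors R M n f i (insert_map R M n as bs z) \<oplus>\<^bsub>tpow R M n\<^esub>
      q \<odot>\<^bsub>tpow R M n\<^esub> insert_map R M n as bs z"
      using *(6) a q by (simp add: w linear_closed[OF f] quad linear_add[OF *(5)] linear_smult[OF *(5)] T2.smult_closed)
  qed (use i in auto)
  show ?thesis
    unfolding Hecke_action_def
  proof (intro ballI conjI impI)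
    fix x i assume x: "x \<in> carrier (tpow R M n)" and i: "i \<in> {1..<n}"
    show "at_factors R M n f i (at_factors R M n f i x) =
      (\<one>\<^bsub>R\<^esub> \<ominus>\<^bsub>R\<^esub> q) \<odot>\<^bsub>tpow R M n\<^esub> at_factors R M n f i x \<oplus>\<^bsub>tpow R M n\<^esub> q \<odot>\<^bsub>tpow R M n\<^esub> x"
      using i x by (intro single) auto
    fix j assume j: "j \<in> {1..<n}"
    {
      assume "\<bar>int i - int j\<bar> = 1"
      then consider "j = i + 1" | "i = j + 1"
        by linarith
      then show "at_factors R M n f i (at_factors R M n f j (at_factors R M n f i x)) =
        at_factors R M n f j (at_factors R M n f i (at_factors R M n f j x))"
      proof cases
        case 1
        with i j show ?thesis
          using braid[OF _ _ x, of i] by simp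
      next
        case 2
        with i j show ?thesis
          using braid[OF _ _ x, of j] by simp
      qed
    next
      assume "\<bar>int i - int j\<bar> > 1"
      then consider "i + 1 < j" | "j + 1 < i"
        by linarith
      then show "at_factors R M n f i (at_factors R M n f j x) = at_factors R M n f j (at_factors R M n f i x)"
        using i j x at_factors_commute[OF f f, of i j n x] at_factors_commute[OF f f, of j i n x]
        by cases simp_all
    }
  qed
qed

text \<open>The relations are known on three factors only. Even those with a single index are
  therefore checked inside a window of three, which fits because \<open>n \<ge> 3\<close>.\<close>

lemma (in int_module) HS_action_at_factors:
  assumes s: "s \<in> linear_maps \<Z> (tpow \<Z> M 2) (tpow \<Z> M 2)" and D: "D \<in> linear_maps \<Z> (tpow \<Z> M 2) (tpow \<Z> M 2)"
    and three: "HS_action_on (tpow \<Z> M 3) 3 (at_factors \<Z> M 3 s) (at_factors \<Z> M 3 D)" and n: "n \<ge> 3"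
  shows "HS_action_on (tpow \<Z> M n) n (at_factors \<Z> M n s) (at_factors \<Z> M n D)"
proof -
  let ?N = "tpow \<Z> M n" and ?N3 = "tpow \<Z> M 3"
  let ?s = "at_factors \<Z> M n s" and ?D = "at_factors \<Z> M n D"
  let ?s3 = "at_factors \<Z> M 3 s" and ?D3 = "at_factors \<Z> M 3 D"
  note Ls = at_factors_linear[OF s] and LD = at_factors_linear[OF D]
  note cl = linear_closed[OF Ls] linear_closed[OF LD]
  interpret N3: abelian_group ?N3 by (rule abelian_tpow)
  have window: "\<exists>p i' j'. p + 3 \<le> n \<and> i = p + i' \<and> j = p + j' \<and> i' \<in> {1..<3} \<and> j' \<in> {1..<3}"
    if "i \<in> {1..<n}" "j \<in> {1..<n}" "\<bar>int i - int j\<bar> \<le> 1" for i j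
  proof -
    have "i = j \<or> i = j + 1 \<or> j = i + 1"
      using that(3) by linarith
    \<comment> \<open>The window begins at the smaller index, unless it would then run over the
      right end, in which case it is the last one; \<open>p\<close> is the number of factors before
      it.\<close>
    then show ?thesis
      using that(1,2) n
      by (intro exI[of _ "min (min i j - 1) (n - 3)"] exI[of _ "i - min (min i j - 1) (n - 3)"]
          exI[of _ "j - min (min i j - 1) (n - 3)"]) auto
  qed
  have w: "?s (p + i) (insert_map \<Z> M n as bs v) = insert_map \<Z> M n as bs (?s3 i v)"
    "?D (p + i) (insert_map \<Z> M n as bs v) = insert_map \<Z> M n as bs (?D3 i v)"
    if "i \<in> {1..<3}" "p + 3 \<le> n" "length as = p" "length bs = n - p - 3" "set as \<subseteq> carrier M" "set bs \<subseteq> carrier M"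
      "v \<in> carrier ?N3" for p i as bs v
    using that by (intro at_factors_window[OF s] at_factors_window[OF D]; simp)+
  have c3: "?s3 i v \<in> carrier ?N3" "?D3 i v \<in> carrier ?N3" if "i \<in> {1..<3}" "v \<in> carrier ?N3" for i v
    using that cl[of i 3] by auto
  note lin = linear_comp linear_maps_add linear_maps_minus linear_id module_tpow
  have single: "HS_single ?N (?s i) (?D i)" if i: "i \<in> {1..<n}" for i
  proof -
    obtain p i' where p: "p + 3 \<le> n" "i = p + i'" "i' \<in> {1..<3}"
      using window[OF i i] by auto
    have rel: "HS_single ?N3 (?s3 i') (?D3 i')"
      using three p(3) by (simp add: HS_action_on_def)
    have L: "?s i \<in> linear_maps \<Z> ?N ?N" "?D i \<in> linear_maps \<Z> ?N ?N"
      using Ls[of i n] LD[of i n] i by auto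
    note loc = local_relation[where p = p and k = 3, OF _ _ p(1)]
    show ?thesis
      unfolding HS_single_def
    proof (intro ballI conjI)
      fix x assume x: "x \<in> carrier ?N"
      show "?s i (?s i x) = x"
        by (rule loc[OF linear_comp[OF L(1) L(1)] linear_id _ x])
          (use rel p in \<open>simp add: w c3 HS_single_def\<close>)
      show "?D i (?D i x) = ?D i x"
        by (rule loc[OF linear_comp[OF L(2) L(2)] L(2) _ x])
          (use rel p in \<open>simp add: w c3 HS_single_def\<close>)
      show "?s i (?D i x) \<oplus>\<^bsub>?N\<^esub> ?D i (?s i x) = ?s i x \<ominus>\<^bsub>?N\<^esub> x"
      proof (rule loc[OF linear_maps_add[OF linear_comp[OF L(2) L(1)] linear_comp[OF L] module_tpow module_tpow]
            linear_maps_minus[OF L(1) linear_id module_tpow module_tpow] _ x])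
        fix as bs z assume *: "length as = p" "length bs = n - p - 3" "set as \<subseteq> carrier M" "set bs \<subseteq> carrier M"
          and I: "insert_map \<Z> M n as bs \<in> linear_maps \<Z> ?N3 ?N" and z: "z \<in> carrier ?N3"
        show "?s i (?D i (insert_map \<Z> M n as bs z)) \<oplus>\<^bsub>?N\<^esub> ?D i (?s i (insert_map \<Z> M n as bs z)) =
          ?s i (insert_map \<Z> M n as bs z) \<ominus>\<^bsub>?N\<^esub> insert_map \<Z> M n as bs z"
          using rel p * z
          by (simp add: w c3 HS_single_def linear_add[OF I, symmetric]
              linear_minus[OF I abelian_tpow abelian_tpow, symmetric])
      qed
    qed
  qed
  have braid: "HS_braid ?N (?s i) (?D i) (?s j) (?D j)" if ij: "i \<in> {1..<n}" "j \<in> {1..<n}" "\<bar>int i - int j\<bar> = 1" for i j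
  proof -
    obtain p i' j' where p: "p + 3 \<le> n" "i = p + i'" "j = p + j'" "i' \<in> {1..<3}" "j' \<in> {1..<3}"
      using window[OF ij(1,2)] ij(3) by auto
    have rel: "HS_braid ?N3 (?s3 i') (?D3 i') (?s3 j') (?D3 j')"
      using three p ij(3) by (simp add: HS_action_on_def)
    have L: "?s i \<in> linear_maps \<Z> ?N ?N" "?D i \<in> linear_maps \<Z> ?N ?N"
      "?s j \<in> linear_maps \<Z> ?N ?N" "?D j \<in> linear_maps \<Z> ?N ?N"
      using Ls[of i n] LD[of i n] Ls[of j n] LD[of j n] ij by auto
    note C = linear_comp[OF linear_comp]
    note loc = local_relation[where p = p and k = 3, OF _ _ p(1)]
    show ?thesis
      unfolding HS_braid_def
    proof (intro ballI conjI)
      fix x assume x: "x \<in> carrier ?N"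
      show "?s j (?s i (?s j x)) = ?s i (?s j (?s i x))"
        by (rule loc[OF C[OF L(3) L(1) L(3)] C[OF L(1) L(3) L(1)] _ x])
          (use rel p in \<open>simp add: w c3 HS_braid_def\<close>)
      show "?D i (?s j (?s i x)) = ?s j (?s i (?D j x))"
        by (rule loc[OF C[OF L(1) L(3) L(2)] C[OF L(4) L(1) L(3)] _ x])
          (use rel p in \<open>simp add: w c3 HS_braid_def\<close>)
      show "?D j (?s i (?D j x)) =
        ?s i (?D j (?D i x)) \<oplus>\<^bsub>?N\<^esub> ?D i (?D j (?s i x)) \<oplus>\<^bsub>?N\<^esub> ?s i (?D j (?s i x))"
      proof (rule loc[OF C[OF L(4) L(1) L(4)] linear_maps_add[OF linear_maps_add[OF C[OF L(2) L(4) L(1)]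
              C[OF L(1) L(4) L(2)] module_tpow module_tpow] C[OF L(1) L(4) L(1)] module_tpow module_tpow] _ x])
        fix as bs z assume *: "length as = p" "length bs = n - p - 3" "set as \<subseteq> carrier M" "set bs \<subseteq> carrier M"
          and I: "insert_map \<Z> M n as bs \<in> linear_maps \<Z> ?N3 ?N" and z: "z \<in> carrier ?N3"
        show "?D j (?s i (?D j (insert_map \<Z> M n as bs z))) =
          ?s i (?D j (?D i (insert_map \<Z> M n as bs z))) \<oplus>\<^bsub>?N\<^esub> ?D i (?D j (?s i (insert_map \<Z> M n as bs z))) \<oplus>\<^bsub>?N\<^esub>
          ?s i (?D j (?s i (insert_map \<Z> M n as bs z)))"
          using rel p * z by (simp add: w c3 HS_braid_def linear_add[OF I, symmetric])
      qed
    qed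
  qed
  have far: "HS_far ?N (?s i) (?D i) (?s j) (?D j)" if ij: "i \<in> {1..<n}" "j \<in> {1..<n}" "\<bar>int i - int j\<bar> > 1" for i j
  proof -
    have "i + 1 < j \<or> j + 1 < i"
      using ij(3) by linarith
    then have c: "at_factors \<Z> M n f i (at_factors \<Z> M n g j x) = at_factors \<Z> M n g j (at_factors \<Z> M n f i x)"
      if "f \<in> linear_maps \<Z> (tpow \<Z> M 2) (tpow \<Z> M 2)" "g \<in> linear_maps \<Z> (tpow \<Z> M 2) (tpow \<Z> M 2)"
        "x \<in> carrier ?N" for f g x
      using ij that at_factors_commute[OF that(1,2), of i j n] at_factors_commute[OF that(2,1), of j i n] by auto
    show ?thesis
      unfolding HS_far_def using c[OF s s] c[OF s D] c[OF D D] by simp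
  qed
  show ?thesis
    unfolding HS_action_on_def using single braid far by blast
qed

text \<open>Appending a factor \<open>u\<close> turns \<open>s\<close> and \<open>D\<close> into the
  operators on the first two of three factors, where the relations hold. The difference of the two
  sides of a relation is therefore annihilating, and so zero.\<close>

lemma (in tensor_square) HS_single_square:
  assumes s: "s \<in> linear_maps \<Z> W W" and D: "D \<in> linear_maps \<Z> W W"
    and three: "HS_single (tpow \<Z> U 3) (at_factors \<Z> U 3 s 1) (at_factors \<Z> U 3 D 1)"
  shows "HS_single W s D"
proof -
  interpret T3: int_module "tpow \<Z> U 3"
    by (rule int_module.intro) (rule module_tpow)
  have zero: "a = b" if ab: "a \<in> carrier W" "b \<in> carrier W"
    "\<And>u. u \<in> carrier U \<Longrightarrow> insert_map \<Z> U 3 [] [u] a = insert_map \<Z> U 3 [] [u] b" for a b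
  proof -
    have "insert_map \<Z> U 3 [] [u] (a \<ominus>\<^bsub>W\<^esub> b) = \<zero>\<^bsub>tpow \<Z> U 3\<^esub>" if u: "u \<in> carrier U" for u
    proof -
      have I: "insert_map \<Z> U 3 [] [u] \<in> linear_maps \<Z> W (tpow \<Z> U 3)"
        using u by (intro insert_map_linear) auto
      show ?thesis
        using linear_closed[OF I ab(2)] ab u
        by (simp add: linear_minus[OF I abelian_tpow abelian_tpow] T3.M.r_neg[unfolded a_minus_def[symmetric]])
    qed
    then have "annihilates (a \<ominus>\<^bsub>W\<^esub> b)"
      using ab by (simp add: annihilates_def)
    then show ?thesis
      using annihilates_imp_zero minus_eq_zeroD[OF W.M.abelian_group_axioms _ ab(1,2)] by blast
  qed
  show ?thesis
    unfolding HS_single_def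
  proof (intro ballI conjI)
    fix x assume x: "x \<in> carrier W"
    note c = linear_closed[OF s] linear_closed[OF D]
    have w: "insert_map \<Z> U 3 [] [u] (f v) = at_factors \<Z> U 3 f 1 (insert_map \<Z> U 3 [] [u] v)"
      if "f \<in> linear_maps \<Z> W W" "u \<in> carrier U" "v \<in> carrier W" for f u v
      using at_factors_insert_map[OF that(1), of 1 2 "[]" "[u]" 3 v] at_factors_two[OF that(1,3)] that by simp
    have I: "insert_map \<Z> U 3 [] [u] \<in> linear_maps \<Z> W (tpow \<Z> U 3)" if "u \<in> carrier U" for u
      using that by (intro insert_map_linear) auto
    note rel = three[unfolded HS_single_def, rule_format, OF linear_closed[OF I x]]
    show "s (s x) = x"
      by (rule zero) (use x c rel in \<open>auto simp: w[OF s]\<close>)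
    show "D (D x) = D x"
      by (rule zero) (use x c rel in \<open>auto simp: w[OF D]\<close>)
    show "s (D x) \<oplus>\<^bsub>W\<^esub> D (s x) = s x \<ominus>\<^bsub>W\<^esub> x"
    proof (rule zero)
      fix u assume u: "u \<in> carrier U"
      show "insert_map \<Z> U 3 [] [u] (s (D x) \<oplus>\<^bsub>W\<^esub> D (s x)) = insert_map \<Z> U 3 [] [u] (s x \<ominus>\<^bsub>W\<^esub> x)"
        using x u c rel[OF u]
        by (simp add: linear_add[OF I] linear_minus[OF I abelian_tpow abelian_tpow] w[OF s] w[OF D])
    qed (use x c in auto)
  qed
qed

section \<open>The twisted tensor product\<close>

text \<open>The first identity is the relation for
  \<open>D\<^sub>1 (s\<^sub>2 (s\<^sub>1 x))\<close> taken at \<open>s\<^sub>1 x\<close>. For the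
  second, \<open>X\<close> denotes \<open>D\<^sub>2 s\<^sub>1 D\<^sub>2\<close>, and the composite
  of \<open>X\<close> with \<open>s\<^sub>1 D\<^sub>1\<close> is computed in two ways.\<close>

lemma
  assumes "abelian_group N"
    and s\<^sub>1: "s\<^sub>1 \<in> linear_maps \<Z> (zmod N) (zmod N)" and D\<^sub>1: "D\<^sub>1 \<in> linear_maps \<Z> (zmod N) (zmod N)"
    and s\<^sub>2: "s\<^sub>2 \<in> linear_maps \<Z> (zmod N) (zmod N)" and D\<^sub>2: "D\<^sub>2 \<in> linear_maps \<Z> (zmod N) (zmod N)"
    and S: "HS_single N s\<^sub>1 D\<^sub>1" "HS_single N s\<^sub>2 D\<^sub>2" and B: "HS_braid N s\<^sub>1 D\<^sub>1 s\<^sub>2 D\<^sub>2"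
    and x: "x \<in> carrier N"
  shows HS_sDs: "s\<^sub>1 (D\<^sub>2 (s\<^sub>1 x)) = s\<^sub>2 (D\<^sub>1 (s\<^sub>2 x))"
    and HS_DDD: "D\<^sub>2 (D\<^sub>1 (D\<^sub>2 x)) = D\<^sub>1 (D\<^sub>2 (D\<^sub>1 x))"
proof -
  interpret N: abelian_group N by fact
  note cl [simp] = linear_closed[OF s\<^sub>1, simplified] linear_closed[OF s\<^sub>2, simplified]
    linear_closed[OF D\<^sub>1, simplified] linear_closed[OF D\<^sub>2, simplified]
  note ad = linear_add[OF s\<^sub>1, simplified] linear_add[OF s\<^sub>2, simplified]
    linear_add[OF D\<^sub>1, simplified] linear_add[OF D\<^sub>2, simplified]
  have ss: "s\<^sub>1 (s\<^sub>1 y) = y" "s\<^sub>2 (s\<^sub>2 y) = y" and DD: "D\<^sub>1 (D\<^sub>1 y) = D\<^sub>1 y" "D\<^sub>2 (D\<^sub>2 y) = D\<^sub>2 y"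
    and sD: "s\<^sub>1 (D\<^sub>1 y) \<oplus>\<^bsub>N\<^esub> D\<^sub>1 (s\<^sub>1 y) = s\<^sub>1 y \<ominus>\<^bsub>N\<^esub> y"
    and Dss: "D\<^sub>1 (s\<^sub>2 (s\<^sub>1 y)) = s\<^sub>2 (s\<^sub>1 (D\<^sub>2 y))"
    and DsD: "D\<^sub>2 (s\<^sub>1 (D\<^sub>2 y)) = s\<^sub>1 (D\<^sub>2 (D\<^sub>1 y)) \<oplus>\<^bsub>N\<^esub> D\<^sub>1 (D\<^sub>2 (s\<^sub>1 y)) \<oplus>\<^bsub>N\<^esub> s\<^sub>1 (D\<^sub>2 (s\<^sub>1 y))"
    if "y \<in> carrier N" for y
    using S B that by (simp_all add: HS_single_def HS_braid_def)
  show "s\<^sub>1 (D\<^sub>2 (s\<^sub>1 x)) = s\<^sub>2 (D\<^sub>1 (s\<^sub>2 x))"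
    using Dss[of "s\<^sub>1 x"] x by (simp add: ss)
  define X where "X y = D\<^sub>2 (s\<^sub>1 (D\<^sub>2 y))" for y
  have Xcl [simp]: "X y \<in> carrier N" if "y \<in> carrier N" for y
    using that by (simp add: X_def)
  have Xad: "X (y \<oplus>\<^bsub>N\<^esub> z) = X y \<oplus>\<^bsub>N\<^esub> X z" if "y \<in> carrier N" "z \<in> carrier N" for y z
    using that by (simp add: X_def ad)
  \<comment> \<open>\<open>D\<^sub>2\<close> is idempotent, so applying it to the relation for
    \<open>X\<close> leaves the left side unchanged.\<close>
  have DX: "X y = X (D\<^sub>1 y) \<oplus>\<^bsub>N\<^esub> D\<^sub>2 (D\<^sub>1 (D\<^sub>2 (s\<^sub>1 y))) \<oplus>\<^bsub>N\<^esub> X (s\<^sub>1 y)" if y: "y \<in> carrier N" for y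
  proof -
    have "X y = D\<^sub>2 (X y)"
      using y by (simp add: X_def DD)
    also have "\<dots> = X (D\<^sub>1 y) \<oplus>\<^bsub>N\<^esub> D\<^sub>2 (D\<^sub>1 (D\<^sub>2 (s\<^sub>1 y))) \<oplus>\<^bsub>N\<^esub> X (s\<^sub>1 y)"
      unfolding X_def using y by (subst DsD) (simp_all add: ad)
    finally show ?thesis .
  qed
  have D1sD: "D\<^sub>1 (s\<^sub>1 (D\<^sub>1 x)) = \<ominus>\<^bsub>N\<^esub> D\<^sub>1 x"
  proof -
    have "s\<^sub>1 (D\<^sub>1 x) \<oplus>\<^bsub>N\<^esub> D\<^sub>1 (s\<^sub>1 (D\<^sub>1 x)) = s\<^sub>1 (D\<^sub>1 x) \<oplus>\<^bsub>N\<^esub> \<ominus>\<^bsub>N\<^esub> D\<^sub>1 x"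
      using sD[of "D\<^sub>1 x"] x by (simp add: DD a_minus_def)
    then show ?thesis
      using x by simp
  qed
  have D2neg: "s\<^sub>1 (D\<^sub>2 (\<ominus>\<^bsub>N\<^esub> y)) = \<ominus>\<^bsub>N\<^esub> s\<^sub>1 (D\<^sub>2 y)" if y: "y \<in> carrier N" for y
  proof -
    note z = module_zmod[OF N.abelian_group_axioms, THEN module.axioms(2)]
    show ?thesis
      using linear_a_inv[OF linear_comp[OF D\<^sub>2 s\<^sub>1] z z, of y] y by (simp add: a_inv_def m_inv_def)
  qed
  \<comment> \<open>The first evaluation: the relation for \<open>X\<close> at
    \<open>s\<^sub>1 (D\<^sub>1 x)\<close>, where
    \<open>D\<^sub>1 s\<^sub>1 D\<^sub>1 = - D\<^sub>1\<close> cancels two of the three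
    terms.\<close>
  have XsD: "X (s\<^sub>1 (D\<^sub>1 x)) = D\<^sub>1 (D\<^sub>2 (D\<^sub>1 x))"
  proof -
    have "X (s\<^sub>1 (D\<^sub>1 x)) = \<ominus>\<^bsub>N\<^esub> s\<^sub>1 (D\<^sub>2 (D\<^sub>1 x)) \<oplus>\<^bsub>N\<^esub> D\<^sub>1 (D\<^sub>2 (D\<^sub>1 x)) \<oplus>\<^bsub>N\<^esub> s\<^sub>1 (D\<^sub>2 (D\<^sub>1 x))"
      unfolding X_def using x by (simp add: DsD ss D1sD D2neg)
    then show ?thesis
      using x by (simp add: N.add.m_ac N.r_neg)
  qed
  \<comment> \<open>The second evaluation:
    \<open>1 + s\<^sub>1 D\<^sub>1 + D\<^sub>1 s\<^sub>1 = s\<^sub>1\<close>, and \<open>DX\<close>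
    at \<open>s\<^sub>1 x\<close> expresses \<open>X (s\<^sub>1 x)\<close> through
    \<open>D\<^sub>2 D\<^sub>1 D\<^sub>2\<close>.\<close>
  have "X x \<oplus>\<^bsub>N\<^esub> X (D\<^sub>1 (s\<^sub>1 x)) \<oplus>\<^bsub>N\<^esub> X (s\<^sub>1 (D\<^sub>1 x)) = X (x \<oplus>\<^bsub>N\<^esub> (s\<^sub>1 (D\<^sub>1 x) \<oplus>\<^bsub>N\<^esub> D\<^sub>1 (s\<^sub>1 x)))"
    using x by (simp add: Xad N.add.m_ac)
  also have "\<dots> = X (s\<^sub>1 x)"
    unfolding sD[OF x] using x N.add.m_lcomm[of x "s\<^sub>1 x" "\<ominus>\<^bsub>N\<^esub> x"]
    by (simp add: a_minus_def N.r_neg)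
  also have "\<dots> = X x \<oplus>\<^bsub>N\<^esub> X (D\<^sub>1 (s\<^sub>1 x)) \<oplus>\<^bsub>N\<^esub> D\<^sub>2 (D\<^sub>1 (D\<^sub>2 x))"
    using DX[of "s\<^sub>1 x"] x by (simp add: ss N.add.m_ac)
  finally show "D\<^sub>2 (D\<^sub>1 (D\<^sub>2 x)) = D\<^sub>1 (D\<^sub>2 (D\<^sub>1 x))"
    using x by (simp add: XsD)
qed

context tensor_product
begin

lemma zpure_simps:
  "\<lbrakk>u \<in> carrier U; u' \<in> carrier U; v \<in> carrier V\<rbrakk> \<Longrightarrow>
    zpure U V (u \<oplus>\<^bsub>U\<^esub> u') v = zpure U V u v \<oplus>\<^bsub>ztensor U V\<^esub> zpure U V u' v"
  "\<lbrakk>u \<in> carrier U; v \<in> carrier V; v' \<in> carrier V\<rbrakk> \<Longrightarrow>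
    zpure U V u (v \<oplus>\<^bsub>V\<^esub> v') = zpure U V u v \<oplus>\<^bsub>ztensor U V\<^esub> zpure U V u v'"
  "\<lbrakk>u \<in> carrier U; v \<in> carrier V\<rbrakk> \<Longrightarrow> zpure U V u v \<in> carrier (ztensor U V)"
  by (rule biadditive_left[OF biadditive_zpure], assumption+)
    (rule biadditive_right[OF biadditive_zpure], assumption+, rule zpure_closed)

lemma linear_additive_ztensor:
  "f \<in> linear_maps R (ztensor U V) (ztensor U V) \<Longrightarrow> f \<in> linear_maps \<Z> (zmod (ztensor U V)) (zmod (ztensor U V))"
  by (rule linear_imp_additive[OF _ abelian_ztensor abelian_ztensor])

text \<open>The square of \<open>s \<otimes> t + a (D \<otimes> 1)\<close> is \<open>1 \<otimes> t t
  + a ((s D + D s) \<otimes> t) + a a (D \<otimes> 1)\<close>. The term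
  \<open>- a (1 \<otimes> t)\<close> from \<open>s D + D s = s - 1\<close> cancels against
  \<open>t t = a t + q\<close>.\<close>

lemma twist_quadratic:
  assumes s: "s \<in> linear_maps \<Z> (zmod U) (zmod U)" and D: "D \<in> linear_maps \<Z> (zmod U) (zmod U)"
    and t: "t \<in> linear_maps R V V" and a: "a \<in> carrier R" and q: "q \<in> carrier R"
    and S: "HS_single U s D"
    and Q: "\<And>v. v \<in> carrier V \<Longrightarrow> t (t v) = a \<odot>\<^bsub>V\<^esub> t v \<oplus>\<^bsub>V\<^esub> q \<odot>\<^bsub>V\<^esub> v"
    and z: "z \<in> carrier (ztensor U V)"
  shows "twist U V s t D a (twist U V s t D a z) =
    a \<odot>\<^bsub>ztensor U V\<^esub> twist U V s t D a z \<oplus>\<^bsub>ztensor U V\<^esub> q \<odot>\<^bsub>ztensor U V\<^esub> z"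
proof -
  interpret W: module R "ztensor U V" by (rule module_ztensor)
  note T = twist_linear[OF s t D a] and Tp = twist_zpure[OF s t D a]
  note add = linear_additive_ztensor
  show ?thesis
  proof (rule ztensor_ext[OF add[OF linear_comp[OF T T]] add[OF linear_maps_add[OF linear_maps_smult[OF T a]
          linear_maps_smult[OF linear_id q]]] abelian_ztensor _ z]; (rule module_ztensor)?)
    fix u v assume u: "u \<in> carrier U" and v: "v \<in> carrier V"
    note [simp] = linear_closed[OF s, simplified] linear_closed[OF D, simplified] linear_closed[OF t] u v a q
    let ?p = "zpure U V"
    have sD: "s (D u) \<oplus>\<^bsub>U\<^esub> D (s u) = s u \<ominus>\<^bsub>U\<^esub> u" "s (s u) = u" "D (D u) = D u"
      using S by (simp_all add: HS_single_def)
    \<comment> \<open>The mixed relation is solved for \<open>s u\<close>, so that the computation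
      involves sums only and can be finished by reordering.\<close>
    have "s u = (s (D u) \<oplus>\<^bsub>U\<^esub> D (s u)) \<oplus>\<^bsub>U\<^esub> u"
      by (simp add: sD a_minus_def U.a_assoc U.l_neg)
    then have p: "?p (s u) w = ?p (s (D u)) w \<oplus>\<^bsub>ztensor U V\<^esub> ?p (D (s u)) w \<oplus>\<^bsub>ztensor U V\<^esub> ?p u w"
      if "w \<in> carrier V" for w
      using that by (metis (no_types, lifting) zpure_simps(1) U.a_closed linear_closed[OF s, simplified]
          linear_closed[OF D, simplified] u)
    have "twist U V s t D a (twist U V s t D a (?p u v)) =
      ?p u (a \<odot>\<^bsub>V\<^esub> t v) \<oplus>\<^bsub>ztensor U V\<^esub> ?p u (q \<odot>\<^bsub>V\<^esub> v) \<oplus>\<^bsub>ztensor U V\<^esub> ?p (D (s u)) (a \<odot>\<^bsub>V\<^esub> t v) \<oplus>\<^bsub>ztensor U V\<^esub>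
      (?p (s (D u)) (a \<odot>\<^bsub>V\<^esub> t v) \<oplus>\<^bsub>ztensor U V\<^esub> ?p (D u) (a \<odot>\<^bsub>V\<^esub> (a \<odot>\<^bsub>V\<^esub> v)))"
      by (simp add: Tp linear_add[OF T] zpure_simps linear_smult[OF t] Q sD)
    also have "\<dots> = ?p (s u) (a \<odot>\<^bsub>V\<^esub> t v) \<oplus>\<^bsub>ztensor U V\<^esub> ?p (D u) (a \<odot>\<^bsub>V\<^esub> (a \<odot>\<^bsub>V\<^esub> v)) \<oplus>\<^bsub>ztensor U V\<^esub> ?p u (q \<odot>\<^bsub>V\<^esub> v)"
      by (simp add: p zpure_simps(3) W.M.add.m_ac)
    also have "\<dots> = a \<odot>\<^bsub>ztensor U V\<^esub> twist U V s t D a (?p u v) \<oplus>\<^bsub>ztensor U V\<^esub> q \<odot>\<^bsub>ztensor U V\<^esub> ?p u v"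
      by (simp add: Tp W.smult_r_distr zpure_simps(3) ztensor_smult_zpure)
    finally show "twist U V s t D a (twist U V s t D a (?p u v)) =
      a \<odot>\<^bsub>ztensor U V\<^esub> twist U V s t D a (?p u v) \<oplus>\<^bsub>ztensor U V\<^esub> q \<odot>\<^bsub>ztensor U V\<^esub> ?p u v" .
  qed
qed

text \<open>The product has eight terms. In one of them \<open>t\<^sub>1 t\<^sub>1\<close> is
  replaced by \<open>a t\<^sub>1 + q\<close>; then three terms belong to
  \<open>a a t\<^sub>1\<close>, and their first factors add up to
  \<open>D\<^sub>2 s\<^sub>1 D\<^sub>2\<close>. The remaining seven terms have a shape suited to
  exchanging the indices.\<close>

lemma twist_triple:
  assumes s\<^sub>1: "s\<^sub>1 \<in> linear_maps \<Z> (zmod U) (zmod U)" and D\<^sub>1: "D\<^sub>1 \<in> linear_maps \<Z> (zmod U) (zmod U)"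
    and s\<^sub>2: "s\<^sub>2 \<in> linear_maps \<Z> (zmod U) (zmod U)" and D\<^sub>2: "D\<^sub>2 \<in> linear_maps \<Z> (zmod U) (zmod U)"
    and t\<^sub>1: "t\<^sub>1 \<in> linear_maps R V V" and t\<^sub>2: "t\<^sub>2 \<in> linear_maps R V V"
    and a: "a \<in> carrier R" and q: "q \<in> carrier R" and B: "HS_braid U s\<^sub>1 D\<^sub>1 s\<^sub>2 D\<^sub>2"
    and Q: "t\<^sub>1 (t\<^sub>1 v) = a \<odot>\<^bsub>V\<^esub> t\<^sub>1 v \<oplus>\<^bsub>V\<^esub> q \<odot>\<^bsub>V\<^esub> v"
    and u: "u \<in> carrier U" and v: "v \<in> carrier V"
  defines "A\<^sub>1 \<equiv> twist U V s\<^sub>1 t\<^sub>1 D\<^sub>1 a" and "A\<^sub>2 \<equiv> twist U V s\<^sub>2 t\<^sub>2 D\<^sub>2 a"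
  shows "A\<^sub>1 (A\<^sub>2 (A\<^sub>1 (zpure U V u v))) =
    zpure U V (s\<^sub>1 (s\<^sub>2 (s\<^sub>1 u))) (t\<^sub>1 (t\<^sub>2 (t\<^sub>1 v))) \<oplus>\<^bsub>ztensor U V\<^esub>
    zpure U V (D\<^sub>1 (s\<^sub>2 (s\<^sub>1 u))) (a \<odot>\<^bsub>V\<^esub> t\<^sub>2 (t\<^sub>1 v)) \<oplus>\<^bsub>ztensor U V\<^esub>
    zpure U V (s\<^sub>1 (s\<^sub>2 (D\<^sub>1 u))) (a \<odot>\<^bsub>V\<^esub> t\<^sub>1 (t\<^sub>2 v)) \<oplus>\<^bsub>ztensor U V\<^esub>
    zpure U V (D\<^sub>2 (s\<^sub>1 (D\<^sub>2 u))) (a \<odot>\<^bsub>V\<^esub> (a \<odot>\<^bsub>V\<^esub> t\<^sub>1 v)) \<oplus>\<^bsub>ztensor U V\<^esub>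
    zpure U V (D\<^sub>1 (s\<^sub>2 (D\<^sub>1 u))) (a \<odot>\<^bsub>V\<^esub> (a \<odot>\<^bsub>V\<^esub> t\<^sub>2 v)) \<oplus>\<^bsub>ztensor U V\<^esub>
    zpure U V (s\<^sub>1 (D\<^sub>2 (s\<^sub>1 u))) (a \<odot>\<^bsub>V\<^esub> (q \<odot>\<^bsub>V\<^esub> v)) \<oplus>\<^bsub>ztensor U V\<^esub>
    zpure U V (D\<^sub>1 (D\<^sub>2 (D\<^sub>1 u))) (a \<odot>\<^bsub>V\<^esub> (a \<odot>\<^bsub>V\<^esub> (a \<odot>\<^bsub>V\<^esub> v)))"
proof -
  interpret W: module R "ztensor U V" by (rule module_ztensor)
  note [simp] = linear_closed[OF s\<^sub>1, simplified] linear_closed[OF D\<^sub>1, simplified] linear_closed[OF t\<^sub>1] u v a q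
    linear_closed[OF s\<^sub>2, simplified] linear_closed[OF D\<^sub>2, simplified] linear_closed[OF t\<^sub>2]
  note T = twist_linear[OF s\<^sub>1 t\<^sub>1 D\<^sub>1 a, folded A\<^sub>1_def] twist_linear[OF s\<^sub>2 t\<^sub>2 D\<^sub>2 a, folded A\<^sub>2_def]
  note Tp = twist_zpure[OF s\<^sub>1 t\<^sub>1 D\<^sub>1 a, folded A\<^sub>1_def] twist_zpure[OF s\<^sub>2 t\<^sub>2 D\<^sub>2 a, folded A\<^sub>2_def]
  have "D\<^sub>2 (s\<^sub>1 (D\<^sub>2 u)) = s\<^sub>1 (D\<^sub>2 (D\<^sub>1 u)) \<oplus>\<^bsub>U\<^esub> D\<^sub>1 (D\<^sub>2 (s\<^sub>1 u)) \<oplus>\<^bsub>U\<^esub> s\<^sub>1 (D\<^sub>2 (s\<^sub>1 u))"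
    using B by (simp add: HS_braid_def)
  then show ?thesis
    by (simp add: Tp linear_add[OF T(1)] linear_add[OF T(2)] zpure_simps linear_smult[OF t\<^sub>1] linear_smult[OF t\<^sub>2]
        Q V.smult_r_distr W.M.add.m_ac)
qed

text \<open>Modulo the relations, exchanging the indices 1 and 2 permutes the seven terms of
  \<open>twist_triple\<close>: two pairs are interchanged and three terms are fixed. The identities
  \<open>HS_sDs\<close> and \<open>HS_DDD\<close> account for two of the fixed terms.\<close>

lemma twist_braid:
  assumes s\<^sub>1: "s\<^sub>1 \<in> linear_maps \<Z> (zmod U) (zmod U)" and D\<^sub>1: "D\<^sub>1 \<in> linear_maps \<Z> (zmod U) (zmod U)"
    and s\<^sub>2: "s\<^sub>2 \<in> linear_maps \<Z> (zmod U) (zmod U)" and D\<^sub>2: "D\<^sub>2 \<in> linear_maps \<Z> (zmod U) (zmod U)"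
    and t\<^sub>1: "t\<^sub>1 \<in> linear_maps R V V" and t\<^sub>2: "t\<^sub>2 \<in> linear_maps R V V"
    and a: "a \<in> carrier R" and q: "q \<in> carrier R"
    and S: "HS_single U s\<^sub>1 D\<^sub>1" "HS_single U s\<^sub>2 D\<^sub>2"
    and B: "HS_braid U s\<^sub>1 D\<^sub>1 s\<^sub>2 D\<^sub>2" "HS_braid U s\<^sub>2 D\<^sub>2 s\<^sub>1 D\<^sub>1"
    and Q: "\<And>v. v \<in> carrier V \<Longrightarrow> t\<^sub>1 (t\<^sub>1 v) = a \<odot>\<^bsub>V\<^esub> t\<^sub>1 v \<oplus>\<^bsub>V\<^esub> q \<odot>\<^bsub>V\<^esub> v"
      "\<And>v. v \<in> carrier V \<Longrightarrow> t\<^sub>2 (t\<^sub>2 v) = a \<odot>\<^bsub>V\<^esub> t\<^sub>2 v \<oplus>\<^bsub>V\<^esub> q \<odot>\<^bsub>V\<^esub> v"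
      "\<And>v. v \<in> carrier V \<Longrightarrow> t\<^sub>1 (t\<^sub>2 (t\<^sub>1 v)) = t\<^sub>2 (t\<^sub>1 (t\<^sub>2 v))"
    and z: "z \<in> carrier (ztensor U V)"
  defines "A\<^sub>1 \<equiv> twist U V s\<^sub>1 t\<^sub>1 D\<^sub>1 a" and "A\<^sub>2 \<equiv> twist U V s\<^sub>2 t\<^sub>2 D\<^sub>2 a"
  shows "A\<^sub>1 (A\<^sub>2 (A\<^sub>1 z)) = A\<^sub>2 (A\<^sub>1 (A\<^sub>2 z))"
proof -
  interpret W: module R "ztensor U V" by (rule module_ztensor)
  note T = twist_linear[OF s\<^sub>1 t\<^sub>1 D\<^sub>1 a, folded A\<^sub>1_def] twist_linear[OF s\<^sub>2 t\<^sub>2 D\<^sub>2 a, folded A\<^sub>2_def]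
  note C = linear_comp[OF linear_comp]
  show ?thesis
  proof (rule ztensor_ext[OF linear_additive_ztensor[OF C[OF T(1) T(2) T(1)]]
        linear_additive_ztensor[OF C[OF T(2) T(1) T(2)]] abelian_ztensor _ z])
    fix u v assume u: "u \<in> carrier U" and v: "v \<in> carrier V"
    note [simp] = linear_closed[OF s\<^sub>1, simplified] linear_closed[OF D\<^sub>1, simplified] linear_closed[OF t\<^sub>1] u v a q
      linear_closed[OF s\<^sub>2, simplified] linear_closed[OF D\<^sub>2, simplified] linear_closed[OF t\<^sub>2]
    have br: "s\<^sub>1 (s\<^sub>2 (s\<^sub>1 u)) = s\<^sub>2 (s\<^sub>1 (s\<^sub>2 u))" "D\<^sub>1 (s\<^sub>2 (s\<^sub>1 u)) = s\<^sub>2 (s\<^sub>1 (D\<^sub>2 u))"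
      "D\<^sub>2 (s\<^sub>1 (s\<^sub>2 u)) = s\<^sub>1 (s\<^sub>2 (D\<^sub>1 u))"
      using B u by (simp_all add: HS_braid_def)
    note triple = twist_triple[OF s\<^sub>1 D\<^sub>1 s\<^sub>2 D\<^sub>2 t\<^sub>1 t\<^sub>2 a q B(1) Q(1)[OF v] u v]
      twist_triple[OF s\<^sub>2 D\<^sub>2 s\<^sub>1 D\<^sub>1 t\<^sub>2 t\<^sub>1 a q B(2) Q(2)[OF v] u v]
    show "A\<^sub>1 (A\<^sub>2 (A\<^sub>1 (zpure U V u v))) = A\<^sub>2 (A\<^sub>1 (A\<^sub>2 (zpure U V u v)))"
      unfolding A\<^sub>1_def A\<^sub>2_def triple
        br Q(3)[OF v] HS_DDD[OF U.abelian_group_axioms s\<^sub>1 D\<^sub>1 s\<^sub>2 D\<^sub>2 S B(1) u]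
        HS_sDs[OF U.abelian_group_axioms s\<^sub>1 D\<^sub>1 s\<^sub>2 D\<^sub>2 S B(1) u]
      by (simp add: zpure_simps(3) W.M.add.m_ac)
  qed
qed

end

section \<open>Comparison of the module structures\<close>

text \<open>\<open>pres_structure\<close> reads scalars and operators on the carrier only. If they
  agree there, the predicates are equal, hence the chosen modules are the same record and not merely
  isomorphic.\<close>

lemma pres_module_cong:
  assumes "carrier N = carrier N'" "zero N = zero N'" "add N = add N'"
    and "\<forall>c\<in>carrier R. \<forall>x\<in>carrier N'. c \<odot>\<^bsub>N\<^esub> x = c \<odot>\<^bsub>N'\<^esub> x"
    and "\<And>g x. \<lbrakk>g \<in> G; x \<in> carrier N'\<rbrakk> \<Longrightarrow> t g x = t' g x"
  shows "pres_module R G S N t = pres_module R G S N' t'"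
proof -
  have "pres_structure R G S N t = pres_structure R G S N' t'"
    using assms by (auto simp: fun_eq_iff pres_structure_def)
  then show ?thesis
    by (simp add: pres_module_def)
qed

text \<open>The modules from which \<open>F_functor\<close> forms its tensor product are known only
  on their carriers; agreement there passes to the tensor product and its maps.\<close>

lemma (in tensor_product) ztensor_cong:
  fixes U' :: "('u, 'h) ring_scheme" and V' :: "('k, 'v, 'i) module_scheme"
  assumes U': "carrier U' = carrier U" "zero U' = zero U" "add U' = add U"
    and V': "carrier V' = carrier V" "zero V' = zero V" "add V' = add V"
    and smult: "\<forall>c\<in>carrier R. \<forall>v\<in>carrier V. c \<odot>\<^bsub>V'\<^esub> v = c \<odot>\<^bsub>V\<^esub> v"
  shows "carrier (ztensor U' V') = carrier (ztensor U V)" "zero (ztensor U' V') = zero (ztensor U V)"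
    and "add (ztensor U' V') = add (ztensor U V)"
    and "\<forall>c\<in>carrier R. \<forall>z\<in>carrier (ztensor U V). c \<odot>\<^bsub>ztensor U' V'\<^esub> z = c \<odot>\<^bsub>ztensor U V\<^esub> z"
    and "\<And>f g f' g' z. \<lbrakk>z \<in> carrier (ztensor U V);
      \<And>u. u \<in> carrier U \<Longrightarrow> f u \<in> carrier U; \<And>v. v \<in> carrier V \<Longrightarrow> g v \<in> carrier V;
      \<And>u. u \<in> carrier U \<Longrightarrow> f' u = f u; \<And>v. v \<in> carrier V \<Longrightarrow> g' v = g v\<rbrakk> \<Longrightarrow>
      zmap U' V' f' g' z = zmap U V f g z"
proof -
  have z: "zmod U' = zmod U" "zmod V' = zmod V"
    using U' V' by (intro zmod_cong; simp)+
  have p: "zpure U' V' = zpure U V"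
    by (simp add: zpure_def z)
  show c: "carrier (ztensor U' V') = carrier (ztensor U V)" "zero (ztensor U' V') = zero (ztensor U V)"
    "add (ztensor U' V') = add (ztensor U V)"
    by (simp_all add: ztensor_simps z)
  show "\<forall>c\<in>carrier R. \<forall>z\<in>carrier (ztensor U V). c \<odot>\<^bsub>ztensor U' V'\<^esub> z = c \<odot>\<^bsub>ztensor U V\<^esub> z"
  proof (intro ballI)
    fix c z assume cz: "c \<in> carrier R" "z \<in> carrier (ztensor U V)"
    have "zpure U V u (c \<odot>\<^bsub>V\<^esub> v) \<in> carrier (tensor \<Z> (zmod U) (zmod V))" if "u \<in> carrier U" "v \<in> carrier V" for u v
      using zpure_closed[of u "c \<odot>\<^bsub>V\<^esub> v"] that cz by (simp add: ztensor_simps)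
    then have "lift \<Z> (tensor \<Z> (zmod U) (zmod V)) (\<lambda>(u, v). zpure U V u (c \<odot>\<^bsub>V'\<^esub> v)) z =
        lift \<Z> (tensor \<Z> (zmod U) (zmod V)) (\<lambda>(u, v). zpure U V u (c \<odot>\<^bsub>V\<^esub> v)) z"
      using cz
      by (intro Z.lift_cong[OF _ _ _ module_tensor]) (auto simp: smult ztensor_simps tensor_eq)
    then show "c \<odot>\<^bsub>ztensor U' V'\<^esub> z = c \<odot>\<^bsub>ztensor U V\<^esub> z"
      by (simp add: ztensor_simps(4) p z)
  qed
  fix f g f' g' z
  assume "z \<in> carrier (ztensor U V)"
    and "\<And>u. u \<in> carrier U \<Longrightarrow> f u \<in> carrier U" "\<And>v. v \<in> carrier V \<Longrightarrow> g v \<in> carrier V"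
    and "\<And>u. u \<in> carrier U \<Longrightarrow> f' u = f u" "\<And>v. v \<in> carrier V \<Longrightarrow> g' v = g v"
  then show "zmap U' V' f' g' z = zmap U V f g z"
    unfolding zmap_def p zmod_cong[OF c]
    by (intro ztensor_lift_cong[OF _ abelian_ztensor]) (simp_all add: zpure_closed)
qed

text \<open>The relations pull back along an injective linear map that intertwines the
  operators.\<close>

lemma Hecke_action_transport:
  assumes H: "Hecke_action R q n N' t'" and "module R N" "module R N'" and q: "q \<in> carrier R"
    and f: "f \<in> linear_maps R N N'" "inj_on f (carrier N)"
    and t: "\<And>i x. \<lbrakk>i \<in> {1..<n}; x \<in> carrier N\<rbrakk> \<Longrightarrow> t i x \<in> carrier N"
    and comm: "\<And>i x. \<lbrakk>i \<in> {1..<n}; x \<in> carrier N\<rbrakk> \<Longrightarrow> f (t i x) = t' i (f x)"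
  shows "Hecke_action R q n N t"
proof -
  interpret N: module R N by fact
  have a: "\<one>\<^bsub>R\<^esub> \<ominus>\<^bsub>R\<^esub> q \<in> carrier R"
    using q N.R.minus_closed by simp
  note inj = inj_onD[OF f(2)]
  show ?thesis
    unfolding Hecke_action_def
  proof (intro ballI conjI impI)
    fix x i assume x: "x \<in> carrier N" and i: "i \<in> {1..<n}"
    note H' = H[unfolded Hecke_action_def, rule_format, OF linear_closed[OF f(1) x] i]
    show "t i (t i x) = (\<one>\<^bsub>R\<^esub> \<ominus>\<^bsub>R\<^esub> q) \<odot>\<^bsub>N\<^esub> t i x \<oplus>\<^bsub>N\<^esub> q \<odot>\<^bsub>N\<^esub> x"
      by (rule inj) (use H' x i a q in \<open>simp_all add: t comm linear_add[OF f(1)] linear_smult[OF f(1)] del: One_nat_def\<close>)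
    fix j assume j: "j \<in> {1..<n}"
    {
      assume "\<bar>int i - int j\<bar> = 1"
      then show "t i (t j (t i x)) = t j (t i (t j x))"
        by (intro inj) (use H' x i j in \<open>simp_all add: t comm del: One_nat_def\<close>)
    next
      assume "\<bar>int i - int j\<bar> > 1"
      then show "t i (t j x) = t j (t i x)"
        by (intro inj) (use H' x i j in \<open>simp_all add: t comm del: One_nat_def\<close>)
    }
  qed
qed

lemma
  assumes N: "module R N" and q: "q \<in> carrier R"
    and t: "\<And>i. i \<in> {1..<n} \<Longrightarrow> t i \<in> linear_maps R N N" and H: "Hecke_action R q n N t"
  shows presented_action_Hecke: "presented_action R {1..<n} N t (Hecke_rels R q n)"
    and pres_structure_Hecke: "pres_structure R {1..<n} (Hecke_rels R q n) N t (Hecke_module R q n N t)"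
proof -
  interpret N: module R N by fact
  interpret generator_action R "{1..<n}" N t
    by (intro generator_action.intro generator_action_axioms.intro free_algebra_over.intro
        N t N.R.is_cring)
  show P: "presented_action R {1..<n} N t (Hecke_rels R q n)"
    by (intro presented_action.intro algebra_presentation.intro algebra_presentation_axioms.intro
        generator_action_axioms free_algebra_over_axioms Hecke_rels_closed N.R.is_cring q)
  show "pres_structure R {1..<n} (Hecke_rels R q n) N t (Hecke_module R q n N t)"
    by (rule presented_action.pres_structure_pres_module[OF P])
      (rule Hecke_action_evaluate[OF generator_action_axioms q H])
qed

lemma HS_action_simps [simp]:
  "HS_action U s D n (GenS i) = at_factors \<Z> U n s i"
  "HS_action U s D n (GenD i) = at_factors \<Z> U n D i"
  by (simp_all add: HS_action_def)

lemma
  assumes "module \<Z> U" and s: "s \<in> linear_maps \<Z> (tpow \<Z> U 2) (tpow \<Z> U 2)"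
    and D: "D \<in> linear_maps \<Z> (tpow \<Z> U 2) (tpow \<Z> U 2)"
  shows generator_action_HS: "generator_action \<Z> (HS_gens n) (tpow \<Z> U n) (HS_action U s D n)"
    and presented_action_HS: "presented_action \<Z> (HS_gens n) (tpow \<Z> U n) (HS_action U s D n) (HS_rels n)"
proof -
  interpret module \<Z> U by fact
  have "HS_action U s D n g \<in> linear_maps \<Z> (tpow \<Z> U n) (tpow \<Z> U n)" if "g \<in> HS_gens n" for g
    using that at_factors_linear[OF s] at_factors_linear[OF D] by (auto simp: HS_gens_def)
  then show G: "generator_action \<Z> (HS_gens n) (tpow \<Z> U n) (HS_action U s D n)"
    by (intro generator_action.intro generator_action_axioms.intro free_algebra_over.intro
        module_tpow int_is_cring)
  show "presented_action \<Z> (HS_gens n) (tpow \<Z> U n) (HS_action U s D n) (HS_rels n)"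
    by (intro presented_action.intro algebra_presentation.intro algebra_presentation_axioms.intro
        free_algebra_over.intro G HS_rels_closed int_is_cring)
qed

locale braided_HS3 = tensor_powers R U V
  for R :: "('k, 'e) ring_scheme" and U :: "(int, 'u) module" and V :: "('k, 'v) module" +
  fixes q :: 'k and s D :: "('u list \<Rightarrow> int) set \<Rightarrow> ('u list \<Rightarrow> int) set"
    and \<Psi> :: "('v list \<Rightarrow> 'k) set \<Rightarrow> ('v list \<Rightarrow> 'k) set"
  assumes q: "q \<in> carrier R" and HS3: "HS3_structure U s D" and braiding: "quadratic_braiding R q V \<Psi>"
begin

lemma
  shows s_linear: "s \<in> linear_maps \<Z> (Upow 2) (Upow 2)"
    and D_linear: "D \<in> linear_maps \<Z> (Upow 2) (Upow 2)"
    and Psi_linear: "\<Psi> \<in> linear_maps R (Vpow 2) (Vpow 2)"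
  using HS3 braiding by (simp_all add: HS3_structure_def quadratic_braiding_def)

definition a :: 'k where "a = \<one>\<^bsub>R\<^esub> \<ominus>\<^bsub>R\<^esub> q"

lemma a_closed: "a \<in> carrier R"
  unfolding a_def using q V.R.minus_closed by simp

text \<open>The hypothesis provides only the existence of a module over the presented algebra; here
  it is turned into identities of operators.\<close>

lemma HS_action_three:
  "HS_action_on (Upow 3) 3 (at_factors \<Z> U 3 s) (at_factors \<Z> U 3 D)"
proof -
  obtain M where M: "pres_structure \<Z> (HS_gens 3) (HS_rels 3) (Upow 3) (HS_action U s D 3) M"
    using HS3 by (auto simp: HS3_structure_def)
  show ?thesis
    using presented_action.pres_structure_rel[OF presented_action_HS[OF U.module_axioms s_linear D_linear] M]
      HS_action_evaluate[OF generator_action_HS[OF U.module_axioms s_linear D_linear, of 3]]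
    unfolding HS_action_simps by blast
qed

lemma HS_single_two: "HS_single (Upow 2) s D"
proof -
  interpret S: tensor_square U
    by (intro tensor_square.intro int_module.intro U.module_axioms)
  show ?thesis
    using HS_action_three by (intro S.HS_single_square s_linear D_linear) (simp add: HS_action_on_def)
qed

text \<open>This justifies the choice in \<open>HS_power\<close>: the required module structure
  exists for \<open>n \<ge> 3\<close>.\<close>

lemma pres_structure_HS_power:
  assumes "n \<ge> 3"
  shows "pres_structure \<Z> (HS_gens n) (HS_rels n) (Upow n) (HS_action U s D n) (HS_power U s D n)"
proof -
  interpret I: int_module U
    by (rule int_module.intro) (rule U.module_axioms)
  note G = generator_action_HS[OF U.module_axioms s_linear D_linear, of n]
  have "\<forall>r\<in>HS_rels n. \<forall>x\<in>carrier (Upow n). evaluate \<Z> (Upow n) (HS_action U s D n) r x = \<zero>\<^bsub>Upow n\<^esub>"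
    using I.HS_action_at_factors[OF s_linear D_linear HS_action_three assms]
    by (subst HS_action_evaluate[OF G]) simp
  then show ?thesis
    unfolding HS_power_def
    by (intro presented_action.pres_structure_pres_module
        presented_action_HS[OF U.module_axioms s_linear D_linear]) simp
qed

abbreviation "\<Psi>\<^sub>U \<equiv> Psi_U R q U s D V \<Psi>"

text \<open>On the carrier \<open>tau23\<close> and its inverse are \<open>unmerge 2\<close> and
  \<open>merge 2\<close>, and moving \<open>1 - q\<close> to the second factor turns the middle
  operator of \<open>Psi_U\<close> into a \<open>twist\<close>.\<close>

sublocale twisted_powers R U V s D \<Psi> a \<Psi>\<^sub>U
proof (rule twisted_powers.intro[OF tensor_powers_axioms], rule twisted_powers_axioms.intro)
  fix z assume z: "z \<in> carrier (Tpow 2)"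
  have D': "D \<in> linear_maps \<Z> (zmod (Upow 2)) (zmod (Upow 2))"
    and s': "s \<in> linear_maps \<Z> (zmod (Upow 2)) (zmod (Upow 2))"
    using linear_maps_int_zmod[OF U.module_tpow U.module_tpow] s_linear D_linear by simp_all
  have w: "unmerge 2 z \<in> carrier (Wpow 2)"
    by (rule linear_closed[OF unmerge_linear z])
  have "zmap (Upow 2) (Vpow 2) s \<Psi> w \<oplus>\<^bsub>Wpow 2\<^esub>
      (\<one>\<^bsub>R\<^esub> \<ominus>\<^bsub>R\<^esub> q) \<odot>\<^bsub>Wpow 2\<^esub> zmap (Upow 2) (Vpow 2) D (\<lambda>y. y) w = twist (Upow 2) (Vpow 2) s \<Psi> D a w"
    if "w \<in> carrier (Wpow 2)" for w
    using P.zmap_smult[OF D' a_closed that] by (simp add: twist_def a_def)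
  then show "\<Psi>\<^sub>U z = merge 2 (twist (Upow 2) (Vpow 2) s \<Psi> D a (unmerge 2 z))"
    using linear_closed[OF P.twist_linear[OF s' Psi_linear D' a_closed] w]
    by (simp add: Psi_U_def Let_def tau23_eq_unmerge[OF z] inv_tau23 w)
qed (rule s_linear D_linear Psi_linear a_closed)+

lemma quadratic: "x \<in> carrier (Vpow 2) \<Longrightarrow> \<Psi> (\<Psi> x) = a \<odot>\<^bsub>Vpow 2\<^esub> \<Psi> x \<oplus>\<^bsub>Vpow 2\<^esub> q \<odot>\<^bsub>Vpow 2\<^esub> x"
  using braiding by (simp add: quadratic_braiding_def a_def)

lemma Hecke_action_Vpow: "Hecke_action R q n (Vpow n) (at_factors R V n \<Psi>)"
  by (rule Hecke_action_at_factors[OF V.module_axioms braiding q])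

text \<open>Every element is of the form \<open>merge n w\<close>, with \<open>n\<close> equal to 2
  or 3, and \<open>merge\<close> intertwines \<open>\<Psi>\<^sub>U\<close> with the twisted
  operators, for which the relations have been computed.\<close>

lemma quadratic_braiding_Psi_U: "quadratic_braiding R q (ztensor U V) \<Psi>\<^sub>U"
  unfolding quadratic_braiding_def Let_def
proof (intro conjI ballI)
  show "module R (ztensor U V)"
    by (rule T.module_ztensor)
  show "\<Psi>\<^sub>U \<in> linear_maps R (Tpow 2) (Tpow 2)"
    by (rule B_linear)
  fix x assume x: "x \<in> carrier (Tpow 2)"
  define w where "w = unmerge 2 x"
  have w: "w \<in> carrier (Wpow 2)" "x = merge 2 w"
    using linear_closed[OF unmerge_linear x] merge_unmerge[OF x] by (simp_all add: w_def)
  note ml = linear_closed[OF merge_linear] linear_add[OF merge_linear] linear_smult[OF merge_linear]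
  note tc = linear_closed[OF twist2_linear]
  interpret W2: module R "Wpow 2" by (rule P.module_ztensor)
  have B2: "\<Psi>\<^sub>U (merge 2 v) = merge 2 (twist (Upow 2) (Vpow 2) s \<Psi> D a v)" if "v \<in> carrier (Wpow 2)" for v
    using that by (simp add: B ml unmerge_merge)
  show "\<Psi>\<^sub>U (\<Psi>\<^sub>U x) = (\<one>\<^bsub>R\<^esub> \<ominus>\<^bsub>R\<^esub> q) \<odot>\<^bsub>Tpow 2\<^esub> \<Psi>\<^sub>U x \<oplus>\<^bsub>Tpow 2\<^esub> q \<odot>\<^bsub>Tpow 2\<^esub> x"
    unfolding a_def[symmetric] w(2)
    using P.twist_quadratic[OF additive_Upow[OF s] additive_Upow[OF D] \<Psi> a q HS_single_two quadratic w(1)]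
      w(1) a q by (simp add: B2 tc ml)
next
  fix x assume x: "x \<in> carrier (Tpow 3)"
  define w where "w = unmerge 3 x"
  have w: "w \<in> carrier (Wpow 3)" "x = merge 3 w"
    using linear_closed[OF unmerge_linear x] merge_unmerge[OF x] by (simp_all add: w_def)
  have i: "(0::nat) < 1" "(1::nat) < 3" "(0::nat) < 2" "(2::nat) < 3" "(1::nat) \<in> {1..<3}" "(2::nat) \<in> {1..<3}"
    by simp_all
  note tc = linear_closed[OF twist_at_linear[OF i(1,2)]] linear_closed[OF twist_at_linear[OF i(3,4)]]
  note m = merge_twist_at[OF i(1,2), symmetric] merge_twist_at[OF i(3,4), symmetric]
  have S: "HS_single (Upow 3) (at_factors \<Z> U 3 s 1) (at_factors \<Z> U 3 D 1)"
    "HS_single (Upow 3) (at_factors \<Z> U 3 s 2) (at_factors \<Z> U 3 D 2)"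
    "HS_braid (Upow 3) (at_factors \<Z> U 3 s 1) (at_factors \<Z> U 3 D 1) (at_factors \<Z> U 3 s 2) (at_factors \<Z> U 3 D 2)"
    "HS_braid (Upow 3) (at_factors \<Z> U 3 s 2) (at_factors \<Z> U 3 D 2) (at_factors \<Z> U 3 s 1) (at_factors \<Z> U 3 D 1)"
    using HS_action_three by (simp_all add: HS_action_on_def)
  have H: "at_factors R V 3 \<Psi> 1 (at_factors R V 3 \<Psi> 1 v) = a \<odot>\<^bsub>Vpow 3\<^esub> at_factors R V 3 \<Psi> 1 v \<oplus>\<^bsub>Vpow 3\<^esub> q \<odot>\<^bsub>Vpow 3\<^esub> v"
    "at_factors R V 3 \<Psi> 2 (at_factors R V 3 \<Psi> 2 v) = a \<odot>\<^bsub>Vpow 3\<^esub> at_factors R V 3 \<Psi> 2 v \<oplus>\<^bsub>Vpow 3\<^esub> q \<odot>\<^bsub>Vpow 3\<^esub> v"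
    "at_factors R V 3 \<Psi> 1 (at_factors R V 3 \<Psi> 2 (at_factors R V 3 \<Psi> 1 v)) =
      at_factors R V 3 \<Psi> 2 (at_factors R V 3 \<Psi> 1 (at_factors R V 3 \<Psi> 2 v))"
    if "v \<in> carrier (Vpow 3)" for v
    using Hecke_action_Vpow[of 3] that by (simp_all add: Hecke_action_def a_def)
  have "twist_at 3 1 (twist_at 3 2 (twist_at 3 1 w)) = twist_at 3 2 (twist_at 3 1 (twist_at 3 2 w))"
    by (rule P.twist_braid[OF additive_Upow[OF U.at_factors_linear[OF s i(1,2)]]
          additive_Upow[OF U.at_factors_linear[OF D i(1,2)]] additive_Upow[OF U.at_factors_linear[OF s i(3,4)]]
          additive_Upow[OF U.at_factors_linear[OF D i(3,4)]] V.at_factors_linear[OF \<Psi> i(1,2)]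
          V.at_factors_linear[OF \<Psi> i(3,4)] a q S H w(1)])
  then show "at_factors R (ztensor U V) 3 \<Psi>\<^sub>U 1 (at_factors R (ztensor U V) 3 \<Psi>\<^sub>U 2 (at_factors R (ztensor U V) 3 \<Psi>\<^sub>U 1 x)) =
    at_factors R (ztensor U V) 3 \<Psi>\<^sub>U 2 (at_factors R (ztensor U V) 3 \<Psi>\<^sub>U 1 (at_factors R (ztensor U V) 3 \<Psi>\<^sub>U 2 x))"
    unfolding w(2) using w(1) by (simp only: m tc)
qed

text \<open>The two modules fed to the functor are results of a choice and are known on carriers
  only; by the congruence lemmas this determines the functor's value as a record, expressed through
  the plain tensor powers.\<close>

lemma F_functor_eq:
  assumes n: "n \<ge> 3"
  shows "F_functor R q n (HS_power U s D n) (braided_power R q V \<Psi> n) = Hecke_module R q n (Wpow n) (twist_at n)"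
proof -
  let ?M = "HS_power U s D n" and ?X = "braided_power R q V \<Psi> n"
  let ?X\<^sub>0 = "underlying_module R {1..<n} (Hecke_rels R q n) ?X"
  have M: "carrier ?M = carrier (Upow n)" "zero ?M = zero (Upow n)" "add ?M = add (Upow n)"
    "\<And>g x. \<lbrakk>g \<in> HS_gens n; x \<in> carrier (Upow n)\<rbrakk> \<Longrightarrow>
      pres_gen \<Z> (HS_gens n) (HS_rels n) g \<odot>\<^bsub>?M\<^esub> x = HS_action U s D n g x"
    using pres_structure_HS_power[OF n] by (simp_all add: pres_structure_def)
  have "pres_structure R {1..<n} (Hecke_rels R q n) (Vpow n) (at_factors R V n \<Psi>) ?X"
    unfolding braided_power_def
    by (rule pres_structure_Hecke[OF V.module_tpow q V.at_factors_linear[OF \<Psi>] Hecke_action_Vpow]) auto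
  then have X: "carrier ?X\<^sub>0 = carrier (Vpow n)" "zero ?X\<^sub>0 = zero (Vpow n)" "add ?X\<^sub>0 = add (Vpow n)"
    "\<forall>c\<in>carrier R. \<forall>x\<in>carrier (Vpow n). c \<odot>\<^bsub>?X\<^sub>0\<^esub> x = c \<odot>\<^bsub>Vpow n\<^esub> x"
    "\<And>i x. \<lbrakk>i \<in> {1..<n}; x \<in> carrier (Vpow n)\<rbrakk> \<Longrightarrow> Hecke_T R q n i \<odot>\<^bsub>?X\<^esub> x = at_factors R V n \<Psi> i x"
    by (simp_all add: pres_structure_def underlying_module_def)
  note W = P.ztensor_cong[OF M(1-3) X(1-4)]
  show ?thesis
    unfolding F_functor_def Let_def
  proof (rule pres_module_cong[OF W(1-4)])
    fix i z assume i: "i \<in> {1..<n}" and z: "z \<in> carrier (Wpow n)"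
    have g: "GenS i \<in> HS_gens n" "GenD i \<in> HS_gens n" and i': "0 < i" "i < n"
      using i by (auto simp: HS_gens_def)
    note cl = linear_closed[OF U.at_factors_linear[OF s i']] linear_closed[OF U.at_factors_linear[OF D i']]
      linear_closed[OF V.at_factors_linear[OF \<Psi> i']] P.V.smult_closed[OF a]
    have "zmap ?M ?X\<^sub>0 (\<lambda>m. HS_s n i \<odot>\<^bsub>?M\<^esub> m) (\<lambda>x. Hecke_T R q n i \<odot>\<^bsub>?X\<^esub> x) z =
        zmap (Upow n) (Vpow n) (at_factors \<Z> U n s i) (at_factors R V n \<Psi> i) z"
      using z by (rule W(5)) (use g i cl M(4) X(5) in \<open>simp_all del: One_nat_def\<close>)
    moreover have "zmap ?M ?X\<^sub>0 (\<lambda>m. HS_D n i \<odot>\<^bsub>?M\<^esub> m) (\<lambda>x. (\<one>\<^bsub>R\<^esub> \<ominus>\<^bsub>R\<^esub> q) \<odot>\<^bsub>?X\<^sub>0\<^esub> x) z =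
        zmap (Upow n) (Vpow n) (at_factors \<Z> U n D i) (\<lambda>x. a \<odot>\<^bsub>Vpow n\<^esub> x) z"
      using z unfolding a_def[symmetric] by (rule W(5)) (use g i cl M(4) X(4) a in \<open>simp_all del: One_nat_def\<close>)
    ultimately show "zmap ?M ?X\<^sub>0 (\<lambda>m. HS_s n i \<odot>\<^bsub>?M\<^esub> m) (\<lambda>x. Hecke_T R q n i \<odot>\<^bsub>?X\<^esub> x) z \<oplus>\<^bsub>ztensor ?M ?X\<^sub>0\<^esub>
        zmap ?M ?X\<^sub>0 (\<lambda>m. HS_D n i \<odot>\<^bsub>?M\<^esub> m) (\<lambda>x. (\<one>\<^bsub>R\<^esub> \<ominus>\<^bsub>R\<^esub> q) \<odot>\<^bsub>?X\<^sub>0\<^esub> x) z = twist_at n i z"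
      by (simp only: W(3) twist_def)
  qed
qed

text \<open>The isomorphism is \<open>merge n\<close>: it is bijective, linear over
  \<open>R\<close>, and intertwines the generators, hence it is linear over the Hecke
  algebra.\<close>

lemma F_functor_iso:
  assumes n: "n \<ge> 3"
  shows "left_module_iso (Hecke_algebra R q n)
    (F_functor R q n (HS_power U s D n) (braided_power R q V \<Psi> n)) (braided_power R q (ztensor U V) \<Psi>\<^sub>U n)"
proof -
  let ?T = "at_factors R (ztensor U V) n \<Psi>\<^sub>U"
  have TL: "?T i \<in> linear_maps R (Tpow n) (Tpow n)" and WL: "twist_at n i \<in> linear_maps R (Wpow n) (Wpow n)"
    if "i \<in> {1..<n}" for i
    using that TV.at_factors_linear[OF B_linear] twist_at_linear by simp_all
  have mt: "merge n (twist_at n i z) = ?T i (merge n z)" if "i \<in> {1..<n}" "z \<in> carrier (Wpow n)" for i z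
    using that merge_twist_at by simp
  have TH: "Hecke_action R q n (Tpow n) ?T"
    by (rule Hecke_action_at_factors[OF TV.module_axioms quadratic_braiding_Psi_U q])
  \<comment> \<open>The Hecke relations for the twisted operators are not computed again for
    \<open>n\<close> factors; they are pulled back along \<open>merge n\<close> from the powers of
    the braiding \<open>\<Psi>\<^sub>U\<close>.\<close>
  have WH: "Hecke_action R q n (Wpow n) (twist_at n)"
  proof (rule Hecke_action_transport[OF TH P.module_ztensor TV.module_tpow q merge_linear
        bij_betw_imp_inj_on[OF bij_betw_merge]])
    show "twist_at n i z \<in> carrier (Wpow n)" if "i \<in> {1..<n}" "z \<in> carrier (Wpow n)" for i z
      by (rule linear_closed[OF WL[OF that(1)] that(2)])
  qed (rule mt)
  have WP: "presented_action R {1..<n} (Wpow n) (twist_at n) (Hecke_rels R q n)"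
    "pres_structure R {1..<n} (Hecke_rels R q n) (Wpow n) (twist_at n) (Hecke_module R q n (Wpow n) (twist_at n))"
    by (rule presented_action_Hecke[OF P.module_ztensor q _ WH], rule WL, assumption)
      (rule pres_structure_Hecke[OF P.module_ztensor q _ WH], rule WL)
  have TP: "presented_action R {1..<n} (Tpow n) ?T (Hecke_rels R q n)"
    "pres_structure R {1..<n} (Hecke_rels R q n) (Tpow n) ?T (Hecke_module R q n (Tpow n) ?T)"
    by (rule presented_action_Hecke[OF TV.module_tpow q _ TH], rule TL, assumption)
      (rule pres_structure_Hecke[OF TV.module_tpow q _ TH], rule TL)
  have "merge n \<in> linear_maps (Hecke_algebra R q n) (Hecke_module R q n (Wpow n) (twist_at n))
      (Hecke_module R q n (Tpow n) ?T)"
    by (rule pres_structure_linear[OF WP(1) TP(1) WP(2) TP(2) merge_linear]) (rule mt)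
  moreover have "bij_betw (merge n) (carrier (Hecke_module R q n (Wpow n) (twist_at n)))
      (carrier (Hecke_module R q n (Tpow n) ?T))"
    using WP(2) TP(2) bij_betw_merge[of n] unfolding pres_structure_def by simp
  ultimately show ?thesis
    using WP(2) TP(2) unfolding left_module_iso_def F_functor_eq[OF n] braided_power_def[of R q "ztensor U V"]
      pres_structure_def by blast
qed

end

theorem theorem2p3:
  fixes R :: "'k ring" and q :: 'k
    and U :: "(int, 'u) module" and V :: "('k, 'v) module"
    and s D :: "('u list \<Rightarrow> int) set \<Rightarrow> ('u list \<Rightarrow> int) set"
    and \<Psi> :: "('v list \<Rightarrow> 'k) set \<Rightarrow> ('v list \<Rightarrow> 'k) set"
  assumes "cring R" and "q \<in> carrier R"
    and "module \<Z> U" and "HS3_structure U s D"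
    and "module R V" and "quadratic_braiding R q V \<Psi>"
  shows "quadratic_braiding R q (ztensor U V) (Psi_U R q U s D V \<Psi>) \<and>
    (\<forall>n\<ge>3. left_module_iso (Hecke_algebra R q n)
      (F_functor R q n (HS_power U s D n) (braided_power R q V \<Psi> n))
      (braided_power R q (ztensor U V) (Psi_U R q U s D V \<Psi>) n))"
proof -
  interpret braided_HS3 R U V q s D \<Psi>
    by (intro braided_HS3.intro tensor_powers.intro braided_HS3_axioms.intro assms)
  show ?thesis
    using quadratic_braiding_Psi_U F_functor_iso by blast
qed

end
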